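(* Let $\mathscr C$ be a non-empty set of finite totally ordered sets of odd cardinality, let $\mathcal Q$ be either the Jones category $\mathcal J(\mathscr C)$ (annular Brauer partitions) or the anti-Jones category $\mathcal J^\pm(\mathscr C)$ (annular or anti-annular Brauer partitions). Let $\xi$ be the least cardinal strictly greater than $|A|$ for every $A\in\mathscr C$, let $I_r=\{\alpha\in\mathcal Q:\operatorname{rank}(\alpha)\le r\}$ for odd $1\le r<\xi$, with $I_\omega=\mathcal Q$ if $\xi=\omega$, and for odd $1\le q<\xi$ let $\mathcal G_q$ be a group $\mathscr H$-class of $\mathcal Q$ contained in $D_q=\{\alpha\in\mathcal Q:\operatorname{rank}(\alpha)=q\}$. (i) The minimal ideal $I_1$ is (isomorphic to) a partial rectangular band, so its congruences are precisely those corresponding to the relations $\sigma_{\mathcal E_1,\mathcal E_2}$ described in the context. In particular, $\operatorname{Cong}(I_1)$ is isomorphic to the lattice direct product $$\prod_{A\in\mathscr C}\mathfrak{Eq}(\mathscr P^+(\mathfrak{Eq}_2(A)))\times\prod_{A\in\mathscr C}\mathfrak{Eq}(\mathscr P^+(\mathfrak{Eq}_2(A))).$$ (ii) For odd $r\ge3$ with $r<\xi$ (and also for $r=\omega$ if $\xi=\omega$), $$\operatorname{Cong}(I_r)=\{\Delta_{I_r},\lambda^{I_r}_{I_1},\rho^{I_r}_{I_1},R^{I_r}_{I_1}\}\cup\{R^{I_r}_{I_q,N}:1\le q<r,\ q\text{ odd},\ N\unlhd\mathcal G_{q+2}\}\cup\{\widetilde\nabla_{I_r}\}.$$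
   Context: **Categories.** Let $X=\bigcup_{A\in\mathscr C}A$ with disjoint copies $X'$, $X''$. For $A,B\in\mathscr C$, a Brauer partition $\alpha\in\mathcal B_{A,B}$ is a set partition of $A\cup B'$ into blocks of size 2; $\mathbf d(\alpha)=A$, $\mathbf r(\alpha)=B$. For $\alpha\in\mathcal B_{A,B}$, $\beta\in\mathcal B_{B,C}$, regard them as equivalences, rename each $b'$ in $\alpha$ and each $b$ in $\beta$ to $b''$ ($b\in B$), take the join of the resulting equivalences on $A\cup B''\cup C'$, and restrict to $A\cup C'$: this is $\alpha\beta\in\mathcal B_{A,C}$. A block is a transversal if it meets both $A$ and $B'$; $\operatorname{rank}(\alpha)$ is the number of transversals. With $A=\{a_1<\cdots<a_k\}$, $B=\{b_1<\cdots<b_l\}$, $\alpha$ is planar if its blocks can be drawn as non-crossing edges inside the rectangle $[0,\max(k,l)+1]\times[0,1]$ with $a_i$ at $(i,1)$ and $b_i'$ at $(i,0)$; $\alpha$ is annular if the same holds with the left and right sides of the rectangle identified (a cylinder, edges allowed to wrap around); equivalently, $\alpha=\delta_A^s\beta\delta_B^t$ for some planar $\beta$ and $s,t\in\mathbb N$, where $\delta_A\in\mathcal B_{A,A}$ has blocks $\{a_i,a'_{i+1}\}$ ($i<k$) and $\{a_k,a_1'\}$. $\alpha$ is anti-annular if $\gamma_A\alpha$ is annular, where $\gamma_A\in\mathcal B_{A,A}$ has blocks $\{a_i,a'_{k+1-i}\}$. $\mathcal Q$ is a stable regular category with $\mathscr J=\mathscr D$-classes the $D_q$, $q$ odd, $1\le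 q<\xi$. $\mathfrak{Eq}(Z)$ is the lattice of equivalences on $Z$. For $|A|$ odd, $\mathfrak{Eq}_2(A)$ is the set of equivalences on $A$ with exactly one singleton class and all other classes of size 2. For $U,V\subseteq A$: $U,V$ are separated if $u<v$ for all $u\in U,v\in V$ or $v<u$ for all such; $U$ is nested by $V$ if there are $v_1,v_2\in V$ with $v_1<u<v_2$ for all $u\in U$ and no $v\in V$ with $v_1<v<v_2$. An equivalence is planar if any two distinct classes are separated or one is nested by the other. $\mathscr P^+(\mathfrak{Eq}_2(A))$ is the set of planar members of $\mathfrak{Eq}_2(A)$. **Congruences.** For a partial semigroup (category without necessarily having identities) $S$, write $x\sim y$ if $\mathbf d(x)=\mathbf d(y)$ and $\mathbf r(x)=\mathbf r(y)$. A congruence on $S$ is an equivalence contained in $\sim$ and compatible with all defined left and right multiplications. $\operatorname{Cong}(S)$ is the lattice of congruences. $\Delta_S$ is equality, $\widetilde\nabla_S=\{(x,y):x\sim y\}$. For an ideal $I$ (non-empty, closed under defined multiplication by elements of $S$ on either side), $R_I^S=\widetilde\nabla_I\cup\Delta_S$. Green's relations: $x\mathrel{\mathscr R}y\Leftrightarrow xS^1=yS^1$, $x\mathrel{\mathscr L}y\Leftrightarrow S^1x=S^1y$, $x\mathrel{\mathscr J}y\Leftrightarrow S^1xS^1=S^1yS^1$, $\mathscr H=\mathscr R\cap\mathscr L$ ($S^1$ is $S$ with identities adjoined where needed). For $N$ a normal subgroup of a group $\mathscr H$-class in a $\mathscr J$-class $D$ minimal among those in $S\setminus I$, $\nu_N=\{(axb,ayb):x,y\in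 N,\ a,b\in S^1,\ axb,ayb\in D\}$ and $R^S_{I,N}=R_I^S\cup\nu_N$. With $M=I_1$ the minimal ideal of $S=I_r$: $\lambda_{I_1}^{S}=\{(x,y)\in M\times M:x\sim y,\ (x,y)\in\mathscr L\}\cup\Delta_S$ and $\rho_{I_1}^{S}=\{(x,y)\in M\times M:x\sim y,\ (x,y)\in\mathscr R\}\cup\Delta_S$. **Partial rectangular bands.** Given non-empty sets $X_A,Y_A$ ($A\in\mathscr C$), the $X_A$ pairwise disjoint and the $Y_A$ pairwise disjoint, the partial rectangular band is $\bigcup_{A,B}X_A\times Y_B$ with $\mathbf d(x,y)=A$, $\mathbf r(x,y)=B$ for $x\in X_A,y\in Y_B$, and $(x_1,y_1)(x_2,y_2)=(x_1,y_2)$ when $\mathbf r(x_1,y_1)=\mathbf d(x_2,y_2)$. For tuples $\mathcal E_1=(\varepsilon^A_1)_A$, $\mathcal E_2=(\varepsilon_2^A)_A$ with $\varepsilon_1^A\in\mathfrak{Eq}(X_A)$, $\varepsilon_2^A\in\mathfrak{Eq}(Y_A)$, $\sigma_{\mathcal E_1,\mathcal E_2}$ relates $(x_1,y_1)$, $(x_2,y_2)$ iff both lie in a common $X_A\times Y_B$ and $(x_1,x_2)\in\varepsilon_1^A$, $(y_1,y_2)\in\varepsilon_2^B$. Isomorphisms preserve $\mathbf d$, $\mathbf r$. *)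

theory Defs
  imports
    "HOL-Analysis.Path_Connected"
    "HOL-Library.Disjoint_Sets"
    "HOL-Library.Extended_Nat"
    "HOL-Algebra.Coset"
    "HOL-Algebra.Lattice"
begin

section \<open>Partial semigroups\<close>

text \<open>The product \<open>pmul S x y\<close> is meaningful only if \<open>tgt S x = src S y\<close>; every definition
  below guards its products accordingly.\<close>

record ('m, 'o) psemigroup = "'m partial_object" +
  src :: "'m \<Rightarrow> 'o"
  tgt :: "'m \<Rightarrow> 'o"
  pmul :: "'m \<Rightarrow> 'm \<Rightarrow> 'm"

definition restrict_psg :: "('m, 'o) psemigroup \<Rightarrow> 'm set \<Rightarrow> ('m, 'o) psemigroup" where
  "restrict_psg S I = S\<lparr>carrier := I\<rparr>"

definition tnabla :: "('m, 'o) psemigroup \<Rightarrow> 'm rel" where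
  "tnabla S = {(x, y). x \<in> carrier S \<and> y \<in> carrier S \<and> src S x = src S y \<and> tgt S x = tgt S y}"

definition congruence_on :: "('m, 'o) psemigroup \<Rightarrow> 'm rel \<Rightarrow> bool" where
  "congruence_on S \<sigma> \<longleftrightarrow>
     equiv (carrier S) \<sigma> \<and> \<sigma> \<subseteq> tnabla S \<and>
     (\<forall>(x, y)\<in>\<sigma>. \<forall>a\<in>carrier S.
        (tgt S a = src S x \<longrightarrow> (pmul S a x, pmul S a y) \<in> \<sigma>) \<and>
        (tgt S x = src S a \<longrightarrow> (pmul S x a, pmul S y a) \<in> \<sigma>))"

definition Cong :: "('m, 'o) psemigroup \<Rightarrow> 'm rel set" where
  "Cong S = {\<sigma>. congruence_on S \<sigma>}"

definition psg_ideal :: "('m, 'o) psemigroup \<Rightarrow> 'm set \<Rightarrow> bool" where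
  "psg_ideal S I \<longleftrightarrow>
     I \<noteq> {} \<and> I \<subseteq> carrier S \<and>
     (\<forall>x\<in>I. \<forall>a\<in>carrier S.
        (tgt S a = src S x \<longrightarrow> pmul S a x \<in> I) \<and> (tgt S x = src S a \<longrightarrow> pmul S x a \<in> I))"

definition minimal_ideal :: "('m, 'o) psemigroup \<Rightarrow> 'm set \<Rightarrow> bool" where
  "minimal_ideal S M \<longleftrightarrow> psg_ideal S M \<and> (\<forall>I. psg_ideal S I \<longrightarrow> M \<subseteq> I)"

definition psg_iso ::
  "('m, 'o) psemigroup \<Rightarrow> ('n, 'o) psemigroup \<Rightarrow> ('m \<Rightarrow> 'n) \<Rightarrow> bool" where
  "psg_iso S T \<phi> \<longleftrightarrow>
     bij_betw \<phi> (carrier S) (carrier T) \<and>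
     (\<forall>x\<in>carrier S. src T (\<phi> x) = src S x \<and> tgt T (\<phi> x) = tgt S x) \<and>
     (\<forall>x\<in>carrier S. \<forall>y\<in>carrier S. tgt S x = src S y \<longrightarrow> \<phi> (pmul S x y) = pmul T (\<phi> x) (\<phi> y))"

text \<open>The monoid-like \<open>S\<^sup>1\<close> is encoded by \<open>'m option\<close>: \<open>None\<close> acts as the (adjoined or already
  present) identity at whichever object it is composed with.\<close>

definition S1 :: "('m, 'o) psemigroup \<Rightarrow> 'm option set" where
  "S1 S = insert None (Some ` carrier S)"

definition lcomposable :: "('m, 'o) psemigroup \<Rightarrow> 'm option \<Rightarrow> 'm \<Rightarrow> bool" where
  "lcomposable S a x = (case a of None \<Rightarrow> True | Some s \<Rightarrow> tgt S s = src S x)"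

definition rcomposable :: "('m, 'o) psemigroup \<Rightarrow> 'm \<Rightarrow> 'm option \<Rightarrow> bool" where
  "rcomposable S x b = (case b of None \<Rightarrow> True | Some s \<Rightarrow> tgt S x = src S s)"

definition lmul1 :: "('m, 'o) psemigroup \<Rightarrow> 'm option \<Rightarrow> 'm \<Rightarrow> 'm" where
  "lmul1 S a x = (case a of None \<Rightarrow> x | Some s \<Rightarrow> pmul S s x)"

definition rmul1 :: "('m, 'o) psemigroup \<Rightarrow> 'm \<Rightarrow> 'm option \<Rightarrow> 'm" where
  "rmul1 S x b = (case b of None \<Rightarrow> x | Some s \<Rightarrow> pmul S x s)"

definition right_ideal1 :: "('m, 'o) psemigroup \<Rightarrow> 'm \<Rightarrow> 'm set" where
  "right_ideal1 S x = {rmul1 S x b | b. b \<in> S1 S \<and> rcomposable S x b}"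

definition left_ideal1 :: "('m, 'o) psemigroup \<Rightarrow> 'm \<Rightarrow> 'm set" where
  "left_ideal1 S x = {lmul1 S a x | a. a \<in> S1 S \<and> lcomposable S a x}"

definition two_sided_ideal1 :: "('m, 'o) psemigroup \<Rightarrow> 'm \<Rightarrow> 'm set" where
  "two_sided_ideal1 S x =
     {rmul1 S (lmul1 S a x) b | a b.
        a \<in> S1 S \<and> b \<in> S1 S \<and> lcomposable S a x \<and> rcomposable S x b}"

definition Green_R :: "('m, 'o) psemigroup \<Rightarrow> 'm rel" where
  "Green_R S = {(x, y). x \<in> carrier S \<and> y \<in> carrier S \<and> right_ideal1 S x = right_ideal1 S y}"

definition Green_L :: "('m, 'o) psemigroup \<Rightarrow> 'm rel" where
  "Green_L S = {(x, y). x \<in> carrier S \<and> y \<in> carrier S \<and> left_ideal1 S x = left_ideal1 S y}"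

definition Green_J :: "('m, 'o) psemigroup \<Rightarrow> 'm rel" where
  "Green_J S = {(x, y). x \<in> carrier S \<and> y \<in> carrier S \<and> two_sided_ideal1 S x = two_sided_ideal1 S y}"

definition Green_H :: "('m, 'o) psemigroup \<Rightarrow> 'm rel" where
  "Green_H S = Green_R S \<inter> Green_L S"

text \<open>In a group, the identity is the unique idempotent.\<close>

definition H_group :: "('m, 'o) psemigroup \<Rightarrow> 'm set \<Rightarrow> 'm monoid" where
  "H_group S H = \<lparr>carrier = H, mult = pmul S, one = (THE e. e \<in> H \<and> pmul S e e = e)\<rparr>"

definition group_H_class :: "('m, 'o) psemigroup \<Rightarrow> 'm set \<Rightarrow> bool" where
  "group_H_class S H \<longleftrightarrow>
     H \<in> carrier S // Green_H S \<and> (\<forall>x\<in>H. \<forall>y\<in>H. tgt S x = src S y) \<and> group (H_group S H)"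

definition Rees :: "('m, 'o) psemigroup \<Rightarrow> 'm set \<Rightarrow> 'm rel" where
  "Rees S I = tnabla (restrict_psg S I) \<union> Id_on (carrier S)"

text \<open>The \<open>\<J>\<close>-class \<open>D\<close> is the one containing \<open>N\<close>, formed in \<open>S\<close> itself.\<close>

definition nu :: "('m, 'o) psemigroup \<Rightarrow> 'm set \<Rightarrow> 'm rel" where
  "nu S N =
     (let D = Green_J S `` N in
      {(rmul1 S (lmul1 S a x) b, rmul1 S (lmul1 S a y) b) | x y a b.
         x \<in> N \<and> y \<in> N \<and> a \<in> S1 S \<and> b \<in> S1 S \<and>
         lcomposable S a x \<and> lcomposable S a y \<and> rcomposable S x b \<and> rcomposable S y b \<and>
         rmul1 S (lmul1 S a x) b \<in> D \<and> rmul1 S (lmul1 S a y) b \<in> D})"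

definition Rees_N :: "('m, 'o) psemigroup \<Rightarrow> 'm set \<Rightarrow> 'm set \<Rightarrow> 'm rel" where
  "Rees_N S I N = Rees S I \<union> nu S N"

definition lambda_cong :: "('m, 'o) psemigroup \<Rightarrow> 'm set \<Rightarrow> 'm rel" where
  "lambda_cong S M = {(x, y) \<in> M \<times> M. (x, y) \<in> tnabla S \<and> (x, y) \<in> Green_L S} \<union> Id_on (carrier S)"

definition rho_cong :: "('m, 'o) psemigroup \<Rightarrow> 'm set \<Rightarrow> 'm rel" where
  "rho_cong S M = {(x, y) \<in> M \<times> M. (x, y) \<in> tnabla S \<and> (x, y) \<in> Green_R S} \<union> Id_on (carrier S)"


section \<open>Partial rectangular bands\<close>

definition band_families :: "'o set \<Rightarrow> ('o \<Rightarrow> 'x set) \<Rightarrow> ('o \<Rightarrow> 'y set) \<Rightarrow> bool" where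
  "band_families C X Y \<longleftrightarrow>
     (\<forall>A\<in>C. X A \<noteq> {} \<and> Y A \<noteq> {}) \<and> disjoint_family_on X C \<and> disjoint_family_on Y C"

definition rect_band ::
  "'o set \<Rightarrow> ('o \<Rightarrow> 'x set) \<Rightarrow> ('o \<Rightarrow> 'y set) \<Rightarrow> ('x \<times> 'y, 'o) psemigroup" where
  "rect_band C X Y =
     \<lparr>carrier = (\<Union>A\<in>C. \<Union>B\<in>C. X A \<times> Y B),
      src = (\<lambda>(x, y). THE A. A \<in> C \<and> x \<in> X A),
      tgt = (\<lambda>(x, y). THE B. B \<in> C \<and> y \<in> Y B),
      pmul = (\<lambda>(x1, y1) (x2, y2). (x1, y2))\<rparr>"

definition Eqv :: "'z set \<Rightarrow> 'z rel set" where
  "Eqv Z = {\<epsilon>. equiv Z \<epsilon>}"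

definition band_sigma ::
  "'o set \<Rightarrow> ('o \<Rightarrow> 'x set) \<Rightarrow> ('o \<Rightarrow> 'y set) \<Rightarrow> ('o \<Rightarrow> 'x rel) \<Rightarrow> ('o \<Rightarrow> 'y rel)
     \<Rightarrow> ('x \<times> 'y) rel" where
  "band_sigma C X Y E1 E2 =
     {((x1, y1), (x2, y2)) | x1 y1 x2 y2. \<exists>A\<in>C. \<exists>B\<in>C.
        x1 \<in> X A \<and> x2 \<in> X A \<and> y1 \<in> Y B \<and> y2 \<in> Y B \<and> (x1, x2) \<in> E1 A \<and> (y1, y2) \<in> E2 B}"


section \<open>Lattices\<close>

definition rel_lattice :: "'z rel set \<Rightarrow> 'z rel gorder" where
  "rel_lattice K = \<lparr>carrier = K, eq = (=), le = (\<subseteq>)\<rparr>"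

definition Cong_lattice :: "('m, 'o) psemigroup \<Rightarrow> 'm rel gorder" where
  "Cong_lattice S = rel_lattice (Cong S)"

definition Eq_lattice :: "'z set \<Rightarrow> 'z rel gorder" where
  "Eq_lattice Z = rel_lattice (Eqv Z)"

definition Prod_lattice :: "'i set \<Rightarrow> ('i \<Rightarrow> 'l gorder) \<Rightarrow> ('i \<Rightarrow> 'l) gorder" where
  "Prod_lattice I L =
     \<lparr>carrier = (\<Pi>\<^sub>E i\<in>I. carrier (L i)), eq = (=), le = (\<lambda>f g. \<forall>i\<in>I. f i \<sqsubseteq>\<^bsub>L i\<^esub> g i)\<rparr>"

definition prod2_lattice :: "'l gorder \<Rightarrow> 'k gorder \<Rightarrow> ('l \<times> 'k) gorder" where
  "prod2_lattice L K =
     \<lparr>carrier = carrier L \<times> carrier K, eq = (=),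
      le = (\<lambda>(a, b) (c, d). a \<sqsubseteq>\<^bsub>L\<^esub> c \<and> b \<sqsubseteq>\<^bsub>K\<^esub> d)\<rparr>"

definition lattice_isomorphic :: "'l gorder \<Rightarrow> 'k gorder \<Rightarrow> bool" where
  "lattice_isomorphic L K \<longleftrightarrow>
     (\<exists>f. bij_betw f (carrier L) (carrier K) \<and> join_pres L K f \<and> meet_pres L K f)"


section \<open>Brauer partitions\<close>

text \<open>A point \<open>a\<close> of the upper set is \<open>Inl a\<close>, a point \<open>b'\<close> of the lower set is \<open>Inr b\<close>.
  Each object \<open>A\<close> carries its own total order \<open>leq A\<close>.\<close>

type_synonym 'a brauer = "('a + 'a) set set"

definition brauer :: "'a set \<Rightarrow> 'a set \<Rightarrow> 'a brauer set" where
  "brauer A B = {\<alpha>. partition_on (A <+> B) \<alpha> \<and> (\<forall>K\<in>\<alpha>. card K = 2)}"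

definition bdom :: "'a brauer \<Rightarrow> 'a set" where
  "bdom \<alpha> = {a. Inl a \<in> \<Union>\<alpha>}"

definition bran :: "'a brauer \<Rightarrow> 'a set" where
  "bran \<alpha> = {b. Inr b \<in> \<Union>\<alpha>}"

definition rank :: "'a brauer \<Rightarrow> nat" where
  "rank \<alpha> = card {K \<in> \<alpha>. \<exists>a b. Inl a \<in> K \<and> Inr b \<in> K}"

datatype 'a layer = Upper_pt 'a | Middle_pt 'a | Lower_pt 'a

definition block_rel :: "'v set set \<Rightarrow> 'v rel" where
  "block_rel P = {(x, y). \<exists>K\<in>P. x \<in> K \<and> y \<in> K}"

text \<open>The join of the two equivalences on \<open>A \<union> B'' \<union> C'\<close> is the transitive closure of their union;
  the missing diagonal parts do not matter, since the blocks of \<open>\<alpha>\<close> and \<open>\<beta>\<close> jointly cover all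
  three layers.\<close>

definition brauer_comp :: "'a brauer \<Rightarrow> 'a brauer \<Rightarrow> 'a brauer" where
  "brauer_comp \<alpha> \<beta> =
     (let J = (block_rel ((`) (case_sum Upper_pt Middle_pt) ` \<alpha>)
               \<union> block_rel ((`) (case_sum Middle_pt Lower_pt) ` \<beta>))\<^sup>+;
          outer = case_sum Upper_pt Lower_pt;
          Z = bdom \<alpha> <+> bran \<beta>
      in Z // {(u, v) \<in> Z \<times> Z. (outer u, outer v) \<in> J})"

text \<open>\<open>pos r a = i\<close> iff \<open>a\<close> is the \<open>i\<close>-th smallest element, counting from 1.\<close>

definition pos :: "'a rel \<Rightarrow> 'a \<Rightarrow> nat" where
  "pos r a = card {x. (x, a) \<in> r}"

definition vertex :: "('a set \<Rightarrow> 'a rel) \<Rightarrow> 'a brauer \<Rightarrow> 'a + 'a \<Rightarrow> real \<times> real" where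
  "vertex leq \<alpha> v =
     (case v of
        Inl a \<Rightarrow> (real (pos (leq (bdom \<alpha>)) a), 1)
      | Inr b \<Rightarrow> (real (pos (leq (bran \<alpha>)) b), 0))"

definition planar :: "('a set \<Rightarrow> 'a rel) \<Rightarrow> 'a brauer \<Rightarrow> bool" where
  "planar leq \<alpha> \<longleftrightarrow>
     (\<exists>\<gamma> :: ('a + 'a) set \<Rightarrow> real \<Rightarrow> real \<times> real.
        (\<forall>K\<in>\<alpha>. arc (\<gamma> K) \<and>
           {pathstart (\<gamma> K), pathfinish (\<gamma> K)} = vertex leq \<alpha> ` K \<and>
           path_image (\<gamma> K)
             \<subseteq> {0 .. real (max (card (bdom \<alpha>)) (card (bran \<alpha>))) + 1} \<times> {0 .. 1}) \<and>
        (\<forall>K\<in>\<alpha>. \<forall>L\<in>\<alpha>. K \<noteq> L \<longrightarrow> path_image (\<gamma> K) \<inter> path_image (\<gamma> L) = {}))"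

definition delta :: "'a rel \<Rightarrow> 'a set \<Rightarrow> 'a brauer" where
  "delta r A =
     {{Inl a, Inr b} | a b. a \<in> A \<and> b \<in> A \<and>
        (pos r b = pos r a + 1 \<or> (pos r a = card A \<and> pos r b = 1))}"

definition gamma :: "'a rel \<Rightarrow> 'a set \<Rightarrow> 'a brauer" where
  "gamma r A = {{Inl a, Inr b} | a b. a \<in> A \<and> b \<in> A \<and> pos r a + pos r b = card A + 1}"

text \<open>Drawable on the cylinder, in the algebraic form \<open>\<alpha> = \<delta>\<^sub>A\<^sup>s \<beta> \<delta>\<^sub>B\<^sup>t\<close> with \<open>\<beta>\<close> planar.\<close>

definition annular :: "('a set \<Rightarrow> 'a rel) \<Rightarrow> 'a brauer \<Rightarrow> bool" where
  "annular leq \<alpha> \<longleftrightarrow>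
     (let A = bdom \<alpha>; B = bran \<alpha> in
      \<exists>s t. \<exists>\<beta>\<in>brauer A B. planar leq \<beta> \<and>
        \<alpha> = ((\<lambda>x. brauer_comp x (delta (leq B) B)) ^^ t)
              ((brauer_comp (delta (leq A) A) ^^ s) \<beta>))"

definition anti_annular :: "('a set \<Rightarrow> 'a rel) \<Rightarrow> 'a brauer \<Rightarrow> bool" where
  "anti_annular leq \<alpha> \<longleftrightarrow> annular leq (brauer_comp (gamma (leq (bdom \<alpha>)) (bdom \<alpha>)) \<alpha>)"

definition Jones :: "'a set set \<Rightarrow> ('a set \<Rightarrow> 'a rel) \<Rightarrow> ('a brauer, 'a set) psemigroup" where
  "Jones C leq =
     \<lparr>carrier = {\<alpha>. \<exists>A\<in>C. \<exists>B\<in>C. \<alpha> \<in> brauer A B \<and> annular leq \<alpha>},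
      src = bdom, tgt = bran, pmul = brauer_comp\<rparr>"

definition anti_Jones :: "'a set set \<Rightarrow> ('a set \<Rightarrow> 'a rel) \<Rightarrow> ('a brauer, 'a set) psemigroup" where
  "anti_Jones C leq =
     \<lparr>carrier = {\<alpha>. \<exists>A\<in>C. \<exists>B\<in>C. \<alpha> \<in> brauer A B \<and> (annular leq \<alpha> \<or> anti_annular leq \<alpha>)},
      src = bdom, tgt = bran, pmul = brauer_comp\<rparr>"

text \<open>All objects are finite, so the cardinals involved are at most \<open>\<omega>\<close>, written \<open>\<infinity> :: enat\<close>.\<close>

definition xi :: "'a set set \<Rightarrow> enat" where
  "xi C = (LEAST c. \<forall>A\<in>C. enat (card A) < c)"

definition rank_ideal ::
  "('a brauer, 'a set) psemigroup \<Rightarrow> enat \<Rightarrow> ('a brauer, 'a set) psemigroup" where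
  "rank_ideal Q r = restrict_psg Q {\<alpha> \<in> carrier Q. enat (rank \<alpha>) \<le> r}"


section \<open>Planar equivalences\<close>

definition Eq2 :: "'a set \<Rightarrow> 'a rel set" where
  "Eq2 A = {\<epsilon> \<in> Eqv A. (\<exists>!K. K \<in> A // \<epsilon> \<and> card K = 1) \<and> (\<forall>K \<in> A // \<epsilon>. card K = 1 \<or> card K = 2)}"

definition lt_in :: "'a rel \<Rightarrow> 'a \<Rightarrow> 'a \<Rightarrow> bool" where
  "lt_in r u v \<longleftrightarrow> (u, v) \<in> r \<and> u \<noteq> v"

definition separated :: "'a rel \<Rightarrow> 'a set \<Rightarrow> 'a set \<Rightarrow> bool" where
  "separated r U V \<longleftrightarrow> (\<forall>u\<in>U. \<forall>v\<in>V. lt_in r u v) \<or> (\<forall>u\<in>U. \<forall>v\<in>V. lt_in r v u)"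

definition nested_by :: "'a rel \<Rightarrow> 'a set \<Rightarrow> 'a set \<Rightarrow> bool" where
  "nested_by r U V \<longleftrightarrow>
     (\<exists>v1\<in>V. \<exists>v2\<in>V. (\<forall>u\<in>U. lt_in r v1 u \<and> lt_in r u v2) \<and>
        \<not> (\<exists>v\<in>V. lt_in r v1 v \<and> lt_in r v v2))"

definition planar_equiv :: "'a rel \<Rightarrow> 'a set \<Rightarrow> 'a rel \<Rightarrow> bool" where
  "planar_equiv r A \<epsilon> \<longleftrightarrow>
     (\<forall>U \<in> A // \<epsilon>. \<forall>V \<in> A // \<epsilon>. U \<noteq> V \<longrightarrow> separated r U V \<or> nested_by r U V \<or> nested_by r V U)"

definition planar_Eq2 :: "('a set \<Rightarrow> 'a rel) \<Rightarrow> 'a set \<Rightarrow> 'a rel set" where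
  "planar_Eq2 leq A = {\<epsilon> \<in> Eq2 A. planar_equiv (leq A) A \<epsilon>}"

end

(* The classification of the congruences is carried out in an abstract category with involution ^~ and
   product <>, in which every morphism of rank below the size of its source X factors through a hook,
   that is, through some et : X -> W with et^~ <> et = 1 and |X| = |W| + 2.  Every morphism is then a
   product of a coisometry, a unit and the adjoint of a coisometry.  A pair of congruent morphisms that
   differ outside rank one can be moved by coisometries into a local monoid as a pair (1, g).  If g has
   smaller rank, generating g from conjugates of hooks collapses everything up to that rank; if g is a
   unit, the hook that it moves collapses everything two ranks below, which leaves a normal subgroup as
   the only remaining datum.  Rank-one morphisms are determined by their two ends, and a pair of distinct
   ends is spread over all pairs by connectedness.

   For the Jones categories, an object is the ordered list of its points.  Annular partitions are the
   matchings of the cyclic list of upper points followed by the reversed lower points that are built by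
   repeatedly inserting adjacent pairs, up to rotating both lists.  To see that this agrees with planar
   drawings, bend the rectangle into a half annulus, so that all end points lie on a line; the Fashoda
   meet theorem forbids interleaved blocks, and conversely half circles realise every non-crossing
   matching.  A rank-one partition is recovered from the two equivalences given by its upper and lower
   blocks, which identifies the minimal ideal with a partial rectangular band. *)
theory Submission
  imports Defs "HOL-Analysis.Fashoda_Theorem"
begin

section \<open>Categories generated by hooks\<close>

text \<open>The ambient category has an object for every list of distinct points of odd length, far
  more than \<open>C\<close> supplies. This makes the normal form possible: the middle object of a
  factorization, in particular the one-point object \<open>pt\<close>, need not belong to
  \<open>C\<close>. The price is that a congruence only sees arrows between the objects
  \<open>L A\<close>, and only multipliers of rank at most \<open>r\<close>. So a local monoid at
  \<open>Z\<close> is always reached by conjugating with a coisometry into some \<open>L A\<close>,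
  and every multiplier must visibly factor through a small object. Odd sizes matter twice. Ranks
  drop in steps of two and end at one, where composites collapse to a band. And the two-point circle
  is excluded, on which both (a, b) and (b, a) are adjacent and contracting a cup could close a loop
  around the cylinder. Size three is the true base case: its different hooks are not linked by
  common multiples, and a rotation of order three replaces the arguments that work from size five
  on. For congruences, statements about right ends come from applying those about left ends to the
  image of the congruence under the involution.\<close>

locale hook_base =
 fixes ob :: "'o => bool"
  and Hom :: "'o => 'o => 'm set"
  and mul :: "'m => 'm => 'm"  (infixr "<>" 70)
  and st :: "'m => 'm"  ("_^~" [1000] 999)
  and one :: "'o => 'm"
  and rk :: "'m => nat"
  and sz :: "'o => nat"
  and hk :: "'o => 'o => 'm set"
  and pt :: "'o"
 assumes Hom_ob: "x : Hom X Y ==> ob X & ob Y"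
  and mul_in [intro]: "x : Hom X Y ==> y : Hom Y Z ==> x <> y : Hom X Z"
  and mul_assoc [simp]: "(x <> y) <> z = x <> y <> z"
  and one_in [intro]: "ob X ==> one X : Hom X X"
  and one_l: "x : Hom X Y ==> one X <> x = x"
  and one_r: "x : Hom X Y ==> x <> one Y = x"
  and st_in [intro]: "x : Hom X Y ==> x^~ : Hom Y X"
  and st_st [simp]: "(x^~)^~ = x"
  and st_mul [simp]: "(x <> y)^~ = y^~ <> x^~"
  and rk_mul1: "x : Hom X Y ==> y : Hom Y Z ==> rk (x <> y) <= rk x"
  and rk_st [simp]: "rk (x^~) = rk x"
  and rk_one: "ob X ==> rk (one X) = sz X"
  and full_unit: "x : Hom X Y ==> rk x = sz X ==> sz Y = sz X ==> x <> x^~ = one X"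
  and sz_odd: "ob X ==> odd (sz X)"
  and iso: "ob X ==> ob Y ==> sz X = sz Y ==> EX g:Hom X Y. rk g = sz X"
  and ob_pt: "ob pt" and sz_pt: "sz pt = 1"
  and pt_triv: "x : Hom pt pt ==> x = one pt"
  and hkD: "et : hk X W ==> et : Hom X W & et^~ <> et = one W & sz X = sz W + 2"
  and factor: "x : Hom X Y ==> rk x ~= sz X ==> \<exists>W. \<exists>et\<in>hk X W. et <> et^~ <> x = x"
  and hk_ex: "ob X ==> sz X >= 3 ==> \<exists>W. hk X W ~= {}"
begin

section \<open>Coisometries and the normal form of a morphism\<close>

definition coiso :: "'o => 'o => 'm set" where
 "coiso X Z = {a : Hom X Z. a^~ <> a = one Z}"

lemma coisoD: "a : coiso X Z ==> a : Hom X Z" "a : coiso X Z ==> a^~ <> a = one Z"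
 by (auto simp: coiso_def)

lemma coiso_cancel: "a : coiso X Z ==> y : Hom Z Y ==> a^~ <> a <> y = y"
 by (metis coisoD(2) mul_assoc one_l)

lemma st_one: "ob X ==> (one X)^~ = one X"
 by (metis one_in one_l st_in st_mul st_st)

lemma rk_mul2: "x : Hom X Y ==> y : Hom Y Z ==> rk (x <> y) <= rk y"
 by (metis rk_mul1 rk_st st_in st_mul)

lemma rk_le1: "x : Hom X Y ==> rk x <= sz X"
 by (metis Hom_ob one_in one_l rk_mul1 rk_one)

lemma rk_le2: "x : Hom X Y ==> rk x <= sz Y"
 by (metis rk_le1 rk_st st_in)

lemma full_unit2: "x : Hom X Y ==> rk x = sz X ==> sz Y = sz X ==> x^~ <> x = one Y"
 by (metis full_unit rk_st st_in st_st)

lemma unit_coiso: "x : Hom X Y ==> rk x = sz X ==> sz Y = sz X ==> x : coiso X Y"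
 by (simp add: coiso_def full_unit2)

lemma one_coiso: "ob X ==> one X : coiso X X"
 by (simp add: one_in rk_one unit_coiso)

lemma coiso_rk: "a : coiso X Z ==> rk a = sz Z"
 by (metis Hom_ob coisoD dual_order.antisym rk_le2 rk_mul2 rk_one st_in)

lemma hk_coiso: "et : hk X W ==> et : coiso X W"
 by (simp add: coiso_def hkD)

lemma coiso_mul: "a : coiso X Y ==> b : coiso Y Z ==> a <> b : coiso X Z"
 unfolding coiso_def by (auto simp: mul_in coiso_cancel coiso_def)

lemma coiso_sz: "a : coiso X Z ==> sz Z <= sz X"
 by (metis coisoD(1) coiso_rk rk_le1)

lemma coiso_rk_mul: "a : coiso X Y ==> x : Hom Y Z ==> rk (a <> x) = rk x"
proof -
 assume a: "a : coiso X Y" and x: "x : Hom Y Z"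
 have aH: "a : Hom X Y" using a coisoD by blast
 have "rk (a^~ <> a <> x) <= rk (a <> x)" using rk_mul2[OF st_in[OF aH] mul_in[OF aH x]] .
 thus ?thesis using coiso_cancel[OF a x] rk_mul2[OF aH x] by simp
qed

lemma coiso_rk_mul2: "a : coiso X Y ==> x : Hom Z Y ==> rk (x <> a^~) = rk x"
 by (metis coiso_rk_mul rk_st st_in st_mul st_st)

text \<open>Hooks are peeled off the source until it has as many points as the rank; this ends
  because each hook removes two points. The product \<open>a\<close> of the hooks is a coisometry,
  so passing from \<open>x\<close> to \<open>a^~ <> x\<close> loses neither rank nor
  information.\<close>

lemma factor_left:
 "x : Hom X Y ==> \<exists>Z a. a : coiso X Z & sz Z = rk x & a^~ <> x : Hom Z Y &
  a <> a^~ <> x = x & rk (a^~ <> x) = rk x"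
proof (induction "sz X" arbitrary: X x rule: less_induct)
 case less
 show ?case
 proof (cases "rk x = sz X")
  case True
  thus ?thesis using less.prems
   by (intro exI[of _ X] exI[of _ "one X"])
    (auto simp: one_coiso Hom_ob st_one one_l)
 next
  case False
  then obtain W et where et: "et : hk X W" "et <> et^~ <> x = x"
   using factor less.prems by blast
  have x1: "et^~ <> x : Hom W Y" using et hkD less.prems by blast
  have rk1: "rk (et^~ <> x) = rk x"
   using et x1 coiso_rk_mul hk_coiso by metis
  obtain Z a where a: "a : coiso W Z" "sz Z = rk x" "a^~ <> et^~ <> x : Hom Z Y"
   "a <> a^~ <> et^~ <> x = et^~ <> x" "rk (a^~ <> et^~ <> x) = rk x"
   using less.hyps[OF _ x1] hkD[OF et(1)] rk1 by auto
  show ?thesis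
   using a et coiso_mul[OF hk_coiso[OF et(1)] a(1)]
   by (intro exI[of _ Z] exI[of _ "et <> a"]) auto
 qed
qed

lemma rank_odd: "x : Hom X Y ==> odd (rk x)"
 by (metis Hom_ob coisoD(1) factor_left sz_odd)

text \<open>Peeling on the left and then on the right leaves a full-rank arrow between two objects
  of the right size, hence a unit; it is absorbed into the right factor. Any prescribed object
  \<open>Z\<close> of that size can serve as the middle, because objects of equal size are linked by
  a unit.\<close>

lemma factorization:
 assumes x: "x : Hom X Y" and Z: "ob Z" "sz Z = rk x"
 shows "\<exists>a b. a : coiso X Z & b : coiso Y Z & x = a <> b^~"
proof -
 obtain Z1 a where a: "a : coiso X Z1" "sz Z1 = rk x" "a^~ <> x : Hom Z1 Y"
  "a <> a^~ <> x = x" "rk (a^~ <> x) = rk x" using factor_left[OF x] by auto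
 let ?y = "(a^~ <> x)^~"
 have y: "?y : Hom Y Z1" "rk ?y = rk x" using a st_in[OF a(3)] by (metis, metis rk_st)
 obtain Z2 b where b: "b : coiso Y Z2" "sz Z2 = rk ?y" "b^~ <> ?y : Hom Z2 Z1"
  "b <> b^~ <> ?y = ?y" "rk (b^~ <> ?y) = rk ?y" using factor_left[OF y(1)] by auto
 obtain k where k: "k : Hom Z1 Z" "rk k = sz Z1"
  using iso Hom_ob Z a by (metis coisoD(1))
 let ?w = "b^~ <> ?y"
 have w: "?w : coiso Z2 Z1" using b y a by (intro unit_coiso) auto
 have kc: "k : coiso Z1 Z" using k Z a by (intro unit_coiso) auto
 have kk: "k <> k^~ = one Z1" using k Z a full_unit by auto
 have "x = a <> ?y^~" using a by simp
 also have "?y^~ = (b <> ?w)^~" using b(4) by simp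
 also have "\<dots> = ?w^~ <> b^~" by simp
 also have "\<dots> = (k <> k^~) <> ?w^~ <> b^~"
  using kk one_l[OF mul_in[OF st_in[OF coisoD(1)[OF w]] st_in[OF coisoD(1)[OF b(1)]]]] by simp
 finally have "x = (a <> k) <> (b <> ?w <> k)^~" by simp
 moreover have "a <> k : coiso X Z" "b <> ?w <> k : coiso Y Z"
  using a b w kc coiso_mul by blast+
 ultimately show ?thesis by blast
qed

lemma coiso_proj: "a : coiso X Z ==> b : coiso Y Z ==> (a <> b^~) <> (a <> b^~)^~ = a <> a^~"
 by (simp, metis coiso_cancel coisoD(1) st_in)

lemma ex_ob: "x : Hom X Y ==> \<exists>Z. ob Z & sz Z = rk x"
 by (metis Hom_ob coisoD(1) factor_left)

lemma regular: "x : Hom X Y ==> x <> x^~ <> x = x"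
proof -
 assume x: "x : Hom X Y"
 then obtain Z a b where "a : coiso X Z" "b : coiso Y Z" "x = a <> b^~"
  using factorization ex_ob by metis
 thus ?thesis
  by (simp, metis coiso_cancel coisoD(1) st_in)
qed

lemma rk_proj: "x : Hom X Y ==> rk (x <> x^~) = rk x"
 by (metis dual_order.antisym mul_assoc regular rk_mul1 mul_in st_in)

text \<open>In the normal form of \<open>s\<close> the second factor is an endomorphism of
  \<open>Z\<close> of full rank, hence a unit. This is the test used whenever a multiplication may
  or may not destroy rank.\<close>

lemma full_coiso: "s : Hom X Z ==> rk s = sz Z ==> s : coiso X Z"
proof -
 assume s: "s : Hom X Z" "rk s = sz Z"
 then obtain a b where ab: "a : coiso X Z" "b : coiso Z Z" "s = a <> b^~"
  using factorization Hom_ob by metis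
 have "b <> b^~ = one Z" using ab full_unit coisoD coiso_rk by metis
 hence "s^~ <> s = one Z" using ab
  by (simp, metis coiso_cancel coisoD(1) st_in)
 thus ?thesis using s by (simp add: coiso_def)
qed

lemma coiso_ex: "ob X ==> ob Z ==> sz Z <= sz X ==> \<exists>a. a : coiso X Z"
proof (induction "sz X" arbitrary: X rule: less_induct)
 case less
 show ?case
 proof (cases "sz Z = sz X")
  case True
  thus ?thesis using iso less unit_coiso by metis
 next
  case False
  hence lt: "sz Z < sz X" using less by auto
  moreover have "odd (sz Z)" "odd (sz X)" using sz_odd less by auto
  ultimately have "sz X >= 3" "sz Z + 2 <= sz X" by presburger+
  then obtain W et where et: "et : hk X W" using hk_ex less by blast
  hence "sz X = sz W + 2" "ob W" using hkD Hom_ob by blast+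
  then obtain a where "a : coiso W Z"
   using less.hyps[of W] less.prems \<open>sz Z + 2 <= sz X\<close> by auto
  thus ?thesis using et hk_coiso coiso_mul by blast
 qed
qed

section \<open>Morphisms into the one-point object\<close>

lemma pt_coiso: "x : Hom X pt ==> x : coiso X pt"
 by (simp add: coiso_def) (metis mul_in st_in pt_triv)

lemma pt_rk: "x : Hom X pt ==> rk x = 1"
 using coiso_rk pt_coiso sz_pt by metis

text \<open>The inner product of two ends over the same object is an endomorphism of
  \<open>pt\<close>, and there is only one. All rectangular-band laws in rank one come from
  this.\<close>

lemma pt_cancel: "u : Hom X pt ==> v : Hom X pt ==> u^~ <> v = one pt"
 by (metis mul_in st_in pt_triv)

lemma pt_cancel2: "u : Hom X pt ==> v : Hom X pt ==> w : Hom pt Y ==> u^~ <> v <> w = w"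
 by (metis mul_assoc pt_cancel one_l)

lemma rank_one_band: "z : Hom Z Z ==> rk z = 1 ==> x : Hom Z Z ==> z <> x <> z = z"
proof -
 assume z: "z : Hom Z Z" "rk z = 1" and x: "x : Hom Z Z"
 obtain a b where ab: "a : coiso Z pt" "b : coiso Z pt" "z = a <> b^~"
  using factorization[OF z(1) ob_pt] z sz_pt by auto
 hence "b^~ <> x <> a <> b^~ = b^~"
  using pt_cancel2[OF coisoD(1)[OF ab(2)] mul_in[OF x coisoD(1)[OF ab(1)]] st_in[OF coisoD(1)[OF ab(2)]]]
  by simp
 thus ?thesis using ab by simp
qed

lemma pt_factor: "x : Hom X Y ==> rk x = 1 ==> EX u:Hom X pt. EX w:Hom Y pt. x = u <> w^~"
 by (metis factorization ob_pt sz_pt coisoD(1))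

lemma pt_proj_eq: "u : Hom X pt ==> v : Hom X pt ==> u <> u^~ = v <> v^~ ==> u = v"
 by (metis mul_assoc one_r pt_cancel regular)

end

text \<open>The further axioms are the combinatorial input: \<open>gen\<close> lets the rank drop,
  \<open>unit_move\<close> makes a nontrivial unit visible on hooks, \<open>meet\<close> connects
  hooks, \<open>sep\<close> lets hooks tell two kernels apart. The bound five is forced: below a
  hook of size three lies size one, where no rank can drop and all projections agree, and two hooks
  of size three with different projections have no common right multiple. There \<open>three\<close>
  takes over: the ends form a single orbit of an element of order three.\<close>

locale hook_category = hook_base ob Hom mul st one rk sz hk pt
 for ob :: "'o => bool" and Hom and mul :: "'m => 'm => 'm" (infixr "<>" 70)
  and st ("_^~" [1000] 999) and one rk sz hk pt +
 assumes gen: "et : hk X W ==> sz X >= 5 ==>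
    EX g:Hom X X. rk g = sz X & rk (et^~ <> g <> et) < sz W"
  and unit_move: "g : Hom X X ==> rk g = sz X ==> sz X >= 3 ==> g ~= one X ==>
    \<exists>W. \<exists>et\<in>hk X W. g <> et <> et^~ <> g^~ ~= et <> et^~"
  and meet: "et : hk X W ==> et' : hk X W' ==> sz X >= 5 ==>
    \<exists>W'' V V' a b a' b'. \<exists>et''\<in>hk X W''.
     a : Hom W V & b : Hom W'' V & et <> a = et'' <> b &
     a' : Hom W'' V' & b' : Hom W' V' & et'' <> a' = et' <> b'"
  and three: "ob T ==> sz T = 3 ==> \<exists>\<tau>\<in>Hom T T. ALL t:Hom T pt. \<tau> <> \<tau> <> \<tau> <> t = t & \<tau> <> t ~= t &
    (ALL s:Hom T pt. s = t \<or> s = \<tau> <> t \<or> s = \<tau> <> \<tau> <> t)"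
  and sep: "x : Hom X Z ==> y : Hom X Z ==> rk x = sz Z ==> rk y = sz Z ==> sz X >= 5 ==>
    x <> x^~ ~= y <> y^~ ==> \<exists>W. \<exists>et\<in>hk X W. (rk (et^~ <> x) = sz Z \<or> rk (et^~ <> y) = sz Z) &
     \<not> (rk (et^~ <> x) = sz Z & rk (et^~ <> y) = sz Z &
      et^~ <> x <> x^~ <> et = et^~ <> y <> y^~ <> et)"
begin

section \<open>Congruences on local monoids\<close>

definition loccong :: "'o => 'm rel => bool" where
 "loccong Z \<tau> \<longleftrightarrow> equiv (Hom Z Z) \<tau> &
  (\<forall>s t u. (s, t) : \<tau> --> u : Hom Z Z --> (u <> s, u <> t) : \<tau> & (s <> u, t <> u) : \<tau>)"

lemma loccongD:
 assumes "loccong Z \<tau>"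
 shows "equiv (Hom Z Z) \<tau>"
  and "(s, t) : \<tau> ==> s : Hom Z Z" "(s, t) : \<tau> ==> t : Hom Z Z"
  and "(s, t) : \<tau> ==> u : Hom Z Z ==> (u <> s, u <> t) : \<tau>"
  and "(s, t) : \<tau> ==> u : Hom Z Z ==> (s <> u, t <> u) : \<tau>"
  and "(s, t) : \<tau> ==> (t, s) : \<tau>"
  and "(s, t) : \<tau> ==> (t, v) : \<tau> ==> (s, v) : \<tau>"
  and "s : Hom Z Z ==> (s, s) : \<tau>"
proof -
 have e: "equiv (Hom Z Z) \<tau>" using assms unfolding loccong_def by blast
 thus "equiv (Hom Z Z) \<tau>" .
 have sub: "\<tau> <= Hom Z Z \<times> Hom Z Z" using e by (rule equiv_type)
 show "(s, t) : \<tau> ==> s : Hom Z Z" "(s, t) : \<tau> ==> t : Hom Z Z" using sub by auto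
 show "(s, t) : \<tau> ==> u : Hom Z Z ==> (u <> s, u <> t) : \<tau>"
  "(s, t) : \<tau> ==> u : Hom Z Z ==> (s <> u, t <> u) : \<tau>"
  using assms unfolding loccong_def by auto
 show "(s, t) : \<tau> ==> (t, s) : \<tau>" using e by (meson equivE symD)
 show "(s, t) : \<tau> ==> (t, v) : \<tau> ==> (s, v) : \<tau>" using e by (meson equivE transD)
 show "s : Hom Z Z ==> (s, s) : \<tau>" using e by (meson equivE refl_onD)
qed

text \<open>Conjugation by a coisometry is multiplicative because \<open>a^~ <> a\<close> is an
  identity, so the local monoid at \<open>Z\<close> sits inside the one at \<open>X\<close>.\<close>

lemma loccong_pullback:
 assumes \<tau>: "loccong X \<tau>" and a: "a : coiso X Z"
 shows "loccong Z {(s, t). s : Hom Z Z & t : Hom Z Z & (a <> s <> a^~, a <> t <> a^~) : \<tau>}"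
proof -
 note T = loccongD[OF \<tau>]
 have aH: "a : Hom X Z" "a^~ : Hom Z X" using a coisoD by auto
 have conj: "s : Hom Z Z ==> a <> s <> a^~ : Hom X X" for s using aH by blast
 have m: "a <> (s <> t) <> a^~ = (a <> s <> a^~) <> (a <> t <> a^~)" if "s : Hom Z Z" "t : Hom Z Z" for s t
  using that coiso_cancel[OF a] aH by (simp, metis mul_in)
 show ?thesis
  unfolding loccong_def equiv_def refl_on_def sym_def trans_def
  apply (intro conjI)
  subgoal by blast
  subgoal using T(8) conj by blast
  subgoal using T(6) by blast
  subgoal using T(7) by blast
  subgoal
   apply (intro allI impI)
   apply (clarsimp simp del: mul_assoc simp: m)
   using T(4,5) conj by (auto simp del: mul_assoc)
  done
qed

text \<open>Descent along hooks: if the identity is congruent to something of smaller rank, it is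
  congruent to a hook projection, then to the conjugate of that projection by the unit from
  \<open>gen\<close>. Cut down by the hook, this is again such a pair, one hook lower.\<close>

lemma loccong_rank_one:
 assumes "loccong Z \<tau>" "ob Z" "sz Z >= 3" "(one Z, g) : \<tau>" "rk g < sz Z"
 shows "\<exists>z. (one Z, z) : \<tau> & rk z = 1"
 using assms
proof (induction "sz Z" arbitrary: Z \<tau> g rule: less_induct)
 case less
 note T = loccongD[OF less.prems(1)]
 have g: "g : Hom Z Z" using T(3) less.prems by blast
 obtain W et where et: "et : hk Z W" "et <> et^~ <> g = g" using factor g less.prems
  by (metis nat_less_le)
 have etH: "et : Hom Z W" "et^~ : Hom W Z" "sz Z = sz W + 2" "et : coiso Z W" "ob W"
  using hkD[OF et(1)] hk_coiso et(1) Hom_ob by blast+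
 \<comment> \<open>Multiplying the pair \<open>(one Z, g)\<close> by the projection leaves
   \<open>g\<close> unchanged, so the projection is congruent to \<open>g\<close> and thereby to the
   identity.\<close>
 have "(et <> et^~, g) : \<tau>"
  using T(4)[OF less.prems(4), of "et <> et^~"] et etH by (metis mul_assoc mul_in one_r)
 hence 1: "(one Z, et <> et^~) : \<tau>" using T(6,7) less.prems(4) by blast
 have hh: "et <> et^~ : Hom Z Z" using etH by blast
 show ?case
 proof (cases "sz Z = 3")
  case True
  hence "rk (et <> et^~) = 1" using etH coiso_rk rk_proj by auto
  with 1 show ?thesis by blast
 next
  case False
  hence "sz Z >= 5" using sz_odd[OF less.prems(2)] less.prems(3)
   by presburger
  then obtain u where u: "u : Hom Z Z" "rk u = sz Z" "rk (et^~ <> u <> et) < sz W"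
   using gen et by blast
  let ?k = "et^~ <> u <> et"
  have k: "?k : Hom W W" using u etH by blast
  have us: "u^~ : Hom Z Z" using u by blast
  have uu: "u <> u^~ = one Z" using full_unit u by auto
  have "(u <> one Z <> u^~, u <> (et <> et^~) <> u^~) : \<tau>"
   using T(4)[OF T(5)[OF 1 us] u(1)] by simp
  moreover have "u <> one Z <> u^~ = one Z" using uu one_l us by metis
  ultimately have "(one Z, u <> et <> et^~ <> u^~) : \<tau>" by simp
  \<comment> \<open>Compression by the projection on both sides turns the conjugate into
    \<open>et <> (?k <> ?k^~) <> et^~\<close>, a statement about the local monoid at
    \<open>W\<close>.\<close>
  from T(4)[OF T(5)[OF this hh] hh]
  have "((et <> et^~) <> one Z <> (et <> et^~), (et <> et^~) <> (u <> et <> et^~ <> u^~) <> (et <> et^~)) : \<tau>"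
   by simp
  moreover have "(et <> et^~) <> one Z <> (et <> et^~) = et <> one W <> et^~"
   using etH hh one_l coiso_cancel[OF etH(4)] by (metis mul_assoc)
  ultimately have kt: "(et <> one W <> et^~, et <> (?k <> ?k^~) <> et^~) : \<tau>" by simp
  have "\<exists>z. (one W, z) : {(s, t). s : Hom W W & t : Hom W W & (et <> s <> et^~, et <> t <> et^~) : \<tau>} & rk z = 1"
  proof (rule less.hyps[OF _ loccong_pullback[OF less.prems(1) etH(4)]])
   show "rk (?k <> ?k^~) < sz W" using rk_proj[OF k] u(3) by simp
   show "(one W, ?k <> ?k^~) : {(s, t). s : Hom W W & t : Hom W W & (et <> s <> et^~, et <> t <> et^~) : \<tau>}"
    using kt k one_in etH(5) mul_in[OF k st_in[OF k]] by blast
  qed (use etH \<open>sz Z >= 5\<close> in auto)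
  then obtain z where z: "z : Hom W W" "rk z = 1" "(et <> one W <> et^~, et <> z <> et^~) : \<tau>" by blast
  have "(one Z, et <> z <> et^~) : \<tau>"
   using z(3) 1 T(7) etH one_l by metis
  moreover have "rk (et <> z <> et^~) = 1"
   using coiso_rk_mul[OF etH(4)] coiso_rk_mul2[OF etH(4)] z etH by (metis mul_in)
  ultimately show ?thesis by blast
 qed
qed

text \<open>With \<open>z\<close> of rank one congruent to the identity, every \<open>x\<close> is
  congruent to \<open>z <> x\<close> and this to \<open>z <> x <> z\<close>, which equals
  \<open>z\<close>.\<close>

lemma loccong_collapse:
 assumes \<tau>: "loccong Z \<tau>" "ob Z" "sz Z >= 3" "(one Z, g) : \<tau>" "rk g < sz Z"
  and st: "s : Hom Z Z" "t : Hom Z Z"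
 shows "(s, t) : \<tau>"
proof -
 note T = loccongD[OF \<tau>(1)]
 obtain z where z: "(one Z, z) : \<tau>" "rk z = 1" using loccong_rank_one[OF \<tau>] by blast
 have zH: "z : Hom Z Z" using T(3) z by blast
 have A: "(x, z) : \<tau>" if x: "x : Hom Z Z" for x
 proof -
  have "(one Z <> x, z <> x) : \<tau>" using T(5) z x by blast
  moreover have "(z <> x <> one Z, z <> x <> z) : \<tau>" using T(4)[OF T(4)[OF z(1) x] zH] by simp
  ultimately show ?thesis
   using rank_one_band[OF zH z(2) x] one_l[OF x] one_r[OF x] T(7)[of x "z <> x" z] by simp
 qed
 show ?thesis using T(7)[OF A[OF st(1)] T(6)[OF A[OF st(2)]]] .
qed

section \<open>Separating and connecting ends\<close>

lemma sz_one_unique: "sz X = 1 ==> u : Hom X pt ==> v : Hom X pt ==> u = v"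
proof -
 assume X: "sz X = 1" and u: "u : Hom X pt" and v: "v : Hom X pt"
 have "v <> v^~ = one X" using full_unit[OF v] pt_rk[OF v] X sz_pt by simp
 hence "u = (v <> v^~) <> u" using one_l[OF u] by simp
 also have "\<dots> = v" using pt_cancel[OF v u] one_r[OF v] by simp
 finally show "u = v" .
qed

text \<open>Ends always have rank one, so \<open>sep\<close> can distinguish them only by their
  projections. Hooks can therefore be stripped without identifying the two ends, down to size
  three.\<close>

lemma sep_pt:
 "u : Hom X pt ==> v : Hom X pt ==> u ~= v ==> \<exists>T c. ob T & sz T = 3 & c : Hom T X & c <> u ~= c <> v"
proof (induction "sz X" arbitrary: X u v rule: less_induct)
 case less
 have X: "ob X" "odd (sz X)" using Hom_ob sz_odd less.prems by blast+
 have "sz X ~= 1" using sz_one_unique less.prems by blast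
 show ?case
 proof (cases "sz X = 3")
  case True
  thus ?thesis using less.prems X one_in one_l by metis
 next
  case False
  with X \<open>sz X ~= 1\<close> have "sz X >= 5" by presburger
  moreover have "u <> u^~ ~= v <> v^~" using pt_proj_eq less.prems by blast
  ultimately obtain W et where et: "et : hk X W" and n: "\<not> (rk (et^~ <> u) = sz pt & rk (et^~ <> v) = sz pt &
      et^~ <> u <> u^~ <> et = et^~ <> v <> v^~ <> et)"
   using sep[OF less.prems(1,2)] pt_rk sz_pt less.prems by metis
  have ets: "et^~ : Hom W X" "sz X = sz W + 2" using et hkD by blast+
  hence H: "et^~ <> u : Hom W pt" "et^~ <> v : Hom W pt" using less.prems by blast+
  have "et^~ <> u ~= et^~ <> v"
  proof
   assume e: "et^~ <> u = et^~ <> v"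
   have "(et^~ <> u) <> (et^~ <> u)^~ = (et^~ <> v) <> (et^~ <> v)^~" unfolding e ..
   with n H pt_rk sz_pt show False by simp
  qed
  then obtain T c where "ob T" "sz T = 3" "c : Hom T W" "c <> et^~ <> u ~= c <> et^~ <> v"
   using less.hyps[OF _ H] ets(2) by auto
  thus ?thesis using ets(1) by (metis mul_assoc mul_in)
 qed
qed

text \<open>Hooks are stripped while both compressions keep full rank. At the first hook where only
  one of them does, the adjoint of that compression turns the one arrow into an identity, while the
  other has already lost rank.\<close>

lemma sep_rank:
 "x : coiso X Z ==> y : coiso X Z ==> sz Z >= 3 ==> x <> x^~ ~= y <> y^~ ==>
  EX c:Hom Z X. (rk (c <> x) = sz Z) ~= (rk (c <> y) = sz Z)"
proof (induction "sz X" arbitrary: X x y rule: less_induct)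
 case less
 have X: "ob X" "odd (sz X)" "ob Z" "odd (sz Z)" using Hom_ob sz_odd less.prems coisoD(1) by blast+
 have xy: "x : Hom X Z" "y : Hom X Z" "rk x = sz Z" "rk y = sz Z"
  using less.prems coisoD(1) coiso_rk by auto
 have "sz Z <= sz X" using less.prems coiso_sz by blast
 moreover have "sz Z ~= sz X" using full_unit less.prems xy by metis
 ultimately have "sz X >= 5" using X less.prems(3) by presburger
 then obtain W et where et: "et : hk X W" and o: "rk (et^~ <> x) = sz Z \<or> rk (et^~ <> y) = sz Z"
  and n: "\<not> (rk (et^~ <> x) = sz Z & rk (et^~ <> y) = sz Z &
      et^~ <> x <> x^~ <> et = et^~ <> y <> y^~ <> et)"
  using sep[OF xy(1,2)] xy less.prems by metis
 have ets: "et^~ : Hom W X" "sz X = sz W + 2" using et hkD by blast+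
 hence H: "et^~ <> x : Hom W Z" "et^~ <> y : Hom W Z" using xy by blast+
 have key: "EX c:Hom Z X. (rk (c <> x) = sz Z) ~= (rk (c <> y) = sz Z)"
  if x: "x : Hom X Z" "y : Hom X Z" "rk (et^~ <> x) = sz Z" "rk (et^~ <> y) ~= sz Z" for x y
 proof -
  have H: "et^~ <> x : Hom W Z" "et^~ <> y : Hom W Z" using x ets by blast+
  let ?c = "(et^~ <> x)^~ <> et^~"
  have c: "?c : Hom Z X" using H st_in ets mul_in by blast
  have "?c <> x = one Z" using full_coiso[OF H(1) x(3)] by (auto dest: coisoD(2))
  hence "rk (?c <> x) = sz Z" using rk_one X by simp
  moreover have "rk (?c <> y) <= rk (et^~ <> y)"
   using rk_mul2[OF st_in[OF H(1)] H(2)] by simp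
  hence "rk (?c <> y) ~= sz Z" using x(4) rk_le2[OF H(2)] by linarith
  ultimately show ?thesis using c by blast
 qed
 consider "rk (et^~ <> x) = sz Z" "rk (et^~ <> y) ~= sz Z" | "rk (et^~ <> y) = sz Z" "rk (et^~ <> x) ~= sz Z"
  | "rk (et^~ <> x) = sz Z" "rk (et^~ <> y) = sz Z" using o by blast
 thus ?case
 proof cases
  case 1
  thus ?thesis using key xy by blast
 next
  case 2
  thus ?thesis using key[of y x] xy by metis
 next
  case 3
  hence "et^~ <> x : coiso W Z" "et^~ <> y : coiso W Z" using full_coiso H by blast+
  moreover have "(et^~ <> x) <> (et^~ <> x)^~ ~= (et^~ <> y) <> (et^~ <> y)^~" using n 3 by simp
  ultimately obtain c where "c : Hom Z W" "(rk (c <> et^~ <> x) = sz Z) ~= (rk (c <> et^~ <> y) = sz Z)"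
   using less.hyps[of W "et^~ <> x" "et^~ <> y"] ets less.prems by auto
  thus ?thesis using ets(1) by (metis mul_assoc mul_in)
 qed
qed

text \<open>Over an object of size at least five each end lies under some hook, ends under one hook
  are linked by induction, and by \<open>meet\<close> any two hooks are linked through a third one
  that shares an end with each of them. Size three is left to the hypothesis.\<close>

lemma pt_connected:
 assumes "ob X" "sz X >= 3" "equiv (Hom X pt) E"
  and "!!T b s s'. ob T ==> sz T = 3 ==> b : Hom X T ==> s : Hom T pt ==> s' : Hom T pt ==> (b <> s, b <> s') : E"
  and "u : Hom X pt" "v : Hom X pt"
 shows "(u, v) : E"
 using assms
proof (induction "sz X" arbitrary: X E u v rule: less_induct)
 case less
 show ?case
 proof (cases "sz X = 3")
  case True
  thus ?thesis using less.prems(4)[OF less.prems(1), of "one X"] less.prems one_in one_l by metis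
 next
  case False
  hence sz: "sz X >= 5" using less.prems(2) sz_odd[OF less.prems(1)] by presburger
  have sym: "(s, t) : E ==> (t, s) : E" and tr: "(s, t) : E ==> (t, t') : E ==> (s, t') : E" for s t t'
   using less.prems(3) by (meson equivE symD, meson equivE transD)
  have A: "(et <> s, et <> s') : E" if et: "et : hk X W" and s: "s : Hom W pt" "s' : Hom W pt" for et W s s'
  proof -
   have etH: "et : Hom X W" "sz X = sz W + 2" "ob W" using hkD[OF et] Hom_ob by blast+
   let ?E = "{(s, s'). s : Hom W pt & s' : Hom W pt & (et <> s, et <> s') : E}"
   have "(s, s') : ?E"
   proof (rule less.hyps[OF _ etH(3)])
    show "equiv (Hom W pt) ?E"
     using less.prems(3) etH(1) unfolding equiv_def refl_on_def sym_def trans_def by blast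
    show "(b <> s, b <> s') : ?E" if "ob T" "sz T = 3" "b : Hom W T" "s : Hom T pt" "s' : Hom T pt" for T b s s'
     using less.prems(4)[of T "et <> b" s s'] that mul_in[OF etH(1)] by (auto simp: mul_in)
   qed (use etH sz s in auto)
   thus ?thesis by simp
  qed
  obtain W et where et: "et : hk X W" "et <> et^~ <> u = u"
   using factor[OF less.prems(5)] pt_rk[OF less.prems(5)] sz by fastforce
  obtain W' et' where et': "et' : hk X W'" "et' <> et'^~ <> v = v"
   using factor[OF less.prems(6)] pt_rk[OF less.prems(6)] sz by fastforce
  obtain W'' V V' a b a' b' et'' where m: "et'' : hk X W''" "a : Hom W V" "b : Hom W'' V" "et <> a = et'' <> b"
   "a' : Hom W'' V'" "b' : Hom W' V'" "et'' <> a' = et' <> b'"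
   using meet[OF et(1) et'(1) sz] by auto
  obtain p p' where p: "p : Hom V pt" "p' : Hom V' pt"
  proof -
   have "ob V" "ob V'" using m Hom_ob by blast+
   moreover have "sz pt <= sz V" "sz pt <= sz V'" using \<open>ob V\<close> \<open>ob V'\<close> sz_odd[of V] sz_odd[of V'] sz_pt
    by (auto simp: Suc_le_eq intro: ccontr)
   ultimately show ?thesis using coiso_ex ob_pt coisoD(1) that by metis
  qed
  have "et^~ <> u : Hom W pt" using et hkD less.prems(5) by blast
  from A[OF et(1) this, of "a <> p"] have "(u, et <> a <> p) : E" using et m p by auto
  also have "et <> a <> p = et'' <> b <> p" using m by (metis mul_assoc)
  finally have 1: "(u, et'' <> b <> p) : E" .
  have "(et'' <> b <> p, et'' <> a' <> p') : E" using A[OF m(1)] m p by blast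
  also have "et'' <> a' <> p' = et' <> b' <> p'" using m by (metis mul_assoc)
  finally have 2: "(et'' <> b <> p, et' <> b' <> p') : E" .
  have "et'^~ <> v : Hom W' pt" using et' hkD less.prems(6) by blast
  from A[OF et'(1) _ this, of "b' <> p'"] have "(et' <> b' <> p', v) : E" using et' m p by auto
  with 1 2 show ?thesis using tr by blast
 qed
qed

end

section \<open>Congruences\<close>

lemma (in hook_category) two_pt: "ob X ==> sz X >= 3 ==> EX u:Hom X pt. EX v:Hom X pt. u ~= v"
proof (induction "sz X" arbitrary: X rule: less_induct)
 case less
 obtain u where u: "u : Hom X pt"
  using coiso_ex[OF less.prems(1) ob_pt] less.prems(2) sz_pt coisoD(1) by fastforce
 show ?case
 proof (cases "sz X = 3")
  case True
  then obtain \<tau> where "\<tau> : Hom X X" "\<tau> <> u ~= u" using three[OF less.prems(1)] u by blast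
  thus ?thesis using u mul_in by blast
 next
  case False
  obtain W et where et: "et : hk X W" using hk_ex less.prems by blast
  have W: "sz X = sz W + 2" "ob W" "et : Hom X W" using hkD[OF et] Hom_ob by blast+
  hence "sz W >= 3" using False less.prems(2) sz_odd[OF W(2)] by presburger
  then obtain s t where st: "s : Hom W pt" "t : Hom W pt" "s ~= t"
   using less.hyps[of W] W by auto
  hence "et <> s ~= et <> t" using coiso_cancel[OF hk_coiso[OF et]] by metis
  thus ?thesis using st W(3) mul_in by blast
 qed
qed

definition dual_rel :: "('m => 'm) => 'm rel => 'm rel" where
 "dual_rel f sg = {(x, y). (f x, f y) : sg}"

section \<open>The partial semigroup over \<open>C\<close> and its Green's relations\<close>

locale hook_subcat = hook_category ob Hom mul st one rk sz hk pt
 for ob :: "'o => bool" and Hom and mul :: "'m => 'm => 'm" (infixr "<>" 70)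
  and st ("_^~" [1000] 999) and one rk sz hk pt +
 fixes C :: "'c set" and L :: "'c => 'o" and sr tg :: "'m => 'c"
 assumes C_ne: "C ~= {}" and L_ob: "A : C ==> ob (L A)"
  and sr_tg: "A : C ==> B : C ==> x : Hom (L A) (L B) ==> sr x = A & tg x = B"
begin

text \<open>Only arrows between the objects \<open>L A\<close> belong to the carrier. Factors
  through other objects are taken in the ambient category and must be recombined before they can
  multiply elements of \<open>Q\<close>.\<close>

definition Q :: "('m, 'c) psemigroup" where
 "Q = \<lparr>carrier = {x. EX A:C. EX B:C. x : Hom (L A) (L B)}, src = sr, tgt = tg, pmul = mul\<rparr>"

definition Ir :: "enat => ('m, 'c) psemigroup" where
 "Ir r = restrict_psg Q {x : carrier Q. enat (rk x) <= r}"

abbreviation H where "H A B \<equiv> Hom (L A) (L B)"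

lemma Ir_simps [simp]: "src (Ir r) = sr" "tgt (Ir r) = tg" "pmul (Ir r) = mul"
 by (auto simp: Ir_def restrict_psg_def Q_def)

lemma Q_simps [simp]: "src Q = sr" "tgt Q = tg" "pmul Q = mul"
 by (auto simp: Q_def)

lemma carrier_Ir: "x : carrier (Ir r) \<longleftrightarrow> (EX A:C. EX B:C. x : H A B) & enat (rk x) <= r"
 by (auto simp: Ir_def restrict_psg_def Q_def)

lemma Ir_infinity: "Ir \<infinity> = Q"
 by (simp add: Ir_def restrict_psg_def)

lemma tnabla_Ir: "(x, y) : tnabla (Ir r) \<longleftrightarrow>
  (EX A:C. EX B:C. x : H A B & y : H A B) & enat (rk x) <= r & enat (rk y) <= r"
 unfolding tnabla_def by (auto simp: carrier_Ir sr_tg) blast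

lemma tnabla_sub: "enat q <= r ==> (x, y) : tnabla (restrict_psg (Ir r) (carrier (Ir (enat q)))) \<longleftrightarrow>
  (EX A:C. EX B:C. x : H A B & y : H A B) & rk x <= q & rk y <= q"
 unfolding tnabla_def by (auto simp: restrict_psg_def carrier_Ir sr_tg intro: order_trans) blast

lemma rk_mul_le: "enat (rk x) <= r \<or> enat (rk y) <= r ==> x : Hom X Y ==> y : Hom Y Z ==> enat (rk (x <> y)) <= r"
 using rk_mul1[of x X Y y Z] rk_mul2[of x X Y y Z] by (meson enat_ord_simps(1) order_trans)

lemma congruence_on_Ir:
 "congruence_on (Ir r) sg \<longleftrightarrow> equiv (carrier (Ir r)) sg & sg <= tnabla (Ir r) &
  (ALL A:C. ALL B:C. ALL D:C. ALL x:H A B. ALL y:H A B. (x, y) : sg -->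
    (ALL a:H D A. enat (rk a) <= r --> (a <> x, a <> y) : sg) &
    (ALL a:H B D. enat (rk a) <= r --> (x <> a, y <> a) : sg))" (is "_ \<longleftrightarrow> _ & _ & ?M")
proof -
 have "(ALL (x, y):sg. ALL a:carrier (Ir r).
    (tgt (Ir r) a = src (Ir r) x --> (pmul (Ir r) a x, pmul (Ir r) a y) : sg) &
    (tgt (Ir r) x = src (Ir r) a --> (pmul (Ir r) x a, pmul (Ir r) y a) : sg)) \<longleftrightarrow> ?M"
  (is "?L \<longleftrightarrow> _") if s: "sg <= tnabla (Ir r)"
 proof
  assume ?L
  hence *: "(x, y) : sg ==> a : carrier (Ir r) ==>
    (tg a = sr x --> (a <> x, a <> y) : sg) & (tg x = sr a --> (x <> a, y <> a) : sg)" for x y a by fastforce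
  show ?M
  proof (intro ballI impI conjI)
   fix A B D x y a assume AB: "A : C" "B : C" "D : C" "x : H A B" "y : H A B" "(x, y) : sg" "enat (rk a) <= r"
   show "(a <> x, a <> y) : sg" if "a : H D A"
    using *[OF AB(6), of a] sr_tg AB that by (auto simp: carrier_Ir)
   show "(x <> a, y <> a) : sg" if "a : H B D"
    using *[OF AB(6), of a] sr_tg AB that by (auto simp: carrier_Ir)
  qed
 next
  assume M: ?M
  show ?L
  proof (intro ballI, clarify)
   fix x y a assume xy: "(x, y) : sg" and a: "a : carrier (Ir r)"
   obtain A B where AB: "A : C" "B : C" "x : H A B" "y : H A B" using s xy tnabla_Ir by blast
   obtain D E where DE: "D : C" "E : C" "a : H D E" "enat (rk a) <= r" using a carrier_Ir by blast
   have t: "sr x = A" "tg x = B" "sr a = D" "tg a = E" using sr_tg AB DE by auto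
   show "(tgt (Ir r) a = src (Ir r) x --> (pmul (Ir r) a x, pmul (Ir r) a y) : sg) &
    (tgt (Ir r) x = src (Ir r) a --> (pmul (Ir r) x a, pmul (Ir r) y a) : sg)"
    unfolding Ir_simps t using M AB DE xy by blast
  qed
 qed
 thus ?thesis unfolding congruence_on_def by blast
qed

text \<open>As in regular star-semigroups, the R-class is recorded by a projection. Restricting to
  rank at most \<open>r\<close> does not change this, since the connecting factors
  \<open>y^~ <> x <> s\<close> contain \<open>x\<close> and so have small rank.\<close>

lemma right_ideal_iff:
 assumes x: "x : carrier (Ir r)" and y: "y : carrier (Ir r)"
 shows "(x, y) : Green_R (Ir r) \<longleftrightarrow> x <> x^~ = y <> y^~"
proof
 have sub: "y <> y^~ <> x = x" if y: "y : carrier (Ir r)" and xy: "x : right_ideal1 (Ir r) y" for x y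
 proof -
  obtain A B where AB: "A : C" "B : C" "y : H A B" using y carrier_Ir by blast
  from xy consider "x = y" | s where "s : carrier (Ir r)" "tg y = sr s" "x = y <> s"
   unfolding right_ideal1_def S1_def rmul1_def rcomposable_def by auto
  thus ?thesis
   by cases (use regular[OF AB(3)] in \<open>auto, metis mul_assoc\<close>)
 qed
 have self: "x : right_ideal1 (Ir r) x" for x
  unfolding right_ideal1_def S1_def by (auto simp: rmul1_def rcomposable_def intro!: exI[of _ None])
 assume "(x, y) : Green_R (Ir r)"
 hence e: "right_ideal1 (Ir r) x = right_ideal1 (Ir r) y" unfolding Green_R_def by auto
 have 1: "y <> y^~ <> x = x" "x <> x^~ <> y = y" using sub x y self e by metis+
 have "x <> x^~ = y <> y^~ <> x <> x^~" using 1 by (metis mul_assoc)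
 also have "\<dots> = ((x <> x^~ <> y) <> y^~)^~" by simp
 also have "\<dots> = y <> y^~" using 1 by simp
 finally show "x <> x^~ = y <> y^~" .
next
 have sub: "right_ideal1 (Ir r) x <= right_ideal1 (Ir r) y"
  if x: "x : carrier (Ir r)" and y: "y : carrier (Ir r)" and e: "x <> x^~ = y <> y^~" for x y
 proof -
  obtain A B where AB: "A : C" "B : C" "x : H A B" "enat (rk x) <= r" using x carrier_Ir by blast
  obtain D E where DE: "D : C" "E : C" "y : H D E" using y carrier_Ir by blast
  have "sr (x <> x^~) = A" "sr (y <> y^~) = D"
   using sr_tg AB DE mul_in[OF AB(3) st_in[OF AB(3)]] mul_in[OF DE(3) st_in[OF DE(3)]] by auto
  hence [simp]: "D = A" using e by simp
  have xy: "x = y <> (y^~ <> x)" using regular[OF AB(3)] e by (metis mul_assoc)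
  have yx: "y^~ <> x : H E B" "y : H A E" using AB DE by auto
  have yxc: "y^~ <> x <> s : carrier (Ir r) & tg y = sr (y^~ <> x <> s)" if s: "s : H B F" "F : C" for s F
  proof -
   have m: "y^~ <> x <> s : H E F" using yx s by (metis mul_assoc mul_in)
   have "enat (rk (x <> s)) <= r" using rk_mul_le AB s by blast
   hence "enat (rk (y^~ <> x <> s)) <= r"
    using rk_mul_le[of "y^~" r "x <> s"] mul_in[OF AB(3) s(1)] st_in[OF yx(2)] by blast
   thus ?thesis using m sr_tg[OF _ _ m] sr_tg[OF _ _ yx(2)] AB DE s carrier_Ir by auto
  qed
  show ?thesis
  proof
   fix z assume "z : right_ideal1 (Ir r) x"
   then consider "z = x" | s where "s : carrier (Ir r)" "tg x = sr s" "z = x <> s"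
    unfolding right_ideal1_def S1_def rmul1_def rcomposable_def by auto
   \<comment> \<open>The adjoined identity is replaced by the identity of the object, whose rank may
     exceed \<open>r\<close>; only its product with \<open>x\<close> has to stay in the
     ideal.\<close>
   then obtain F s where s: "F : C" "s : H B F" "z = x <> s"
   proof cases
    case 1
    thus ?thesis using that[of B "one (L B)"] AB one_r L_ob one_in by metis
   next
    case 2
    thus ?thesis using that carrier_Ir sr_tg AB by metis
   qed
   have "z = y <> (y^~ <> x <> s)" using xy s(3) by (metis mul_assoc)
   thus "z : right_ideal1 (Ir r) y"
    using yxc[OF s(2,1)] unfolding right_ideal1_def S1_def
    by (auto simp: rmul1_def rcomposable_def intro!: exI[of _ "Some (y^~ <> x <> s)"])
  qed
 qed
 assume "x <> x^~ = y <> y^~"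
 thus "(x, y) : Green_R (Ir r)" unfolding Green_R_def using sub[OF x y] sub[OF y x] x y by auto
qed

lemma left_ideal_iff:
 assumes x: "x : carrier (Ir r)" and y: "y : carrier (Ir r)"
 shows "(x, y) : Green_L (Ir r) \<longleftrightarrow> x^~ <> x = y^~ <> y"
proof
 have sub: "x <> y^~ <> y = x" if y: "y : carrier (Ir r)" and xy: "x : left_ideal1 (Ir r) y" for x y
 proof -
  obtain A B where AB: "A : C" "B : C" "y : H A B" using y carrier_Ir by blast
  from xy consider "x = y" | s where "s : carrier (Ir r)" "tg s = sr y" "x = s <> y"
   unfolding left_ideal1_def S1_def lmul1_def lcomposable_def by auto
  thus ?thesis
   by cases (use regular[OF AB(3)] in auto)
 qed
 have self: "x : left_ideal1 (Ir r) x" for x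
  unfolding left_ideal1_def S1_def by (auto simp: lmul1_def lcomposable_def intro!: exI[of _ None])
 assume "(x, y) : Green_L (Ir r)"
 hence e: "left_ideal1 (Ir r) x = left_ideal1 (Ir r) y" unfolding Green_L_def by auto
 have 1: "x <> y^~ <> y = x" "y <> x^~ <> x = y" using sub x y self e by metis+
 have "x^~ <> x = x^~ <> x <> y^~ <> y" using 1 by simp
 also have "\<dots> = (y^~ <> (y <> x^~ <> x))^~" by simp
 also have "\<dots> = y^~ <> y" using 1 by simp
 finally show "x^~ <> x = y^~ <> y" .
next
 have sub: "left_ideal1 (Ir r) x <= left_ideal1 (Ir r) y"
  if x: "x : carrier (Ir r)" and y: "y : carrier (Ir r)" and e: "x^~ <> x = y^~ <> y" for x y
 proof -
  obtain A B where AB: "A : C" "B : C" "x : H A B" "enat (rk x) <= r" using x carrier_Ir by blast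
  obtain D E where DE: "D : C" "E : C" "y : H D E" using y carrier_Ir by blast
  have "tg (x^~ <> x) = B" "tg (y^~ <> y) = E"
   using sr_tg AB DE mul_in[OF st_in[OF AB(3)] AB(3)] mul_in[OF st_in[OF DE(3)] DE(3)] by auto
  hence [simp]: "E = B" using e by simp
  have xy: "x = x <> y^~ <> y" using regular[OF AB(3)] e by metis
  have yx: "x <> y^~ : H A D" "y : H D B" using AB DE by auto
  have yxc: "s <> x <> y^~ : carrier (Ir r) & tg (s <> x <> y^~) = sr y" if s: "s : H F A" "F : C" for s F
  proof -
   have m: "s <> x <> y^~ : H F D" using yx s by (metis mul_in)
   have "enat (rk (x <> y^~)) <= r" using rk_mul_le AB st_in[OF yx(2)] by blast
   hence "enat (rk (s <> x <> y^~)) <= r"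
    using rk_mul_le[of s r "x <> y^~"] yx(1) s by blast
   thus ?thesis using m sr_tg[OF _ _ m] sr_tg[OF _ _ yx(2)] AB DE s carrier_Ir by auto
  qed
  show ?thesis
  proof
   fix z assume "z : left_ideal1 (Ir r) x"
   then consider "z = x" | s where "s : carrier (Ir r)" "tg s = sr x" "z = s <> x"
    unfolding left_ideal1_def S1_def lmul1_def lcomposable_def by auto
   then obtain F s where s: "F : C" "s : H F A" "z = s <> x"
   proof cases
    case 1
    thus ?thesis using that[of A "one (L A)"] AB one_l L_ob one_in by metis
   next
    case 2
    thus ?thesis using that carrier_Ir sr_tg AB by metis
   qed
   have "z = (s <> x <> y^~) <> y" using xy s(3) by simp
   thus "z : left_ideal1 (Ir r) y"
    using yxc[OF s(2,1)] unfolding left_ideal1_def S1_def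
    by (auto simp del: mul_assoc simp: lmul1_def lcomposable_def intro!: exI[of _ "Some (s <> x <> y^~)"])
  qed
 qed
 assume "x^~ <> x = y^~ <> y"
 thus "(x, y) : Green_L (Ir r)" unfolding Green_L_def using sub[OF x y] sub[OF y x] x y by auto
qed

lemma Green_H_Ir: "x : carrier (Ir r) ==>
 (x, y) : Green_H (Ir r) \<longleftrightarrow> y : carrier (Ir r) & x <> x^~ = y <> y^~ & x^~ <> x = y^~ <> y"
 using right_ideal_iff left_ideal_iff unfolding Green_H_def
 by (auto simp: Green_R_def)

lemma two_sided_rank:
 assumes y: "y : carrier (Ir r)" and x: "x : two_sided_ideal1 (Ir r) y"
 shows "rk x <= rk y"
proof -
 obtain A B where AB: "A : C" "B : C" "y : H A B" using y carrier_Ir by blast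
 from x obtain a b where ab: "a : S1 (Ir r)" "b : S1 (Ir r)" "lcomposable (Ir r) a y"
  "rcomposable (Ir r) y b" "x = rmul1 (Ir r) (lmul1 (Ir r) a y) b"
  unfolding two_sided_ideal1_def by blast
 have 1: "\<exists>D. lmul1 (Ir r) a y : H D B & rk (lmul1 (Ir r) a y) <= rk y"
 proof (cases a)
  case None
  thus ?thesis using AB by (auto simp: lmul1_def)
 next
  case (Some s)
  then obtain D E where DE: "D : C" "E : C" "s : H D E" "tg s = sr y"
   using ab carrier_Ir by (auto simp: S1_def lcomposable_def)
  hence "E = A" using sr_tg AB by metis
  thus ?thesis using Some DE AB rk_mul2[of s "L D" "L A" y "L B"] by (auto simp: lmul1_def)
 qed
 then obtain D where D: "lmul1 (Ir r) a y : H D B" "rk (lmul1 (Ir r) a y) <= rk y" by blast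
 show ?thesis
 proof (cases b)
  case None
  thus ?thesis using D ab by (auto simp: rmul1_def)
 next
  case (Some s)
  then obtain F E where DE: "F : C" "E : C" "s : H F E" "tg y = sr s"
   using ab carrier_Ir by (auto simp: S1_def rcomposable_def)
  hence "F = B" using sr_tg AB by metis
  thus ?thesis using Some DE D ab rk_mul1[OF D(1), of s "L E"] by (auto simp: rmul1_def)
 qed
qed

lemma two_sidedI: "y : H A B ==> a : H D A ==> b : H B E ==> A : C ==> B : C ==> D : C ==> E : C ==>
 enat (rk a) <= r ==> enat (rk b) <= r ==> a <> y <> b : two_sided_ideal1 (Ir r) y"
 unfolding two_sided_ideal1_def S1_def
 by (rule CollectI, rule exI[of _ "Some a"], rule exI[of _ "Some b"])
  (auto simp: lmul1_def rmul1_def lcomposable_def rcomposable_def carrier_Ir sr_tg intro!: imageI, blast+)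

text \<open>Elements of equal rank have normal forms through the same \<open>Z\<close>, and then
  each is a two-sided multiple of the other by factors of that same rank.\<close>

lemma Green_J_Ir:
 assumes x: "x : carrier (Ir r)"
 shows "(x, y) : Green_J (Ir r) \<longleftrightarrow> y : carrier (Ir r) & rk x = rk y"
proof
 have self: "x : two_sided_ideal1 (Ir r) x" for x
  unfolding two_sided_ideal1_def S1_def
  by (auto simp: lmul1_def rmul1_def lcomposable_def rcomposable_def intro!: exI[of _ None])
 assume "(x, y) : Green_J (Ir r)"
 hence "x : two_sided_ideal1 (Ir r) y" "y : two_sided_ideal1 (Ir r) x" "y : carrier (Ir r)"
  using self unfolding Green_J_def by auto
 thus "y : carrier (Ir r) & rk x = rk y" using two_sided_rank x by (simp add: le_antisym)
next
 have mem: "u : two_sided_ideal1 (Ir r) y" if u: "u : two_sided_ideal1 (Ir r) x" and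
  x: "x : carrier (Ir r)" and y: "y : carrier (Ir r)" and e: "rk x = rk y" for x y u
 proof -
  obtain A B where AB: "A : C" "B : C" "x : H A B" "enat (rk x) <= r" using x carrier_Ir by blast
  obtain D E where DE: "D : C" "E : C" "y : H D E" using y carrier_Ir by blast
  obtain Z where Z: "ob Z" "sz Z = rk x" using ex_ob AB by blast
  obtain a b where ab: "a : coiso (L A) Z" "b : coiso (L B) Z" "x = a <> b^~"
   using factorization AB Z by blast
  obtain c d where cd: "c : coiso (L D) Z" "d : coiso (L E) Z" "y = c <> d^~"
   using factorization[of y "L D" "L E" Z] DE Z e by auto
  have H: "a : Hom (L A) Z" "b : Hom (L B) Z" "c : Hom (L D) Z" "d : Hom (L E) Z"
   using ab cd coisoD by blast+
  let ?p = "a <> c^~" and ?q = "d <> b^~"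
  have pq: "?p : H A D" "?q : H E B" using H by blast+
  have rpq: "rk ?p = rk x" "rk ?q = rk x"
   using coiso_rk_mul2 coiso_rk_mul H ab cd Z coiso_rk rk_st st_in by metis+
  have xe: "x = ?p <> y <> ?q"
   using ab cd H coiso_cancel[OF cd(1)] coiso_cancel[OF cd(2)] by (simp, metis st_in mul_in)
  from u obtain s t where st: "s : S1 (Ir r)" "t : S1 (Ir r)" "lcomposable (Ir r) s x"
  "rcomposable (Ir r) x t" "u = rmul1 (Ir r) (lmul1 (Ir r) s x) t"
   unfolding two_sided_ideal1_def by blast
  obtain F s' where s': "s' : H F A" "F : C" "lmul1 (Ir r) s x = s' <> x"
  proof (cases s)
   case None
   thus ?thesis using that[of "one (L A)" A] AB one_in L_ob one_l by (auto simp: lmul1_def)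
  next
   case (Some v)
   then obtain G K where "G : C" "K : C" "v : H G K" "tg v = sr x"
    using st carrier_Ir by (auto simp: S1_def lcomposable_def)
   moreover from this have "K = A" using sr_tg AB by metis
   ultimately show ?thesis using that Some by (auto simp: lmul1_def)
  qed
  obtain F' t' where t': "t' : H B F'" "F' : C" "u = s' <> x <> t'"
  proof (cases t)
   case None
   thus ?thesis using that[of "one (L B)" B] AB one_in L_ob one_r st s' by (auto simp: rmul1_def)
  next
   case (Some v)
   then obtain G K where "G : C" "K : C" "v : H G K" "sr v = tg x"
    using st carrier_Ir by (auto simp: S1_def rcomposable_def)
   moreover from this have "G = B" using sr_tg AB by metis
   ultimately show ?thesis using that Some st s' by (auto simp: rmul1_def)
  qed
  have "u = (s' <> ?p) <> y <> (?q <> t')" using t' xe by simp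
  moreover have "(s' <> ?p) <> y <> (?q <> t') : two_sided_ideal1 (Ir r) y"
   by (rule two_sidedI[of _ D E _ F _ F'])
    (use DE s' t' pq rpq AB rk_mul_le[of ?p r] rk_mul_le[of ?q r _ "L E" "L B" "L F'"]
     rk_mul_le[of _ r ?p "L F" "L A" "L D"] mul_in[OF pq(2) t'(1)] in auto)
  ultimately show ?thesis by simp
 qed
 assume "y : carrier (Ir r) & rk x = rk y"
 thus "(x, y) : Green_J (Ir r)" using x mem[of _ x y] mem[of _ y x] unfolding Green_J_def by auto
qed

text \<open>The identity of a group H-class is an idempotent but not necessarily a projection, hence
  two coisometries \<open>a\<close> and \<open>b\<close> instead of one. Its idempotency amounts to
  \<open>b^~ <> a = one Z\<close>, and this makes the map from \<open>g\<close> to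
  \<open>a <> g <> b^~\<close> multiplicative on the units of \<open>Z\<close>.\<close>

lemma group_H_form:
 assumes "group_H_class Q G"
 shows "EX A:C. \<exists>Z a b. a : coiso (L A) Z & b : coiso (L A) Z & b^~ <> a = one Z &
  G = {a <> g <> b^~ | g. g : Hom Z Z & rk g = sz Z} & monoid.one (H_group Q G) = a <> b^~"
proof -
 interpret group "H_group Q G" using assms unfolding group_H_class_def by blast
 let ?e = "monoid.one (H_group Q G)"
 have G: "G : carrier Q // Green_H Q" and comp: "!!x y. x : G ==> y : G ==> tg x = sr y"
  using assms unfolding group_H_class_def Q_simps by blast+
 have c: "carrier (H_group Q G) = G" "!!x y. x \<otimes>\<^bsub>H_group Q G\<^esub> y = x <> y"
  by (auto simp: H_group_def)
 have e: "?e : G" "?e <> ?e = ?e" using one_closed l_one[OF one_closed] unfolding c by auto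
 obtain x where "x : carrier Q" "G = Green_H Q `` {x}" using G by (auto elim: quotientE)
 hence Gx: "x : carrier (Ir \<infinity>)" "G = Green_H (Ir \<infinity>) `` {x}" by (auto simp: Ir_infinity)
 have Ge: "G = {y : carrier (Ir \<infinity>). y <> y^~ = ?e <> ?e^~ & y^~ <> y = ?e^~ <> ?e}"
  using e(1) unfolding Gx(2) Image_singleton_iff Green_H_Ir[OF Gx(1)] by (auto simp: Green_H_Ir[OF Gx(1)])
 have "?e : carrier (Ir \<infinity>)" using e(1) Ge by blast
 then obtain A B where AB: "A : C" "B : C" "?e : H A B" using carrier_Ir by blast
 hence [simp]: "B = A" using comp[OF e(1) e(1)] sr_tg by metis
 obtain Z where Z: "ob Z" "sz Z = rk ?e" using ex_ob AB by blast
 obtain a b where ab: "a : coiso (L A) Z" "b : coiso (L A) Z" "?e = a <> b^~"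
  using factorization[OF AB(3) Z] by auto
 have aH: "a : Hom (L A) Z" "b : Hom (L A) Z" using ab coisoD by auto
 have ba: "b^~ <> a = one Z"
 proof -
  have bab: "b^~ <> a : Hom Z Z" using aH by blast
  \<comment> \<open>Compressing the idempotent law between \<open>a^~\<close> and \<open>b\<close>
    cancels the outer coisometries on both sides.\<close>
  have "a^~ <> (?e <> ?e) <> b = a^~ <> ?e <> b" using e by simp
  hence "(a^~ <> a) <> (b^~ <> a) <> (b^~ <> b) = (a^~ <> a) <> (b^~ <> b)" by (simp add: ab(3))
  thus ?thesis unfolding coisoD(2)[OF ab(1)] coisoD(2)[OF ab(2)]
   using one_l[OF bab] one_r[OF bab] one_l[OF one_in[OF Z(1)]] by simp
 qed
 have ee: "?e <> ?e^~ = a <> a^~" "?e^~ <> ?e = b <> b^~"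
  using coiso_proj[OF ab(1,2)] coiso_proj[OF ab(2,1)] ab(3) by simp_all
 have "G = {a <> g <> b^~ | g. g : Hom Z Z & rk g = sz Z}"
 proof (rule subset_antisym; rule subsetI)
  fix y assume "y : G"
  hence y: "y : carrier (Ir \<infinity>)" "y <> y^~ = a <> a^~" "y^~ <> y = b <> b^~" using Ge ee by auto
  obtain D E where DE: "D : C" "E : C" "y : H D E" using y carrier_Ir by blast
  have "sr (y <> y^~) = D" "sr (a <> a^~) = A" "tg (y^~ <> y) = E" "tg (b <> b^~) = A"
   using sr_tg DE AB aH by (meson mul_in st_in)+
  hence yH: "y : H A A" using y DE by simp
  let ?g = "a^~ <> y <> b"
  have g: "?g : Hom Z Z" using aH yH by blast
  have "a <> ?g <> b^~ = (a <> a^~) <> y <> (b <> b^~)" by simp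
  also have "\<dots> = (y <> y^~) <> y <> (y^~ <> y)" using y by simp
  also have "\<dots> = y" using regular[OF yH] by simp
  finally have ye: "a <> ?g <> b^~ = y" .
  have "rk y = rk ?g" using ye coiso_rk_mul[OF ab(1)] coiso_rk_mul2[OF ab(2)] g aH by (metis mul_in st_in)
  moreover have "rk y = sz Z" using rk_proj[OF yH] rk_proj[OF aH(1)] y coiso_rk ab by simp
  ultimately show "y : {a <> g <> b^~ | g. g : Hom Z Z & rk g = sz Z}"
   using g ye by (intro CollectI exI[of _ ?g]) simp
 next
  fix y assume "y : {a <> g <> b^~ | g. g : Hom Z Z & rk g = sz Z}"
  then obtain g where g: "y = a <> g <> b^~" "g : Hom Z Z" "rk g = sz Z" by blast
  have gc: "g : coiso Z Z" "g^~ : coiso Z Z" using unit_coiso g st_in rk_st by auto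
  have yH: "y : H A A" using g aH by blast
  have "a <> g : coiso (L A) Z" "b <> g^~ : coiso (L A) Z" using coiso_mul ab gc by blast+
  from coiso_proj[OF this(1) ab(2)] coiso_proj[OF this(2) ab(1)]
  have "y <> y^~ = (a <> g) <> (a <> g)^~" "y^~ <> y = (b <> g^~) <> (b <> g^~)^~" using g by auto
  moreover have "g <> g^~ <> a^~ = a^~" "g^~ <> g <> b^~ = b^~"
   using coiso_cancel[OF gc(1)] coiso_cancel[OF gc(2)] aH st_in by (metis st_st)+
  ultimately have "y <> y^~ = a <> a^~" "y^~ <> y = b <> b^~" by simp_all
  thus "y : G" using yH AB Ge ee carrier_Ir by auto
 qed
 thus ?thesis using AB ab ba by blast
qed

section \<open>Congruences from normal subgroups of units\<close>

definition nuZ :: "'o => 'm set => 'm rel" where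
 "nuZ Z N = {(a <> g <> b^~, a <> g' <> b^~) | a b g g'.
  (EX A:C. a : coiso (L A) Z) & (EX B:C. b : coiso (L B) Z) & g : N & g' : N}"

text \<open>The units of \<open>Z\<close> are its endomorphisms of full rank, with \<open>^~\<close>
  as inverse; \<open>N\<close> is a normal subgroup of them. Phrased by such an \<open>N\<close>,
  the relation \<open>nuZ\<close> does not refer to a particular group H-class, which makes it
  easier to handle than \<open>nu\<close>.\<close>

definition unit_normal :: "'o => 'm set => bool" where
 "unit_normal Z N \<longleftrightarrow> N <= {g : Hom Z Z. rk g = sz Z} & one Z : N &
  (ALL g:N. ALL h:N. g <> h : N) & (ALL g:N. g^~ : N) &
  (ALL g:N. ALL k:Hom Z Z. rk k = sz Z --> k <> g <> k^~ : N)"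

lemma nuZ_E:
 assumes "(s, t) : nuZ Z N" and N: "unit_normal Z N"
 obtains A B a b g g' where "A : C" "B : C" "a : coiso (L A) Z" "b : coiso (L B) Z" "g : N" "g' : N"
  "s = a <> g <> b^~" "t = a <> g' <> b^~" "s : H A B" "t : H A B" "rk s = sz Z" "rk t = sz Z"
proof -
 obtain A B a b g g' where 1: "A : C" "B : C" "a : coiso (L A) Z" "b : coiso (L B) Z" "g : N" "g' : N"
  "s = a <> g <> b^~" "t = a <> g' <> b^~" using assms(1) unfolding nuZ_def by blast
 have H: "g : Hom Z Z" "g' : Hom Z Z" "rk g = sz Z" "rk g' = sz Z" using N 1 unfolding unit_normal_def by auto
 hence "g <> b^~ : Hom Z (L B)" "g' <> b^~ : Hom Z (L B)" using 1 coisoD(1) by (meson mul_in st_in)+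
 moreover from this have "s : H A B" "t : H A B" using 1 coisoD(1) by (meson mul_in st_in)+
 moreover have "rk s = sz Z" "rk t = sz Z"
  using 1 H coiso_rk_mul[OF 1(3)] coiso_rk_mul2[OF 1(4)] calculation by metis+
 ultimately show ?thesis using that 1 by blast
qed

lemma nuZ_sym: "(s, t) : nuZ Z N ==> (t, s) : nuZ Z N"
 unfolding nuZ_def by blast

text \<open>The middle element has two presentations, whose coisometries differ by units of
  \<open>Z\<close> because they have the same projections. Normality moves these units past the
  quotient of two members of \<open>N\<close>.\<close>

lemma nuZ_trans:
 assumes N: "unit_normal Z N" and st: "(s, t) : nuZ Z N" and tw: "(t, w) : nuZ Z N"
 shows "(s, w) : nuZ Z N"
proof -
 from nuZ_E[OF st N] obtain A B a b g g' where 1: "A : C" "B : C" "a : coiso (L A) Z" "b : coiso (L B) Z" "g : N" "g' : N"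
  "s = a <> g <> b^~" "t = a <> g' <> b^~" "t : H A B" by metis
 from nuZ_E[OF tw N] obtain A' B' c d h h' where 2: "A' : C" "B' : C" "c : coiso (L A') Z" "d : coiso (L B') Z" "h : N" "h' : N"
  "t = c <> h <> d^~" "w = c <> h' <> d^~" "t : H A' B'" by metis
 have [simp]: "A' = A" "B' = B" using sr_tg 1 2 by metis+
 have gU: "g : Hom Z Z" "g' : Hom Z Z" "h : Hom Z Z" "h' : Hom Z Z" "rk g' = sz Z" "rk h = sz Z" "rk g = sz Z" "rk h' = sz Z"
  using N 1 2 unfolding unit_normal_def by auto
 have H: "a : Hom (L A) Z" "c : Hom (L A) Z" "b : Hom (L B) Z" "d : Hom (L B) Z" using 1 2 coisoD by auto
 have gc: "g' : coiso Z Z" "h : coiso Z Z" "g'^~ : coiso Z Z" "h^~ : coiso Z Z"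
  using gU unit_coiso st_in rk_st by auto
 have ag: "a <> g' : coiso (L A) Z" "c <> h : coiso (L A) Z" "b <> g'^~ : coiso (L B) Z" "d <> h^~ : coiso (L B) Z"
  using coiso_mul gc 1 2 by simp_all
 have ggc: "g' <> g'^~ <> y = y" "h <> h^~ <> y = y" "g'^~ <> g' <> y = y" "h^~ <> h <> y = y" if "y : Hom Z Y" for y Y
  using coiso_cancel[OF gc(3) that] coiso_cancel[OF gc(4) that] coiso_cancel[OF gc(1) that] coiso_cancel[OF gc(2) that] by simp_all
 have "t <> t^~ = a <> a^~" unfolding 1(8)
  using coiso_proj[OF ag(1) 1(4)] ggc(1)[OF st_in[OF H(1)]] by simp
 moreover have "t^~ <> t = b <> b^~" unfolding 1(8)
  using coiso_proj[OF ag(3) 1(3)] ggc(3)[OF st_in[OF H(3)]] by simp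
 moreover have "t <> t^~ = c <> c^~" unfolding 2(7)
  using coiso_proj[OF ag(2) 2(4)] ggc(2)[OF st_in[OF H(2)]] by simp
 moreover have "t^~ <> t = d <> d^~" unfolding 2(7)
  using coiso_proj[OF ag(4) 2(3)] ggc(4)[OF st_in[OF H(4)]] by simp
 ultimately have p: "a <> a^~ = c <> c^~" "b <> b^~ = d <> d^~" by simp_all
 let ?k = "a^~ <> c" and ?l = "d^~ <> b"
 have kl: "?k : Hom Z Z" "?l : Hom Z Z" using H by blast+
 have ca: "c = a <> ?k" using p(1) H regular[OF H(2)] by (metis mul_assoc)
 have bd: "d = b <> ?l^~" using p(2) regular[OF H(4)] by (simp, metis mul_assoc)
 have rk: "rk ?k = sz Z" "rk (?l^~) = sz Z"
  using ca bd coiso_rk 1 2 coiso_rk_mul[OF 1(3) kl(1)] coiso_rk_mul[OF 1(4) st_in[OF kl(2)]] by (metis, metis)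
 have kk: "?k^~ <> ?k <> y = y" "?k <> ?k^~ <> y = y" if "y : Hom Z Y" for y Y
  using full_unit[OF kl(1) rk(1)] full_unit2[OF kl(1) rk(1)] one_l[OF that] by (metis mul_assoc)+
 have "a^~ <> t <> b = (a^~ <> a) <> g' <> (b^~ <> b)" unfolding 1(8) by simp
 hence "g' = a^~ <> t <> b"
  unfolding coisoD(2)[OF 1(3)] coisoD(2)[OF 1(4)] using one_l[OF gU(2)] one_r[OF gU(2)] by simp
 also have "\<dots> = ?k <> h <> ?l" unfolding 2(7) by simp
 finally have g': "g' = ?k <> h <> ?l" .
 \<comment> \<open>Conjugating \<open>h' <> h^~\<close> by \<open>?k\<close> and multiplying by
   \<open>g' = ?k <> h <> ?l\<close> yields \<open>?k <> h' <> ?l\<close>, which is thereby seen to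
   lie in \<open>N\<close>.\<close>
 let ?g2 = "(?k <> (h' <> h^~) <> ?k^~) <> g'"
 have "h' <> h^~ : N" using N 2 unfolding unit_normal_def by blast
 hence "?k <> (h' <> h^~) <> ?k^~ : N" using N kl rk unfolding unit_normal_def by blast
 hence g2: "?g2 : N" using N 1(6) unfolding unit_normal_def by blast
 have "?g2 = ?k <> h' <> h^~ <> (?k^~ <> ?k <> (h <> ?l))" using g' by simp
 also have "\<dots> = ?k <> h' <> (h^~ <> h <> ?l)" using kk(1)[OF mul_in[OF gU(3) kl(2)]] by simp
 also have "\<dots> = ?k <> h' <> ?l" using ggc(4)[OF kl(2)] by simp
 finally have g2e: "?g2 = ?k <> h' <> ?l" .
 have "w = (a <> ?k) <> h' <> (b <> ?l^~)^~" using 2(8) ca bd by metis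
 also have "\<dots> = a <> ?g2 <> b^~" unfolding g2e by simp
 finally show ?thesis using 1 g2 unfolding nuZ_def by blast
qed

text \<open>Whether the rank survives is decided by \<open>x <> a\<close> alone, which both members
  share: it is either again a coisometry or of smaller rank.\<close>

lemma nuZ_left:
 assumes N: "unit_normal Z N" and st: "(s, t) : nuZ Z N"
  and s: "s : H A B" and x: "x : H D A" and C: "A : C" "B : C" "D : C"
 shows "(x <> s, x <> t) : nuZ Z N \<or> (rk (x <> s) < sz Z & rk (x <> t) < sz Z)"
proof -
 from nuZ_E[OF st N] obtain A' B' a b g g' where 1: "A' : C" "B' : C" "a : coiso (L A') Z" "b : coiso (L B') Z" "g : N" "g' : N"
  "s = a <> g <> b^~" "t = a <> g' <> b^~" "s : H A' B'" by metis
 have [simp]: "A' = A" "B' = B" using sr_tg 1 s C by metis+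
 have H: "a : Hom (L A) Z" "b : Hom (L B) Z" "g : Hom Z Z" "g' : Hom Z Z"
  using 1 coisoD N unfolding unit_normal_def by auto
 have xa: "x <> a : Hom (L D) Z" using x H by blast
 show ?thesis
 proof (cases "rk (x <> a) = sz Z")
  case True
  hence "x <> a : coiso (L D) Z" using full_coiso xa by blast
  moreover have "x <> s = (x <> a) <> g <> b^~" "x <> t = (x <> a) <> g' <> b^~" using 1 by simp_all
  ultimately show ?thesis using 1 C unfolding nuZ_def by blast
 next
  case False
  hence "rk (x <> a) < sz Z" using rk_le2[OF xa] by linarith
  moreover have "rk (x <> s) <= rk (x <> a)" "rk (x <> t) <= rk (x <> a)"
   using rk_mul1[OF xa, of "g <> b^~"] rk_mul1[OF xa, of "g' <> b^~"] 1 H by (simp, meson mul_in st_in)+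
  ultimately show ?thesis by linarith
 qed
qed

lemma nuZ_star: "unit_normal Z N ==> (s, t) : nuZ Z N ==> (s^~, t^~) : nuZ Z N"
proof -
 assume N: "unit_normal Z N" and "(s, t) : nuZ Z N"
 then obtain A B a b g g' where 1: "A : C" "B : C" "a : coiso (L A) Z" "b : coiso (L B) Z" "g : N" "g' : N"
  "s = a <> g <> b^~" "t = a <> g' <> b^~" unfolding nuZ_def by blast
 hence "g^~ : N" "g'^~ : N" "s^~ = b <> g^~ <> a^~" "t^~ = b <> g'^~ <> a^~"
  using N unfolding unit_normal_def by auto
 thus ?thesis using 1 unfolding nuZ_def by blast
qed

lemma Rees_Ir: "enat q <= r ==> (x, y) : Rees (Ir r) (carrier (Ir (enat q))) \<longleftrightarrow>
 (EX A:C. EX B:C. x : H A B & y : H A B) & rk x <= q & rk y <= q \<or> x = y & x : carrier (Ir r)"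
 unfolding Rees_def using tnabla_sub by (auto simp: Id_on_def)

text \<open>The two parts do not interfere: \<open>nuZ\<close> lives in rank \<open>q + 2\<close>
  exactly, and a product that leaves this rank has rank at most \<open>q\<close> by parity, for both
  members at once.\<close>

lemma Rees_nuZ_congruence:
 assumes N: "unit_normal Z N" and Z: "ob Z" "sz Z = q + 2" "enat (q + 2) <= r"
 shows "congruence_on (Ir r) (Rees (Ir r) (carrier (Ir (enat q))) Un nuZ Z N)" (is "congruence_on _ ?R")
proof -
 have qr: "enat q <= r" using Z(3) by (meson enat_ord_simps(1) le_add1 order_trans)
 note R = Rees_Ir[OF qr]
 have nuE: "EX A:C. EX B:C. s : H A B & t : H A B & rk s = q + 2 & rk t = q + 2" if "(s, t) : nuZ Z N" for s t
  using nuZ_E[OF that N] Z by metis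
 have excl: "(s, t) : nuZ Z N ==> (t, w) : Rees (Ir r) (carrier (Ir (enat q))) ==> t = w" for s t w
  using nuE[of s t] R[of t w] by auto
 have ty: "?R <= tnabla (Ir r)"
 proof (rule subrelI)
  fix x y assume "(x, y) : ?R"
  then consider "(x, y) : nuZ Z N" | "(EX A:C. EX B:C. x : H A B & y : H A B) & rk x <= q & rk y <= q"
   | "x = y & x : carrier (Ir r)" using R by blast
  thus "(x, y) : tnabla (Ir r)"
  proof cases
   case 1
   thus ?thesis using nuE[OF 1] Z(3) unfolding tnabla_Ir by auto
  next
   case 2
   thus ?thesis using qr unfolding tnabla_Ir by (meson enat_ord_simps(1) order_trans)
  next
   case 3
   thus ?thesis unfolding tnabla_Ir carrier_Ir by auto
  qed
 qed
 have nuc: "(s, t) : nuZ Z N ==> s : carrier (Ir r) & t : carrier (Ir r)" for s t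
  using nuE[of s t] Z(3) unfolding carrier_Ir by auto
 have sy: "(x, y) : ?R ==> (y, x) : ?R" for x y
  using nuZ_sym[of x y] R[of x y] R[of y x] by blast
 have tr: "(x, z) : ?R" if xyz: "(x, y) : ?R" "(y, z) : ?R" for x y z
 proof -
  consider "(x, y) : nuZ Z N" "(y, z) : nuZ Z N"
   | "(x, y) : nuZ Z N" "(y, z) : Rees (Ir r) (carrier (Ir (enat q)))"
   | "(x, y) : Rees (Ir r) (carrier (Ir (enat q)))" "(y, z) : nuZ Z N"
   | "(x, y) : Rees (Ir r) (carrier (Ir (enat q)))" "(y, z) : Rees (Ir r) (carrier (Ir (enat q)))"
   using xyz by blast
  thus ?thesis
  proof cases
   case 1
   thus ?thesis using nuZ_trans N by blast
  next
   case 2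
   thus ?thesis using excl by blast
  next
   case 3
   hence "(y, x) : Rees (Ir r) (carrier (Ir (enat q)))" using R[of x y] R[of y x] by blast
   hence "y = x" using excl[OF nuZ_sym[OF 3(2)]] by blast
   thus ?thesis using 3 by blast
  next
   case 4
   have "(x, z) : Rees (Ir r) (carrier (Ir (enat q)))"
    using 4 unfolding R by (metis sr_tg)
   thus ?thesis by blast
  qed
 qed
 have eq: "equiv (carrier (Ir r)) ?R"
 proof (rule equivI)
  show "?R <= carrier (Ir r) \<times> carrier (Ir r)" using ty unfolding tnabla_def by auto
  show "refl_on (carrier (Ir r)) ?R" unfolding refl_on_def using R by blast
  show "sym ?R" using sy by (auto intro: symI)
  show "trans ?R" using tr by (blast intro: transI)
 qed
 have left: "(a <> x, a <> y) : ?R"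
  if AB: "A : C" "B : C" "D : C" "x : H A B" "y : H A B" "(x, y) : ?R" "a : H D A" "enat (rk a) <= r" for A B D x y a
 proof -
  have H: "a <> x : H D B" "a <> y : H D B" using AB by blast+
  have le: "rk (a <> x) <= rk x" "rk (a <> y) <= rk y" using rk_mul2 AB by blast+
  from AB(6) consider "(x, y) : nuZ Z N" | "rk x <= q & rk y <= q" | "x = y" using R by blast
  thus ?thesis
  proof cases
   case 1
   from nuZ_left[OF N 1 AB(4) AB(7)] AB consider "(a <> x, a <> y) : nuZ Z N" | "rk (a <> x) < q + 2" "rk (a <> y) < q + 2"
    using Z by auto
   thus ?thesis
   proof cases
    case 2
    have "odd q" using sz_odd[OF Z(1)] Z(2) by simp
    hence "rk (a <> x) <= q" "rk (a <> y) <= q" using 2 rank_odd[OF H(1)] rank_odd[OF H(2)] by presburger+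
    thus ?thesis using R AB H by blast
   qed blast
  next
   case 2
   hence "rk (a <> x) <= q" "rk (a <> y) <= q" using le by linarith+
   thus ?thesis using R AB H by blast
  next
   case 3
   thus ?thesis using H R AB carrier_Ir rk_mul_le by blast
  qed
 qed
 have star: "(x^~, y^~) : ?R" if xy: "(x, y) : ?R" for x y
 proof -
  from xy consider "(x, y) : nuZ Z N" | "(EX A:C. EX B:C. x : H A B & y : H A B) & rk x <= q & rk y <= q"
   | "x = y & x : carrier (Ir r)" using R by blast
  thus ?thesis
  proof cases
   case 1
   thus ?thesis using nuZ_star[OF N] by blast
  next
   case 2
   hence "(EX A:C. EX B:C. x^~ : H A B & y^~ : H A B) & rk (x^~) <= q & rk (y^~) <= q"
    using st_in rk_st by metis
   thus ?thesis using R by blast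
  next
   case 3
   hence "x^~ = y^~ & x^~ : carrier (Ir r)" unfolding carrier_Ir by auto
   thus ?thesis using R by blast
  qed
 qed
 have right: "(x <> a, y <> a) : ?R"
  if AB: "A : C" "B : C" "D : C" "x : H A B" "y : H A B" "(x, y) : ?R" "a : H B D" "enat (rk a) <= r" for A B D x y a
 proof -
  have "(a^~ <> x^~, a^~ <> y^~) : ?R"
   using left[of B A D "x^~" "y^~" "a^~"] AB star[OF AB(6)] by auto
  from star[OF this] show ?thesis by simp
 qed
 show ?thesis unfolding congruence_on_Ir
  by (intro conjI eq ty ballI impI left right; assumption)
qed

end

lemma (in hook_category) pt_proj:
 "u : Hom X pt ==> w : Hom Y pt ==> u <> w^~ <> w <> u^~ = u <> u^~"
 using pt_cancel2[OF _ _ st_in] by metis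

section \<open>Consequences of a pair of congruent morphisms\<close>

locale hook_cong = hook_subcat ob Hom mul st one rk sz hk pt C L sr tg
 for ob :: "'o => bool" and Hom and mul :: "'m => 'm => 'm" (infixr "<>" 70)
  and st ("_^~" [1000] 999) and one rk sz hk pt and C :: "'c set" and L sr tg +
 fixes r :: enat and sg :: "'m rel"
 assumes cong: "congruence_on (Ir r) sg" and r3: "enat 3 <= r"
begin

lemma dual: "hook_cong ob Hom mul st one rk sz hk pt C L sr tg r (dual_rel st sg)"
proof -
 have e: "equiv (carrier (Ir r)) sg" and t: "sg <= tnabla (Ir r)" and
  m: "!!A B D x y a. A : C ==> B : C ==> D : C ==> x : H A B ==> y : H A B ==> (x, y) : sg ==> enat (rk a) <= r ==>
    (a : H D A --> (a <> x, a <> y) : sg) & (a : H B D --> (x <> a, y <> a) : sg)"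
  using cong unfolding congruence_on_Ir by blast+
 have c: "x^~ : carrier (Ir r) \<longleftrightarrow> x : carrier (Ir r)" for x
  unfolding carrier_Ir by (metis rk_st st_in st_st)
 have "dual_rel st sg <= carrier (Ir r) \<times> carrier (Ir r)"
  using equiv_type[OF e] c unfolding dual_rel_def by blast
 hence "equiv (carrier (Ir r)) (dual_rel st sg)"
  using e c unfolding equiv_def refl_on_def sym_def trans_def dual_rel_def by blast
 moreover have "dual_rel st sg <= tnabla (Ir r)"
 proof (rule subrelI)
  fix x y assume "(x, y) : dual_rel st sg"
  hence "(x^~, y^~) : tnabla (Ir r)" using t unfolding dual_rel_def by blast
  thus "(x, y) : tnabla (Ir r)" unfolding tnabla_Ir by (metis rk_st st_in st_st)
 qed
 moreover have "ALL A:C. ALL B:C. ALL D:C. ALL x:H A B. ALL y:H A B. (x, y) : dual_rel st sg -->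
    (ALL a:H D A. enat (rk a) <= r --> (a <> x, a <> y) : dual_rel st sg) &
    (ALL a:H B D. enat (rk a) <= r --> (x <> a, y <> a) : dual_rel st sg)"
 proof (intro ballI impI conjI)
  fix A B D x y a assume AB: "A : C" "B : C" "D : C" "x : H A B" "y : H A B" "(x, y) : dual_rel st sg" "enat (rk a) <= r"
  have s: "(x^~, y^~) : sg" "enat (rk (a^~)) <= r" using AB unfolding dual_rel_def by auto
  show "(a <> x, a <> y) : dual_rel st sg" if "a : H D A"
   using m[OF AB(2,1,3) st_in[OF AB(4)] st_in[OF AB(5)] s] st_in[OF that] by (simp add: dual_rel_def)
  show "(x <> a, y <> a) : dual_rel st sg" if "a : H B D"
   using m[OF AB(2,1,3) st_in[OF AB(4)] st_in[OF AB(5)] s] st_in[OF that] by (simp add: dual_rel_def)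
 qed
 ultimately have "congruence_on (Ir r) (dual_rel st sg)" unfolding congruence_on_Ir by (intro conjI)
 thus ?thesis
  by (intro hook_cong.intro hook_cong_axioms.intro hook_subcat_axioms r3)
qed

lemma rel_refl: "A : C ==> B : C ==> x : H A B ==> enat (rk x) <= r ==> (x, x) : sg"
 using cong unfolding congruence_on_Ir equiv_def refl_on_def by (auto simp: carrier_Ir)

lemma rel_sym: "(x, y) : sg ==> (y, x) : sg"
 using cong unfolding congruence_on_Ir by (meson equivE symD)

lemma rel_trans: "(x, y) : sg ==> (y, z) : sg ==> (x, z) : sg"
 using cong unfolding congruence_on_Ir by (meson equivE transD)

lemma rel_typed:
 assumes "(x, y) : sg"
 obtains A B where "A : C" "B : C" "x : H A B" "y : H A B" "enat (rk x) <= r" "enat (rk y) <= r"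
proof -
 have "(x, y) : tnabla (Ir r)" using assms cong unfolding congruence_on_Ir by blast
 thus ?thesis using that unfolding tnabla_Ir by blast
qed

lemma rel_left: "(x, y) : sg ==> x : H A B ==> y : H A B ==> a : H D A ==> enat (rk a) <= r ==>
  A : C ==> B : C ==> D : C ==> (a <> x, a <> y) : sg"
 using cong unfolding congruence_on_Ir by blast

lemma rel_right: "(x, y) : sg ==> x : H A B ==> y : H A B ==> a : H B D ==> enat (rk a) <= r ==>
  A : C ==> B : C ==> D : C ==> (x <> a, y <> a) : sg"
 using cong unfolding congruence_on_Ir by blast

lemma rank_le_r: "rk x <= n ==> enat n <= r ==> enat (rk x) <= r"
 by (meson enat_ord_simps(1) order_trans)

lemma one_le_r: "enat 1 <= r"
 using r3 by (meson enat_ord_simps(1) order_trans one_le_numeral)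

text \<open>The object \<open>Z\<close> need not come from \<open>C\<close>; the congruence sees its
  local monoid only through a coisometry from some \<open>L A\<close>.\<close>

definition loc :: "'m => 'o => 'm rel" where
 "loc a Z = {(s, t). s : Hom Z Z & t : Hom Z Z & (a <> s <> a^~, a <> t <> a^~) : sg}"

lemma loc_loccong:
 assumes A: "A : C" and a: "a : coiso (L A) Z" and Z: "enat (sz Z) <= r"
 shows "loccong Z (loc a Z)"
proof -
 have aH: "a : Hom (L A) Z" "a^~ : Hom Z (L A)" using a coisoD by auto
 have conj: "s : Hom Z Z ==> a <> s <> a^~ : H A A" for s using aH by blast
 have rkc: "enat (rk (a <> s <> a^~)) <= r" if "s : Hom Z Z" for s
  using rk_mul1[OF aH(1), of "s <> a^~"] rk_le2[OF aH(1)] that aH Z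
  by (meson le_trans mul_in rank_le_r)
 have m: "a <> s <> t <> a^~ = (a <> s <> a^~) <> (a <> t <> a^~)" if "s : Hom Z Z" "t : Hom Z Z" for s t
  using coiso_cancel[OF a mul_in[OF that(2) aH(2)]] by simp
 have "equiv (Hom Z Z) (loc a Z)"
 proof (rule equivI)
  show "loc a Z <= Hom Z Z \<times> Hom Z Z" unfolding loc_def by auto
  show "refl_on (Hom Z Z) (loc a Z)" unfolding refl_on_def loc_def
   using rel_refl[OF A A conj rkc] by auto
  show "sym (loc a Z)" unfolding loc_def using rel_sym by (auto intro: symI)
  show "trans (loc a Z)" unfolding loc_def trans_def using rel_trans by blast
 qed
 moreover have "(u <> s, u <> t) : loc a Z & (s <> u, t <> u) : loc a Z"
  if st: "(s, t) : loc a Z" and u: "u : Hom Z Z" for s t u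
 proof -
  have H: "s : Hom Z Z" "t : Hom Z Z" "(a <> s <> a^~, a <> t <> a^~) : sg" using st unfolding loc_def by auto
  show ?thesis
   using rel_left[OF H(3) conj conj conj[OF u] rkc[OF u] A A A]
    rel_right[OF H(3) conj conj conj[OF u] rkc[OF u] A A A] H u
    m[OF u H(1)] m[OF u H(2)] m[OF H(1) u] m[OF H(2) u]
   unfolding loc_def by (auto simp: mul_in)
 qed
 ultimately show ?thesis unfolding loccong_def by blast
qed

text \<open>Multiplication by \<open>x^~\<close> on the right and by the projection of
  \<open>a\<close> on the left turns \<open>x\<close> into \<open>a <> a^~\<close> and
  \<open>y\<close> into the conjugate of \<open>a^~ <> y <> b\<close> by \<open>a\<close>. Every
  related pair thus yields one that starts with an identity, in a local monoid whose size is the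
  rank of \<open>x\<close>.\<close>

lemma one_loc:
 assumes xy: "(x, y) : sg" "x : H A B" "y : H A B" and C: "A : C" "B : C"
  and ab: "a : coiso (L A) Z" "b : coiso (L B) Z" "x = a <> b^~"
 shows "(one Z, a^~ <> y <> b) : loc a Z"
proof -
 have H: "a : Hom (L A) Z" "b : Hom (L B) Z" using ab coisoD by auto
 have Z: "ob Z" using H Hom_ob by blast
 have r: "enat (rk x) <= r" using rel_typed[OF xy(1)] by blast
 have rx: "rk x = sz Z" using ab coiso_rk_mul2[OF ab(2) H(1)] coiso_rk by simp
 have "(x <> x^~, y <> x^~) : sg"
  using rel_right[OF xy st_in[OF xy(2)] _ C C(1)] r by simp
 hence "((a <> a^~) <> (x <> x^~), (a <> a^~) <> (y <> x^~)) : sg"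
  using rel_left[of "x <> x^~" "y <> x^~" A A "a <> a^~" A] C xy H rk_proj[OF H(1)] coiso_rk[OF ab(1)] rx r
  by (simp del: mul_assoc add: mul_in st_in)
 moreover have "(a <> a^~) <> (x <> x^~) = a <> one Z <> a^~"
  using coiso_proj[OF ab(1,2)] ab(3) coiso_cancel[OF ab(1) st_in[OF H(1)]] one_l[OF st_in[OF H(1)]] by simp
 moreover have "(a <> a^~) <> (y <> x^~) = a <> (a^~ <> y <> b) <> a^~" using ab(3) by simp
 ultimately show ?thesis using xy H Z unfolding loc_def by (auto simp: one_in mul_in st_in)
qed

text \<open>Interchangeability as left ends in rank one. Asking for all right ends \<open>w\<close>
  frees the relation from the right-hand object; by \<open>apxI\<close> a single right end is enough
  to establish it.\<close>

definition apx :: "'c => 'm => 'm => bool" where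
 "apx A u v \<longleftrightarrow> u : Hom (L A) pt & v : Hom (L A) pt &
  (ALL B:C. ALL w:Hom (L B) pt. (u <> w^~, v <> w^~) : sg)"

definition lfull :: bool where
 "lfull \<longleftrightarrow> (ALL A:C. ALL u:Hom (L A) pt. ALL v:Hom (L A) pt. apx A u v)"

definition fullto :: "nat => bool" where
 "fullto q \<longleftrightarrow> (ALL A:C. ALL B:C. ALL x:H A B. ALL y:H A B. rk x <= q --> rk y <= q --> (x, y) : sg)"

lemma fulltoD: "fullto q ==> A : C ==> B : C ==> x : H A B ==> y : H A B ==> rk x <= q ==> rk y <= q ==> (x, y) : sg"
 unfolding fullto_def by blast

lemma fullto_mono: "fullto q ==> p <= q ==> fullto p"
 unfolding fullto_def by (meson order_trans)

lemma pt_in: "u : Hom X pt ==> w : Hom Y pt ==> u <> w^~ : Hom X Y" by blast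

lemma pt_rk2: "u : Hom X pt ==> w : Hom Y pt ==> rk (u <> w^~) = 1"
 using coiso_rk_mul2 pt_coiso pt_rk by metis

lemma apxI:
 assumes "u : Hom (L A) pt" "v : Hom (L A) pt" "w : Hom (L B) pt" "A : C" "B : C"
  and "(u <> w^~, v <> w^~) : sg"
 shows "apx A u v"
 unfolding apx_def
proof (intro conjI ballI assms)
 fix D w' assume D: "D : C" "w' : Hom (L D) pt"
 have "((u <> w^~) <> (w <> w'^~), (v <> w^~) <> (w <> w'^~)) : sg"
  using rel_right[OF assms(6) pt_in[OF assms(1,3)] pt_in[OF assms(2,3)] pt_in[OF assms(3) D(2)] _ assms(4,5) D(1)]
   pt_rk2[OF assms(3) D(2)] one_le_r by simp
 thus "(u <> w'^~, v <> w'^~) : sg"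
  using pt_cancel2[OF assms(3,3) st_in[OF D(2)]] by simp
qed

lemma apx_mul:
 assumes "apx A u v" "A : C" "D : C" "c : H D A" "enat (rk c) <= r"
 shows "apx D (c <> u) (c <> v)"
proof -
 have uv: "u : Hom (L A) pt" "v : Hom (L A) pt" using assms unfolding apx_def by auto
 have s: "(u <> u^~, v <> u^~) : sg" using assms uv unfolding apx_def by blast
 have "((c <> u) <> u^~, (c <> v) <> u^~) : sg"
  using rel_left[OF s pt_in[OF uv(1,1)] pt_in[OF uv(2,1)] assms(4,5)] assms by simp
 thus ?thesis using apxI[of "c <> u" D "c <> v" u A] uv assms by (simp del: mul_assoc add: mul_in)
qed

lemma apx_refl: "u : Hom (L A) pt ==> A : C ==> apx A u u"
 using rel_refl pt_in pt_rk2 one_le_r unfolding apx_def by simp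

lemma apx_sym: "apx A u v ==> apx A v u"
 unfolding apx_def using rel_sym by blast

lemma apx_trans: "apx A u v ==> apx A v w ==> apx A u w"
 unfolding apx_def using rel_trans by blast

lemma apx_equiv: "A : C ==> equiv (Hom (L A) pt) {(u, v). apx A u v}"
proof (rule equivI)
 show "{(u, v). apx A u v} <= Hom (L A) pt \<times> Hom (L A) pt" unfolding apx_def by auto
 show "A : C ==> refl_on (Hom (L A) pt) {(u, v). apx A u v}" using apx_refl by (auto simp: refl_on_def)
 show "sym {(u, v). apx A u v}" using apx_sym by (auto intro: symI)
 show "trans {(u, v). apx A u v}" unfolding trans_def using apx_trans by blast
qed

text \<open>One nontrivial pair is carried to an object of size three, where the ends form an orbit
  under \<tau> of order three, so that any nontrivial pair generates all others;
  \<open>pt_connected\<close> then spreads this to every object.\<close>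

lemma apx_lfull:
 assumes uv: "apx A u v" "u ~= v" and A: "A : C"
 shows lfull
proof -
 have uvH: "u : Hom (L A) pt" "v : Hom (L A) pt" using uv unfolding apx_def by auto
 obtain T c where T: "ob T" "sz T = 3" and c: "c : Hom T (L A)" "c <> u ~= c <> v"
  using sep_pt[OF uvH uv(2)] by blast
 obtain \<tau> where \<tau>: "\<tau> : Hom T T" and \<tau>t: "!!t. t : Hom T pt ==> \<tau> <> \<tau> <> \<tau> <> t = t"
  "!!t s. t : Hom T pt ==> s : Hom T pt ==> s = t \<or> s = \<tau> <> t \<or> s = \<tau> <> \<tau> <> t"
  using three[OF T] by blast
 have "apx B s s'" if B: "B : C" and s: "s : Hom (L B) pt" "s' : Hom (L B) pt" for B s s'
 proof (cases "sz (L B) = 1")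
  case True
  thus ?thesis using sz_one_unique[OF _ s] apx_refl B s by auto
 next
  case False
  \<comment> \<open>\<open>T\<close> need not be an object of \<open>C\<close>, so ends over
    \<open>T\<close> are compared after composition with all arrows \<open>b\<close> from
    \<open>L B\<close>.\<close>
  let ?K = "%t t'. t : Hom T pt & t' : Hom T pt & (ALL b:Hom (L B) T. apx B (b <> t) (b <> t'))"
  note E = apx_equiv[OF B]
  have K1: "?K t t' ==> ?K t' t" for t t' using apx_sym by blast
  have K2: "?K t t' ==> ?K t' t'' ==> ?K t t''" for t t' t'' using apx_trans by blast
  have K3: "?K t t' ==> ?K (\<tau> <> t) (\<tau> <> t')" for t t'
   using \<tau> mul_in by (metis mul_assoc)
  have K4: "t : Hom T pt ==> ?K t t" for t using apx_refl B mul_in by blast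
  have K0: "?K (c <> u) (c <> v)"
  proof (intro conjI ballI)
   fix b assume b: "b : Hom (L B) T"
   \<comment> \<open>The multiplier passes through \<open>T\<close>; this is where \<open>r\<close>
     has to be at least three.\<close>
   have "rk (b <> c) <= 3" using rk_mul1[OF b c(1)] rk_le2[OF b] T by simp
   thus "apx B (b <> c <> u) (b <> c <> v)"
    using apx_mul[OF uv(1) A B mul_in[OF b c(1)]] rank_le_r r3 by auto
  qed (use uvH c in blast)+
  let ?t = "c <> u"
  have t: "?t : Hom T pt" using uvH c by blast
  have k1: "?K ?t (\<tau> <> ?t)"
  proof -
   consider "c <> v = \<tau> <> ?t" | "c <> v = \<tau> <> \<tau> <> ?t" using \<tau>t(2)[OF t, of "c <> v"] c uvH mul_in by metis
   thus ?thesis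
   proof cases
    case 1
    thus ?thesis using K0 by simp
   next
    case 2
    \<comment> \<open>One more application of \<tau> closes the orbit and gives the pair of
      \<open>?t\<close> and its first image.\<close>
    hence "?K (\<tau> <> ?t) (\<tau> <> \<tau> <> \<tau> <> ?t)" using K3[OF K0] by simp
    thus ?thesis using \<tau>t(1)[OF t] K1 by simp
   qed
  qed
  have k2: "?K ?t (\<tau> <> \<tau> <> ?t)" by (rule K2[OF k1 K3[OF k1]])
  have k: "?K ?t t'" if t': "t' : Hom T pt" for t'
  proof -
   consider "t' = ?t" | "t' = \<tau> <> ?t" | "t' = \<tau> <> \<tau> <> ?t" using \<tau>t(2)[OF t t'] by blast
   thus ?thesis
   proof cases
    case 1
    thus ?thesis using K4[OF t] by simp
   next
    case 2
    thus ?thesis using k1 by simp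
   next
    case 3
    thus ?thesis using k2 by simp
   qed
  qed
  have "(s, s') : {(u, v). apx B u v}"
  proof (rule pt_connected[OF L_ob[OF B] _ E _ s])
   show "3 <= sz (L B)" using False sz_odd[OF L_ob[OF B]] by presburger
   fix T' b t t' assume T': "ob T'" "sz T' = 3" "b : Hom (L B) T'" "t : Hom T' pt" "t' : Hom T' pt"
   obtain g where g: "g : Hom T' T" "rk g = sz T'" using iso[OF T'(1) T(1)] T T' by auto
   have gg: "g <> g^~ <> x = x" if "x : Hom T' pt" for x
    using full_unit[OF g] T T' one_l[OF that] by (metis mul_assoc)
   have "?K (g^~ <> t) (g^~ <> t')"
    using K2[OF K1[OF k] k] T' g by (meson mul_in st_in)
   hence "apx B ((b <> g) <> g^~ <> t) ((b <> g) <> g^~ <> t')" using g T' mul_in by blast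
   thus "(b <> t, b <> t') : {(u, v). apx B u v}" using gg T' by simp
  qed
  thus ?thesis by simp
 qed
 thus ?thesis unfolding lfull_def by blast
qed

lemma loc_total_lfull:
 assumes A: "A : C" and a: "a : coiso (L A) Z" and Z: "sz Z >= 3"
  and tot: "!!s t. s : Hom Z Z ==> t : Hom Z Z ==> (s, t) : loc a Z"
 shows lfull
proof -
 have aH: "a : Hom (L A) Z" "ob Z" using a coisoD Hom_ob by blast+
 obtain u v where uv: "u : Hom Z pt" "v : Hom Z pt" "u ~= v" using two_pt aH Z by blast
 have "(a <> (u <> u^~) <> a^~, a <> (v <> u^~) <> a^~) : sg"
  using tot[OF pt_in[OF uv(1,1)] pt_in[OF uv(2,1)]] unfolding loc_def by blast
 hence "((a <> u) <> (a <> u)^~, (a <> v) <> (a <> u)^~) : sg" by simp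
 hence "apx A (a <> u) (a <> v)"
  using apxI[OF mul_in[OF aH(1) uv(1)] mul_in[OF aH(1) uv(2)] mul_in[OF aH(1) uv(1)] A A] by simp
 moreover have "a <> u ~= a <> v" using coiso_cancel[OF a] uv by metis
 ultimately show ?thesis using apx_lfull A by blast
qed

end

context hook_cong begin

text \<open>The dual congruence satisfies the same hypotheses, so each statement about left ends
  becomes one about right ends under the prefix \<open>D\<close>.\<close>

interpretation D: hook_cong ob Hom mul st one rk sz hk pt C L sr tg r "dual_rel st sg"
 by (rule dual)

lemma dual_iff: "(x, y) : dual_rel st sg \<longleftrightarrow> (x^~, y^~) : sg"
 by (simp add: dual_rel_def)

lemma rank_one_full:
 assumes "lfull" "D.lfull" "A : C" "B : C" "x : H A B" "y : H A B" "rk x = 1" "rk y = 1"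
 shows "(x, y) : sg"
proof -
 obtain u w where x: "u : Hom (L A) pt" "w : Hom (L B) pt" "x = u <> w^~" using pt_factor[OF assms(5,7)] by blast
 obtain v t where y: "v : Hom (L A) pt" "t : Hom (L B) pt" "y = v <> t^~" using pt_factor[OF assms(6,8)] by blast
 have "(u <> w^~, v <> w^~) : sg" using assms x y unfolding lfull_def apx_def by blast
 moreover have "(w <> v^~, t <> v^~) : dual_rel st sg"
  using assms x y unfolding D.lfull_def D.apx_def by blast
 hence "(v <> w^~, v <> t^~) : sg" unfolding dual_iff by simp
 ultimately show ?thesis using rel_trans x y by blast
qed

lemma rank_one_fullto: "lfull ==> D.lfull ==> fullto 1"
 unfolding fullto_def
proof (intro ballI impI)
 fix A B x y assume 1: "lfull" "D.lfull" and 2: "A : C" "B : C" "x : H A B" "y : H A B" and 3: "rk x <= 1" "rk y <= 1"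
 have "rk x = 1" "rk y = 1" using 3 rank_odd[OF 2(3)] rank_odd[OF 2(4)] by (auto simp: le_Suc_eq)
 thus "(x, y) : sg" using rank_one_full[OF 1 2] by blast
qed

text \<open>An arrow of rank at most the size of \<open>Z\<close> factors through \<open>Z\<close>.
  Replacing the identity of \<open>Z\<close> inside it by a rank-one projection makes it congruent
  to an arrow of rank one, and those are all congruent.\<close>

lemma loc_total_fullto:
 assumes A: "A : C" and a: "a : coiso (L A) Z" and Z: "sz Z >= 3" "enat (sz Z) <= r"
  and tot: "!!s t. s : Hom Z Z ==> t : Hom Z Z ==> (s, t) : loc a Z"
 shows "fullto (sz Z)"
proof -
 have aH: "a : Hom (L A) Z" "ob Z" using a coisoD Hom_ob by blast+
 have lf: lfull using loc_total_lfull[OF A a Z(1) tot] .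
 have Dlf: D.lfull
 proof (rule D.loc_total_lfull[OF A a Z(1)])
  fix s t assume st: "s : Hom Z Z" "t : Hom Z Z"
  have "(s^~, t^~) : loc a Z" using tot st by blast
  thus "(s, t) : D.loc a Z" using st unfolding loc_def D.loc_def dual_iff by simp
 qed
 obtain u where u: "u : Hom Z pt" using two_pt[OF aH(2) Z(1)] by blast
 have down: "EX x1:H D B. rk x1 = 1 & (x, x1) : sg"
  if DB: "D : C" "B : C" "x : H D B" "rk x <= sz Z" for D B x
 proof -
  obtain W where W: "ob W" "sz W = rk x" using ex_ob DB by blast
  obtain c d where cd: "c : coiso (L D) W" "d : coiso (L B) W" "x = c <> d^~" using factorization DB W by blast
  obtain f where f: "f : coiso Z W" using coiso_ex aH W DB by metis
  have H: "c : Hom (L D) W" "d : Hom (L B) W" "f : Hom Z W" using cd f coisoD by auto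
  \<comment> \<open>Both factors start or end at \<open>L A\<close>, so that a pair conjugated into
    \<open>L A\<close> fits between them, and both factor through \<open>Z\<close>, which bounds
    their rank.\<close>
  let ?p = "c <> f^~ <> a^~" and ?q = "a <> f <> d^~"
  have pq: "?p : H D A" "?q : H A B" using H aH by blast+
  have "rk ?p <= sz Z"
   using rk_mul1[OF H(1) mul_in[OF st_in[OF H(3)] st_in[OF aH(1)]]] rk_le2[OF H(1)] W DB by linarith
  moreover have "rk ?q <= sz Z"
   using rk_mul1[OF aH(1) mul_in[OF H(3) st_in[OF H(2)]]] rk_le2[OF aH(1)] by linarith
  ultimately have rpq: "enat (rk ?p) <= r" "enat (rk ?q) <= r" using Z rank_le_r by blast+
  have zz: "(a <> one Z <> a^~, a <> (u <> u^~) <> a^~) : sg"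
   using tot[OF one_in[OF aH(2)] pt_in[OF u u]] unfolding loc_def by blast
  have aa: "a <> one Z <> a^~ : H A A" "a <> (u <> u^~) <> a^~ : H A A" using aH u one_in by blast+
  have "(?p <> (a <> one Z <> a^~) <> ?q, ?p <> (a <> (u <> u^~) <> a^~) <> ?q) : sg"
   using rel_right[OF rel_left[OF zz aa pq(1) rpq(1) A A DB(1)] mul_in[OF pq(1) aa(1)] mul_in[OF pq(1) aa(2)] pq(2) rpq(2) DB(1) A DB(2)] by simp
  moreover have "?p <> (a <> one Z <> a^~) <> ?q = x"
  proof -
   have "?p <> (a <> one Z <> a^~) <> ?q = c <> f^~ <> (a^~ <> a) <> one Z <> (a^~ <> a) <> f <> d^~" by simp
   also have "\<dots> = c <> f^~ <> f <> d^~"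
    unfolding coisoD(2)[OF a] using one_l[OF mul_in[OF H(3) st_in[OF H(2)]]] by simp
   also have "\<dots> = x" using coiso_cancel[OF f st_in[OF H(2)]] cd by simp
   finally show ?thesis .
  qed
  moreover have "?p <> (a <> (u <> u^~) <> a^~) <> ?q = (c <> f^~ <> u) <> (d <> f^~ <> u)^~"
  proof -
   have "?p <> (a <> (u <> u^~) <> a^~) <> ?q = c <> f^~ <> (a^~ <> a <> u) <> (a^~ <> a <> u)^~ <> f <> d^~" by simp
   also have "\<dots> = c <> f^~ <> u <> u^~ <> f <> d^~" unfolding coiso_cancel[OF a u] ..
   finally show ?thesis by simp
  qed
  moreover have "c <> f^~ <> u : Hom (L D) pt" "d <> f^~ <> u : Hom (L B) pt" using H u by blast+
  ultimately show ?thesis using pt_rk2 pt_in by metis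
 qed
 show ?thesis unfolding fullto_def
 proof (intro ballI impI)
  fix D B x y assume 1: "D : C" "B : C" "x : H D B" "y : H D B" "rk x <= sz Z" "rk y <= sz Z"
  obtain x1 where x1: "x1 : H D B" "rk x1 = 1" "(x, x1) : sg" using down 1 by blast
  obtain y1 where y1: "y1 : H D B" "rk y1 = 1" "(y, y1) : sg" using down 1 by blast
  have "(x1, y1) : sg" using rank_one_full[OF lf Dlf] 1 x1 y1 by blast
  thus "(x, y) : sg" using x1 y1 rel_sym rel_trans by blast
 qed
qed

lemma drop_fullto:
 assumes xy: "(x, y) : sg" "rk y < rk x" "rk x >= 3"
 shows "fullto (rk x)"
proof -
 obtain A B where AB: "A : C" "B : C" "x : H A B" "y : H A B" "enat (rk x) <= r" using rel_typed[OF xy(1)] by metis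
 obtain Z where Z: "ob Z" "sz Z = rk x" using ex_ob AB by blast
 obtain a b where ab: "a : coiso (L A) Z" "b : coiso (L B) Z" "x = a <> b^~" using factorization AB Z by blast
 have H: "a : Hom (L A) Z" "b : Hom (L B) Z" using ab coisoD by auto
 have "rk (a^~ <> y <> b) <= rk (y <> b)" using rk_mul2[OF st_in[OF H(1)] mul_in[OF AB(4) H(2)]] .
 also have "\<dots> <= rk y" using rk_mul1[OF AB(4) H(2)] .
 finally have lt: "rk (a^~ <> y <> b) < sz Z" using xy Z by simp
 have "fullto (sz Z)"
  using loc_total_fullto[OF AB(1) ab(1) _ _ loccong_collapse[OF loc_loccong[OF AB(1) ab(1)] Z(1) _ one_loc[OF xy(1) AB(3,4,1,2) ab] lt]]
  Z xy AB by simp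
 thus ?thesis using Z by simp
qed

text \<open>By \<open>sep_rank\<close> some left multiplication keeps the rank of one member and
  lowers that of the other, which reduces the claim to a pair of different ranks.\<close>

lemma kernel_fullto:
 assumes xy: "(x, y) : sg" "rk y = rk x" "rk x >= 3" "x <> x^~ ~= y <> y^~"
 shows "fullto (rk x)"
proof -
 obtain A B where AB: "A : C" "B : C" "x : H A B" "y : H A B" "enat (rk x) <= r" using rel_typed[OF xy(1)] by metis
 obtain Z where Z: "ob Z" "sz Z = rk x" using ex_ob AB by blast
 obtain a b where ab: "a : coiso (L A) Z" "b : coiso (L B) Z" "x = a <> b^~" using factorization AB Z by blast
 obtain a' b' where ab': "a' : coiso (L A) Z" "b' : coiso (L B) Z" "y = a' <> b'^~"
  using factorization[OF AB(4) Z(1)] Z xy by auto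
 have H: "a : Hom (L A) Z" "b : Hom (L B) Z" "a' : Hom (L A) Z" "b' : Hom (L B) Z" using ab ab' coisoD by auto
 have "a <> a^~ ~= a' <> a'^~" using xy(4) coiso_proj[OF ab(1,2)] coiso_proj[OF ab'(1,2)] ab ab' by auto
 then obtain c where c: "c : Hom Z (L A)" "(rk (c <> a) = sz Z) ~= (rk (c <> a') = sz Z)"
  using sep_rank[OF ab(1) ab'(1)] Z xy by auto
 \<comment> \<open>\<open>c\<close> starts at \<open>Z\<close> and is not itself available as a
   multiplier; composing it with the coisometry \<open>a\<close> brings it into \<open>Q\<close>
   without changing ranks.\<close>
 have acH: "a <> c : H A A" using H c by blast
 have "rk (a <> c) <= sz Z" using rk_mul1[OF H(1) c(1)] rk_le2[OF H(1)] by simp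
 hence "enat (rk (a <> c)) <= r" using rank_le_r Z AB by metis
 hence s: "((a <> c) <> x, (a <> c) <> y) : sg" using rel_left[OF xy(1) AB(3,4) acH] AB by blast
 have "rk ((a <> c) <> x) = rk (c <> a)" "rk ((a <> c) <> y) = rk (c <> a')"
  using coiso_rk_mul[OF ab(1) mul_in[OF c(1) AB(3)]] coiso_rk_mul2[OF ab(2) mul_in[OF c(1) H(1)]] ab(3)
   coiso_rk_mul[OF ab(1) mul_in[OF c(1) AB(4)]] coiso_rk_mul2[OF ab'(2) mul_in[OF c(1) H(3)]] ab'(3)
  by simp_all
 moreover have "rk (c <> a) <= sz Z" "rk (c <> a') <= sz Z" using rk_le2 c H mul_in by blast+
 ultimately show ?thesis
  using c(2) drop_fullto[OF s] drop_fullto[OF rel_sym[OF s]] Z xy by auto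
qed

lemma loc_mulR: "A : C ==> a : coiso (L A) Z ==> enat (sz Z) <= r ==> (s, t) : loc a Z ==> u : Hom Z Z ==>
  (a <> (s <> u) <> a^~, a <> (t <> u) <> a^~) : sg"
 using loccongD(5)[OF loc_loccong, of A a Z s t u] unfolding loc_def by blast

text \<open>Normalised to \<open>(one Z, g)\<close> with a unit \<open>g\<close>, the pair relates a
  hook to its image under \<open>g\<close>. For a hook that \<open>g\<close> moves, the two have
  different kernels, and the rank has gone down by two. If that leaves rank one, different kernels
  no longer force a collapse and only the left ends get identified.\<close>

lemma group_pair:
 assumes xy: "(x, y) : sg" "x ~= y" "x <> x^~ = y <> y^~" "x^~ <> x = y^~ <> y" "rk x >= 3"
 shows "(rk x >= 5 --> fullto (rk x - 2)) & (rk x = 3 --> lfull)"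
proof -
 obtain A B where AB: "A : C" "B : C" "x : H A B" "y : H A B" "enat (rk x) <= r" using rel_typed[OF xy(1)] by metis
 obtain Z where Z: "ob Z" "sz Z = rk x" using ex_ob AB by blast
 obtain a b where ab: "a : coiso (L A) Z" "b : coiso (L B) Z" "x = a <> b^~" using factorization AB Z by blast
 have H: "a : Hom (L A) Z" "b : Hom (L B) Z" using ab coisoD by auto
 let ?g = "a^~ <> y <> b"
 have g: "?g : Hom Z Z" using H AB by blast
 note l = one_loc[OF xy(1) AB(3,4,1,2) ab]
 have "a <> ?g <> b^~ = (a <> a^~) <> y <> (b <> b^~)" by simp
 also have "a <> a^~ = y <> y^~" using coiso_proj[OF ab(1,2)] xy(3) ab by simp
 also have "b <> b^~ = y^~ <> y" using coiso_proj[OF ab(2,1)] xy(4) ab by simp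
 also have "(y <> y^~) <> y <> y^~ <> y = y" using regular[OF AB(4)] by simp
 finally have ye: "a <> ?g <> b^~ = y" .
 have g1: "?g ~= one Z"
 proof
  assume "?g = one Z"
  thus False using ye ab(3) xy(2) one_l[OF st_in[OF H(2)]] by metis
 qed
 have "rk y = rk x" using rk_proj[OF AB(3)] rk_proj[OF AB(4)] xy(3) by simp
 hence rg: "rk ?g = sz Z"
  using ye coiso_rk_mul[OF ab(1) mul_in[OF g st_in[OF H(2)]]] coiso_rk_mul2[OF ab(2) g] Z by metis
 obtain W et where et: "et : hk Z W" "?g <> et <> et^~ <> ?g^~ ~= et <> et^~"
  using unit_move[OF g rg _ g1] Z xy by auto
 have etH: "et : Hom Z W" "sz Z = sz W + 2" "et : coiso Z W" "ob W" using hkD[OF et(1)] hk_coiso[OF et(1)] Hom_ob by blast+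
 have hh: "et <> et^~ : Hom Z Z" using etH by blast
 have "(a <> (one Z <> et <> et^~) <> a^~, a <> (?g <> et <> et^~) <> a^~) : sg"
  using loc_mulR[OF AB(1) ab(1) _ l hh] Z AB by simp
 hence s: "((a <> et) <> (a <> et)^~, (a <> ?g <> et) <> (a <> et)^~) : sg"
  using one_l[OF hh] by simp
 have c1: "a <> et : coiso (L A) W" "a <> ?g <> et : coiso (L A) W"
  using coiso_mul[OF ab(1) etH(3)] coiso_mul[OF ab(1) coiso_mul[OF unit_coiso[OF g rg] etH(3)]] by simp_all
 have ne: "(a <> et) <> (a <> et)^~ ~= (a <> ?g <> et) <> (a <> ?g <> et)^~"
 proof
  assume e: "(a <> et) <> (a <> et)^~ = (a <> ?g <> et) <> (a <> ?g <> et)^~"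
  have cc: "a^~ <> (a <> v <> a^~) <> a = v" if v: "v : Hom Z Z" for v
  proof -
   have "a^~ <> (a <> v <> a^~) <> a = (a^~ <> a) <> v <> (a^~ <> a)" by simp
   thus ?thesis unfolding coisoD(2)[OF ab(1)] using one_l[OF v] one_r[OF v] by simp
  qed
  have "a <> (et <> et^~) <> a^~ = a <> (?g <> et <> et^~ <> ?g^~) <> a^~" using e by simp
  hence "et <> et^~ = ?g <> et <> et^~ <> ?g^~"
   using cc[OF hh] cc[of "?g <> et <> et^~ <> ?g^~"] g etH by (metis mul_in st_in)
  thus False using et(2) by simp
 qed
 show ?thesis
 proof (intro conjI impI)
  assume 5: "rk x >= 5"
  have rk1: "rk ((a <> et) <> (a <> et)^~) = sz W" "rk ((a <> ?g <> et) <> (a <> et)^~) = sz W"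
   using coiso_rk_mul2[OF c1(1) coisoD(1)[OF c1(1)]] coiso_rk_mul2[OF c1(1) coisoD(1)[OF c1(2)]] coiso_rk c1 by metis+
  have "fullto (rk ((a <> et) <> (a <> et)^~))"
   using kernel_fullto[OF s] rk1 ne coiso_proj[OF c1(1,1)] coiso_proj[OF c1(2,1)] 5 Z etH(2) by simp
  moreover have "rk x - 2 = sz W" using Z etH(2) by simp
  ultimately show "fullto (rk x - 2)" using rk1 by metis
 next
  assume 3: "rk x = 3"
  hence W1: "sz W = 1" using Z etH by simp
  \<comment> \<open>\<open>W\<close> has one point and is linked to \<open>pt\<close> by a unit;
    through \<open>k\<close> the hook becomes an end.\<close>
  obtain k where k: "k : Hom W pt" "rk k = sz W" using iso[OF etH(4) ob_pt] W1 sz_pt by auto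
  have kk: "k <> k^~ = one W" using full_unit[OF k] W1 sz_pt by simp
  let ?u = "a <> et <> k" and ?v = "a <> ?g <> et <> k"
  have uv: "?u : Hom (L A) pt" "?v : Hom (L A) pt"
   using mul_in[OF coisoD(1)[OF c1(1)] k(1)] mul_in[OF coisoD(1)[OF c1(2)] k(1)] by simp_all
  have kx: "k <> k^~ <> y = y" if "y : Hom W Y" for y Y using kk one_l[OF that] by (metis mul_assoc)
  have kk2: "k <> k^~ <> et^~ <> y = et^~ <> y" if "y : Hom Z Y" for y Y
   using kx[OF mul_in[OF st_in[OF etH(1)] that]] .
  have "(?u <> ?u^~, ?v <> ?u^~) : sg"
   using s kk2[OF st_in[OF H(1)]] by simp
  hence "apx A ?u ?v" using apxI[OF uv(1,2,1) AB(1,1)] by blast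
  moreover have "?u ~= ?v"
  proof
   assume "?u = ?v"
   hence "?u <> ?u^~ = ?v <> ?v^~" by metis
   thus False using ne kk2[OF st_in[OF H(1)]] kk2[OF mul_in[OF st_in[OF g] st_in[OF H(1)]]] by simp
  qed
  ultimately show lfull using apx_lfull AB by blast
 qed
qed

end

context hook_cong begin

interpretation D: hook_cong ob Hom mul st one rk sz hk pt C L sr tg r "dual_rel st sg"
 by (rule dual)

lemma dual_fullto: "D.fullto q ==> fullto q"
 unfolding fullto_def D.fullto_def dual_iff by (metis rk_st st_in st_st)

lemma not_group_fullto:
 assumes xy: "(x, y) : sg" "rk y <= rk x" "rk x >= 3"
  and n: "\<not> (x <> x^~ = y <> y^~ & x^~ <> x = y^~ <> y)"
 shows "fullto (rk x)"
proof -
 consider "rk y < rk x" | "rk y = rk x" "x <> x^~ ~= y <> y^~" | "rk y = rk x" "x^~ <> x ~= y^~ <> y"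
  using xy n by linarith
 thus ?thesis
 proof cases
  case 1
  thus ?thesis using drop_fullto xy by blast
 next
  case 2
  thus ?thesis using kernel_fullto xy by blast
 next
  case 3
  have "D.fullto (rk (x^~))"
   by (rule D.kernel_fullto[of _ "y^~"]) (use 3 xy in \<open>auto simp: dual_iff\<close>)
  thus ?thesis using dual_fullto by simp
 qed
qed

text \<open>In rank three the left and the right ends have to be identified separately, the latter
  by applying \<open>group_pair\<close> to the adjoint pair.\<close>

lemma group_fullto:
 assumes xy: "(x, y) : sg" "x ~= y" "x <> x^~ = y <> y^~" "x^~ <> x = y^~ <> y" "rk x >= 3"
 shows "fullto (rk x - 2)"
proof -
 have o: "odd (rk x)" using rel_typed[OF xy(1)] rank_odd by metis
 have g: "(rk x >= 5 --> fullto (rk x - 2)) & (rk x = 3 --> lfull)" using group_pair[OF xy] .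
 have "x^~ ~= y^~" using xy(2) st_st by metis
 hence d: "rk x = 3 --> D.lfull"
  using D.group_pair[of "x^~" "y^~"] xy by (simp add: dual_iff)
 show ?thesis
 proof (cases "rk x = 3")
  case True
  thus ?thesis using g d rank_one_fullto by simp
 next
  case False
  hence "rk x >= 5" using o xy(5) by presburger
  thus ?thesis using g by blast
 qed
qed

text \<open>Right multiplication by \<open>w <> u^~\<close> replaces both right ends by
  \<open>u\<close>, whatever they were.\<close>

lemma lfull_of_pair:
 assumes "(u <> w^~, v <> t^~) : sg" "u ~= v" "u : Hom (L A) pt" "v : Hom (L A) pt"
  "w : Hom (L B) pt" "t : Hom (L B) pt" "A : C" "B : C"
 shows lfull
proof -
 have "((u <> w^~) <> (w <> u^~), (v <> t^~) <> (w <> u^~)) : sg"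
  using rel_right[OF assms(1) pt_in[OF assms(3,5)] pt_in[OF assms(4,6)] pt_in[OF assms(5,3)] _ assms(7,8,7)]
   pt_rk2[OF assms(5,3)] one_le_r by simp
 hence "(u <> u^~, v <> u^~) : sg"
  using pt_cancel2[OF assms(5,5) st_in[OF assms(3)]] pt_cancel2[OF assms(6,5) st_in[OF assms(3)]] by simp
 thus ?thesis using apx_lfull apxI assms by metis
qed

end

context hook_cong begin

interpretation D: hook_cong ob Hom mul st one rk sz hk pt C L sr tg r "dual_rel st sg"
 by (rule dual)

text \<open>When nothing happens above rank one, two yes-or-no questions remain: are the left ends
  identified, and are the right ends. Because one identification forces all others on its side, the
  four answers give the four relations.\<close>

lemma low_cases:
 assumes low: "!!x y. (x, y) : sg ==> x ~= y ==> rk x = 1 & rk y = 1"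
 shows "sg : {Id_on (carrier (Ir r)), lambda_cong (Ir r) (carrier (Ir 1)),
  rho_cong (Ir r) (carrier (Ir 1)), Rees (Ir r) (carrier (Ir 1))}"
proof -
 have 1: "(1::enat) = enat 1" by (simp add: one_enat_def)
 have sub: "x : carrier (Ir r)" if "x : carrier (Ir 1)" for x
  using that one_le_r unfolding carrier_Ir 1 by (meson order_trans)
 have I1: "x : carrier (Ir 1) \<longleftrightarrow> (EX A:C. EX B:C. EX u:Hom (L A) pt. EX w:Hom (L B) pt. x = u <> w^~)" for x
 proof
  assume "x : carrier (Ir 1)"
  then obtain A B where AB: "A : C" "B : C" "x : H A B" "rk x <= 1" unfolding carrier_Ir 1 by auto
  hence "rk x = 1" using rank_odd[OF AB(3)] by (auto simp: le_Suc_eq)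
  thus "EX A:C. EX B:C. EX u:Hom (L A) pt. EX w:Hom (L B) pt. x = u <> w^~"
   using pt_factor[OF AB(3)] AB(1,2) by blast
 next
  assume "EX A:C. EX B:C. EX u:Hom (L A) pt. EX w:Hom (L B) pt. x = u <> w^~"
  thus "x : carrier (Ir 1)" unfolding carrier_Ir 1 using pt_in pt_rk2 by (metis order_refl)
 qed
 have Idr: "(x, x) : sg" if "x : carrier (Ir r)" for x using that rel_refl unfolding carrier_Ir by blast
 have car: "x : carrier (Ir r)" "y : carrier (Ir r)" if "(x, y) : sg" for x y
  using rel_typed[OF that] carrier_Ir by (metis, metis)
 define pair where "pair x y u w v t A B \<longleftrightarrow> A : C & B : C & u : Hom (L A) pt & v : Hom (L A) pt &
   w : Hom (L B) pt & t : Hom (L B) pt & x = u <> w^~ & y = v <> t^~" for x y u w v t A B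
 have ex: "\<exists>u w v t A B. pair x y u w v t A B" if xy: "(x, y) : sg" "x ~= y" for x y
 proof -
  obtain A B where AB: "A : C" "B : C" "x : H A B" "y : H A B" using rel_typed[OF xy(1)] by metis
  show ?thesis using pt_factor[OF AB(3)] pt_factor[OF AB(4)] low[OF xy] AB unfolding pair_def by blast
 qed
 have ex2: "\<exists>u w v t A B. pair x y u w v t A B" if xy: "(x, y) : tnabla (Ir r)" "x : carrier (Ir 1)" "y : carrier (Ir 1)" for x y
 proof -
  obtain A B where AB: "A : C" "B : C" "x : H A B" "y : H A B" using xy(1) unfolding tnabla_Ir by blast
  have "rk x = 1" "rk y = 1" using xy(2,3) pt_rk2 unfolding I1 by blast+
  thus ?thesis using pt_factor[OF AB(3)] pt_factor[OF AB(4)] AB unfolding pair_def by blast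
 qed
 have pairc: "x : carrier (Ir 1)" "y : carrier (Ir 1)" "(x, y) : tnabla (Ir r)"
  "(x, y) : Green_L (Ir r) \<longleftrightarrow> w = t" "(x, y) : Green_R (Ir r) \<longleftrightarrow> u = v" if p: "pair x y u w v t A B" for x y u w v t A B
 proof -
  show c: "x : carrier (Ir 1)" "y : carrier (Ir 1)" using p unfolding pair_def I1 by blast+
  have "x : H A B" "y : H A B" "rk x = 1" "rk y = 1" using p pt_in pt_rk2 unfolding pair_def by auto
  thus "(x, y) : tnabla (Ir r)" using p one_le_r unfolding tnabla_Ir pair_def by auto
  have "x <> x^~ = u <> u^~" "y <> y^~ = v <> v^~" "x^~ <> x = w <> w^~" "y^~ <> y = t <> t^~"
   using p pt_proj unfolding pair_def by auto
  thus "(x, y) : Green_L (Ir r) \<longleftrightarrow> w = t" "(x, y) : Green_R (Ir r) \<longleftrightarrow> u = v"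
   unfolding left_ideal_iff[OF sub[OF c(1)] sub[OF c(2)]] right_ideal_iff[OF sub[OF c(1)] sub[OF c(2)]]
   using p pt_proj_eq unfolding pair_def by metis+
 qed
 have Lf: "u = v \<or> lfull" "w = t \<or> D.lfull" if "(x, y) : sg" "pair x y u w v t A B" for x y u w v t A B
 proof -
  show "u = v \<or> lfull" using lfull_of_pair that unfolding pair_def by blast
  have "(w <> u^~, t <> v^~) : dual_rel st sg" using that unfolding dual_iff pair_def by simp
  thus "w = t \<or> D.lfull" using D.lfull_of_pair that(2) unfolding pair_def by blast
 qed
 have lam: "(x, y) : sg" if "lfull" "pair x y u w v t A B" "w = t" for x y u w v t A B
  using that unfolding lfull_def apx_def pair_def by blast
 have rho: "(x, y) : sg" if "D.lfull" "pair x y u w v t A B" "u = v" for x y u w v t A B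
 proof -
  have "(w <> u^~, t <> v^~) : dual_rel st sg"
   using that unfolding D.lfull_def D.apx_def pair_def by blast
  thus ?thesis using that unfolding dual_iff pair_def by simp
 qed
 consider "\<not> lfull" "\<not> D.lfull" | "lfull" "\<not> D.lfull" | "\<not> lfull" "D.lfull" | "lfull" "D.lfull" by blast
 thus ?thesis
 proof cases
  case 1
  have "sg = Id_on (carrier (Ir r))"
  proof (rule subset_antisym; rule subrelI)
   fix x y assume xy: "(x, y) : sg"
   have "x = y"
   proof (rule ccontr)
    assume n: "x ~= y"
    then obtain u w v t A B where p: "pair x y u w v t A B" using ex xy by blast
    hence "u = v" "w = t" using Lf[OF xy p] 1 by blast+
    thus False using n p unfolding pair_def by blast
   qed
   thus "(x, y) : Id_on (carrier (Ir r))" using car[OF xy] by blast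
  qed (use Idr in blast)
  thus ?thesis by blast
 next
  case 2
  have "sg = lambda_cong (Ir r) (carrier (Ir 1))"
  proof (rule subset_antisym; rule subrelI)
   fix x y assume xy: "(x, y) : sg"
   show "(x, y) : lambda_cong (Ir r) (carrier (Ir 1))"
   proof (cases "x = y")
    case True
    thus ?thesis using car[OF xy] unfolding lambda_cong_def by blast
   next
    case False
    then obtain u w v t A B where p: "pair x y u w v t A B" using ex xy by blast
    hence "w = t" using Lf[OF xy p] 2 by blast
    thus ?thesis using pairc[OF p] unfolding lambda_cong_def by blast
   qed
  next
   fix x y assume "(x, y) : lambda_cong (Ir r) (carrier (Ir 1))"
   then consider "x = y" "x : carrier (Ir r)"
    | "x : carrier (Ir 1)" "y : carrier (Ir 1)" "(x, y) : tnabla (Ir r)" "(x, y) : Green_L (Ir r)"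
    unfolding lambda_cong_def by blast
   thus "(x, y) : sg"
   proof cases
    case 2
    then obtain u w v t A B where p: "pair x y u w v t A B" using ex2 by blast
    thus ?thesis using pairc(4)[OF p] 2(4) lam[OF \<open>lfull\<close> p] by blast
   qed (use Idr in blast)
  qed
  thus ?thesis by blast
 next
  case 3
  have "sg = rho_cong (Ir r) (carrier (Ir 1))"
  proof (rule subset_antisym; rule subrelI)
   fix x y assume xy: "(x, y) : sg"
   show "(x, y) : rho_cong (Ir r) (carrier (Ir 1))"
   proof (cases "x = y")
    case True
    thus ?thesis using car[OF xy] unfolding rho_cong_def by blast
   next
    case False
    then obtain u w v t A B where p: "pair x y u w v t A B" using ex xy by blast
    hence "u = v" using Lf[OF xy p] 3 by blast
    thus ?thesis using pairc[OF p] unfolding rho_cong_def by blast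
   qed
  next
   fix x y assume "(x, y) : rho_cong (Ir r) (carrier (Ir 1))"
   then consider "x = y" "x : carrier (Ir r)"
    | "x : carrier (Ir 1)" "y : carrier (Ir 1)" "(x, y) : tnabla (Ir r)" "(x, y) : Green_R (Ir r)"
    unfolding rho_cong_def by blast
   thus "(x, y) : sg"
   proof cases
    case 2
    then obtain u w v t A B where p: "pair x y u w v t A B" using ex2 by blast
    thus ?thesis using pairc(5)[OF p] 2(4) rho[OF \<open>D.lfull\<close> p] by blast
   qed (use Idr in blast)
  qed
  thus ?thesis by blast
 next
  case 4
  note R = Rees_Ir[OF one_le_r]
  have "sg = Rees (Ir r) (carrier (Ir 1))" unfolding 1
  proof (rule subset_antisym; rule subrelI)
   fix x y assume xy: "(x, y) : sg"
   obtain A B where "A : C" "B : C" "x : H A B" "y : H A B" using rel_typed[OF xy] by metis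
   thus "(x, y) : Rees (Ir r) (carrier (Ir (enat 1)))" using low[OF xy] car[OF xy] unfolding R by auto
  next
   fix x y assume "(x, y) : Rees (Ir r) (carrier (Ir (enat 1)))"
   then consider "x = y" "x : carrier (Ir r)" | A B where "A : C" "B : C" "x : H A B" "y : H A B" "rk x <= 1" "rk y <= 1"
    unfolding R by blast
   thus "(x, y) : sg"
   proof cases
    case 2
    thus ?thesis using fulltoD[OF rank_one_fullto[OF 4]] by blast
   qed (use Idr in blast)
  qed
  thus ?thesis by blast
 qed
qed

end

section \<open>The listed relations are congruences\<close>

context hook_subcat begin

text \<open>A common right end of two rank-one arrows survives multiplication on the left; on the
  right, compatibility is read off from \<open>x^~ <> x\<close>. The claim for
  \<open>rho_cong\<close> is the image of the one for \<open>lambda_cong\<close> under the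
  involution.\<close>

lemma lambda_congruence: "enat 1 <= r ==> congruence_on (Ir r) (lambda_cong (Ir r) (carrier (Ir 1)))"
 and rho_congruence: "enat 1 <= r ==> congruence_on (Ir r) (rho_cong (Ir r) (carrier (Ir 1)))"
proof -
 assume r: "enat 1 <= r"
 have 1: "(1::enat) = enat 1" by (simp add: one_enat_def)
 have sub: "x : carrier (Ir r)" if "x : carrier (Ir 1)" for x
  using that r unfolding carrier_Ir 1 by (meson order_trans)
 define E where "E x y \<longleftrightarrow> (EX A:C. EX B:C. x : H A B & y : H A B) & rk x = 1 & rk y = 1" for x y
 have L: "(x, y) : lambda_cong (Ir r) (carrier (Ir 1)) \<longleftrightarrow>
  (E x y & x^~ <> x = y^~ <> y) \<or> x = y & x : carrier (Ir r)" for x y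
 proof -
  have "x : carrier (Ir 1) & y : carrier (Ir 1) & (x, y) : tnabla (Ir r) \<longleftrightarrow> E x y"
  proof -
   have "rk x <= 1 \<longleftrightarrow> rk x = 1" if "x : H A B" for x A B
    using rank_odd[OF that] by (auto simp: le_Suc_eq)
   thus ?thesis using r unfolding tnabla_Ir carrier_Ir 1 E_def by auto
  qed
  thus ?thesis using left_ideal_iff[OF sub sub] unfolding lambda_cong_def by blast
 qed
 have R: "(x, y) : rho_cong (Ir r) (carrier (Ir 1)) \<longleftrightarrow>
  (E x y & x <> x^~ = y <> y^~) \<or> x = y & x : carrier (Ir r)" for x y
 proof -
  have "x : carrier (Ir 1) & y : carrier (Ir 1) & (x, y) : tnabla (Ir r) \<longleftrightarrow> E x y"
  proof -
   have "rk x <= 1 \<longleftrightarrow> rk x = 1" if "x : H A B" for x A B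
    using rank_odd[OF that] by (auto simp: le_Suc_eq)
   thus ?thesis using r unfolding tnabla_Ir carrier_Ir 1 E_def by auto
  qed
  thus ?thesis using right_ideal_iff[OF sub sub] unfolding rho_cong_def by blast
 qed
 have Er: "E x y ==> x : carrier (Ir r) & y : carrier (Ir r) & (x, y) : tnabla (Ir r)" for x y
  using r unfolding E_def carrier_Ir tnabla_Ir by auto
 have Es: "E x y ==> E y x" for x y unfolding E_def by auto
 have Et: "E x y ==> E y z ==> E x z" for x y z unfolding E_def by (metis sr_tg)
 have El: "E (a <> x) (a <> y)" if "E x y" "x : H A B" "y : H A B" "a : H D A" "A : C" "B : C" "D : C" for x y a A B D
 proof -
  have "a <> x : H D B" "a <> y : H D B" using that by blast+
  moreover from this have "rk (a <> x) = 1" "rk (a <> y) = 1"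
   using rk_mul2[OF that(4,2)] rk_mul2[OF that(4,3)] that(1) rank_odd[of "a <> x"] rank_odd[of "a <> y"]
   unfolding E_def by (auto simp: le_Suc_eq)
  ultimately show ?thesis using that unfolding E_def by blast
 qed
 have Eq: "equiv (carrier (Ir r)) {(x, y). E x y & f x = f y \<or> x = y & x : carrier (Ir r)}" for f :: "'m => 'm"
  by (rule equivI) (auto simp: refl_on_def sym_def trans_def dest: Er Es intro: Et)
 have lamE: "lambda_cong (Ir r) (carrier (Ir 1)) = {(x, y). E x y & x^~ <> x = y^~ <> y \<or> x = y & x : carrier (Ir r)}"
  using L by auto
 have rhoE: "rho_cong (Ir r) (carrier (Ir 1)) = {(x, y). E x y & x <> x^~ = y <> y^~ \<or> x = y & x : carrier (Ir r)}"
  using R by auto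
 have ty: "lambda_cong (Ir r) (carrier (Ir 1)) <= tnabla (Ir r)" "rho_cong (Ir r) (carrier (Ir 1)) <= tnabla (Ir r)"
 proof -
  have tr: "x : carrier (Ir r) ==> (x, x) : tnabla (Ir r)" for x unfolding tnabla_def by simp
  show "lambda_cong (Ir r) (carrier (Ir 1)) <= tnabla (Ir r)"
   by (rule subrelI) (use L Er tr in blast)
  show "rho_cong (Ir r) (carrier (Ir 1)) <= tnabla (Ir r)"
   by (rule subrelI) (use R Er tr in blast)
 qed
 have same: "a : H D A ==> x : H A B ==> enat (rk a) <= r ==> D : C ==> B : C ==> a <> x : carrier (Ir r)"
  "x : H A B ==> a : H B D ==> enat (rk a) <= r ==> D : C ==> A : C ==> x <> a : carrier (Ir r)" for a x A B D
  using rk_mul_le unfolding carrier_Ir by blast+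
 have lamL: "(a <> x, a <> y) : lambda_cong (Ir r) (carrier (Ir 1))"
  if t0: "A : C" "B : C" "D : C" "x : H A B" "y : H A B" "(x, y) : lambda_cong (Ir r) (carrier (Ir 1))" "a : H D A" "enat (rk a) <= r" for A B D x y a
 proof (cases "x = y")
  case True
  thus ?thesis unfolding L using same(1)[OF t0(7,4,8,3,2)] by blast
 next
  case False
  hence e: "E x y" "x^~ <> x = y^~ <> y" using that L by auto
  hence Ea: "E (a <> x) (a <> y)" using El that by blast
  obtain u w where x: "u : Hom (L A) pt" "w : Hom (L B) pt" "x = u <> w^~" using pt_factor[OF t0(4)] e E_def by blast
  obtain v t where y: "v : Hom (L A) pt" "t : Hom (L B) pt" "y = v <> t^~" using pt_factor[OF t0(5)] e E_def by blast
  have "x^~ <> x = w <> w^~" "y^~ <> y = t <> t^~" using x y pt_proj by auto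
  hence "w = t" using pt_proj_eq e x y by metis
  moreover have "a <> u : Hom (L D) pt" "a <> v : Hom (L D) pt" using t0 x y by blast+
  ultimately have "(a <> x)^~ <> (a <> x) = (a <> y)^~ <> (a <> y)"
   using x y pt_proj[OF x(2), of "a <> u"] pt_proj[OF y(2), of "a <> v"] by simp
  thus ?thesis unfolding L using Ea by blast
 qed
 have lamR: "(x <> a, y <> a) : lambda_cong (Ir r) (carrier (Ir 1))"
  if "A : C" "B : C" "D : C" "x : H A B" "y : H A B" "(x, y) : lambda_cong (Ir r) (carrier (Ir 1))" "a : H B D" "enat (rk a) <= r" for A B D x y a
 proof (cases "x = y")
  case True
  thus ?thesis unfolding L using same(2)[OF that(4,7,8,3,1)] by blast
 next
  case False
  hence e: "E x y" "x^~ <> x = y^~ <> y" using that L by auto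
  have "E (x^~) (y^~)" using e unfolding E_def using that st_in rk_st by metis
  hence "E (a^~ <> x^~) (a^~ <> y^~)" using El[of "x^~" "y^~" B A "a^~" D] that st_in by blast
  hence "E (x <> a) (y <> a)" unfolding E_def using that
   by (metis mul_in rk_st st_mul st_st)
  moreover have "(x <> a)^~ <> (x <> a) = a^~ <> (x^~ <> x) <> a" "(y <> a)^~ <> (y <> a) = a^~ <> (y^~ <> y) <> a" by simp_all
  ultimately show ?thesis unfolding L using e by auto
 qed
 show lam: "congruence_on (Ir r) (lambda_cong (Ir r) (carrier (Ir 1)))"
  unfolding congruence_on_Ir using Eq lamE
  by (intro conjI ty ballI impI lamL lamR; (assumption | simp))
 have dual: "(x, y) : rho_cong (Ir r) (carrier (Ir 1)) \<longleftrightarrow> (x^~, y^~) : lambda_cong (Ir r) (carrier (Ir 1))" for x y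
 proof -
  have "E x y \<longleftrightarrow> E (x^~) (y^~)" unfolding E_def by (metis rk_st st_in st_st)
  moreover have "x^~ : carrier (Ir r) \<longleftrightarrow> x : carrier (Ir r)" unfolding carrier_Ir by (metis rk_st st_in st_st)
  moreover have "x = y \<longleftrightarrow> x^~ = y^~" by (metis st_st)
  ultimately show ?thesis unfolding L R by simp
 qed
 have rhoL: "(a <> x, a <> y) : rho_cong (Ir r) (carrier (Ir 1))"
  if "A : C" "B : C" "D : C" "x : H A B" "y : H A B" "(x, y) : rho_cong (Ir r) (carrier (Ir 1))" "a : H D A" "enat (rk a) <= r" for A B D x y a
  using lamR[of B A D "x^~" "y^~" "a^~"] that unfolding dual by (auto simp: st_in)
 have rhoR: "(x <> a, y <> a) : rho_cong (Ir r) (carrier (Ir 1))"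
  if "A : C" "B : C" "D : C" "x : H A B" "y : H A B" "(x, y) : rho_cong (Ir r) (carrier (Ir 1))" "a : H B D" "enat (rk a) <= r" for A B D x y a
  using lamL[of B A D "x^~" "y^~" "a^~"] that unfolding dual by (auto simp: st_in)
 show "congruence_on (Ir r) (rho_cong (Ir r) (carrier (Ir 1)))"
  unfolding congruence_on_Ir using Eq rhoE
  by (intro conjI ty ballI impI rhoL rhoR; (assumption | simp))
qed

lemma Rees_congruence:
 assumes q: "enat q <= r"
 shows "congruence_on (Ir r) (Rees (Ir r) (carrier (Ir (enat q))))" (is "congruence_on _ ?R")
proof -
 note R = Rees_Ir[OF q]
 have low: "enat (rk x) <= r" if "rk x <= q" for x using that q by (meson enat_ord_simps(1) order_trans)
 have ty: "?R <= tnabla (Ir r)"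
 proof (rule subrelI)
  fix x y assume "(x, y) : ?R"
  thus "(x, y) : tnabla (Ir r)" unfolding R tnabla_Ir carrier_Ir using low by blast
 qed
 have "equiv (carrier (Ir r)) ?R"
 proof (rule equivI)
  show "?R <= carrier (Ir r) \<times> carrier (Ir r)" using ty unfolding tnabla_def by auto
  show "refl_on (carrier (Ir r)) ?R" using R unfolding refl_on_def by blast
  show "sym ?R" unfolding sym_def R by blast
  show "trans ?R" unfolding trans_def R by (metis sr_tg)
 qed
 moreover have "(a <> x, a <> y) : ?R"
  if "A : C" "B : C" "D : C" "x : H A B" "y : H A B" "(x, y) : ?R" "a : H D A" "enat (rk a) <= r" for A B D x y a
 proof (cases "x = y")
  case True
  thus ?thesis unfolding R carrier_Ir using that rk_mul_le by blast
 next
  case False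
  hence "rk x <= q" "rk y <= q" using that(6) R by auto
  hence "rk (a <> x) <= q" "rk (a <> y) <= q" using rk_mul2[OF that(7,4)] rk_mul2[OF that(7,5)] by linarith+
  thus ?thesis unfolding R using that by blast
 qed
 moreover have "(x <> a, y <> a) : ?R"
  if "A : C" "B : C" "D : C" "x : H A B" "y : H A B" "(x, y) : ?R" "a : H B D" "enat (rk a) <= r" for A B D x y a
 proof (cases "x = y")
  case True
  thus ?thesis unfolding R carrier_Ir using that rk_mul_le by blast
 next
  case False
  hence "rk x <= q" "rk y <= q" using that(6) R by auto
  hence "rk (x <> a) <= q" "rk (y <> a) <= q" using rk_mul1[OF that(4,7)] rk_mul1[OF that(5,7)] by linarith+
  thus ?thesis unfolding R using that by blast
 qed
 ultimately show ?thesis unfolding congruence_on_Ir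
  by (intro conjI ty ballI impI; assumption?)
qed

lemma Id_congruence: "congruence_on (Ir r) (Id_on (carrier (Ir r)))"
proof -
 have "Id_on (carrier (Ir r)) <= tnabla (Ir r)" unfolding tnabla_def by auto
 moreover have "equiv (carrier (Ir r)) (Id_on (carrier (Ir r)))"
  by (rule equivI) (auto simp: refl_on_def sym_def trans_def)
 ultimately show ?thesis unfolding congruence_on_Ir
  using rk_mul_le by (auto simp: Id_on_iff carrier_Ir)
qed

lemma tnabla_congruence: "congruence_on (Ir r) (tnabla (Ir r))"
proof -
 have "equiv (carrier (Ir r)) (tnabla (Ir r))"
  unfolding tnabla_def by (rule equivI) (auto simp: refl_on_def sym_def trans_def)
 thus ?thesis unfolding congruence_on_Ir
  using rk_mul_le by (auto simp: tnabla_Ir)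
qed

text \<open>A multiple of \<open>a <> g <> b^~\<close> that stays in the J-class has kept its rank,
  which forces \<open>p' <> a\<close> and its counterpart on the right to be coisometries.
  Conversely, \<open>c <> a^~\<close> and \<open>b <> d^~\<close> carry the given presentation into
  any other.\<close>

lemma nu_eq_nuZ:
 assumes A0: "A0 : C" and ab: "a : coiso (L A0) Z" "b : coiso (L A0) Z" "b^~ <> a = one Z"
  and r: "enat (sz Z) <= r"
  and U: "unit_normal Z N'" and N: "N = {a <> g <> b^~ | g. g : N'}"
 shows "nu (Ir r) N = nuZ Z N'"
proof -
 have H: "a : Hom (L A0) Z" "b : Hom (L A0) Z" using ab coisoD by auto
 have N'H: "g : Hom Z Z" "rk g = sz Z" if "g : N'" for g using U that unfolding unit_normal_def by auto
 have one: "one Z : N'" using U unfolding unit_normal_def by blast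
 have NH: "x : H A0 A0" "rk x = sz Z" "x : carrier (Ir r)" if xN: "x : N" for x
 proof -
  obtain g where g: "g : N'" "x = a <> g <> b^~" using xN N by blast
  thus x: "x : H A0 A0" using H N'H by blast
  show "rk x = sz Z" using g N'H coiso_rk_mul[OF ab(1)] coiso_rk_mul2[OF ab(2)] H by (metis mul_in st_in)
  thus "x : carrier (Ir r)" using x A0 r carrier_Ir by auto
 qed
 have ne: "N ~= {}" using one N by blast
 have D: "Green_J (Ir r) `` N = {y : carrier (Ir r). rk y = sz Z}"
  using Green_J_Ir NH ne by (auto simp: Image_def)
 show ?thesis
 proof (rule subset_antisym; rule subrelI)
  fix s t assume "(s, t) : nu (Ir r) N"
  then obtain x y p q where 1: "x : N" "y : N" "p : S1 (Ir r)" "q : S1 (Ir r)"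
   "lcomposable (Ir r) p x" "lcomposable (Ir r) p y" "rcomposable (Ir r) x q" "rcomposable (Ir r) y q"
   "s = rmul1 (Ir r) (lmul1 (Ir r) p x) q" "t = rmul1 (Ir r) (lmul1 (Ir r) p y) q"
   "rk s = sz Z" "rk t = sz Z" unfolding nu_def Let_def D by blast
  obtain F p' where p: "F : C" "p' : H F A0" "lmul1 (Ir r) p x = p' <> x" "lmul1 (Ir r) p y = p' <> y"
  proof (cases p)
   case None
   thus ?thesis using that[of A0 "one (L A0)"] A0 one_in[OF L_ob[OF A0]] one_l[OF NH(1)[OF 1(1)]] one_l[OF NH(1)[OF 1(2)]] by (simp add: lmul1_def)
  next
   case (Some v)
   then obtain G K where "G : C" "K : C" "v : H G K" "tg v = sr x"
    using 1 carrier_Ir by (auto simp: S1_def lcomposable_def)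
   moreover from this have "K = A0" using sr_tg A0 NH 1 by metis
   ultimately show ?thesis using that Some by (auto simp: lmul1_def)
  qed
  obtain F' q' where q: "F' : C" "q' : H A0 F'" "s = p' <> x <> q'" "t = p' <> y <> q'"
  proof (cases q)
   case None
   thus ?thesis using that[of A0 "one (L A0)"] A0 one_in[OF L_ob[OF A0]] one_r[OF NH(1)[OF 1(1)]] one_r[OF NH(1)[OF 1(2)]] 1 p by (simp add: rmul1_def)
  next
   case (Some v)
   then obtain G K where "G : C" "K : C" "v : H G K" "sr v = tg x"
    using 1 carrier_Ir by (auto simp: S1_def rcomposable_def)
   moreover from this have "G = A0" using sr_tg A0 NH 1 by metis
   ultimately show ?thesis using that Some 1 p by (auto simp: rmul1_def)
  qed
  obtain g g' where g: "g : N'" "g' : N'" "x = a <> g <> b^~" "y = a <> g' <> b^~" using 1 N by blast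
  have pa: "p' <> a : Hom (L F) Z" "q'^~ <> b : Hom (L F') Z" using p q H by blast+
  have s: "s = (p' <> a) <> g <> (q'^~ <> b)^~" "t = (p' <> a) <> g' <> (q'^~ <> b)^~" using q g by simp_all
  have gH: "g : Hom Z Z" using g N'H by blast
  have "sz Z <= rk (p' <> a)" using rk_mul1[OF pa(1) mul_in[OF gH st_in[OF pa(2)]]] s(1) 1 by simp
  hence c1: "p' <> a : coiso (L F) Z" using full_coiso[OF pa(1)] rk_le2[OF pa(1)] by simp
  have "rk s <= rk (g <> (q'^~ <> b)^~)" unfolding s(1) using rk_mul2[OF pa(1) mul_in[OF gH st_in[OF pa(2)]]] .
  also have "\<dots> <= rk ((q'^~ <> b)^~)" using rk_mul2[OF gH st_in[OF pa(2)]] .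
  finally have "sz Z <= rk (q'^~ <> b)" using 1 by (simp only: rk_st)
  hence c2: "q'^~ <> b : coiso (L F') Z" using full_coiso[OF pa(2)] rk_le2[OF pa(2)] by simp
  show "(s, t) : nuZ Z N'" unfolding nuZ_def using s c1 c2 p(1) q(1) g(1,2) by blast
 next
  fix s t assume st: "(s, t) : nuZ Z N'"
  from nuZ_E[OF st U] obtain A B c d g g' where 1: "A : C" "B : C" "c : coiso (L A) Z" "d : coiso (L B) Z" "g : N'" "g' : N'"
   "s = c <> g <> d^~" "t = c <> g' <> d^~" "s : H A B" "t : H A B" "rk s = sz Z" "rk t = sz Z" by metis
  have H2: "c : Hom (L A) Z" "d : Hom (L B) Z" "g : Hom Z Z" "g' : Hom Z Z" using 1 coisoD N'H by auto
  let ?p = "c <> a^~" and ?q = "b <> d^~"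
  have pq: "?p : H A A0" "?q : H A0 B" using H H2 by blast+
  have "rk ?p <= sz Z" "rk ?q <= sz Z"
   using rk_mul1[OF H2(1) st_in[OF H(1)]] rk_le2[OF H2(1)] rk_mul1[OF H(2) st_in[OF H2(2)]] rk_le2[OF H(2)] by linarith+
  hence rpq: "enat (rk ?p) <= r" "enat (rk ?q) <= r" using r by (meson enat_ord_simps(1) order_trans)+
  have eq: "?p <> (a <> h <> b^~) <> ?q = c <> h <> d^~" if h: "h : Hom Z Z" for h
  proof -
   have "?p <> (a <> h <> b^~) <> ?q = c <> (a^~ <> a) <> h <> (b^~ <> b) <> d^~" by simp
   also have "\<dots> = c <> h <> d^~" unfolding coisoD(2)[OF ab(1)] coisoD(2)[OF ab(2)]
    using one_l[OF st_in[OF H2(2)]] one_l[OF mul_in[OF h st_in[OF H2(2)]]] by simp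
   finally show ?thesis .
  qed
  have xy: "a <> g <> b^~ : N" "a <> g' <> b^~ : N" using N 1 by blast+
  have t: "tg ?p = A0" "sr ?q = A0" using sr_tg pq 1 A0 by blast+
  have t2: "sr (a <> g <> b^~) = A0" "tg (a <> g <> b^~) = A0" "sr (a <> g' <> b^~) = A0" "tg (a <> g' <> b^~) = A0"
   using sr_tg NH(1)[OF xy(1)] NH(1)[OF xy(2)] A0 by blast+
  have pqc: "Some ?p : S1 (Ir r)" "Some ?q : S1 (Ir r)" unfolding S1_def using carrier_Ir pq rpq 1 A0 by blast+
  have stD: "s : carrier (Ir r)" "t : carrier (Ir r)" using 1 r carrier_Ir by auto
  have e: "rmul1 (Ir r) (lmul1 (Ir r) (Some ?p) (a <> g <> b^~)) (Some ?q) = s"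
   "rmul1 (Ir r) (lmul1 (Ir r) (Some ?p) (a <> g' <> b^~)) (Some ?q) = t"
   using eq[OF H2(3)] eq[OF H2(4)] 1 unfolding rmul1_def lmul1_def by simp_all
  show "(s, t) : nu (Ir r) N"
   unfolding nu_def Let_def D
   by (rule CollectI, rule exI[of _ "a <> g <> b^~"], rule exI[of _ "a <> g' <> b^~"], rule exI[of _ "Some ?p"], rule exI[of _ "Some ?q"])
    (use xy pqc e stD 1 t t2 in \<open>simp add: lcomposable_def rcomposable_def del: mul_assoc\<close>)
 qed
qed

lemma H_group_simps [simp]: "carrier (H_group Q G) = G" "x \<otimes>\<^bsub>H_group Q G\<^esub> y = x <> y"
 by (auto simp: H_group_def)

text \<open>Since \<open>b^~ <> a\<close> is an identity, sending \<open>g\<close> to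
  \<open>a <> g <> b^~\<close> is a group isomorphism from the units of \<open>Z\<close> onto
  \<open>G\<close>, under which \<open>^~\<close> corresponds to the inverse; normality is carried
  over.\<close>

lemma normal_unit_normal:
 assumes grp: "group_H_class Q G" and ab: "a : coiso (L A) Z" "b : coiso (L A) Z" "b^~ <> a = one Z"
  and G: "G = {a <> g <> b^~ | g. g : Hom Z Z & rk g = sz Z}" "monoid.one (H_group Q G) = a <> b^~"
  and N: "N \<lhd> H_group Q G" and N': "N' = {g : Hom Z Z. rk g = sz Z & a <> g <> b^~ : N}"
 shows "unit_normal Z N'" "N = {a <> g <> b^~ | g. g : N'}"
proof -
 interpret normal N "H_group Q G" by fact
 have H: "a : Hom (L A) Z" "b : Hom (L A) Z" "ob Z" using ab coisoD Hom_ob by blast+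
 show Ne: "N = {a <> g <> b^~ | g. g : N'}"
  using subset unfolding N' H_group_simps by (subst (asm) G(1)) blast
 have mm: "(a <> g <> b^~) <> (a <> h <> b^~) = a <> (g <> h) <> b^~" if "h : Hom Z Z" for g h
 proof -
  have "(a <> g <> b^~) <> (a <> h <> b^~) = a <> g <> (b^~ <> a) <> h <> b^~" by simp
  also have "\<dots> = a <> (g <> h) <> b^~" unfolding ab(3)
   using one_l[OF mul_in[OF that st_in[OF H(2)]]] by simp
  finally show ?thesis .
 qed
 have inG: "a <> g <> b^~ : G" if "g : Hom Z Z" "rk g = sz Z" for g using that by (subst G(1)) blast
 have ops: "g <> h : Hom Z Z" "rk (g <> h) = sz Z" if "g : Hom Z Z" "rk g = sz Z" "h : Hom Z Z" "rk h = sz Z" for g h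
  using that coiso_rk_mul[OF unit_coiso[of g Z Z]] by (auto simp: mul_in)
 have inv: "inv\<^bsub>H_group Q G\<^esub> (a <> g <> b^~) = a <> g^~ <> b^~" if g: "g : Hom Z Z" "rk g = sz Z" for g
 proof (rule inv_equality)
  have "g^~ <> g = one Z" using full_unit2[OF g] by simp
  thus "(a <> g^~ <> b^~) \<otimes>\<^bsub>H_group Q G\<^esub> (a <> g <> b^~) = \<one>\<^bsub>H_group Q G\<^esub>"
   unfolding H_group_simps mm[OF g(1)] G(2) using one_l[OF st_in[OF H(2)]] by simp
 qed (use inG[OF g] inG[of "g^~"] g st_in rk_st in simp_all)
 have o: "a <> one Z <> b^~ = a <> b^~" using one_l[OF st_in[OF H(2)]] by simp
 show "unit_normal Z N'" unfolding unit_normal_def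
 proof (intro conjI ballI impI)
  show "N' <= {g : Hom Z Z. rk g = sz Z}" unfolding N' by blast
  show "one Z : N'" unfolding N' using one_in rk_one H(3) subgroup.one_closed[OF subgroup_axioms] o G(2) by auto
  show "g <> h : N'" if "g : N'" "h : N'" for g h
   using that subgroup.m_closed[OF subgroup_axioms, of "a <> g <> b^~" "a <> h <> b^~"] mm[of h g] ops unfolding N' by (auto simp del: mul_assoc)
  show "g^~ : N'" if "g : N'" for g
   using that subgroup.m_inv_closed[OF subgroup_axioms, of "a <> g <> b^~"] inv[of g] unfolding N' by (auto simp: st_in)
  show "k <> g <> k^~ : N'" if g: "g : N'" and k: "k : Hom Z Z" "rk k = sz Z" for g k
  proof -
   have g': "g : Hom Z Z" "rk g = sz Z" "a <> g <> b^~ : N" using g N' by auto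
   have ks: "k^~ : Hom Z Z" "rk (k^~) = sz Z" using k st_in rk_st by auto
   have "(a <> k <> b^~) \<otimes>\<^bsub>H_group Q G\<^esub> (a <> g <> b^~) \<otimes>\<^bsub>H_group Q G\<^esub> inv\<^bsub>H_group Q G\<^esub> (a <> k <> b^~) : N"
    by (rule inv_op_closed2) (use g' inG[OF k] in simp_all)
   hence "((a <> k <> b^~) <> (a <> g <> b^~)) <> (a <> k^~ <> b^~) : N"
    unfolding inv[OF k] H_group_simps .
   hence "a <> ((k <> g) <> k^~) <> b^~ : N" unfolding mm[OF g'(1)] mm[OF ks(1)] .
   thus ?thesis unfolding N' using ops[OF k ops[OF g'(1,2) ks]] by simp
  qed
 qed
qed

lemma Rees_N_congruence:
 assumes grp: "group_H_class Q G" and G: "G <= {x : carrier Q. rk x = q + 2}"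
  and r: "enat (q + 2) <= r" and N: "N \<lhd> H_group Q G"
 shows "congruence_on (Ir r) (Rees_N (Ir r) (carrier (Ir (enat q))) N)"
proof -
 obtain A Z a b where A: "A : C" and ab: "a : coiso (L A) Z" "b : coiso (L A) Z" "b^~ <> a = one Z"
  and Ge: "G = {a <> g <> b^~ | g. g : Hom Z Z & rk g = sz Z}" "monoid.one (H_group Q G) = a <> b^~"
  using group_H_form[OF grp] by blast
 let ?N' = "{g : Hom Z Z. rk g = sz Z & a <> g <> b^~ : N}"
 note U = normal_unit_normal[OF grp ab Ge N refl]
 have H: "a : Hom (L A) Z" "b : Hom (L A) Z" "ob Z" using ab coisoD Hom_ob by blast+
 have "one Z : ?N'" using U(1) unfolding unit_normal_def by blast
 hence "a <> one Z <> b^~ : G" by (subst Ge(1)) blast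
 hence "a <> b^~ : G" using one_l[OF st_in[OF H(2)]] by simp
 hence Z: "sz Z = q + 2" using G coiso_rk_mul2[OF ab(2) H(1)] coiso_rk[OF ab(1)] by auto
 show ?thesis
  unfolding Rees_N_def nu_eq_nuZ[OF A ab r[folded Z] U]
  by (rule Rees_nuZ_congruence[OF U(1) H(3) Z r])
qed

section \<open>The classification of the congruences\<close>

lemma conj_transport:
 assumes ab: "a : coiso X Z" "b : coiso Y Z" "c : coiso X' Z" "d : coiso Y' Z" and h: "h : Hom Z Z"
 shows "(c <> a^~) <> (a <> h <> b^~) <> (b <> d^~) = c <> h <> d^~" "rk (c <> a^~) = sz Z" "c <> a^~ : Hom X' X"
proof -
 have H: "a : Hom X Z" "b : Hom Y Z" "c : Hom X' Z" "d : Hom Y' Z" using ab coisoD by auto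
 have "(c <> a^~) <> (a <> h <> b^~) <> (b <> d^~) = c <> (a^~ <> a) <> h <> (b^~ <> b) <> d^~" by simp
 also have "\<dots> = c <> h <> d^~" unfolding coisoD(2)[OF ab(1)] coisoD(2)[OF ab(2)]
  using one_l[OF st_in[OF H(4)]] one_l[OF mul_in[OF h st_in[OF H(4)]]] by simp
 finally show "(c <> a^~) <> (a <> h <> b^~) <> (b <> d^~) = c <> h <> d^~" .
 show "rk (c <> a^~) = sz Z" using coiso_rk_mul2[OF ab(1) H(3)] coiso_rk[OF ab(3)] by simp
 show "c <> a^~ : Hom X' X" using H by blast
qed

text \<open>Above rank one the least odd rank \<open>p\<close> that does not collapse completely
  governs the congruence: everything below it is identified, and above rank \<open>p - 2\<close> the
  only nontrivial pairs are H-related and of rank exactly \<open>p\<close>. What remains is the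
  class of the identity in the chosen group.\<close>

lemma congruence_cases:
 assumes r3: "enat 3 <= r" and cong: "congruence_on (Ir r) sg"
  and G: "!!q. odd q ==> enat (q + 2) <= r ==> group_H_class Q (G (q + 2)) & G (q + 2) <= {x : carrier Q. rk x = q + 2}"
 shows "sg : {Id_on (carrier (Ir r)), lambda_cong (Ir r) (carrier (Ir 1)),
   rho_cong (Ir r) (carrier (Ir 1)), Rees (Ir r) (carrier (Ir 1)), tnabla (Ir r)}
  \<or> (\<exists>q N. 1 <= q & odd q & enat (q + 2) <= r & N \<lhd> H_group Q (G (q + 2)) &
     sg = Rees_N (Ir r) (carrier (Ir (enat q))) N)"
proof -
 interpret S: hook_cong ob Hom mul st one rk sz hk pt C L sr tg r sg
  by (intro hook_cong.intro hook_cong_axioms.intro hook_subcat_axioms cong r3)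
 show ?thesis
 proof (cases "\<forall>x y. (x, y) : sg --> x ~= y --> rk x = 1 & rk y = 1")
  case True
  thus ?thesis using S.low_cases by blast
 next
  case False
  have big: "S.fullto (rk x - 2) &
    (\<not> (x <> x^~ = y <> y^~ & x^~ <> x = y^~ <> y) --> S.fullto (rk x))"
   if xy: "(x, y) : sg" "x ~= y" "rk y <= rk x" "rk x >= 3" for x y
  proof (cases "x <> x^~ = y <> y^~ & x^~ <> x = y^~ <> y")
   case True
   thus ?thesis using S.group_fullto xy by blast
  next
   case False
   hence "S.fullto (rk x)" using S.not_group_fullto xy by blast
   thus ?thesis using S.fullto_mono[of "rk x" "rk x - 2"] by simp
  qed
  obtain x0 y0 where x0: "(x0, y0) : sg" "x0 ~= y0" "\<not> (rk x0 = 1 & rk y0 = 1)" using False by blast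
  have odds: "odd (rk x)" "odd (rk y)" if "(x, y) : sg" for x y
   using S.rel_typed[OF that] rank_odd by (metis, metis)
  have full1: "S.fullto 1"
  proof (cases "rk y0 <= rk x0")
   case True
   moreover from this have "rk x0 >= 3" using x0(3) odds[OF x0(1)] by presburger
   ultimately have "S.fullto (rk x0 - 2)" using big x0 by blast
   thus ?thesis using S.fullto_mono \<open>rk x0 >= 3\<close> by simp
  next
   case False
   hence "rk y0 >= 3" using x0(3) odds[OF x0(1)] by presburger
   hence "S.fullto (rk y0 - 2)" using big[OF S.rel_sym[OF x0(1)]] x0 False by simp
   thus ?thesis using S.fullto_mono \<open>rk y0 >= 3\<close> by simp
  qed
  show ?thesis
  proof (cases "\<exists>q. odd q & enat q <= r & \<not> S.fullto q")
   case False
   have "sg = tnabla (Ir r)"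
   proof (rule subset_antisym)
    show "sg <= tnabla (Ir r)" using cong unfolding congruence_on_Ir by blast
    show "tnabla (Ir r) <= sg"
    proof (rule subrelI)
     fix x y assume "(x, y) : tnabla (Ir r)"
     then obtain A B where AB: "A : C" "B : C" "x : H A B" "y : H A B" "enat (rk x) <= r" "enat (rk y) <= r"
      unfolding tnabla_Ir by blast
     hence "S.fullto (max (rk x) (rk y))" using False rank_odd by (metis max_def)
     thus "(x, y) : sg" using S.fulltoD AB by (meson max.cobounded1 max.cobounded2)
    qed
   qed
   thus ?thesis by blast
  next
   case True
   \<comment> \<open>\<open>p\<close> exceeds one, since rank one collapses by \<open>full1\<close>;
     so \<open>q = p - 2\<close> is again an admissible rank.\<close>
   define p where "p = (LEAST q. odd q & enat q <= r & \<not> S.fullto q)"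
   have p: "odd p" "enat p <= r" "\<not> S.fullto p" using LeastI_ex[OF True] unfolding p_def by auto
   have pmin: "!!q. odd q ==> enat q <= r ==> q < p ==> S.fullto q" unfolding p_def using not_less_Least by blast
   have "p ~= 1" using p full1 by auto
   hence p3: "p >= 3" using p(1) by presburger
   define q where "q = p - 2"
   have q: "odd q" "1 <= q" "q + 2 = p" using p p3 unfolding q_def by auto
   have qr: "enat (q + 2) <= r" "enat q <= r" using p q by (auto intro: order_trans[of _ "enat p"])
   have qf: "S.fullto q" using pmin[OF q(1) qr(2)] q by simp
   have grp: "group_H_class Q (G (q + 2))" and Gs: "G (q + 2) <= {x : carrier Q. rk x = q + 2}"
    using G[OF q(1) qr(1)] by auto
   obtain A0 Z a b where A0: "A0 : C" and ab: "a : coiso (L A0) Z" "b : coiso (L A0) Z" "b^~ <> a = one Z"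
    and Ge: "G (q + 2) = {a <> g <> b^~ | g. g : Hom Z Z & rk g = sz Z}"
     "monoid.one (H_group Q (G (q + 2))) = a <> b^~"
    using group_H_form[OF grp] by blast
   let ?\<G> = "H_group Q (G (q + 2))" and ?e = "a <> b^~"
   interpret gr: group ?\<G> using grp unfolding group_H_class_def by blast
   have Hab: "a : Hom (L A0) Z" "b : Hom (L A0) Z" "ob Z" using ab coisoD Hom_ob by blast+
   have e: "?e : G (q + 2)" using gr.one_closed Ge(2) by simp
   hence Z: "sz Z = q + 2" using Gs coiso_rk_mul2[OF ab(2) Hab(1)] coiso_rk[OF ab(1)] by auto
   have GH: "x : H A0 A0" "enat (rk x) <= r" if "x : G (q + 2)" for x
   proof -
    show "x : H A0 A0" using that unfolding Ge(1) using Hab by blast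
    show "enat (rk x) <= r" using that Gs qr by auto
   qed
   \<comment> \<open>On a group a congruence is determined by the class of the identity, here
     \<open>?e\<close>.\<close>
   define N where "N = {x : G (q + 2). (x, ?e) : sg}"
   have mulG: "x <> y : G (q + 2)" if "x : G (q + 2)" "y : G (q + 2)" for x y
    using gr.m_closed that by simp
   have lft: "(z <> x, z <> y) : sg" "(x <> z, y <> z) : sg"
    if "(x, y) : sg" "x : G (q + 2)" "y : G (q + 2)" "z : G (q + 2)" for x y z
    using S.rel_left[OF that(1) GH(1)[OF that(2)] GH(1)[OF that(3)] GH[OF that(4)]]
     S.rel_right[OF that(1) GH(1)[OF that(2)] GH(1)[OF that(3)] GH[OF that(4)]] A0 by blast+
   have eu: "?e <> x = x" "x <> ?e = x" if "x : G (q + 2)" for x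
    using gr.l_one[of x] gr.r_one[of x] that unfolding Ge(2) by simp_all
   have N: "N \<lhd> ?\<G>"
   proof (rule gr.normal_invI)
    show "subgroup N ?\<G>"
    proof (rule gr.subgroupI)
     show "N <= carrier ?\<G>" unfolding N_def by auto
     have "?e : N" unfolding N_def using e S.rel_refl[OF A0 A0 GH[OF e]] by blast
     thus "N ~= {}" by blast
     show "inv\<^bsub>?\<G>\<^esub> x : N" if "x : N" for x
     proof -
      have x: "x : G (q + 2)" "(x, ?e) : sg" using that unfolding N_def by auto
      let ?i = "inv\<^bsub>?\<G>\<^esub> x"
      have i: "?i : G (q + 2)" using gr.inv_closed[of x] x by simp
      have "(?i <> x, ?i <> ?e) : sg" using lft(1)[OF x(2,1) e i] .
      moreover have "?i <> x = ?e" using gr.l_inv[of x] x Ge(2) by simp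
      ultimately have "(?e, ?i) : sg" using eu(2)[OF i] by simp
      thus ?thesis using i S.rel_sym unfolding N_def by blast
     qed
     show "x \<otimes>\<^bsub>?\<G>\<^esub> y : N" if "x : N" "y : N" for x y
     proof -
      have x: "x : G (q + 2)" "(x, ?e) : sg" and y: "y : G (q + 2)" "(y, ?e) : sg" using that unfolding N_def by auto
      have "(x <> y, x <> ?e) : sg" using lft(1)[OF y(2,1) e x(1)] .
      hence "(x <> y, ?e) : sg" using eu(2)[OF x(1)] x(2) S.rel_trans by simp
      thus ?thesis using mulG x y unfolding N_def by simp
     qed
    qed
    show "x \<otimes>\<^bsub>?\<G>\<^esub> h \<otimes>\<^bsub>?\<G>\<^esub> inv\<^bsub>?\<G>\<^esub> x : N" if x: "x : carrier ?\<G>" and h: "h : N" for x h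
    proof -
     have h': "h : G (q + 2)" "(h, ?e) : sg" using h unfolding N_def by auto
     have x': "x : G (q + 2)" using x by simp
     let ?i = "inv\<^bsub>?\<G>\<^esub> x"
     have i: "?i : G (q + 2)" using gr.inv_closed[of x] x by simp
     have "((x <> h) <> ?i, (x <> ?e) <> ?i) : sg"
      using lft(2)[OF lft(1)[OF h'(2,1) e x'] mulG[OF x' h'(1)] mulG[OF x' e] i] .
     moreover have "(x <> ?e) <> ?i = ?e" using eu(2)[OF x'] gr.r_inv[of x] x Ge(2) by simp
     ultimately show ?thesis using mulG[OF mulG[OF x' h'(1)] i] unfolding N_def H_group_simps by simp
    qed
   qed
   let ?N' = "{g : Hom Z Z. rk g = sz Z & a <> g <> b^~ : N}"
   note U = normal_unit_normal[OF grp ab Ge N refl]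
   have RN: "Rees_N (Ir r) (carrier (Ir (enat q))) N = Rees (Ir r) (carrier (Ir (enat q))) Un nuZ Z ?N'"
    unfolding Rees_N_def nu_eq_nuZ[OF A0 ab qr(1)[folded Z] U] ..
   have half: "(x, y) : Rees (Ir r) (carrier (Ir (enat q))) Un nuZ Z ?N'"
    if xy: "(x, y) : sg" and le: "rk y <= rk x" for x y
   proof -
    obtain A B where AB: "A : C" "B : C" "x : H A B" "y : H A B" "enat (rk x) <= r" using S.rel_typed[OF xy] by metis
    consider "x = y" | "rk x <= q" | "x ~= y" "rk x > q" by linarith
    thus ?thesis
    proof cases
     case 1
     thus ?thesis using AB Rees_Ir[OF qr(2)] carrier_Ir by blast
    next
     case 2
     thus ?thesis using AB Rees_Ir[OF qr(2)] le by (meson UnI1 order_trans)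
    next
     case 3
     have x2: "rk x >= q + 2" using 3 odds[OF xy] q by presburger
     note b' = big[OF xy 3(1) le]
     \<comment> \<open>A nontrivial pair of rank above \<open>q + 2\<close> would, by
       \<open>big\<close>, collapse rank \<open>q + 2\<close> as well, contrary to the choice of
       \<open>p\<close>.\<close>
     have "\<not> S.fullto (rk x - 2) \<or> rk x = q + 2"
     proof (rule disjCI)
      assume "rk x ~= q + 2"
      hence "q + 2 <= rk x - 2" using x2 odds[OF xy] q(1) by presburger
      thus "\<not> S.fullto (rk x - 2)" using S.fullto_mono p q by metis
     qed
     hence rx: "rk x = q + 2" using b' x2 q by simp
     hence HH: "x <> x^~ = y <> y^~" "x^~ <> x = y^~ <> y" using b' p q by auto
     obtain c d where cd: "c : coiso (L A) Z" "d : coiso (L B) Z" "x = c <> d^~"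
      using factorization[OF AB(3) Hab(3)] Z rx by auto
     have Hcd: "c : Hom (L A) Z" "d : Hom (L B) Z" using cd coisoD by auto
     let ?g = "c^~ <> y <> d"
     have g: "?g : Hom Z Z" using Hcd AB by blast
     have "c <> ?g <> d^~ = (c <> c^~) <> y <> (d <> d^~)" by simp
     also have "c <> c^~ = y <> y^~" using coiso_proj[OF cd(1,2)] HH(1) cd by simp
     also have "d <> d^~ = y^~ <> y" using coiso_proj[OF cd(2,1)] HH(2) cd by simp
     also have "(y <> y^~) <> y <> y^~ <> y = y" using regular[OF AB(4)] by simp
     finally have ye: "y = c <> ?g <> d^~" by simp
     have "rk y = rk x" using rk_proj[OF AB(3)] rk_proj[OF AB(4)] HH by simp
     hence rg: "rk ?g = sz Z"
      using ye coiso_rk_mul[OF cd(1) mul_in[OF g st_in[OF Hcd(2)]]] coiso_rk_mul2[OF cd(2) g] Z rx by metis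
     have xe: "x = c <> one Z <> d^~" using cd one_l[OF st_in[OF Hcd(2)]] by simp
     note t1 = conj_transport[OF cd(1,2) ab(1,2) one_in[OF Hab(3)]]
     note t2 = conj_transport[OF cd(1,2) ab(1,2) g]
     note t3 = conj_transport[OF ab(2,1) cd(2,1) one_in[OF Hab(3)]]
     \<comment> \<open>The pair is transported from the objects of \<open>x\<close> to that of the
       chosen group, where it reads \<open>?e\<close> and \<open>a <> ?g <> b^~\<close>.\<close>
     have "((a <> c^~) <> x, (a <> c^~) <> y) : sg"
      using S.rel_left[OF xy AB(3,4) t1(3) _ AB(1,2) A0] t1(2) Z qr by simp
     hence "(((a <> c^~) <> x) <> (d <> b^~), ((a <> c^~) <> y) <> (d <> b^~)) : sg"
      using S.rel_right[OF _ mul_in[OF t1(3) AB(3)] mul_in[OF t1(3) AB(4)] t3(3) _ A0 AB(2) A0] t3(2) Z qr by simp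
     hence "(a <> one Z <> b^~, a <> ?g <> b^~) : sg"
      using t1(1) t2(1) xe ye by simp
     hence "(a <> ?g <> b^~, ?e) : sg" using S.rel_sym one_l[OF st_in[OF Hab(2)]] by simp
     moreover have "a <> ?g <> b^~ : G (q + 2)" by (subst Ge(1)) (use g rg in blast)
     ultimately have "?g : ?N'" using g rg unfolding N_def by blast
     moreover have "one Z : ?N'" using U(1) unfolding unit_normal_def by blast
     ultimately have "(x, y) : nuZ Z ?N'" unfolding nuZ_def using xe ye cd(1,2) AB(1,2) by blast
     thus ?thesis by blast
    qed
   qed
   have "sg = Rees_N (Ir r) (carrier (Ir (enat q))) N" unfolding RN
   proof (rule subset_antisym; rule subrelI)
    fix x y assume xy: "(x, y) : sg"
    show "(x, y) : Rees (Ir r) (carrier (Ir (enat q))) Un nuZ Z ?N'"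
    proof (cases "rk y <= rk x")
     case True
     thus ?thesis using half xy by blast
    next
     case False
     hence "(y, x) : Rees (Ir r) (carrier (Ir (enat q))) Un nuZ Z ?N'" using half S.rel_sym[OF xy] by simp
     thus ?thesis using nuZ_sym[of y x] Rees_Ir[OF qr(2), of x y] Rees_Ir[OF qr(2), of y x] by blast
    qed
   next
    fix x y assume "(x, y) : Rees (Ir r) (carrier (Ir (enat q))) Un nuZ Z ?N'"
    then consider "x = y" "x : carrier (Ir r)"
     | A B where "A : C" "B : C" "x : H A B" "y : H A B" "rk x <= q" "rk y <= q"
     | "(x, y) : nuZ Z ?N'" using Rees_Ir[OF qr(2)] by blast
    thus "(x, y) : sg"
    proof cases
     case 1
     thus ?thesis using S.rel_refl carrier_Ir by blast
    next
     case 2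
     thus ?thesis using S.fulltoD[OF qf] by blast
    next
     case 3
     obtain A B c d g g' where 4: "A : C" "B : C" "c : coiso (L A) Z" "d : coiso (L B) Z"
      "g : ?N'" "g' : ?N'" "x = c <> g <> d^~" "y = c <> g' <> d^~"
      by (rule nuZ_E[OF 3 U(1)]) blast
     have gg: "g : Hom Z Z" "g' : Hom Z Z" "a <> g <> b^~ : N" "a <> g' <> b^~ : N" using 4 by auto
     note t1 = conj_transport[OF ab(1,2) 4(3,4) gg(1)]
     note t2 = conj_transport[OF ab(1,2) 4(3,4) gg(2)]
     have t4: "rk (b <> d^~) = sz Z" "b <> d^~ : H A0 B"
      using conj_transport(2,3)[OF 4(4,3) ab(2,1) one_in[OF Hab(3)]] by simp_all
     have s: "(a <> g <> b^~, a <> g' <> b^~) : sg" using gg S.rel_sym S.rel_trans unfolding N_def by blast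
     have Hs: "a <> g <> b^~ : H A0 A0" "a <> g' <> b^~ : H A0 A0" using Hab gg by blast+
     have "((c <> a^~) <> (a <> g <> b^~), (c <> a^~) <> (a <> g' <> b^~)) : sg"
      using S.rel_left[OF s Hs t1(3) _ A0 A0 4(1)] t1(2) Z qr by simp
     hence "(((c <> a^~) <> (a <> g <> b^~)) <> (b <> d^~), ((c <> a^~) <> (a <> g' <> b^~)) <> (b <> d^~)) : sg"
      by (rule S.rel_right[OF _ mul_in[OF t1(3) Hs(1)] mul_in[OF t1(3) Hs(2)] t4(2) _ 4(1) A0 4(2)])
       (use t4 Z qr in simp)
     thus ?thesis using t1(1) t2(1) 4(7,8) by simp
    qed
   qed
   thus ?thesis using q qr N by blast
  qed
 qed
qed

theorem Cong_Ir:
 assumes r3: "enat 3 <= r" and rodd: "r = \<infinity> \<or> (\<exists>n. r = enat n & odd n)"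
  and G: "!!q. odd q ==> enat (q + 2) <= r ==> group_H_class Q (G (q + 2)) & G (q + 2) <= {x : carrier Q. rk x = q + 2}"
 shows "Cong (Ir r) = {Id_on (carrier (Ir r)), lambda_cong (Ir r) (carrier (Ir 1)),
   rho_cong (Ir r) (carrier (Ir 1)), Rees (Ir r) (carrier (Ir 1))}
  Un {Rees_N (Ir r) (carrier (Ir (enat q))) N | q N.
     1 <= q & enat q < r & odd q & N \<lhd> H_group Q (G (q + 2))} Un {tnabla (Ir r)}" (is "_ = ?F Un ?N Un _")
proof -
 \<comment> \<open>Both \<open>q\<close> and a finite \<open>r\<close> are odd, so a strict
   inequality leaves room for \<open>q + 2\<close>.\<close>
 have q2: "enat q < r \<longleftrightarrow> enat (q + 2) <= r" if "odd q" for q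
 proof (cases r)
  case (enat n)
  hence "odd n" using rodd by auto
  hence "q < n \<longleftrightarrow> q + 2 <= n" using that by presburger
  thus ?thesis using enat by simp
 qed simp
 have r1: "enat 1 <= r" using r3 by (meson enat_ord_simps(1) one_le_numeral order_trans)
 show ?thesis
 proof (rule Set.set_eqI)
  fix sg
  have 1: "sg : Cong (Ir r)" if "sg : ?F"
   using that Id_congruence lambda_congruence[OF r1] rho_congruence[OF r1] Rees_congruence[OF r1]
   unfolding Cong_def by (auto simp: one_enat_def)
  have 2: "sg : Cong (Ir r)" if "sg : ?N"
   using that Rees_N_congruence G q2 unfolding Cong_def by blast
  have 3: "tnabla (Ir r) : Cong (Ir r)" using tnabla_congruence unfolding Cong_def by blast
  have 4: "sg : ?F Un ?N Un {tnabla (Ir r)}" if "sg : Cong (Ir r)"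
  proof -
   have c: "congruence_on (Ir r) sg" using that unfolding Cong_def by simp
   from congruence_cases[OF r3 c G] show ?thesis
   proof
    assume "\<exists>q N. 1 <= q & odd q & enat (q + 2) <= r & N \<lhd> H_group Q (G (q + 2)) &
     sg = Rees_N (Ir r) (carrier (Ir (enat q))) N"
    then obtain q N where "1 <= q" "odd q" "enat (q + 2) <= r" "N \<lhd> H_group Q (G (q + 2))"
     "sg = Rees_N (Ir r) (carrier (Ir (enat q))) N" by blast
    moreover from this have "enat q < r" using q2 by blast
    ultimately have "sg : ?N" by blast
    thus ?thesis by blast
   qed auto
  qed
  show "sg : Cong (Ir r) \<longleftrightarrow> sg : ?F Un ?N Un {tnabla (Ir r)}"
  proof
   assume "sg : ?F Un ?N Un {tnabla (Ir r)}"
   then consider "sg : ?F" | "sg : ?N" | "sg = tnabla (Ir r)" by (elim UnE singletonE)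
   thus "sg : Cong (Ir r)"
    by cases (rule 1, assumption, rule 2, assumption, simp only: 3)
  qed (rule 4)
 qed
qed

end

section \<open>Composition of Brauer partitions\<close>

lemma trancl_image:
 assumes "(x, y) : R\<^sup>+" and "!!a b. (a, b) : R ==> (f a, f b) : S"
 shows "(f x, f y) : S\<^sup>+"
 using assms(1) by (induction rule: trancl_induct) (auto intro: assms(2) trancl_into_trancl)

lemma trancl_image_iff:
 assumes "inj e"
 shows "(e x, e y) : {(e a, e b) | a b. (a, b) : R}\<^sup>+ \<longleftrightarrow> (x, y) : R\<^sup>+"
proof
 assume "(e x, e y) : {(e a, e b) | a b. (a, b) : R}\<^sup>+"
 hence "(the_inv e (e x), the_inv e (e y)) : R\<^sup>+"
  by (rule trancl_image) (use assms in \<open>auto simp: the_inv_f_f\<close>)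
 thus "(x, y) : R\<^sup>+" using assms by (simp add: the_inv_f_f)
next
 assume "(x, y) : R\<^sup>+"
 thus "(e x, e y) : {(e a, e b) | a b. (a, b) : R}\<^sup>+"
  by (rule trancl_image) blast
qed

text \<open>A path in \<open>R Un S\<close> can leave \<open>W\<close> only through \<open>P\<close> and along \<open>R\<close>-steps.\<close>

lemma trancl_glue:
 assumes P: "Field R Int Field S <= P" and W: "W = P Un Field S"
  and E: "E = R\<^sup>+ Int P \<times> P"
  and uv: "u : W" "v : W" "u : Field R --> u : Field S \<or> u : P"
 shows "(u, v) : (R Un S)\<^sup>+ \<longleftrightarrow> (u, v) : (E Un S)\<^sup>+"
proof
 have RP: "x : W ==> x : Field R ==> x : P" for x using P W by blast
 define I where "I w \<longleftrightarrow> (if w : W then (u, w) : (E Un S)\<^sup>+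
   else EX p:P. (u, p) : (E Un S)\<^sup>* & (p, w) : R\<^sup>+)" for w
 have stepI: "I w" if uv: "(u, v) : (E Un S)\<^sup>*" "v : W" and vw: "(v, w) : R Un S" for v w
 proof (cases "(v, w) : S")
  case True
  hence "w : W" "(u, w) : (E Un S)\<^sup>+" using W uv by (auto simp: Field_def intro: rtrancl_into_trancl1)
  thus ?thesis unfolding I_def by simp
 next
  case False
  hence R: "(v, w) : R" using vw by blast
  hence vP: "v : P" using RP uv by (auto simp: Field_def)
  show ?thesis
  proof (cases "w : W")
   case True
   hence "w : P" using RP R by (auto simp: Field_def)
   hence "(v, w) : E" using E R vP by blast
   thus ?thesis using True uv unfolding I_def by (simp add: rtrancl_into_trancl1)
  next
   case False
   thus ?thesis unfolding I_def using vP uv R by auto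
  qed
 qed
 assume "(u, v) : (R Un S)\<^sup>+"
 hence "I v"
 proof (induction rule: trancl_induct)
  case (base w)
  thus ?case using stepI[of u w] uv by blast
 next
  case (step v w)
  show ?case
  proof (cases "v : W")
   case True
   thus ?thesis using step.IH step.hyps stepI[of v w]
    unfolding I_def by (auto simp: trancl_into_rtrancl)
  next
   case False
   then obtain p where p: "p : P" "(u, p) : (E Un S)\<^sup>*" "(p, v) : R\<^sup>+" using step.IH unfolding I_def by auto
   have "v ~: Field S" using False W by blast
   hence "(v, w) : R" using step.hyps by (auto simp: Field_def)
   hence pw: "(p, w) : R\<^sup>+" and wF: "w : Field R" using p by (auto simp: Field_def)
   show ?thesis
   proof (cases "w : W")
    case True
    hence "(p, w) : E" using RP wF pw p E by blast
    thus ?thesis unfolding I_def using True p by (simp add: rtrancl_into_trancl1)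
   next
    case False
    thus ?thesis unfolding I_def using p pw by auto
   qed
  qed
 qed
 thus "(u, v) : (E Un S)\<^sup>+" using uv unfolding I_def by simp
next
 assume "(u, v) : (E Un S)\<^sup>+"
 thus "(u, v) : (R Un S)\<^sup>+"
 proof (induction rule: trancl_induct)
  case (base w)
  thus ?case using E trancl_mono[of _ R "R Un S"] by blast
 next
  case (step v w)
  have "(v, w) : (R Un S)\<^sup>+" using step.hyps E trancl_mono[of _ R "R Un S"] by blast
  thus ?case using step.IH by (rule trancl_trans[rotated])
 qed
qed

section \<open>Layered diagrams, associativity and the involution\<close>

abbreviation cmp :: "'a brauer => 'a brauer => 'a brauer" where
 "cmp == brauer_comp"

text \<open>Numbered layers instead of the three constructors of \<open>layer\<close>: a product of
  three partitions needs four layers, and an inner product must be placed on any two of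
  them.\<close>

definition lev :: "nat => nat => 'a + 'a => nat \<times> 'a" where
 "lev i j = case_sum (Pair i) (Pair j)"

definition lay :: "nat => nat => 'a brauer => (nat \<times> 'a) rel" where
 "lay i j al = {(lev i j u, lev i j v) | u v. (u, v) : block_rel al}"

lemma lev_simps [simp]: "lev i j (Inl a) = (i, a)" "lev i j (Inr a) = (j, a)"
 by (auto simp: lev_def)

lemma block_rel_image: "block_rel ((`) h ` al) = {(h u, h v) | u v. (u, v) : block_rel al}"
 unfolding block_rel_def by blast

lemma sym_block_rel: "sym (block_rel al)"
 unfolding block_rel_def sym_def by blast

definition comp_rel :: "'a brauer => 'a brauer => 'a layer rel" where
 "comp_rel al be = (block_rel ((`) (case_sum Upper_pt Middle_pt) ` al)
       Un block_rel ((`) (case_sum Middle_pt Lower_pt) ` be))\<^sup>+"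

definition outer_pt :: "'a + 'a => 'a layer" where
 "outer_pt = case_sum Upper_pt Lower_pt"

lemma outer_pt_simps [simp]: "outer_pt (Inl a) = Upper_pt a" "outer_pt (Inr a) = Lower_pt a"
 by (auto simp: outer_pt_def)

lemma brauer_comp_alt:
 "cmp al be = (bdom al <+> bran be) //
  {(u, v) : (bdom al <+> bran be) \<times> (bdom al <+> bran be). (outer_pt u, outer_pt v) : comp_rel al be}"
 unfolding brauer_comp_def Let_def comp_rel_def outer_pt_def ..

lemma sym_comp_rel: "sym (comp_rel al be)"
 unfolding comp_rel_def by (intro sym_trancl sym_Un sym_block_rel)

lemma trans_comp_rel: "trans (comp_rel al be)"
 unfolding comp_rel_def by simp

lemma comp_rel_edge1: "K : al ==> u : K ==> v : K ==>
  (case_sum Upper_pt Middle_pt u, case_sum Upper_pt Middle_pt v) : comp_rel al be"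
 unfolding comp_rel_def by (rule r_into_trancl) (auto simp: block_rel_def)

lemma comp_rel_edge2: "K : be ==> u : K ==> v : K ==>
  (case_sum Middle_pt Lower_pt u, case_sum Middle_pt Lower_pt v) : comp_rel al be"
 unfolding comp_rel_def by (rule r_into_trancl) (auto simp: block_rel_def)

lemma equiv_brauer_comp: "equiv (bdom al <+> bran be)
  {(u, v) : (bdom al <+> bran be) \<times> (bdom al <+> bran be). (outer_pt u, outer_pt v) : comp_rel al be}"
proof (rule equivI)
 have "(outer_pt u, outer_pt u) : comp_rel al be" if uZ: "u : bdom al <+> bran be" for u
 proof (cases u)
  case (Inl a)
  then obtain K where "K : al" "Inl a : K" using uZ unfolding bdom_def by auto
  thus ?thesis using comp_rel_edge1[of K al "Inl a" "Inl a" be] Inl by simp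
 next
  case (Inr a)
  then obtain K where "K : be" "Inr a : K" using uZ unfolding bran_def by auto
  thus ?thesis using comp_rel_edge2[of K be "Inr a" "Inr a" al] Inr by simp
 qed
 thus "refl_on (bdom al <+> bran be) {(u, v) : (bdom al <+> bran be) \<times> (bdom al <+> bran be). (outer_pt u, outer_pt v) : comp_rel al be}"
  unfolding refl_on_def by blast
 show "sym {(u, v) : (bdom al <+> bran be) \<times> (bdom al <+> bran be). (outer_pt u, outer_pt v) : comp_rel al be}"
  using sym_comp_rel[of al be] unfolding sym_def by blast
 show "trans {(u, v) : (bdom al <+> bran be) \<times> (bdom al <+> bran be). (outer_pt u, outer_pt v) : comp_rel al be}"
  using trans_comp_rel[of al be] unfolding trans_def by blast
qed blast

lemma partition_brauer_comp: "partition_on (bdom al <+> bran be) (cmp al be)"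
 unfolding brauer_comp_alt by (rule partition_on_quotient[OF equiv_brauer_comp])

lemma bdom_bran_partition: "partition_on (A <+> B) al ==> bdom al = A & bran al = B"
 unfolding partition_on_def bdom_def bran_def by auto

lemma bdom_comp [simp]: "bdom (cmp al be) = bdom al" and bran_comp [simp]: "bran (cmp al be) = bran be"
 using bdom_bran_partition[OF partition_brauer_comp[of al be]] by simp_all

lemma block_rel_quotient:
 assumes "equiv A r" shows "block_rel (A // r) = r"
proof (rule subset_antisym; rule subrelI)
 fix u v assume "(u, v) : block_rel (A // r)"
 thus "(u, v) : r" unfolding block_rel_def using assms quotient_eq_iff[OF assms] by blast
next
 fix u v assume uv: "(u, v) : r"
 hence "u : A" "u : r `` {u}" "v : r `` {u}"
  using equiv_class_self[OF assms] equiv_type[OF assms] by auto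
 thus "(u, v) : block_rel (A // r)" unfolding block_rel_def using quotientI[of u A r] by blast
qed

lemma block_rel_comp: "(u, v) : block_rel (cmp al be) \<longleftrightarrow>
 u : bdom al <+> bran be & v : bdom al <+> bran be & (outer_pt u, outer_pt v) : comp_rel al be"
 unfolding brauer_comp_alt block_rel_quotient[OF equiv_brauer_comp] by blast

lemma partition_eqI:
 assumes "partition_on A P" "partition_on A Q" "block_rel P = block_rel Q"
 shows "P = Q"
proof -
 have "P = A // block_rel P" "Q = A // block_rel Q"
  unfolding block_rel_def
  by (rule partition_on_eq_quotient[symmetric], fact)+
 thus ?thesis using assms(3) by metis
qed

lemma comp_rel_lay:
 assumes "distinct [i, j, k]"
 shows "(outer_pt u, outer_pt v) : comp_rel al be \<longleftrightarrow> (lev i k u, lev i k v) : (lay i j al Un lay j k be)\<^sup>+"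
proof -
 define e where "e x = (case x of Upper_pt a => (i, a) | Middle_pt a => (j, a) | Lower_pt a => (k, a))" for x :: "'a layer"
 have inj: "inj e" using assms unfolding e_def inj_def by (auto split: layer.splits)
 have e1: "e (case_sum Upper_pt Middle_pt u) = lev i j u" "e (case_sum Middle_pt Lower_pt u) = lev j k u"
  "e (outer_pt u) = lev i k u" for u by (cases u; simp add: e_def)+
 have S: "{(e a, e b) | a b. (a, b) : block_rel ((`) (case_sum Upper_pt Middle_pt) ` al) Un block_rel ((`) (case_sum Middle_pt Lower_pt) ` be)}
   = lay i j al Un lay j k be"
  unfolding lay_def block_rel_image e1[symmetric] by blast
 have "(outer_pt u, outer_pt v) : comp_rel al be \<longleftrightarrow> (e (outer_pt u), e (outer_pt v)) : (lay i j al Un lay j k be)\<^sup>+"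
  unfolding comp_rel_def S[symmetric] by (rule trancl_image_iff[OF inj, symmetric])
 thus ?thesis unfolding e1 .
qed

lemma Field_lay: "Field (lay i j al) = lev i j ` (bdom al <+> bran al)"
proof -
 have "\<Union>al = bdom al <+> bran al"
 proof (rule Set.set_eqI)
  fix u show "u : \<Union>al \<longleftrightarrow> u : bdom al <+> bran al"
   by (cases u) (auto simp: bdom_def bran_def)
 qed
 moreover have "Field (lay i j al) = lev i j ` \<Union>al"
  unfolding lay_def Field_def block_rel_def by blast
 ultimately show ?thesis by simp
qed

text \<open>The edges of a product are the connections of the joined diagram between its outer
  points. This is the shape of \<open>E\<close> in \<open>trancl_glue\<close>, which can then
  replace an inner product by its factors.\<close>

lemma lay_comp:
 assumes "distinct [i, j, k]"
 shows "lay i k (cmp al be) = (lay i j al Un lay j k be)\<^sup>+ Int (lev i k ` (bdom al <+> bran be)) \<times> (lev i k ` (bdom al <+> bran be))"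
 unfolding lay_def[of i k] block_rel_comp comp_rel_lay[OF assms] by blast

lemma lev_image: "lev i j ` (A <+> B) = {i} \<times> A Un {j} \<times> B"
 by (auto simp: image_Un Plus_def image_image)

text \<open>Both bracketings express connectivity between the outer layers of one and the same
  four-layer diagram, once \<open>trancl_glue\<close> has resolved the inner product.\<close>

theorem brauer_comp_assoc: "cmp (cmp al be) \<gamma> = cmp al (cmp be \<gamma>)"
proof (rule partition_eqI)
 let ?Z = "bdom al <+> bran \<gamma>"
 show "partition_on ?Z (cmp (cmp al be) \<gamma>)" "partition_on ?Z (cmp al (cmp be \<gamma>))"
  using partition_brauer_comp[of "cmp al be" \<gamma>] partition_brauer_comp[of al "cmp be \<gamma>"] by simp_all
 have lev_in': "(lev 0 3 u : lev 0 2 ` (bdom al <+> bran be) \<or> lev 0 3 u : Field (lay 2 3 \<gamma>)) &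
  (lev 0 3 u : lev 1 3 ` (bdom be <+> bran \<gamma>) \<or> lev 0 3 u : Field (lay 0 1 al))" if "u : ?Z" for u
  using that unfolding Field_lay lev_image by (cases u) auto
 have lev_in: "lev 0 3 u : lev 0 2 ` (bdom al <+> bran be) Un Field (lay 2 3 \<gamma>)"
  "lev 0 3 u : lev 1 3 ` (bdom be <+> bran \<gamma>) Un Field (lay 0 1 al)"
  "lev 0 3 u : lev 0 2 ` (bdom al <+> bran be) \<or> lev 0 3 u : Field (lay 2 3 \<gamma>)"
  "lev 0 3 u : lev 1 3 ` (bdom be <+> bran \<gamma>) \<or> lev 0 3 u : Field (lay 0 1 al)" if "u : ?Z" for u
  using lev_in'[OF that] by blast+
 \<comment> \<open>The first two factors meet the third only in layer 2, hence in lower points of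
   \<open>be\<close>, which are outer points of the inner product; the second inclusion is the
   mirror image.\<close>
 have F: "Field (lay 0 1 al Un lay 1 2 be) Int Field (lay 2 3 \<gamma>) <= lev 0 2 ` (bdom al <+> bran be)"
  "Field (lay 1 2 be Un lay 2 3 \<gamma>) Int Field (lay 0 1 al) <= lev 1 3 ` (bdom be <+> bran \<gamma>)"
  unfolding Field_Un Field_lay lev_image by auto
 have L: "(lev 0 3 u, lev 0 3 v) : (lay 0 2 (cmp al be) Un lay 2 3 \<gamma>)\<^sup>+ \<longleftrightarrow>
   (lev 0 3 u, lev 0 3 v) : ((lay 0 1 al Un lay 1 2 be) Un lay 2 3 \<gamma>)\<^sup>+" if "u : ?Z" "v : ?Z" for u v
  by (rule trancl_glue[OF F(1) refl lay_comp, symmetric])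
   (use lev_in(1,2)[OF that(1)] lev_in(1,2)[OF that(2)] in auto)
 have R: "(lev 0 3 u, lev 0 3 v) : (lay 1 3 (cmp be \<gamma>) Un lay 0 1 al)\<^sup>+ \<longleftrightarrow>
   (lev 0 3 u, lev 0 3 v) : ((lay 1 2 be Un lay 2 3 \<gamma>) Un lay 0 1 al)\<^sup>+" if "u : ?Z" "v : ?Z" for u v
  by (rule trancl_glue[OF F(2) refl lay_comp, symmetric])
   (use lev_in(1,2)[OF that(1)] lev_in(1,2)[OF that(2)] in auto)
 show "block_rel (cmp (cmp al be) \<gamma>) = block_rel (cmp al (cmp be \<gamma>))"
 proof (rule Set.set_eqI, clarify)
  fix u v
  have "(outer_pt u, outer_pt v) : comp_rel (cmp al be) \<gamma> \<longleftrightarrow> (outer_pt u, outer_pt v) : comp_rel al (cmp be \<gamma>)"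
   if "u : ?Z" "v : ?Z"
   using L[OF that] R[OF that] comp_rel_lay[of 0 2 3 u v "cmp al be" \<gamma>] comp_rel_lay[of 0 1 3 u v al "cmp be \<gamma>"]
   by (simp add: Un_ac)
  thus "(u, v) : block_rel (cmp (cmp al be) \<gamma>) \<longleftrightarrow> (u, v) : block_rel (cmp al (cmp be \<gamma>))"
   unfolding block_rel_comp by auto
 qed
qed

definition swap_sum :: "'a + 'a => 'a + 'a" where
 "swap_sum = case_sum Inr Inl"

lemma swap_sum_simps [simp]: "swap_sum (Inl a) = Inr a" "swap_sum (Inr a) = Inl a" "swap_sum (swap_sum u) = u"
 by (auto simp: swap_sum_def split: sum.splits)

lemma inj_swap_sum: "inj swap_sum"
 by (metis injI swap_sum_simps(3))

lemma inj_on_swap_sum: "inj_on swap_sum S"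
 using inj_swap_sum inj_on_subset by blast

definition bflip :: "'a brauer => 'a brauer" where
 "bflip al = (`) swap_sum ` al"

lemma bflip_bflip [simp]: "bflip (bflip al) = al"
 by (simp add: bflip_def image_image)

lemma mem_swap_image: "u : swap_sum ` K \<longleftrightarrow> swap_sum u : K"
 by (metis image_eqI imageE swap_sum_simps(3))

lemma mem_bflip: fixes K :: "('a + 'a) set" shows "K : bflip al \<longleftrightarrow> swap_sum ` K : al"
proof -
 have s: "swap_sum ` swap_sum ` K = K" for K :: "('a + 'a) set" by (simp add: image_image)
 show ?thesis unfolding bflip_def
 proof
  assume "K : (`) swap_sum ` al"
  then obtain M where "M : al" "K = swap_sum ` M" by blast
  thus "swap_sum ` K : al" using s[of M] by simp
 next
  assume "swap_sum ` K : al"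
  thus "K : (`) swap_sum ` al" using s[of K] by (metis imageI)
 qed
qed

lemma bdom_bflip [simp]: "bdom (bflip al) = bran al" and bran_bflip [simp]: "bran (bflip al) = bdom al"
 unfolding bdom_def bran_def bflip_def by (auto simp: mem_swap_image)

lemma lay_bflip: "lay i j (bflip al) = lay j i al"
proof -
 have h: "lev i j (swap_sum u) = lev j i u" for u :: "'a + 'a" by (cases u) auto
 have "lay i j (bflip al) = {(lev i j (swap_sum a), lev i j (swap_sum b)) | a b. (a, b) : block_rel al}"
  unfolding lay_def bflip_def block_rel_image by blast
 thus ?thesis unfolding h lay_def .
qed

lemma partition_image_inj: "partition_on A P ==> inj_on f A ==> partition_on (f ` A) ((`) f ` P)"
proof -
 assume "partition_on A P" "inj_on f A"
 hence "partition_on (f ` A) ((`) f ` P - {{}})" by (rule partition_on_inj_image)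
 moreover have "{} ~: (`) f ` P" using \<open>partition_on A P\<close> unfolding partition_on_def by auto
 ultimately show ?thesis by simp
qed

lemma partition_bflip: "partition_on (A <+> B) al ==> partition_on (B <+> A) (bflip al)"
proof -
 assume "partition_on (A <+> B) al"
 hence "partition_on (swap_sum ` (A <+> B)) (bflip al)"
  unfolding bflip_def using partition_image_inj inj_on_swap_sum by blast
 moreover have "swap_sum ` (A <+> B) = B <+> A" by (force simp: mem_swap_image)
 ultimately show ?thesis by simp
qed

text \<open>With numbered layers, turning the diagram upside down only reverses the
  numbering.\<close>

theorem bflip_comp: "bflip (cmp al be) = cmp (bflip be) (bflip al)"
proof (rule partition_eqI)
 let ?Z = "bran be <+> bdom al"
 show "partition_on ?Z (bflip (cmp al be))" using partition_bflip[OF partition_brauer_comp] .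
 show "partition_on ?Z (cmp (bflip be) (bflip al))"
  using partition_brauer_comp[of "bflip be" "bflip al"] by simp
 show "block_rel (bflip (cmp al be)) = block_rel (cmp (bflip be) (bflip al))"
 proof (rule Set.set_eqI, clarify)
  fix u v
  have sw: "lev i j (swap_sum u) = lev j i u" for i j and u :: "'a + 'a" by (cases u) auto
  have "(u, v) : block_rel (bflip (cmp al be)) \<longleftrightarrow> (swap_sum u, swap_sum v) : block_rel (cmp al be)"
   unfolding bflip_def block_rel_image by (auto, metis swap_sum_simps(3))
  also have "\<dots> \<longleftrightarrow> swap_sum u : bdom al <+> bran be & swap_sum v : bdom al <+> bran be &
    (lev 2 0 u, lev 2 0 v) : (lay 0 1 al Un lay 1 2 be)\<^sup>+"
   unfolding block_rel_comp comp_rel_lay[of 0 1 2 "swap_sum u", simplified] sw by (simp add: sw)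
  also have "\<dots> \<longleftrightarrow> (u, v) : block_rel (cmp (bflip be) (bflip al))"
  proof -
   have m: "swap_sum u : bdom al <+> bran be \<longleftrightarrow> u : bran be <+> bdom al" for u by (cases u) auto
   show ?thesis
    unfolding block_rel_comp comp_rel_lay[of 2 1 0, simplified] lay_bflip m by (auto simp: Un_commute)
  qed
  finally show "(u, v) : block_rel (bflip (cmp al be)) \<longleftrightarrow> (u, v) : block_rel (cmp (bflip be) (bflip al))" .
 qed
qed

text \<open>A product is computed by exhibiting connections inside the blocks of the candidate \<open>M\<close> and
 a labelling of the three layers, constant along edges, that separates these blocks.\<close>

lemma brauer_comp_eqI:
 fixes f :: "'a layer => 'b"
 assumes M: "partition_on (bdom al <+> bran be) M"
  and conn: "!!K u v. K : M ==> u : K ==> v : K ==> (outer_pt u, outer_pt v) : comp_rel al be"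
  and f1: "!!K u v. K : al ==> u : K ==> v : K ==> f (case_sum Upper_pt Middle_pt u) = f (case_sum Upper_pt Middle_pt v)"
  and f2: "!!K u v. K : be ==> u : K ==> v : K ==> f (case_sum Middle_pt Lower_pt u) = f (case_sum Middle_pt Lower_pt v)"
  and sep: "!!u v K. K : M ==> u : K ==> v : bdom al <+> bran be ==> f (outer_pt u) = f (outer_pt v) ==> v : K"
 shows "cmp al be = M"
proof (rule partition_eqI[OF partition_brauer_comp M])
 have fe: "f x = f y" if "(x, y) : block_rel ((`) (case_sum Upper_pt Middle_pt) ` al)
   Un block_rel ((`) (case_sum Middle_pt Lower_pt) ` be)" for x y
  using that
 proof
  assume "(x, y) : block_rel ((`) (case_sum Upper_pt Middle_pt) ` al)"
  then obtain K u v where "K : al" "u : K" "v : K" "x = case_sum Upper_pt Middle_pt u" "y = case_sum Upper_pt Middle_pt v"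
   unfolding block_rel_def by blast
  thus ?thesis using f1[of K u v] by simp
 next
  assume "(x, y) : block_rel ((`) (case_sum Middle_pt Lower_pt) ` be)"
  then obtain K u v where "K : be" "u : K" "v : K" "x = case_sum Middle_pt Lower_pt u" "y = case_sum Middle_pt Lower_pt v"
   unfolding block_rel_def by blast
  thus ?thesis using f2[of K u v] by simp
 qed
 have fc: "f x = f y" if "(x, y) : comp_rel al be" for x y
  using that unfolding comp_rel_def
 proof (induction rule: trancl_induct)
  case (base y)
  thus ?case using fe by blast
 next
  case (step y z)
  thus ?case using fe[of y z] by simp
 qed
 have Mu: "\<Union>M = bdom al <+> bran be" using M unfolding partition_on_def by simp
 show "block_rel (cmp al be) = block_rel M"
 proof (rule Set.set_eqI, clarify)
  fix u v
  show "(u, v) : block_rel (cmp al be) \<longleftrightarrow> (u, v) : block_rel M"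
  proof
   assume "(u, v) : block_rel (cmp al be)"
   hence uv: "u : bdom al <+> bran be" "v : bdom al <+> bran be" "(outer_pt u, outer_pt v) : comp_rel al be"
    unfolding block_rel_comp by auto
   hence "u : \<Union>M" unfolding Mu by simp
   then obtain K where "K : M" "u : K" by (rule UnionE)
   thus "(u, v) : block_rel M" using sep[of K u v] fc[OF uv(3)] uv unfolding block_rel_def by blast
  next
   assume "(u, v) : block_rel M"
   then obtain K where "K : M" "u : K" "v : K" unfolding block_rel_def by blast
   thus "(u, v) : block_rel (cmp al be)" unfolding block_rel_comp using conn Mu by blast
  qed
 qed
qed

text \<open>No edge of \<open>be\<close> reaches the upper layer, so a block inside the upper layer
  is a whole connected component of the joined diagram.\<close>

lemma comp_cup_persist:
 assumes al: "partition_on (A <+> B) al" and K: "K : al" "K <= range Inl"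
 shows "K : cmp al be"
proof -
 let ?E = "{(u, v) : (bdom al <+> bran be) \<times> (bdom al <+> bran be). (outer_pt u, outer_pt v) : comp_rel al be}"
 have ne: "K ~= {}" using al K unfolding partition_on_def by auto
 then obtain a where a: "Inl a : K" using K by blast
 have uniq: "L : al ==> u : L ==> u : K ==> L = K" for L u
  using al K unfolding partition_on_def disjoint_def by blast
 let ?h = "case_sum Upper_pt Middle_pt"
 have inj: "?h u = ?h v ==> u = v" for u v :: "'a + 'a" by (cases u; cases v) auto
 have edge: "y : ?h ` K"
  if xy: "(x, y) : block_rel ((`) ?h ` al) Un block_rel ((`) (case_sum Middle_pt Lower_pt) ` be)"
   and x: "x : ?h ` K" for x y
 proof -
  obtain w where w: "w : K" "x = ?h w" "x = Upper_pt (projl w)" using x K(2) by force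
  from xy show ?thesis
  proof
   assume "(x, y) : block_rel ((`) ?h ` al)"
   then obtain L u v where "L : al" "u : L" "v : L" "x = ?h u" "y = ?h v" unfolding block_rel_def by blast
   moreover from this have "u = w" using inj w by simp
   ultimately show ?thesis using uniq w by blast
  next
   assume "(x, y) : block_rel ((`) (case_sum Middle_pt Lower_pt) ` be)"
   then obtain u where "x = case_sum Middle_pt Lower_pt u" unfolding block_rel_def by blast
   thus ?thesis using w(3) by (cases u) auto
  qed
 qed
 have cl: "y : ?h ` K" if "(x, y) : comp_rel al be" "x : ?h ` K" for x y
  using that unfolding comp_rel_def
 proof (induction rule: trancl_induct)
  case (base y)
  thus ?case using edge by blast
 next
  case (step y z)
  thus ?case using edge by blast
 qed
 have aZ: "Inl a : bdom al <+> bran be" using a K unfolding bdom_def by auto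
 have "?E `` {Inl a} = K"
 proof (rule subset_antisym; rule subsetI)
  fix v assume "v : ?E `` {Inl a}"
  hence "(Upper_pt a, outer_pt v) : comp_rel al be" by auto
  hence "outer_pt v : ?h ` K" using cl a by force
  thus "v : K" using K(2) by (cases v) (auto split: sum.splits)
 next
  fix v assume v: "v : K"
  then obtain b where b: "v = Inl b" using K by blast
  hence "v : bdom al <+> bran be" using v K unfolding bdom_def by auto
  moreover have "(outer_pt (Inl a), outer_pt v) : comp_rel al be"
   using comp_rel_edge1[OF K(1) a v] b by simp
  ultimately show "v : ?E `` {Inl a}" using aZ by blast
 qed
 thus ?thesis unfolding brauer_comp_alt using quotientI[OF aZ, of ?E] by simp
qed

section \<open>Products with bijections and hooks\<close>

definition bd :: "('a => 'a) => 'a set => 'a brauer" where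
 "bd f X = {{Inl c, Inr (f c)} | c. c : X}"

definition hook :: "'a set => 'a => 'a => 'a brauer" where
 "hook W a b = insert {Inl a, Inl b} (bd id W)"

text \<open>Only upper points are renamed; this is the effect of multiplying by a bijection on the
  left.\<close>

definition relabel :: "('a => 'a) => 'a brauer => 'a brauer" where
 "relabel g x = (`) (map_sum g id) ` x"

lemma hook_commute: "hook W a b = hook W b a"
 by (simp add: hook_def insert_commute)

lemma brauerD: "x : brauer A B ==> partition_on (A <+> B) x"
 and brauer_card: "x : brauer A B ==> K : x ==> card K = 2"
 by (auto simp: brauer_def)

lemma brauer_block: "x : brauer A B ==> K : x ==> \<exists>p q. p ~= q & K = {p, q}"
 using brauer_card card_2_iff by metis

lemma brauer_dom: "x : brauer A B ==> bdom x = A" "x : brauer A B ==> bran x = B"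
 using bdom_bran_partition brauerD by blast+

lemma brauer_unique: "x : brauer A B ==> K : x ==> L : x ==> u : K ==> u : L ==> K = L"
 unfolding brauer_def partition_on_def disjoint_def by blast

lemma brauer_cover: "x : brauer A B ==> a : A ==> EX K:x. Inl a : K" "x : brauer A B ==> b : B ==> EX K:x. Inr b : K"
 unfolding brauer_def partition_on_def by blast+

lemma brauer_sub: "x : brauer A B ==> K : x ==> Inl a : K ==> a : A" "x : brauer A B ==> K : x ==> Inr a : K ==> a : B"
 unfolding brauer_def partition_on_def by blast+

lemma bflip_brauer: "x : brauer A B ==> bflip x : brauer B A"
proof -
 assume x: "x : brauer A B"
 have "card K = 2" if "K : bflip x" for K
 proof -
  have "card (swap_sum ` K) = 2" using that x brauer_card mem_bflip by blast
  thus ?thesis using card_image[OF inj_on_swap_sum] by metis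
 qed
 thus ?thesis using x partition_bflip unfolding brauer_def by blast
qed

lemma bd_brauer: "inj_on f X ==> bd f X : brauer X (f ` X)"
 unfolding brauer_def partition_on_def disjoint_def bd_def
 by (auto simp: inj_on_eq_iff)

lemma insert_cup_brauer:
 assumes M: "M : brauer W Y" and ab: "a ~: W" "b ~: W" "a ~= b"
 shows "insert {Inl a, Inl b} M : brauer (insert a (insert b W)) Y"
proof -
 have "disjnt {Inl a, Inl b} (W <+> Y)" using ab by (auto simp: disjnt_def)
 hence "partition_on ({Inl a, Inl b} Un (W <+> Y)) (insert {Inl a, Inl b} M)"
  using partition_on_insert[of "{Inl a, Inl b}" M] brauerD[OF M] unfolding partition_on_def disjoint_def disjnt_def by auto
 moreover have "{Inl a, Inl b} Un (W <+> Y) = insert a (insert b W) <+> Y" by auto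
 ultimately show ?thesis using M ab unfolding brauer_def by auto
qed

lemma hook_brauer: "a ~: W ==> b ~: W ==> a ~= b ==> hook W a b : brauer (insert a (insert b W)) W"
 unfolding hook_def using insert_cup_brauer[OF bd_brauer[of id W]] by simp

lemma bd_image: "bd f X = (%c. {Inl c, Inr (f c)}) ` X"
 unfolding bd_def by auto

lemma bflip_bd: "inj_on f X ==> bflip (bd f X) = bd (the_inv_into X f) (f ` X)"
proof -
 assume f: "inj_on f X"
 have "bflip (bd f X) = (%c. {Inl (f c), Inr c}) ` X"
  unfolding bflip_def bd_image image_image by (simp add: insert_commute)
 also have "\<dots> = bd (the_inv_into X f) (f ` X)"
  unfolding bd_image image_image by (rule image_cong) (simp_all add: the_inv_into_f_f[OF f])
 finally show ?thesis .
qed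

lemma bflip_bd_id [simp]: "bflip (bd id X) = bd id X"
 unfolding bflip_def bd_image image_image by (simp add: insert_commute)

lemma bd_cong: "(!!x. x : X ==> f x = g x) ==> bd f X = bd g X"
 unfolding bd_def by auto

lemma bflip_insert: "bflip (insert K x) = insert (swap_sum ` K) (bflip x)"
 by (simp add: bflip_def)

lemma bflip_hook: "bflip (hook W a b) = insert {Inr a, Inr b} (bd id W)"
 unfolding hook_def bflip_insert by simp

lemma comp_pairI: "K = {p, q} ==> (outer_pt p, outer_pt q) : R ==> \<exists>p q. K = {p, q} & (outer_pt p, outer_pt q) : R"
 by blast

text \<open>Blocks have two elements, so one connection per block suffices; symmetry and
  transitivity supply the rest.\<close>

lemma comp_eqI2:
 fixes f :: "'a layer => 'b"
 assumes al: "al : brauer A B" and be: "be : brauer B D" and M: "M : brauer A D"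
  and conn: "!!K. K : M ==> \<exists>p q. K = {p, q} & (outer_pt p, outer_pt q) : comp_rel al be"
  and f1: "!!K u v. K : al ==> u : K ==> v : K ==> f (case_sum Upper_pt Middle_pt u) = f (case_sum Upper_pt Middle_pt v)"
  and f2: "!!K u v. K : be ==> u : K ==> v : K ==> f (case_sum Middle_pt Lower_pt u) = f (case_sum Middle_pt Lower_pt v)"
  and sep: "!!u v K. K : M ==> u : K ==> v : A <+> D ==> f (outer_pt u) = f (outer_pt v) ==> v : K"
 shows "cmp al be = M"
proof (rule brauer_comp_eqI[where f = f])
 have d: "bdom al = A" "bran be = D" using brauer_dom al be by blast+
 show "partition_on (bdom al <+> bran be) M" unfolding d using brauerD[OF M] .
 show "(outer_pt u, outer_pt v) : comp_rel al be" if K: "K : M" "u : K" "v : K" for K u v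
 proof -
  obtain p q where pq: "K = {p, q}" "(outer_pt p, outer_pt q) : comp_rel al be" using conn K(1) by blast
  hence qp: "(outer_pt q, outer_pt p) : comp_rel al be" using sym_comp_rel symD by metis
  have "(outer_pt p, outer_pt p) : comp_rel al be" "(outer_pt q, outer_pt q) : comp_rel al be"
   using pq(2) qp trans_comp_rel transD by metis+
  thus ?thesis using K pq qp by blast
 qed
 show "v : K" if "K : M" "u : K" "v : bdom al <+> bran be" "f (outer_pt u) = f (outer_pt v)" for u v K
  using sep that unfolding d by blast
qed (use f1 f2 in blast)+

lemma comp_rel_trans: "(x, y) : comp_rel al be ==> (y, z) : comp_rel al be ==> (x, z) : comp_rel al be"
 using trans_comp_rel transD by metis

lemma comp_rel_sym: "(x, y) : comp_rel al be ==> (y, x) : comp_rel al be"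
 using sym_comp_rel symD by metis

definition blk :: "'v set set => 'v => 'v set" where
 "blk x u = {v. (u, v) : block_rel x}"

lemma blk_eq: "partition_on A x ==> K : x ==> u : K ==> blk x u = K"
 unfolding blk_def block_rel_def partition_on_def disjoint_def by blast

text \<open>The left factor consists of upper cups \<open>N\<close> and the transversals \<open>c \<mapsto> f c\<close>.\<close>

lemma relabel_brauer:
 assumes f: "inj_on f W" and x: "x : brauer (f ` W) Y"
 shows "relabel (the_inv_into W f) x : brauer W Y"
proof -
 let ?g = "map_sum (the_inv_into W f) id"
 have inj: "inj_on ?g (f ` W <+> Y)"
  unfolding inj_on_def using the_inv_into_f_f[OF f] by (auto simp: Plus_def)
 have im: "?g ` (f ` W <+> Y) = W <+> Y" using the_inv_into_f_f[OF f] by (force simp: Plus_def image_Un image_image)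
 have "partition_on (W <+> Y) (relabel (the_inv_into W f) x)"
  using partition_image_inj[OF brauerD[OF x] inj] unfolding im relabel_def .
 moreover have "card K = 2" if K: "K : relabel (the_inv_into W f) x" for K
 proof -
  obtain L where L: "L : x" "K = ?g ` L" using K unfolding relabel_def by blast
  have "L <= f ` W <+> Y" using L brauerD[OF x] unfolding partition_on_def by blast
  thus ?thesis using L brauer_card[OF x L(1)] card_image[OF inj_on_subset[OF inj]] by auto
 qed
 ultimately show ?thesis unfolding brauer_def by blast
qed

text \<open>The left factor has no lower cups, so each middle point \<open>f c\<close> is tied
  directly to the upper point \<open>c\<close>: the cups stay, and \<open>x\<close> is read through
  \<open>f\<close>. Products with hooks and with bijections are both instances.\<close>

lemma comp_cups_bd:
 assumes N: "partition_on (Inl ` U) N" "!!K. K : N ==> \<exists>p q. p ~= q & K = {p, q}" and UW: "U Int W = {}"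
  and f: "inj_on f W" and x: "x : brauer (f ` W) Y"
 shows "cmp (N Un bd f W) x = N Un relabel (the_inv_into W f) x"
  and "N Un relabel (the_inv_into W f) x : brauer (U Un W) Y" and "N Un bd f W : brauer (U Un W) (f ` W)"
proof -
 let ?g = "the_inv_into W f"
 note gf = the_inv_into_f_f[OF f]
 have un: "N Un M : brauer (U Un W) Y'" if M: "M : brauer W Y'" for M Y'
 proof -
  have "\<Union>N = Inl ` U" "\<Union>M = W <+> Y'" using N(1) brauerD[OF M] unfolding partition_on_def by auto
  moreover have "Inl ` U Int (W <+> Y') = {}" using UW by auto
  ultimately have "partition_on (Inl ` U Un (W <+> Y')) (N Un M)"
   using N(1) brauerD[OF M] disjoint_union[of N M] unfolding partition_on_def by simp
  moreover have "Inl ` U Un (W <+> Y') = (U Un W) <+> Y'" by auto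
  moreover have "card K = 2" if "K : N Un M" for K
   using that N(2) brauer_card[OF M] by (auto, metis card_2_iff)
  ultimately show ?thesis unfolding brauer_def by auto
 qed
 show M: "N Un relabel ?g x : brauer (U Un W) Y" using un relabel_brauer[OF f x] .
 show A: "N Un bd f W : brauer (U Un W) (f ` W)" using un bd_brauer[OF f] .
 have mid: "(outer_pt (map_sum ?g id p), case_sum Middle_pt Lower_pt p) : comp_rel (N Un bd f W) x" if K: "K : x" "p : K" for p K
 proof (cases p)
  case (Inl d)
  then obtain c where c: "c : W" "d = f c" using brauer_sub(1)[OF x K(1)] K by blast
  have "{Inl c, Inr (f c)} : N Un bd f W" using c unfolding bd_def by blast
  from comp_rel_edge1[OF this, of "Inl c" "Inr (f c)"] show ?thesis using c Inl gf by simp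
 next
  case (Inr e)
  thus ?thesis using comp_rel_edge2[OF K K(2)] by simp
 qed
 \<comment> \<open>The separating label is the block of \<open>N\<close> on the upper cups and the
   block of \<open>x\<close> elsewhere; the two tags keep the kinds apart.\<close>
 define F where "F l = (case l of Upper_pt c => (if c : U then Inl (blk N (Inl c)) else Inr (blk x (Inl (f c))))
   | Middle_pt d => Inr (blk x (Inl d)) | Lower_pt e => Inr (blk x (Inr e)))" for l
 have F2: "F (case_sum Middle_pt Lower_pt u) = Inr (blk x u)" for u by (cases u) (auto simp: F_def)
 have F3: "F (outer_pt (map_sum ?g id u)) = Inr (blk x u)" if "u : f ` W <+> Y" for u
  using that gf UW by (cases u) (auto simp: F_def)
 have F4: "F (outer_pt u) = Inl (blk N u)" if "u : Inl ` U" for u using that by (auto simp: F_def)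
 have bx: "K : x ==> u : K ==> blk x u = K" for K u using blk_eq[OF brauerD[OF x]] .
 have bN: "K : N ==> u : K ==> blk N u = K" for K u using blk_eq[OF N(1)] .
 have cov: "u : blk x u & blk x u : x" if u0: "u : f ` W <+> Y" for u
 proof -
  obtain K where "K : x" "u : K" using u0 brauerD[OF x] unfolding partition_on_def by blast
  thus ?thesis using bx by auto
 qed
 have covN: "u : blk N u" if u0: "u : Inl ` U" for u
 proof -
  obtain K where "K : N" "u : K" using u0 N(1) unfolding partition_on_def by blast
  thus ?thesis using bN by auto
 qed
 have Ksub: "K : x ==> K <= f ` W <+> Y" for K using brauerD[OF x] unfolding partition_on_def by blast
 have NU: "K : N ==> K <= Inl ` U" for K using N(1) unfolding partition_on_def by blast
 show "cmp (N Un bd f W) x = N Un relabel ?g x"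
 proof (rule comp_eqI2[OF A x M, where f = F])
  fix K assume "K : N Un relabel ?g x"
  thus "\<exists>p q. K = {p, q} & (outer_pt p, outer_pt q) : comp_rel (N Un bd f W) x"
  proof
   assume K: "K : N"
   then obtain p q where pq: "K = {p, q}" using N(2) by blast
   then obtain a b where "p = Inl a" "q = Inl b" using NU[OF K] by blast
   hence e: "(outer_pt p, outer_pt q) : comp_rel (N Un bd f W) x"
    using comp_rel_edge1[of K "N Un bd f W" p q x] K pq by auto
   show ?thesis by (rule comp_pairI[OF pq e])
  next
   assume "K : relabel ?g x"
   then obtain L where L: "L : x" "K = map_sum ?g id ` L" unfolding relabel_def by blast
   then obtain p q where pq: "L = {p, q}" using brauer_block[OF x] by blast
   have "(outer_pt (map_sum ?g id p), outer_pt (map_sum ?g id q)) : comp_rel (N Un bd f W) x"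
    using mid[OF L(1), of p] mid[OF L(1), of q] comp_rel_edge2[OF L(1), of p q] pq
    by (meson comp_rel_sym comp_rel_trans insertCI)
   thus ?thesis using L pq by blast
  qed
 next
  fix K u v assume K: "K : N Un bd f W" "u : K" "v : K"
  from K(1) show "F (case_sum Upper_pt Middle_pt u) = F (case_sum Upper_pt Middle_pt v)"
  proof
   assume N': "K : N"
   then obtain a b where "u = Inl a" "v = Inl b" "a : U" "b : U" using NU K by blast
   thus ?thesis using bN[OF N'] K by (simp add: F_def)
  next
   assume "K : bd f W"
   then obtain c where "c : W" "K = {Inl c, Inr (f c)}" unfolding bd_def by blast
   thus ?thesis using K UW by (auto simp: F_def)
  qed
 next
  fix K u v assume K: "K : x" "u : K" "v : K"
  show "F (case_sum Middle_pt Lower_pt u) = F (case_sum Middle_pt Lower_pt v)"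
   unfolding F2 using bx[OF K(1)] K by simp
 next
  fix u v K assume K: "K : N Un relabel ?g x" "u : K" and v: "v : (U Un W) <+> Y" and F: "F (outer_pt u) = F (outer_pt v)"
  have v': "v : Inl ` U \<or> (EX w:f ` W <+> Y. v = map_sum ?g id w)"
  proof (cases v)
   case (Inl c)
   then consider "c : U" | "c : W" using v by auto
   thus ?thesis
   proof cases
    case 2
    hence "v = map_sum ?g id (Inl (f c))" using Inl gf by simp
    thus ?thesis using 2 by blast
   qed (use Inl in blast)
  next
   case (Inr e)
   hence "v = map_sum ?g id (Inr e)" "Inr e : f ` W <+> Y" using v by auto
   thus ?thesis by blast
  qed
  from K(1) show "v : K"
  proof
   assume N': "K : N"
   have "u : Inl ` U" using NU[OF N'] K(2) by blast
   hence Fu: "F (outer_pt u) = Inl K" using F4[of u] bN[OF N' K(2)] by simp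
   from v' show ?thesis
   proof
    assume v: "v : Inl ` U"
    hence "F (outer_pt v) = Inl (blk N v)" by (rule F4)
    hence "blk N v = K" using Fu F by simp
    thus ?thesis using covN[OF v] by simp
   next
    assume "EX w:f ` W <+> Y. v = map_sum ?g id w"
    then obtain w where w: "w : f ` W <+> Y" "v = map_sum ?g id w" by blast
    have "F (outer_pt v) = Inr (blk x w)" unfolding w(2) by (rule F3[OF w(1)])
    thus ?thesis using Fu F by simp
   qed
  next
   assume "K : relabel ?g x"
   then obtain L where L: "L : x" "K = map_sum ?g id ` L" unfolding relabel_def by blast
   then obtain w where w: "w : L" "u = map_sum ?g id w" using K by blast
   have "w : f ` W <+> Y" using Ksub[OF L(1)] w(1) by blast
   hence Fu: "F (outer_pt u) = Inr L" unfolding w(2) using F3[of w] bx[OF L(1) w(1)] by simp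
   from v' show ?thesis
   proof
    assume "v : Inl ` U"
    hence "F (outer_pt v) = Inl (blk N v)" by (rule F4)
    thus ?thesis using Fu F by simp
   next
    assume "EX w:f ` W <+> Y. v = map_sum ?g id w"
    then obtain w' where w': "w' : f ` W <+> Y" "v = map_sum ?g id w'" by blast
    have "F (outer_pt v) = Inr (blk x w')" unfolding w'(2) by (rule F3[OF w'(1)])
    hence "blk x w' = L" using Fu F by simp
    thus ?thesis using cov[OF w'(1)] w' L by blast
   qed
  qed
 qed
qed

lemma relabel_id: "relabel (the_inv_into W id) x = x" if "x : brauer W Y"
proof -
 have "map_sum (the_inv_into W id) id u = u" if "K : x" "u : K" for K u
  using brauer_sub(1)[OF \<open>x : brauer W Y\<close> that(1)] that the_inv_into_f_f[of id W] by (cases u) auto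
 hence "map_sum (the_inv_into W id) id ` K = K" if "K : x" for K using that by force
 thus ?thesis unfolding relabel_def by force
qed

lemma hook_comp:
 assumes x: "x : brauer W Y" and ab: "a ~: W" "b ~: W" "a ~= b"
 shows "cmp (hook W a b) x = insert {Inl a, Inl b} x"
proof -
 have N: "partition_on (Inl ` {a, b}) {{Inl a, Inl b}}" by (auto simp: partition_on_def)
 have "cmp ({{Inl a, Inl b}} Un bd id W) x = {{Inl a, Inl b}} Un relabel (the_inv_into W id) x"
 proof (rule comp_cups_bd(1)[OF N])
  show "\<exists>p q. p ~= q & K = {p, q}" if "K : {{Inl a, Inl b}}" for K :: "('a + 'a) set"
   using that ab(3) by (metis Inl_inject singletonD)
 qed (use x ab in auto)
 thus ?thesis unfolding relabel_id[OF x] by (simp add: hook_def)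
qed

lemma bd_comp: "inj_on f W ==> x : brauer (f ` W) Y ==> cmp (bd f W) x = relabel (the_inv_into W f) x"
 using comp_cups_bd(1)[of "{}" "{}" W f x Y] by (simp add: partition_on_def)

lemma one_comp: "x : brauer X Y ==> cmp (bd id X) x = x"
 using bd_comp[of id X x Y] relabel_id[of x X Y] by simp

lemma comp_one: "x : brauer X Y ==> cmp x (bd id Y) = x"
 using one_comp[OF bflip_brauer] bflip_comp by (metis bflip_bd_id bflip_bflip)

lemma bd_bd:
 assumes "inj_on f X" "inj_on g (f ` X)"
 shows "cmp (bd f X) (bd g (f ` X)) = bd (g \<circ> f) X"
proof -
 have "cmp (bd f X) (bd g (f ` X)) = relabel (the_inv_into X f) (bd g (f ` X))"
  using bd_comp[OF assms(1) bd_brauer[OF assms(2)]] .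
 also have "\<dots> = bd (g \<circ> f) X"
  unfolding relabel_def bd_image image_image by (rule image_cong) (simp_all add: the_inv_into_f_f[OF assms(1)])
 finally show ?thesis .
qed

lemma bd_bflip: "inj_on f X ==> cmp (bd f X) (bflip (bd f X)) = bd id X"
proof -
 assume f: "inj_on f X"
 hence fi: "inj_on (the_inv_into X f) (f ` X)" by (simp add: inj_on_the_inv_into)
 show ?thesis unfolding bflip_bd[OF f] bd_bd[OF f fi]
  by (intro bd_cong) (simp add: the_inv_into_f_f[OF f])
qed

lemma label_ext:
 assumes "!!l. f (Upper_pt l) = g l" "!!l. f (Middle_pt l) = g l" "!!l. f (Lower_pt l) = g l"
 shows "f (case_sum Upper_pt Middle_pt u) = case_sum g g u" "f (case_sum Middle_pt Lower_pt u) = case_sum g g u"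
  "f (outer_pt u) = case_sum g g u"
 using assms by (cases u; simp)+

text \<open>The cap and the cup on the middle points \<open>a\<close>, \<open>b\<close> form a
  closed loop that reaches no outer point and disappears. The labelling \<open>g\<close> merges
  exactly the points of this loop.\<close>

lemma hook_cancel:
 assumes ab: "a ~: W" "b ~: W" "a ~= b"
 shows "cmp (bflip (hook W a b)) (hook W a b) = bd id W"
proof -
 let ?h = "hook W a b"
 define g where "g x = (if x : {a, b} then {a, b} else {x})" for x
 define f where "f l = (case l of Upper_pt x => g x | Middle_pt x => g x | Lower_pt x => g x)" for l
 note fs = label_ext[of f g, unfolded f_def, simplified]
 have h: "?h : brauer (insert a (insert b W)) W" by (rule hook_brauer[OF ab])
 have idW: "bd id W : brauer W W" using bd_brauer[of id W] by simp
 show ?thesis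
 proof (rule comp_eqI2[OF bflip_brauer[OF h] h idW, where f = f])
  fix K assume "K : bd id W"
  then obtain c where c: "c : W" "K = {Inl c, Inr c}" unfolding bd_def by auto
  hence "K : bflip ?h" "K : ?h" unfolding bflip_hook by (auto simp: hook_def bd_def)
  hence e: "(Upper_pt c, Middle_pt c) : comp_rel (bflip ?h) ?h" "(Middle_pt c, Lower_pt c) : comp_rel (bflip ?h) ?h"
   using comp_rel_edge1[of K "bflip ?h" "Inl c" "Inr c" ?h] comp_rel_edge2[of K ?h "Inl c" "Inr c" "bflip ?h"] c by auto
  show "\<exists>p q. K = {p, q} & (outer_pt p, outer_pt q) : comp_rel (bflip ?h) ?h"
   by (rule comp_pairI[of _ "Inl c" "Inr c"]) (simp add: c(2), metis e outer_pt_simps comp_rel_trans)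
 qed (use ab in \<open>unfold bflip_hook, auto simp: f_def g_def hook_def bd_def split: if_splits\<close>)
qed

text \<open>The strand from the upper \<open>c\<close> runs to the middle \<open>c\<close>, along
  the cup to \<open>b\<close>, along the cap to \<open>a\<close>, and leaves at the lower
  \<open>a\<close>: a zigzag that straightens.\<close>

lemma hook_adjacent:
 assumes "a ~: V" "b ~: V" "c ~: V" "distinct [a, b, c]"
 shows "cmp (bflip (hook (insert c V) a b)) (hook (insert a V) b c) = bd (id(c := a)) (insert c V)"
proof -
 let ?h = "hook (insert c V) a b" and ?k = "hook (insert a V) b c"
 define g where "g x = (if x : {a, b, c} then {a, b, c} else {x})" for x
 define f where "f l = (case l of Upper_pt x => g x | Middle_pt x => g x | Lower_pt x => g x)" for l
 have h: "?h : brauer (insert a (insert b (insert c V))) (insert c V)" by (rule hook_brauer) (use assms in auto)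
 have k: "?k : brauer (insert a (insert b (insert c V))) (insert a V)"
  using hook_brauer[of b "insert a V" c] assms by (auto simp: insert_commute)
 have inj: "inj_on (id(c := a)) (insert c V)" using assms by (auto simp: inj_on_def)
 have "(id(c := a)) ` (insert c V) = insert a V" using assms by auto
 hence u: "bd (id(c := a)) (insert c V) : brauer (insert c V) (insert a V)" using bd_brauer[OF inj] by simp
 show ?thesis
 proof (rule comp_eqI2[OF bflip_brauer[OF h] k u, where f = f])
  fix K assume "K : bd (id(c := a)) (insert c V)"
  then obtain x where x: "x : insert c V" "K = {Inl x, Inr ((id(c := a)) x)}" unfolding bd_def by blast
  then consider "x : V" "K = {Inl x, Inr x}" | "K = {Inl c, Inr a}" by (cases "x = c") auto
  thus "\<exists>p q. K = {p, q} & (outer_pt p, outer_pt q) : comp_rel (bflip ?h) ?k"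
  proof cases
   case 1
   hence "K : bflip ?h" "K : ?k" unfolding bflip_hook by (auto simp: hook_def bd_def)
   hence e: "(Upper_pt x, Middle_pt x) : comp_rel (bflip ?h) ?k" "(Middle_pt x, Lower_pt x) : comp_rel (bflip ?h) ?k"
    using comp_rel_edge1[of K "bflip ?h" "Inl x" "Inr x" ?k] comp_rel_edge2[of K ?k "Inl x" "Inr x" "bflip ?h"] 1 by auto
   show ?thesis by (rule comp_pairI[of _ "Inl x" "Inr x"]) (simp add: 1(2), metis e outer_pt_simps comp_rel_trans)
  next
   case 2
   have "{Inl c, Inr c} : bflip ?h" "{Inr a, Inr b} : bflip ?h" "{Inl b, Inl c} : ?k" "{Inl a, Inr a} : ?k"
    unfolding bflip_hook by (auto simp: hook_def bd_def)
   hence e: "(Upper_pt c, Middle_pt c) : comp_rel (bflip ?h) ?k" "(Middle_pt b, Middle_pt a) : comp_rel (bflip ?h) ?k"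
    "(Middle_pt c, Middle_pt b) : comp_rel (bflip ?h) ?k" "(Middle_pt a, Lower_pt a) : comp_rel (bflip ?h) ?k"
    using comp_rel_edge1[of "{Inl c, Inr c}" "bflip ?h" "Inl c" "Inr c" ?k] comp_rel_edge1[of "{Inr a, Inr b}" "bflip ?h" "Inr b" "Inr a" ?k]
    comp_rel_edge2[of "{Inl b, Inl c}" ?k "Inl c" "Inl b" "bflip ?h"] comp_rel_edge2[of "{Inl a, Inr a}" ?k "Inl a" "Inr a" "bflip ?h"] by auto
   show ?thesis by (rule comp_pairI[of _ "Inl c" "Inr a"]) (simp add: 2, metis e outer_pt_simps comp_rel_trans)
  qed
 qed (use assms in \<open>unfold bflip_hook, auto simp: f_def g_def hook_def bd_def split: if_splits\<close>)
qed

text \<open>Two hooks on disjoint pairs slide past each other: the cup at \<open>c\<close>,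
  \<open>d\<close> moves up and the cap at \<open>a\<close>, \<open>b\<close> moves down.\<close>

lemma hook_far:
 assumes "a ~: V" "b ~: V" "c ~: V" "d ~: V" "distinct [a, b, c, d]"
 shows "cmp (bflip (hook (insert c (insert d V)) a b)) (hook (insert a (insert b V)) c d)
  = cmp (hook V c d) (bflip (hook V a b))"
proof -
 let ?h = "hook (insert c (insert d V)) a b" and ?k = "hook (insert a (insert b V)) c d"
 define g where "g x = (if x : {a, b} then {a, b} else if x : {c, d} then {c, d} else {x})" for x
 define f where "f l = (case l of Upper_pt x => g x | Middle_pt x => g x | Lower_pt x => g x)" for l
 have h: "?h : brauer (insert a (insert b (insert c (insert d V)))) (insert c (insert d V))" by (rule hook_brauer) (use assms in auto)
 have "insert c (insert d (insert a (insert b V))) = insert a (insert b (insert c (insert d V)))" by auto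
 hence k: "?k : brauer (insert a (insert b (insert c (insert d V)))) (insert a (insert b V))"
  using hook_brauer[of c "insert a (insert b V)" d] assms by auto
 have ab: "bflip (hook V a b) : brauer V (insert a (insert b V))" by (rule bflip_brauer, rule hook_brauer) (use assms in auto)
 have R: "cmp (hook V c d) (bflip (hook V a b)) = insert {Inl c, Inl d} (bflip (hook V a b))"
  by (rule hook_comp[OF ab]) (use assms in auto)
 have u: "insert {Inl c, Inl d} (bflip (hook V a b)) : brauer (insert c (insert d V)) (insert a (insert b V))"
  by (rule insert_cup_brauer[OF ab]) (use assms in auto)
 show ?thesis unfolding R
 proof (rule comp_eqI2[OF bflip_brauer[OF h] k u, where f = f])
  fix K assume "K : insert {Inl c, Inl d} (bflip (hook V a b))"
  then consider x where "x : V" "K = {Inl x, Inr x}" | "K = {Inl c, Inl d}" | "K = {Inr a, Inr b}"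
   unfolding bflip_hook bd_def using assms by auto
  thus "\<exists>p q. K = {p, q} & (outer_pt p, outer_pt q) : comp_rel (bflip ?h) ?k"
  proof cases
   case 1
   hence "K : bflip ?h" "K : ?k" unfolding bflip_hook by (auto simp: hook_def bd_def)
   hence e: "(Upper_pt x, Middle_pt x) : comp_rel (bflip ?h) ?k" "(Middle_pt x, Lower_pt x) : comp_rel (bflip ?h) ?k"
    using comp_rel_edge1[of K "bflip ?h" "Inl x" "Inr x" ?k] comp_rel_edge2[of K ?k "Inl x" "Inr x" "bflip ?h"] 1 by auto
   show ?thesis by (rule comp_pairI[of _ "Inl x" "Inr x"]) (simp add: 1(2), metis e outer_pt_simps comp_rel_trans)
  next
   case 2
   have "{Inl c, Inr c} : bflip ?h" "{Inl d, Inr d} : bflip ?h" "{Inl c, Inl d} : ?k"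
    unfolding bflip_hook by (auto simp: hook_def bd_def)
   hence e: "(Upper_pt c, Middle_pt c) : comp_rel (bflip ?h) ?k" "(Middle_pt d, Upper_pt d) : comp_rel (bflip ?h) ?k"
    "(Middle_pt c, Middle_pt d) : comp_rel (bflip ?h) ?k"
    using comp_rel_edge1[of "{Inl c, Inr c}" "bflip ?h" "Inl c" "Inr c" ?k] comp_rel_edge1[of "{Inl d, Inr d}" "bflip ?h" "Inr d" "Inl d" ?k]
    comp_rel_edge2[of "{Inl c, Inl d}" ?k "Inl c" "Inl d" "bflip ?h"] by auto
   show ?thesis by (rule comp_pairI[of _ "Inl c" "Inl d"]) (simp add: 2, metis e outer_pt_simps comp_rel_trans)
  next
   case 3
   have "{Inl a, Inr a} : ?k" "{Inl b, Inr b} : ?k" "{Inr a, Inr b} : bflip ?h"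
    unfolding bflip_hook by (auto simp: hook_def bd_def)
   hence e: "(Lower_pt a, Middle_pt a) : comp_rel (bflip ?h) ?k" "(Middle_pt b, Lower_pt b) : comp_rel (bflip ?h) ?k"
    "(Middle_pt a, Middle_pt b) : comp_rel (bflip ?h) ?k"
    using comp_rel_edge2[of "{Inl a, Inr a}" ?k "Inr a" "Inl a" "bflip ?h"] comp_rel_edge2[of "{Inl b, Inr b}" ?k "Inl b" "Inr b" "bflip ?h"]
    comp_rel_edge1[of "{Inr a, Inr b}" "bflip ?h" "Inr a" "Inr b" ?k] by auto
   show ?thesis by (rule comp_pairI[of _ "Inr a" "Inr b"]) (simp add: 3, metis e outer_pt_simps comp_rel_trans)
  qed
 qed (use assms in \<open>unfold bflip_hook, auto simp: f_def g_def hook_def bd_def split: if_splits\<close>)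
qed

text \<open>A hook slides through a bijection when its points are replaced by their
  preimages.\<close>

lemma bd_hook:
 assumes f: "inj_on f X" "f ` X = insert a (insert b W)" and ab: "a ~: W" "b ~: W" "a ~= b"
 defines "g \<equiv> the_inv_into X f"
 shows "cmp (bd f X) (hook W a b) = cmp (hook (g ` W) (g a) (g b)) (bd f (g ` W))"
  and "insert (g a) (insert (g b) (g ` W)) = X" "g a ~: g ` W" "g b ~: g ` W" "g a ~= g b" "inj_on f (g ` W)" "f ` g ` W = W"
proof -
 have gi: "inj_on g (f ` X)" unfolding g_def using f(1) by (simp add: inj_on_the_inv_into)
 have fg: "f (g y) = y" if "y : f ` X" for y unfolding g_def using f_the_inv_into_f f(1) that by metis
 have "g ` f ` X = X" unfolding g_def using f(1) by (simp add: the_inv_into_onto)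
 thus X: "insert (g a) (insert (g b) (g ` W)) = X" unfolding f(2) by simp
 have W: "W <= f ` X" "a : f ` X" "b : f ` X" using f(2) by auto
 show n: "g a ~: g ` W" "g b ~: g ` W" "g a ~= g b" 
  using inj_on_image_mem_iff[OF gi W(2,1)] inj_on_image_mem_iff[OF gi W(3,1)] inj_on_eq_iff[OF gi W(2,3)] ab by simp_all
 show fi: "inj_on f (g ` W)" using inj_on_subset[OF f(1)] X by blast
 show fgW: "f ` g ` W = W" using fg W by force
 have h: "hook W a b : brauer (f ` X) W" unfolding f(2) by (rule hook_brauer[OF ab])
 have "cmp (bd f X) (hook W a b) = relabel g (hook W a b)" unfolding g_def by (rule bd_comp[OF f(1) h])
 also have "\<dots> = insert {Inl (g a), Inl (g b)} ((%c. {Inl (g c), Inr c}) ` W)"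
  unfolding relabel_def hook_def bd_image by (simp add: image_image)
 also have "(%c. {Inl (g c), Inr c}) ` W = bd f (g ` W)"
  unfolding bd_image image_image by (rule image_cong) (use fg W in auto)
 also have "insert {Inl (g a), Inl (g b)} (bd f (g ` W)) = cmp (hook (g ` W) (g a) (g b)) (bd f (g ` W))"
  using hook_comp[OF bd_brauer[OF fi] n] by simp
 finally show "cmp (bd f X) (hook W a b) = cmp (hook (g ` W) (g a) (g b)) (bd f (g ` W))" .
qed

section \<open>Rank as the number of upper points on transversals\<close>

definition thr :: "'a brauer => 'a set" where
 "thr x = {a. EX K:x. Inl a : K & (\<exists>b. Inr b : K)}"

lemma rank_thr: assumes x: "x : brauer A B" shows "rank x = card (thr x)" "thr x <= A"
proof -
 show "thr x <= A" unfolding thr_def using brauer_sub[OF x] by blast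
 let ?T = "{K : x. \<exists>a b. Inl a : K & Inr b : K}"
 have tr: "\<exists>a b. K = {Inl a, Inr b}" if "K : ?T" for K
 proof -
  obtain a b where ab: "K : x" "Inl a : K" "Inr b : K" using \<open>K : ?T\<close> by blast
  obtain p q where "K = {p, q}" using brauer_block[OF x ab(1)] by blast
  thus ?thesis using ab by auto
 qed
 have "bij_betw (%K. THE a. Inl a : K) ?T (thr x)"
 proof (rule bij_betwI')
  fix K L assume K: "K : ?T" and L: "L : ?T"
  obtain a b where k: "K = {Inl a, Inr b}" using tr[OF K] by blast
  obtain c d where l: "L = {Inl c, Inr d}" using tr[OF L] by blast
  have "(THE a. Inl a : K) = a" "(THE a. Inl a : L) = c" unfolding k l by auto
  thus "((THE a. Inl a : K) = (THE a. Inl a : L)) = (K = L)"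
   using brauer_unique[OF x, of K L "Inl a"] K L k l by auto
 next
  fix K assume K: "K : ?T"
  obtain a b where k: "K = {Inl a, Inr b}" using tr[OF K] by blast
  hence "(THE a. Inl a : K) = a" by auto
  thus "(THE a. Inl a : K) : thr x" using K k unfolding thr_def by auto
 next
  fix a assume "a : thr x"
  then obtain K where K: "K : ?T" "Inl a : K" unfolding thr_def by blast
  then obtain a' b where k: "K = {Inl a', Inr b}" using tr by blast
  hence "(THE a. Inl a : K) = a" using K(2) by auto
  thus "EX K:?T. a = (THE a. Inl a : K)" using K(1) by auto
 qed
 thus "rank x = card (thr x)" unfolding rank_def by (rule bij_betw_same_card)
qed

lemma thr_iff: assumes x: "x : brauer A B" and a: "a : A" shows "a ~: thr x \<longleftrightarrow> (\<exists>c. {Inl a, Inl c} : x)"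
proof
 obtain K where K: "K : x" "Inl a : K" using brauer_cover(1)[OF x a] by blast
 then obtain p where p: "K = {Inl a, p}" using brauer_block[OF x K(1)] by auto
 assume "a ~: thr x"
 then obtain c where "p = Inl c" using K p unfolding thr_def by (cases p) auto
 thus "\<exists>c. {Inl a, Inl c} : x" using K p by auto
next
 assume "\<exists>c. {Inl a, Inl c} : x"
 then obtain c where "{Inl a, Inl c} : x" by blast
 thus "a ~: thr x" using brauer_unique[OF x, of _ "{Inl a, Inl c}" "Inl a"] unfolding thr_def by auto
qed

text \<open>Upper cups survive multiplication on the right, so the set of upper points on
  transversals can only shrink.\<close>

lemma rank_comp_le:
 assumes x: "x : brauer A B" and y: "cmp x y : brauer A D" and fin: "finite A"
 shows "rank (cmp x y) <= rank x"
proof -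
 have "thr (cmp x y) <= thr x"
 proof
  fix a assume a: "a : thr (cmp x y)"
  hence aA: "a : A" using rank_thr(2)[OF y] by blast
  show "a : thr x"
  proof (rule ccontr)
   assume "a ~: thr x"
   then obtain c where "{Inl a, Inl c} : x" using thr_iff[OF x aA] by blast
   hence "{Inl a, Inl c} : cmp x y" using comp_cup_persist[OF brauerD[OF x]] by auto
   thus False using a thr_iff[OF y aA] by blast
  qed
 qed
 thus ?thesis unfolding rank_thr(1)[OF x] rank_thr(1)[OF y]
  using card_mono finite_subset[OF rank_thr(2)[OF x] fin] by blast
qed

lemma rank_bflip: "rank (bflip x) = rank x"
proof -
 have "bij_betw ((`) swap_sum) {K : bflip x. \<exists>a b. Inl a : K & Inr b : K} {K : x. \<exists>a b. Inl a : K & Inr b : K}"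
 proof (rule bij_betwI[where g = "(`) swap_sum"])
  have sw: "swap_sum ` K : {K : x. \<exists>a b. Inl a : K & Inr b : K}" if "K : {K : bflip x. \<exists>a b. Inl a : K & Inr b : K}" for K and x :: "'a brauer"
   using that by (auto simp: mem_bflip mem_swap_image)
  show "(`) swap_sum : {K : bflip x. \<exists>a b. Inl a : K & Inr b : K} \<rightarrow> {K : x. \<exists>a b. Inl a : K & Inr b : K}"
   using sw by blast
  show "(`) swap_sum : {K : x. \<exists>a b. Inl a : K & Inr b : K} \<rightarrow> {K : bflip x. \<exists>a b. Inl a : K & Inr b : K}"
   using sw[of _ "bflip x"] by (simp only: bflip_bflip) blast
 qed (auto simp: image_image)
 thus ?thesis unfolding rank_def by (rule bij_betw_same_card)
qed

lemma rank_bd: "inj_on f X ==> rank (bd f X) = card X"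
proof -
 assume f: "inj_on f X"
 have "thr (bd f X) = X" unfolding thr_def bd_def by auto
 thus ?thesis using rank_thr(1)[OF bd_brauer[OF f]] by simp
qed

lemma rank_full_no_cups:
 assumes x: "x : brauer A B" and fin: "finite A" and r: "rank x = card A"
 shows "{Inl a, Inl b} ~: x"
proof
 assume ab: "{Inl a, Inl b} : x"
 hence "a : A" using brauer_sub(1)[OF x] by blast
 moreover have "thr x = A" using rank_thr[OF x] r fin by (simp add: card_subset_eq)
 ultimately show False using thr_iff[OF x] ab by blast
qed

section \<open>Non-crossing matchings\<close>

definition rot :: "'a list => 'a list => bool" where
 "rot xs ys \<longleftrightarrow> (\<exists>n. ys = rotate n xs)"

lemma rot_refl [simp]: "rot xs xs"
 unfolding rot_def by (metis rotate0 id_apply)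

lemma rot_trans: "rot xs ys ==> rot ys zs ==> rot xs zs"
 unfolding rot_def by (metis rotate_rotate)

lemma rot_append: "rot (us @ vs) (vs @ us)"
 unfolding rot_def by (metis rotate_append)

lemma rotE: "rot xs ys ==> \<exists>us vs. xs = us @ vs & ys = vs @ us"
 unfolding rot_def rotate_drop_take by (metis append_take_drop_id)

lemma rot_sym: "rot xs ys ==> rot ys xs"
 using rotE rot_append by metis

lemma rot_set: "rot xs ys ==> set ys = set xs"
 and rot_distinct: "rot xs ys ==> distinct ys = distinct xs"
 and rot_length: "rot xs ys ==> length ys = length xs"
 unfolding rot_def by auto

lemma rot_map: "rot xs ys ==> rot (map f xs) (map f ys)"
 unfolding rot_def by (metis rotate_map)

lemma rot_rev: "rot xs ys ==> rot (rev xs) (rev ys)"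
 using rotE[of xs ys] rot_append by (metis rev_append)

lemma rot_mapE: "rot (map f xs) ys ==> \<exists>zs. rot xs zs & ys = map f zs"
 unfolding rot_def by (metis rotate_map)

text \<open>\<open>NC l M\<close>: the matching \<open>M\<close> of the points of \<open>l\<close> is non-crossing; it is built by inserting
 adjacent pairs.\<close>

inductive NC :: "'v list => 'v set set => bool" where
 NC_Nil: "NC [] {}"
| NC_insert: "NC (us @ vs) M ==> NC (us @ a # b # vs) (insert {a, b} M)"

lemma NC_partition: "NC l M ==> distinct l ==> partition_on (set l) M & (ALL K:M. card K = 2)"
proof (induction rule: NC.induct)
 case NC_Nil
 thus ?case by (simp add: partition_on_def)
next
 case (NC_insert us vs M a b)
 hence "partition_on (set (us @ vs)) M" and d: "{a, b} Int set (us @ vs) = {}" "a ~= b" and c: "ALL K:M. card K = 2" by auto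
 hence "partition_on ({a, b} Un set (us @ vs)) ({{a, b}} Un M)"
  using disjoint_union[of "{{a, b}}" M] unfolding partition_on_def by simp
 moreover have "{a, b} Un set (us @ vs) = set (us @ a # b # vs)" by auto
 ultimately show ?case using c d by simp
qed

lemma NC_nest: "NC l N ==> NC (us @ vs) M ==> NC (us @ l @ vs) (M Un N)"
proof (induction arbitrary: rule: NC.induct)
 case (NC_insert us' vs' N a b)
 hence "NC ((us @ us') @ (vs' @ vs)) (M Un N)" by simp
 from NC.NC_insert[OF this, of a b] show ?case by simp
qed simp

lemma NC_append: "NC l M ==> NC l' M' ==> NC (l @ l') (M Un M')"
 using NC_nest[of l' M' l "[]" M] by simp

lemma NC_wrap: "NC l M ==> NC (a # l @ [b]) (insert {a, b} M)"
proof -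
 assume l: "NC l M"
 have "NC ([] @ a # b # []) (insert {a, b} {})" by (rule NC_insert) (simp add: NC_Nil)
 hence "NC ([a] @ [b]) {{a, b}}" by simp
 from NC_nest[OF l this] show ?thesis by simp
qed

text \<open>The partner of the first point cuts the list into an inner and an outer part, each
  matched within itself. The induction follows the part into which the last inserted pair
  falls.\<close>

lemma NC_first:
 "NC (a # l) M ==> \<exists>p b q N1 N2. l = p @ b # q & NC p N1 & NC q N2 & M = insert {a, b} (N1 Un N2)"
proof (induction "a # l" M arbitrary: l rule: NC.induct)
 case (NC_insert us vs M a' b')
 show ?case
 proof (cases us)
  case Nil
  hence "l = [] @ b' # vs" "a = a'" "NC vs M" using NC_insert by auto
  thus ?thesis using NC_Nil by (metis Un_empty_left)
 next
  case (Cons x us1)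
  hence l: "l = us1 @ a' # b' # vs" "us @ vs = a # (us1 @ vs)" using NC_insert by auto
  from NC_insert.hyps(2)[OF l(2)] obtain p b q N1 N2 where
   h: "us1 @ vs = p @ b # q" "NC p N1" "NC q N2" "M = insert {a, b} (N1 Un N2)" by blast
  from h(1) consider us' where "us1 = p @ b # us'" "q = us' @ vs" | p' where "p = us1 @ p'" "vs = p' @ b # q"
   by (auto simp: append_eq_append_conv2 append_eq_Cons_conv Cons_eq_append_conv)
  thus ?thesis
  proof cases
   case 1
   hence "NC (us' @ a' # b' # vs) (insert {a', b'} N2)" using h NC.NC_insert[of us' vs N2 a' b'] by simp
   moreover have "l = p @ b # (us' @ a' # b' # vs)" using 1 l by simp
   moreover have "insert {a', b'} M = insert {a, b} (N1 Un insert {a', b'} N2)" using h(4) by auto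
   ultimately show ?thesis using h(2) by blast
  next
   case 2
   hence "NC (us1 @ a' # b' # p') (insert {a', b'} N1)" using h NC.NC_insert[of us1 p' N1 a' b'] by simp
   moreover have "l = (us1 @ a' # b' # p') @ b # q" using 2 l by simp
   moreover have "insert {a', b'} M = insert {a, b} (insert {a', b'} N1 Un N2)" using h(4) by auto
   ultimately show ?thesis using h(3) by blast
  qed
 qed
qed

text \<open>Moving the first point to the end exchanges the inside and the outside of its
  arc.\<close>

lemma NC_rotate1: "NC (a # l) M ==> NC (l @ [a]) M"
proof -
 assume n: "NC (a # l) M"
 obtain p b q N1 N2 where h: "l = p @ b # q" "NC p N1" "NC q N2" "M = insert {a, b} (N1 Un N2)"
  using NC_first[OF n] by blast
 have "NC (p @ b # q @ [a]) (N1 Un insert {b, a} N2)" using NC_append[OF h(2) NC_wrap[OF h(3)]] .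
 thus ?thesis using h by (simp add: insert_commute)
qed

lemma NC_rotate: "NC l M ==> NC (rotate n l) M"
proof (induction n)
 case (Suc n)
 hence n: "NC (rotate n l) M" by simp
 show ?case
 proof (cases "rotate n l")
  case Nil
  thus ?thesis using n by simp
 next
  case (Cons a l')
  thus ?thesis using NC_rotate1[of a l' M] n by simp
 qed
qed simp

lemma NC_rot: "NC l M ==> rot l l' ==> NC l' M"
 unfolding rot_def using NC_rotate by blast

lemma NC_rev: "NC l M ==> NC (rev l) M"
proof (induction rule: NC.induct)
 case (NC_insert us vs M a b)
 from NC.NC_insert[of "rev vs" "rev us" M b a] NC_insert show ?case by (simp add: insert_commute)
qed (simp add: NC_Nil)

lemma NC_map: "NC l M ==> NC (map f l) ((`) f ` M)"
proof (induction rule: NC.induct)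
 case (NC_insert us vs M a b)
 from NC.NC_insert[of "map f us" "map f vs" "(`) f ` M" "f a" "f b"] NC_insert show ?case by simp
qed (simp add: NC_Nil)

lemma two_part_cases:
 assumes "us0 @ x # y # vs0 = map Inl us @ map Inr ws"
 obtains (left) p a b q where "us = p @ a # b # q" "x = Inl a" "y = Inl b" "us0 = map Inl p" "vs0 = map Inl q @ map Inr ws"
 | (mid) p a b q where "us = p @ [a]" "ws = b # q" "x = Inl a" "y = Inr b" "us0 = map Inl p" "vs0 = map Inr q"
 | (right) p a b q where "ws = p @ a # b # q" "x = Inr a" "y = Inr b" "us0 = map Inl us @ map Inr p" "vs0 = map Inr q"
proof -
 from assms consider us1 where "map Inl us = us0 @ us1" "us1 @ map Inr ws = x # y # vs0"
  | us1 where "us0 = map Inl us @ us1" "us1 @ x # y # vs0 = map Inr ws"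
  by (auto simp: append_eq_append_conv2)
 thus ?thesis
 proof cases
  case 1
  then consider "us1 = []" | a where "us1 = [a]" | a b us2 where "us1 = a # b # us2" by (metis list.exhaust)
  thus ?thesis
  proof cases
   case empty: 1
   hence "map Inr ws = [] @ x # y # vs0" "us0 = map Inl us" using 1 by auto
   thus ?thesis using right[of "[]"] by (auto simp: map_eq_Cons_conv)
  next
   case 2
   thus ?thesis using 1 mid by (auto simp: map_eq_append_conv map_eq_Cons_conv)
  next
   case 3
   thus ?thesis using 1 left by (auto simp: map_eq_append_conv map_eq_Cons_conv)
  qed
 next
  case 2
  hence "map Inr ws = us1 @ x # y # vs0" by simp
  then obtain p a b q where "ws = p @ a # b # q" "us1 = map Inr p" "x = Inr a" "y = Inr b" "vs0 = map Inr q"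
   by (auto simp: map_eq_append_conv map_eq_Cons_conv)
  thus ?thesis using right[of p a b q] 2(1) by simp
 qed
qed

text \<open>Insertions can be reordered: the last inserted pair is either itself an upper cup, or it
  can be put back after an adjacent upper cup of the rest has been removed.\<close>

lemma NC_left_cup:
 "NC l M ==> l = map Inl us @ map Inr ws ==> K : M ==> K <= range Inl ==>
  \<exists>p a b q M'. us = p @ a # b # q & M = insert {Inl a, Inl b} M' & NC (map Inl (p @ q) @ map Inr ws) M'"
proof (induction arbitrary: us ws rule: NC.induct)
 case (NC_insert us0 vs0 M x y)
 from NC_insert.prems(1) show ?case
 proof (cases rule: two_part_cases)
  case (left p a b q)
  hence "NC (map Inl (p @ q) @ map Inr ws) M" using NC_insert.hyps by simp
  thus ?thesis using left by blast
 next
  case (mid p a b q)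
  have "K : M" using NC_insert.prems mid by auto
  then obtain p' c d q' M' where h: "p = p' @ c # d # q'" "M = insert {Inl c, Inl d} M'" "NC (map Inl (p' @ q') @ map Inr q) M'"
   using NC_insert.IH[of p q] mid NC_insert.prems by auto
  from NC.NC_insert[OF h(3), of "Inl a" "Inr b"]
  have "NC (map Inl (p' @ q' @ [a]) @ map Inr ws) (insert {x, y} M')" using mid by simp
  moreover have "us = p' @ c # d # (q' @ [a])" using mid h by simp
  moreover have "insert {x, y} M = insert {Inl c, Inl d} (insert {x, y} M')" using h(2) by auto
  ultimately show ?thesis by blast
 next
  case (right p a b q)
  have "K : M" using NC_insert.prems right by auto
  then obtain p' c d q' M' where h: "us = p' @ c # d # q'" "M = insert {Inl c, Inl d} M'" "NC (map Inl (p' @ q') @ map Inr (p @ q)) M'"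
   using NC_insert.IH[of us "p @ q"] right NC_insert.prems by auto
  have "NC ((map Inl (p' @ q') @ map Inr p) @ map Inr q) M'" using h by simp
  from NC.NC_insert[OF this, of "Inr a" "Inr b"]
  have "NC (map Inl (p' @ q') @ map Inr ws) (insert {x, y} M')" using right by simp
  moreover have "insert {x, y} M = insert {Inl c, Inl d} (insert {x, y} M')" using h(2) by auto
  ultimately show ?thesis using h(1) by blast
 qed
qed simp

definition pairs :: "'a list => 'a list => 'a brauer" where
 "pairs us ws = (%(a, b). {Inl a, Inr b}) ` set (zip us ws)"

text \<open>Without cups every insertion happens at the boundary of the two parts, so the matching
  is a bundle of parallel strands.\<close>

lemma NC_no_cups:
 "NC l M ==> l = map Inl us @ map Inr ws ==> (!!K. K : M ==> \<not> K <= range Inl & \<not> K <= range Inr) ==>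
  length us = length ws & M = pairs us (rev ws)"
proof (induction arbitrary: us ws rule: NC.induct)
 case NC_Nil
 thus ?case by (auto simp: pairs_def)
next
 case (NC_insert us0 vs0 M x y)
 from NC_insert.prems(1) show ?case
 proof (cases rule: two_part_cases)
  case (left p a b q)
  thus ?thesis using NC_insert.prems(2)[of "{x, y}"] by auto
 next
  case (mid p a b q)
  hence "length p = length q & M = pairs p (rev q)" using NC_insert.IH[of p q] NC_insert.prems(2) by auto
  thus ?thesis using mid by (auto simp: pairs_def)
 next
  case (right p a b q)
  thus ?thesis using NC_insert.prems(2)[of "{x, y}"] by auto
 qed
qed

lemma NC_pairs: "length us = length ws ==> NC (map Inl us @ rev (map Inr ws)) (pairs us ws)"
proof (induction us ws rule: list_induct2)
 case (Cons a us b ws)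
 from NC_wrap[OF Cons.IH, of "Inl a" "Inr b"] show ?case by (simp add: pairs_def)
qed (simp add: pairs_def NC_Nil)

lemma pairs_map: "pairs us (map f us) = bd f (set us)"
 unfolding pairs_def bd_image by (auto simp: zip_map2 zip_same_conv_map)

lemma distinct_map_ex: "distinct us ==> length us = length ws ==> \<exists>f. ws = map f us"
proof -
 assume d: "distinct us" and l: "length us = length ws"
 have "map (%x. the (map_of (zip us ws) x)) us = ws"
  using d l by (intro nth_equalityI) (auto simp: map_of_zip_nth)
 thus ?thesis by metis
qed

section \<open>Annular matchings and their products\<close>

definition Jhom :: "'a list => 'a list => 'a brauer set" where
 "Jhom xs ys = {M. \<exists>xs' ys'. rot xs xs' & rot ys ys' & NC (map Inl xs' @ rev (map Inr ys')) M}"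

lemma JhomI: "rot xs xs' ==> rot ys ys' ==> NC (map Inl xs' @ rev (map Inr ys')) M ==> M : Jhom xs ys"
 unfolding Jhom_def by blast

lemma Jhom_rot: "rot xs xs2 ==> rot ys ys2 ==> Jhom xs ys = Jhom xs2 ys2"
 unfolding Jhom_def using rot_trans rot_sym by blast

lemma Jhom_brauer:
 assumes "distinct xs" "distinct ys" "M : Jhom xs ys"
 shows "M : brauer (set xs) (set ys)"
proof -
 obtain xs' ys' where h: "rot xs xs'" "rot ys ys'" "NC (map Inl xs' @ rev (map Inr ys')) M" using assms unfolding Jhom_def by blast
 have d: "distinct (map Inl xs' @ rev (map Inr ys') :: ('a + 'a) list)"
  using assms rot_distinct h by (auto simp: distinct_map)
 have "set (map Inl xs' @ rev (map Inr ys')) = set xs <+> set ys" using rot_set h by auto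
 thus ?thesis using NC_partition[OF h(3) d] unfolding brauer_def by auto
qed

lemma map_swap_parts: "map swap_sum (map Inl xs @ rev (map Inr ys)) = map Inr xs @ rev (map Inl ys)"
 by (simp add: rev_map)

lemma Jhom_bflip: "M : Jhom xs ys ==> bflip M : Jhom ys xs"
proof -
 assume "M : Jhom xs ys"
 then obtain xs' ys' where h: "rot xs xs'" "rot ys ys'" "NC (map Inl xs' @ rev (map Inr ys')) M" unfolding Jhom_def by blast
 have "NC (rev (map swap_sum (map Inl xs' @ rev (map Inr ys')))) (bflip M)"
  unfolding bflip_def using NC_rev[OF NC_map[OF h(3)]] .
 hence "NC (map Inl ys' @ rev (map Inr xs')) (bflip M)" unfolding map_swap_parts by simp
 thus ?thesis using h JhomI by blast
qed

text \<open>Reversing the whole word and rotating it back reflects the cylinder. Hence reversing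
  only the source amounts to reversing only the target, and one reversal is enough to describe the
  anti-annular partitions.\<close>

lemma Jhom_mirror1: "M : Jhom xs ys ==> M : Jhom (rev xs) (rev ys)"
proof -
 assume "M : Jhom xs ys"
 then obtain xs' ys' where h: "rot xs xs'" "rot ys ys'" "NC (map Inl xs' @ rev (map Inr ys')) M" unfolding Jhom_def by blast
 have "NC (map Inr ys' @ rev (map Inl xs')) M" using NC_rev[OF h(3)] by simp
 hence "NC (rev (map Inl xs') @ map Inr ys') M" using NC_rot rot_append by blast
 hence "NC (map Inl (rev xs') @ rev (map Inr (rev ys'))) M" by (simp add: rev_map)
 thus ?thesis using JhomI rot_rev h by blast
qed

lemma Jhom_mirror: "Jhom (rev xs) (rev ys) = Jhom xs ys"
 using Jhom_mirror1[of _ "rev xs" "rev ys"] Jhom_mirror1[of _ xs ys] by auto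

lemma Jhom_mirror_left: "Jhom (rev xs) ys = Jhom xs (rev ys)"
 using Jhom_mirror[of xs "rev ys"] by simp

lemma Jhom_insert:
 assumes "rot xs (a # b # us)" "M : Jhom us ys"
 shows "insert {Inl a, Inl b} M : Jhom xs ys"
proof -
 obtain us' ys' where h: "rot us us'" "rot ys ys'" "NC (map Inl us' @ rev (map Inr ys')) M" using assms unfolding Jhom_def by blast
 obtain p q where pq: "us = p @ q" "us' = q @ p" using rotE h by blast
 have "NC (map Inl q @ (map Inl p @ rev (map Inr ys'))) M" using h pq by simp
 from NC_insert[OF this, of "Inl a" "Inl b"]
 have "NC (map Inl (q @ a # b # p) @ rev (map Inr ys')) (insert {Inl a, Inl b} M)" by simp
 moreover have "rot xs (q @ a # b # p)" using assms(1) rot_trans rot_append[of "a # b # p" q] pq by auto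
 ultimately show ?thesis using JhomI h by blast
qed

lemma Jhom_factor:
 assumes M: "M : Jhom xs ys" and K: "K : M" "K <= range Inl"
 shows "\<exists>a b us M'. rot xs (a # b # us) & M' : Jhom us ys & M = insert {Inl a, Inl b} M'"
proof -
 obtain xs' ys' where h: "rot xs xs'" "rot ys ys'" "NC (map Inl xs' @ rev (map Inr ys')) M" using M unfolding Jhom_def by blast
 have e: "map Inl xs' @ rev (map Inr ys') = map Inl xs' @ map Inr (rev ys')" by (simp add: rev_map)
 from NC_left_cup[OF h(3) e K] obtain p a b q M' where
  f: "xs' = p @ a # b # q" "M = insert {Inl a, Inl b} M'" "NC (map Inl (p @ q) @ map Inr (rev ys')) M'" by blast
 have "rot xs (a # b # q @ p)" using rot_trans[OF h(1)] rot_append[of p "a # b # q"] f by simp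
 moreover have "M' : Jhom (q @ p) ys" using f(3) h(2) rot_append[of q p] JhomI by (metis rev_map)
 ultimately show ?thesis using f by blast
qed

lemma Jhom_unit:
 assumes d: "distinct xs" "distinct ys" and M: "M : Jhom xs ys"
  and n: "!!K. K : M ==> \<not> K <= range Inl & \<not> K <= range Inr"
 shows "\<exists>f. rot ys (map f xs) & inj_on f (set xs) & M = bd f (set xs)"
proof -
 obtain xs' ys' where h: "rot xs xs'" "rot ys ys'" "NC (map Inl xs' @ rev (map Inr ys')) M" using M unfolding Jhom_def by blast
 have e: "map Inl xs' @ rev (map Inr ys') = map Inl xs' @ map Inr (rev ys')" by (simp add: rev_map)
 have l: "length xs' = length ys'" "M = pairs xs' ys'" using NC_no_cups[OF h(3) e n] by auto
 obtain f where f: "ys' = map f xs'" using distinct_map_ex[OF _ l(1)] rot_distinct[OF h(1)] d by blast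
 have "rot ys (map f xs)" using h(2) f rot_map[OF rot_sym[OF h(1)]] rot_trans by blast
 moreover have "inj_on f (set xs)" using rot_distinct[OF h(2)] d f rot_set[OF h(1)] by (simp add: distinct_map)
 moreover have "M = bd f (set xs)" using l f pairs_map rot_set[OF h(1)] by metis
 ultimately show ?thesis by blast
qed

lemma bd_Jhom: "rot ys (map f xs) ==> bd f (set xs) : Jhom xs ys"
 using NC_pairs[of xs "map f xs"] JhomI[OF rot_refl] pairs_map by (metis length_map)

lemma one_Jhom: "bd id (set xs) : Jhom xs xs"
 using bd_Jhom[of xs id xs] by simp

lemma Jhom_relabel:
 assumes f: "inj_on f (set xs)" and r: "rot ys (map f xs)" and x: "x : Jhom ys zs"
 shows "relabel (the_inv_into (set xs) f) x : Jhom xs zs"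
proof -
 let ?g = "the_inv_into (set xs) f"
 obtain ys' zs' where h: "rot ys ys'" "rot zs zs'" "NC (map Inl ys' @ rev (map Inr zs')) x" using x unfolding Jhom_def by blast
 obtain xs' where xs': "rot xs xs'" "ys' = map f xs'" using rot_mapE rot_trans[OF rot_sym[OF r] h(1)] by blast
 have "map ?g ys' = xs'" unfolding xs'(2) map_map
  by (rule map_idI) (use rot_set[OF xs'(1)] the_inv_into_f_f[OF f] in simp)
 hence "map (map_sum ?g id) (map Inl ys' @ rev (map Inr zs')) = map Inl xs' @ rev (map Inr zs')"
  by (auto simp: rev_map)
 thus ?thesis using NC_map[OF h(3), of "map_sum ?g id"] JhomI[OF xs'(1) h(2)] unfolding relabel_def by simp
qed

lemma bd_mul_Jhom:
 assumes "distinct ys" "distinct zs" "inj_on f (set xs)" "rot ys (map f xs)" "x : Jhom ys zs"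
 shows "cmp (bd f (set xs)) x : Jhom xs zs"
proof -
 have "set ys = f ` set xs" using rot_set[OF assms(4)] by simp
 hence "x : brauer (f ` set xs) (set zs)" using Jhom_brauer[OF assms(1,2,5)] by simp
 thus ?thesis using bd_comp[OF assms(3)] Jhom_relabel[OF assms(3,4,5)] by simp
qed

text \<open>The induction scheme for annular partitions: a cup or a cap can be removed at an
  adjacent pair, and what has neither is a bijection preserving the cyclic order.\<close>

lemma Jhom_cases:
 assumes d: "distinct xs" "distinct ys" and M: "M : Jhom xs ys"
 obtains (cup) a b us M' where "rot xs (a # b # us)" "M' : Jhom us ys" "M = insert {Inl a, Inl b} M'"
 | (cap) a b us M' where "rot ys (a # b # us)" "M' : Jhom us xs" "bflip M = insert {Inl a, Inl b} M'"
 | (unit) f where "rot ys (map f xs)" "inj_on f (set xs)" "M = bd f (set xs)"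
proof -
 consider K where "K : M" "K <= range Inl" | K where "K : M" "K <= range Inr"
  | "!!K. K : M ==> \<not> K <= range Inl & \<not> K <= range Inr" by blast
 thus ?thesis
 proof cases
  case 1
  thus ?thesis using Jhom_factor[OF M 1] cup by blast
 next
  case 2
  hence "swap_sum ` K : bflip M" unfolding bflip_def by blast
  moreover have "swap_sum ` K <= range Inl" using 2 by auto
  ultimately show ?thesis using Jhom_factor[OF Jhom_bflip[OF M]] cap by blast
 next
  case 3
  thus ?thesis using Jhom_unit[OF d M] unit by blast
 qed
qed

lemma rot_Cons2:
 assumes "rot xs (a # b # us)"
 shows "set xs = insert a (insert b (set us))" "distinct xs ==> distinct us & a ~: set us & b ~: set us & a ~= b"
  "length xs = length us + 2"
 using rot_set[OF assms] rot_distinct[OF assms] rot_length[OF assms] by auto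

text \<open>Odd length excludes the one other possibility, a circle of two points on which (a, b)
  and (b, a) are both adjacent.\<close>

lemma adjacent_cases:
 assumes "rot xs (a # b # us)" "rot xs (c # d # vs)" "distinct xs" "odd (length xs)"
 obtains (same) "c = a" "d = b" "vs = us"
 | (succ) ts where "c = b" "us = d # ts" "vs = ts @ [a]"
 | (prev) ts where "d = a" "vs = b # ts" "us = ts @ [c]"
 | (far) p q where "us = p @ c # d # q" "vs = q @ a # b # p"
proof -
 have "rot (a # b # us) (c # d # vs)" using assms(1,2) rot_sym rot_trans by blast
 then obtain s t where st: "a # b # us = s @ t" "c # d # vs = t @ s" using rotE by blast
 have odd: "odd (length us)" using rot_Cons2(3)[OF assms(1)] assms(4) by simp
 consider "s = []" | "s = [a]" "t = b # us" | s' where "s = a # b # s'" "us = s' @ t"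
  using st(1) by (auto simp: Cons_eq_append_conv)
 thus ?thesis
 proof cases
  case 1
  hence "c # d # vs = a # b # us" using st by simp
  thus ?thesis using same by simp
 next
  case 2
  hence e: "c = b" "d # vs = us @ [a]" using st by auto
  then obtain ts where "us = d # ts" "vs = ts @ [a]" using odd by (cases us) auto
  thus ?thesis using succ e by blast
 next
  case 3
  hence e: "c # d # vs = t @ a # b # s'" using st by simp
  consider "t = []" | "t = [c]" | t' where "t = c # d # t'" using e by (auto simp: Cons_eq_append_conv)
  thus ?thesis
  proof cases
   case 1
   thus ?thesis using e 3 same by simp
  next
   case 2
   thus ?thesis using e 3 prev by simp
  next
   case t: 3
   thus ?thesis using e 3 far by simp
  qed
 qed
qed

lemma hook_Jhom: "rot xs (a # b # us) ==> hook (set us) a b : Jhom xs us"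
 unfolding hook_def by (rule Jhom_insert[OF _ one_Jhom])

lemma hook_mul:
 assumes "rot xs (a # b # us)" "distinct xs" "distinct ys" "M : Jhom us ys"
 shows "cmp (hook (set us) a b) M = insert {Inl a, Inl b} M"
 using hook_comp[OF Jhom_brauer[of us ys M]] rot_Cons2(2)[OF assms(1,2)] assms by blast

lemma hook_cancel_mul:
 assumes "rot xs (a # b # us)" "distinct xs" "distinct ys" "M : Jhom us ys"
 shows "cmp (bflip (hook (set us) a b)) (cmp (hook (set us) a b) M) = M"
 using hook_cancel[of a "set us" b] rot_Cons2(2)[OF assms(1,2)] one_comp[OF Jhom_brauer[of us ys M]] assms
 by (simp flip: brauer_comp_assoc)

text \<open>Closing off an adjacent pair keeps a partition annular. If \<open>y\<close> has an upper
  cup, its position relative to the pair decides: equal pairs cancel, overlapping ones straighten to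
  a bijection, distant ones slide past each other and leave a smaller instance. A lower cap of
  \<open>y\<close> is split off on the far side, and a bijection carries the pair over to the
  target.\<close>

lemma contract_Jhom:
 "distinct ys ==> odd (length ys) ==> distinct zs ==> rot ys (a # b # us) ==> y : Jhom ys zs ==>
  cmp (bflip (hook (set us) a b)) y : Jhom us zs"
proof (induction "length ys + length zs" arbitrary: ys zs a b us y rule: less_induct)
 case less
 note ab = rot_Cons2[OF less.prems(4)]
 have us: "distinct us" "a ~: set us" "b ~: set us" "a ~= b" using ab(2)[OF less.prems(1)] by auto
 from less.prems(1,3,5) show ?case
 proof (cases rule: Jhom_cases)
  case (cup c d vs y')
  have vs: "distinct vs" "c ~: set vs" "d ~: set vs" "c ~= d" using rot_Cons2(2)[OF cup(1) less.prems(1)] by auto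
  have y: "y = cmp (hook (set vs) c d) y'" using hook_mul[OF cup(1) less.prems(1,3) cup(2)] cup(3) by simp
  from less.prems(4) cup(1) less.prems(1,2) show ?thesis
  proof (cases rule: adjacent_cases)
   case same
   thus ?thesis using y hook_cancel_mul[OF less.prems(4,1,3)] cup(2) by simp
  next
   case (succ ts)
   let ?f = "id(d := a)"
   have "a ~: set ts" "b ~: set ts" "d ~: set ts" "distinct [a, b, d]" using us vs succ by auto
   from hook_adjacent[OF this] have "cmp (bflip (hook (set us) a b)) (hook (set vs) c d) = bd ?f (set us)"
    using succ by simp
   hence e: "cmp (bflip (hook (set us) a b)) y = cmp (bd ?f (set us)) y'"
    unfolding y by (metis brauer_comp_assoc)
   \<comment> \<open>Straightening sends \<open>d\<close> to \<open>a\<close>, and the relabelled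
     list is \<open>vs\<close> turned by one place.\<close>
   have "map ?f us = a # ts" using succ us by (auto simp: map_idI)
   hence "rot vs (map ?f us)" using succ rot_append[of ts "[a]"] by simp
   moreover have "inj_on ?f (set us)" using succ us by (auto simp: inj_on_def)
   ultimately show ?thesis unfolding e using bd_mul_Jhom[OF vs(1) less.prems(3) _ _ cup(2)] by blast
  next
   case (prev ts)
   let ?f = "id(c := b)"
   have "b ~: set ts" "a ~: set ts" "c ~: set ts" "distinct [b, a, c]" using us vs prev by auto
   from hook_adjacent[OF this] have "cmp (bflip (hook (set us) a b)) (hook (set vs) c d) = bd ?f (set us)"
    using prev by (simp add: hook_commute)
   hence e: "cmp (bflip (hook (set us) a b)) y = cmp (bd ?f (set us)) y'"
    unfolding y by (metis brauer_comp_assoc)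
   have "map ?f us = ts @ [b]" using prev us by (auto simp: map_idI)
   hence "rot vs (map ?f us)" using prev rot_append[of "[b]" ts] by simp
   moreover have "inj_on ?f (set us)" using prev us by (auto simp: inj_on_def)
   ultimately show ?thesis unfolding e using bd_mul_Jhom[OF vs(1) less.prems(3) _ _ cup(2)] by blast
  next
   case (far p q)
   let ?V = "set p Un set q"
   have dist: "a ~: ?V" "b ~: ?V" "c ~: ?V" "d ~: ?V" "distinct [a, b, c, d]" using us vs far by auto
   have sets: "set us = insert c (insert d ?V)" "set vs = insert a (insert b ?V)" using far by auto
   from hook_far[OF dist] have e0: "cmp (bflip (hook (set us) a b)) (hook (set vs) c d) =
     cmp (hook ?V c d) (bflip (hook ?V a b))" unfolding sets .
   hence e: "cmp (bflip (hook (set us) a b)) y = cmp (hook ?V c d) (cmp (bflip (hook ?V a b)) y')"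
    unfolding y by (metis brauer_comp_assoc)
   have rv: "rot vs (a # b # p @ q)" using far rot_append[of q "a # b # p"] by simp
   have ru: "rot us (c # d # q @ p)" using far rot_append[of p "c # d # q"] by simp
   have lv: "length vs < length ys" "odd (length vs)" using rot_Cons2(3)[OF cup(1)] less.prems(2) by auto
   have "cmp (bflip (hook (set (p @ q)) a b)) y' : Jhom (p @ q) zs"
    using less.hyps[OF _ vs(1) lv(2) less.prems(3) rv cup(2)] lv by simp
   hence m: "cmp (bflip (hook ?V a b)) y' : Jhom (q @ p) zs" using Jhom_rot[OF rot_append[of p q] rot_refl] by auto
   have "cmp (hook (set (q @ p)) c d) (cmp (bflip (hook ?V a b)) y') : Jhom us zs"
    using hook_mul[OF ru us(1) less.prems(3) m] Jhom_insert[OF ru m] by simp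
   moreover have "set (q @ p) = ?V" by auto
   ultimately show ?thesis unfolding e by simp
  qed
 next
  case (cap c d vs y')
  have vs: "distinct vs" "length zs = length vs + 2" using rot_Cons2(2,3)[OF cap(1)] less.prems(3) by auto
  have fy: "bflip y = cmp (hook (set vs) c d) y'" using hook_mul[OF cap(1) less.prems(3,1) cap(2)] cap(3) by simp
  have IH: "cmp (bflip (hook (set us) a b)) (bflip y') : Jhom us vs"
   using less.hyps[OF _ less.prems(1,2) vs(1) less.prems(4) Jhom_bflip[OF cap(2)]] vs by simp
  have "bflip (cmp (bflip (hook (set us) a b)) y) = cmp (hook (set vs) c d) (cmp y' (hook (set us) a b))"
   unfolding bflip_comp fy by (simp add: brauer_comp_assoc)
  also have "cmp y' (hook (set us) a b) = bflip (cmp (bflip (hook (set us) a b)) (bflip y'))"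
   unfolding bflip_comp by simp
  finally have "bflip (cmp (bflip (hook (set us) a b)) y) : Jhom zs us"
   using hook_mul[OF cap(1) less.prems(3) us(1) Jhom_bflip[OF IH]] Jhom_insert[OF cap(1) Jhom_bflip[OF IH]] by simp
  thus ?thesis using Jhom_bflip by fastforce
 next
  case (unit f)
  let ?X = "set ys"
  have Zs: "set zs = f ` ?X" using rot_set[OF unit(1)] by simp
  let ?g = "the_inv_into ?X f"
  have gi: "inj_on ?g (set zs)" unfolding Zs using unit(2) by (simp add: inj_on_the_inv_into)
  have gz: "?g ` set zs = ?X" unfolding Zs using unit(2) by (simp add: the_inv_into_onto)
  have fy: "bflip y = bd ?g (set zs)" unfolding unit(3) Zs by (rule bflip_bd[OF unit(2)])
  \<comment> \<open>A bijection preserving the cyclic order carries adjacent pairs to adjacent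
    pairs, so the pair of \<open>ys\<close> corresponds to one of \<open>zs\<close>.\<close>
  obtain zs' where zs': "rot zs zs'" "a # b # us = map ?g zs'"
  proof -
   have "rot (map ?g zs) (map ?g (map f ys))" using rot_map[OF unit(1)] .
   moreover have "map ?g (map f ys) = ys" using the_inv_into_f_f[OF unit(2)] by (simp add: map_idI)
   ultimately have "rot (map ?g zs) (a # b # us)" using less.prems(4) rot_trans by metis
   thus ?thesis using rot_mapE that by metis
  qed
  obtain a' b' us' where z: "zs' = a' # b' # us'" "a = ?g a'" "b = ?g b'" "us = map ?g us'"
   using zs'(2) by (auto simp: Cons_eq_map_conv)
  have rz: "rot zs (a' # b' # us')" using zs' z by simp
  have gX: "?g ` set zs = insert a (insert b (set us))" using gz ab(1) by simp
  have us'Z: "set us' <= set zs" "a' : set zs" "b' : set zs" using rot_Cons2(1)[OF rz] by auto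
  let ?h = "the_inv_into (set zs) ?g"
  have hg: "?h (?g z) = z" if "z : set zs" for z using the_inv_into_f_f[OF gi that] .
  have h: "?h a = a'" "?h b = b'" "?h ` set us = set us'" using z hg us'Z by (auto simp: image_image image_iff subset_iff)
  have "cmp (bflip y) (hook (set us) a b) = cmp (hook (set us') a' b') (bd ?g (set us'))"
   unfolding fy using bd_hook(1)[OF gi gX us(2,3,4)] unfolding h .
  moreover have u': "bd ?g (set us') : Jhom us' us" using bd_Jhom[of us ?g us'] z by simp
  ultimately have "cmp (bflip y) (hook (set us) a b) : Jhom zs us"
   using hook_mul[OF rz less.prems(3) us(1) u'] Jhom_insert[OF rz u'] by simp
  hence "bflip (cmp (bflip y) (hook (set us) a b)) : Jhom us zs" by (rule Jhom_bflip)
  thus ?thesis unfolding bflip_comp by simp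
 qed
qed

text \<open>The left factor is taken apart: its cups are put on afterwards, its caps contract the
  right factor, and a bijection only relabels.\<close>

theorem Jhom_comp:
 "distinct xs ==> distinct ys ==> odd (length ys) ==> distinct zs ==> x : Jhom xs ys ==> y : Jhom ys zs ==>
  cmp x y : Jhom xs zs"
proof (induction "length xs + length ys" arbitrary: xs ys x y rule: less_induct)
 case less
 from less.prems(1,2,5) show ?case
 proof (cases rule: Jhom_cases)
  case (cup a b us x')
  have us: "distinct us" "length xs = length us + 2" using rot_Cons2(2,3)[OF cup(1)] less.prems(1) by auto
  have m: "cmp x' y : Jhom us zs" using less.hyps[OF _ us(1) less.prems(2,3,4) cup(2) less.prems(6)] us by simp
  have "cmp x y = cmp (hook (set us) a b) (cmp x' y)"
   using hook_mul[OF cup(1) less.prems(1,2) cup(2)] cup(3) by (metis brauer_comp_assoc)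
  thus ?thesis using hook_mul[OF cup(1) less.prems(1,4) m] Jhom_insert[OF cup(1) m] by simp
 next
  case (cap a b us x')
  have us: "distinct us" "length ys = length us + 2" using rot_Cons2(2,3)[OF cap(1)] less.prems(2) by auto
  have "bflip x = cmp (hook (set us) a b) x'" using hook_mul[OF cap(1) less.prems(2,1) cap(2)] cap(3) by simp
  hence "x = cmp (bflip x') (bflip (hook (set us) a b))" using bflip_comp by (metis bflip_bflip)
  hence e: "cmp x y = cmp (bflip x') (cmp (bflip (hook (set us) a b)) y)"
   by (metis brauer_comp_assoc)
  have m: "cmp (bflip (hook (set us) a b)) y : Jhom us zs"
   using contract_Jhom[OF less.prems(2,3,4) cap(1) less.prems(6)] .
  have "odd (length us)" using us less.prems(3) by simp
  thus ?thesis unfolding e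
   using less.hyps[OF _ less.prems(1) us(1) _ less.prems(4) Jhom_bflip[OF cap(2)] m] us by simp
 next
  case (unit f)
  thus ?thesis using bd_mul_Jhom[OF less.prems(2,4) _ _ less.prems(6)] by blast
 qed
qed

section \<open>The Jones and anti-Jones categories\<close>

text \<open>The flag \<open>s\<close> of \<open>JH s\<close> selects the anti-Jones category.\<close>

definition olist :: "'a list => bool" where
 "olist xs \<longleftrightarrow> distinct xs & odd (length xs)"

definition JH :: "bool => 'a list => 'a list => 'a brauer set" where
 "JH s xs ys = {M. olist xs & olist ys & (M : Jhom xs ys \<or> s & M : Jhom (rev xs) ys)}"

text \<open>The remaining points are read from behind the pair onwards, so that the adjacent pair
  alone determines the target list.\<close>

definition hooks :: "'a list => 'a list => 'a brauer set" where
 "hooks xs us = {hook (set us) a b | a b. olist xs & rot xs (a # b # us)}"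

definition idb :: "'a list => 'a brauer" where
 "idb xs = bd id (set xs)"

lemma JH_I: "olist xs ==> olist ys ==> M : Jhom xs ys ==> M : JH s xs ys"
 unfolding JH_def by blast

lemma JH_ob: "x : JH s xs ys ==> olist xs & olist ys"
 unfolding JH_def by blast

lemma JH_rot: "rot xs xs' ==> rot ys ys' ==> JH s xs ys = JH s xs' ys'"
 unfolding JH_def olist_def
 using Jhom_rot[of xs xs' ys ys'] Jhom_rot[of "rev xs" "rev xs'" ys ys'] rot_rev[of xs xs']
  rot_distinct[of xs xs'] rot_distinct[of ys ys'] rot_length[of xs xs'] rot_length[of ys ys'] by simp

lemma JH_brauer: "x : JH s xs ys ==> x : brauer (set xs) (set ys)"
 unfolding JH_def olist_def using Jhom_brauer[of xs ys x] Jhom_brauer[of "rev xs" ys x] by auto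

lemma JH_cases:
 assumes "x : JH s xs ys"
 obtains xs' where "x : Jhom xs' ys" "distinct xs'" "set xs' = set xs" "length xs' = length xs" "xs' = xs \<or> s & xs' = rev xs"
 using assms that[of xs] that[of "rev xs"] unfolding JH_def olist_def by auto

lemma JH_mul:
 assumes x: "x : JH s xs ys" and y: "y : JH s ys zs"
 shows "cmp x y : JH s xs zs"
proof -
 have o: "olist xs" "olist ys" "olist zs" using JH_ob x y by blast+
 note d = o[unfolded olist_def]
 have c: "x : Jhom as bs ==> y : Jhom bs zs ==> distinct as ==> distinct bs ==> odd (length bs) ==> cmp x y : Jhom as zs" for as bs
  using Jhom_comp d by blast
 consider "x : Jhom xs ys" "y : Jhom ys zs" | "s" "x : Jhom (rev xs) ys" "y : Jhom ys zs"
  | "s" "x : Jhom xs ys" "y : Jhom (rev ys) zs" | "s" "x : Jhom (rev xs) ys" "y : Jhom (rev ys) zs"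
  using x y unfolding JH_def by blast
 thus ?thesis
 proof cases
  case 1
  thus ?thesis using c[of xs ys] d o JH_I by blast
 next
  case 2
  hence "cmp x y : Jhom (rev xs) zs" using c[of "rev xs" ys] d by simp
  thus ?thesis using 2 o unfolding JH_def by blast
 next
  case 3
  hence "x : Jhom (rev xs) (rev ys)" using Jhom_mirror by blast
  hence "cmp x y : Jhom (rev xs) zs" using c[of "rev xs" "rev ys"] d 3 by simp
  thus ?thesis using 3 o unfolding JH_def by blast
 next
  case 4
  hence "x : Jhom xs (rev ys)" using Jhom_mirror_left by blast
  hence "cmp x y : Jhom xs zs" using c[of xs "rev ys"] d 4 by simp
  thus ?thesis using o JH_I by blast
 qed
qed

lemma JH_bflip: "x : JH s xs ys ==> bflip x : JH s ys xs"
 using Jhom_bflip[of x xs ys] Jhom_bflip[of x "rev xs" ys] Jhom_mirror_left[of ys xs] unfolding JH_def by auto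

lemma brauer_no_cup_sets:
 assumes x: "x : brauer A B" and n: "!!a b. {Inl a, Inl b} ~: x" and K: "K : x"
 shows "\<not> K <= range Inl"
proof
 assume s: "K <= range Inl"
 obtain p q where "K = {p, q}" using brauer_block[OF x K] by blast
 thus False using n K s by auto
qed

lemma JH_unit:
 assumes x: "x : JH s xs ys" and r: "rank x = length xs" "length ys = length xs"
 shows "\<exists>f. inj_on f (set xs) & f ` set xs = set ys & x = bd f (set xs)"
proof -
 obtain xs' where xs': "x : Jhom xs' ys" "distinct xs'" "set xs' = set xs" using JH_cases[OF x] by metis
 have d: "distinct xs" "distinct ys" using JH_ob[OF x] unfolding olist_def by auto
 have b: "x : brauer (set xs) (set ys)" "bflip x : brauer (set ys) (set xs)" using JH_brauer[OF x] bflip_brauer by blast+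
 have n1: "{Inl a, Inl b} ~: x" for a b using rank_full_no_cups[OF b(1)] r(1) distinct_card[OF d(1)] by simp
 have n2: "{Inl a, Inl b} ~: bflip x" for a b
  using rank_full_no_cups[OF b(2)] r distinct_card[OF d(2)] by (simp add: rank_bflip)
 have "\<not> K <= range Inl & \<not> K <= range Inr" if K: "K : x" for K
 proof (intro conjI notI)
  assume "K <= range Inl" thus False using brauer_no_cup_sets[OF b(1) n1 K] by blast
 next
  assume "K <= range Inr"
  hence "swap_sum ` K <= range Inl" by auto
  moreover have "swap_sum ` K : bflip x" using K unfolding bflip_def by blast
  ultimately show False using brauer_no_cup_sets[OF b(2) n2] by blast
 qed
 from Jhom_unit[OF xs'(2) d(2) xs'(1) this] obtain f where
  "rot ys (map f xs')" "inj_on f (set xs')" "x = bd f (set xs')" by blast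
 thus ?thesis using xs'(3) rot_set by fastforce
qed

lemma olist_Cons2: "olist xs ==> rot xs (a # b # us) ==> olist us & a ~: set us & b ~: set us & a ~= b & length xs = length us + 2
  & set xs = insert a (insert b (set us))"
 using rot_Cons2[of xs a b us] unfolding olist_def by auto

lemma hooksE:
 assumes "et : hooks xs us"
 obtains a b where "et = hook (set us) a b" "rot xs (a # b # us)" "olist xs"
 using assms unfolding hooks_def by blast

lemma hooksI: "olist xs ==> rot xs (a # b # us) ==> hook (set us) a b : hooks xs us"
 unfolding hooks_def by blast

lemma hook_JH: "olist xs ==> rot xs (a # b # us) ==> hook (set us) a b : JH s xs us"
 by (rule JH_I[OF _ _ hook_Jhom]) (simp_all add: olist_Cons2)

text \<open>The list \<open>[undefined]\<close> provides a one-point object over any type of points,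
  independently of \<open>C\<close>. Factoring out a hook is the removal of an adjacent cup, which
  exists as soon as some upper point is off the transversals.\<close>

lemma hook_base_JH: "hook_base olist (JH s) cmp bflip idb rank length hooks [undefined]"
proof
 show "x : JH s X Y ==> olist X & olist Y" for x X Y by (rule JH_ob)
 show "x : JH s X Y ==> y : JH s Y Z ==> cmp x y : JH s X Z" for x X Y y Z by (rule JH_mul)
 show "cmp (cmp x y) z = cmp x (cmp y z)" for x y z :: "'a brauer" by (rule brauer_comp_assoc)
 show "olist X ==> idb X : JH s X X" for X using JH_I[OF _ _ one_Jhom] unfolding idb_def by blast
 show "x : JH s X Y ==> cmp (idb X) x = x" for x X Y unfolding idb_def by (rule one_comp[OF JH_brauer])
 show "x : JH s X Y ==> cmp x (idb Y) = x" for x X Y unfolding idb_def by (rule comp_one[OF JH_brauer])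
 show "x : JH s X Y ==> bflip x : JH s Y X" for x X Y by (rule JH_bflip)
 show "bflip (bflip x) = x" for x :: "'a brauer" by simp
 show "bflip (cmp x y) = cmp (bflip y) (bflip x)" for x y :: "'a brauer" by (rule bflip_comp)
 show "rank (cmp x y) <= rank x" if "x : JH s X Y" "y : JH s Y Z" for x X Y y Z
  using rank_comp_le[OF JH_brauer[OF that(1)] JH_brauer[OF JH_mul[OF that]]] by simp
 show "rank (bflip x) = rank x" for x :: "'a brauer" by (rule rank_bflip)
 show "olist X ==> rank (idb X) = length X" for X :: "'a list"
  unfolding idb_def olist_def by (simp add: rank_bd distinct_card)
 show "cmp x (bflip x) = idb X" if "x : JH s X Y" "rank x = length X" "length Y = length X" for x X Y
  using JH_unit[OF that] bd_bflip unfolding idb_def by blast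
 show "olist X ==> odd (length X)" for X :: "'a list" unfolding olist_def by blast
 show "EX g:JH s X Y. rank g = length X" if xy: "olist X" "olist Y" "length X = length Y" for X Y
 proof -
  obtain f where f: "Y = map f X" using distinct_map_ex[of X Y] xy unfolding olist_def by auto
  have "rot Y (map f X)" unfolding f by (rule rot_refl)
  hence "bd f (set X) : JH s X Y" by (intro JH_I[OF xy(1,2)] bd_Jhom)
  moreover have "inj_on f (set X)" using xy(2) f unfolding olist_def by (simp add: distinct_map)
  hence "rank (bd f (set X)) = length X" using xy(1) unfolding olist_def by (simp add: rank_bd distinct_card)
  ultimately show ?thesis by blast
 qed
 show "olist [undefined]" "length [undefined] = 1" by (simp_all add: olist_def)
 show "x = idb [undefined]" if "x : JH s [undefined] [undefined]" for x :: "'a brauer"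
 proof -
  have b: "x : brauer {undefined} {undefined}" using JH_brauer[OF that] by simp
  let ?K = "{Inl undefined, Inr undefined} :: ('a + 'a) set"
  obtain K where K: "K : x" "Inl undefined : K" using brauer_cover(1)[OF b] by blast
  obtain p q where pq: "p ~= q" "K = {p, q}" using brauer_block[OF b K(1)] by blast
  have sub: "L <= ?K" if L: "L : x" for L
   using brauerD[OF b] L unfolding partition_on_def by blast
  have KK: "K = ?K" using sub[OF K(1)] pq K(2) by auto
  have "L = K" if L: "L : x" for L
  proof -
   obtain p q where "L = {p, q}" using brauer_block[OF b L] by blast
   hence "p : K" using sub[OF L] KK by auto
   thus ?thesis using brauer_unique[OF b L K(1), of p] \<open>L = {p, q}\<close> by auto
  qed
  hence "x = {K}" using K(1) by blast
  thus ?thesis using KK unfolding idb_def bd_def by auto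
 qed
 show "et : JH s X W & cmp (bflip et) et = idb W & length X = length W + 2" if "et : hooks X W" for et X W
  using that
 proof (rule hooksE)
  fix a b assume h: "et = hook (set W) a b" "rot X (a # b # W)" "olist X"
  show ?thesis using hook_JH[OF h(3,2)] hook_cancel[of a "set W" b] olist_Cons2[OF h(3,2)] h(1) unfolding idb_def by simp
 qed
 show "\<exists>W. \<exists>et\<in>hooks X W. cmp et (cmp (bflip et) x) = x" if x: "x : JH s X Y" and r: "rank x ~= length X" for x X Y
 proof -
  have o: "olist X" "olist Y" using JH_ob[OF x] by auto
  have b: "x : brauer (set X) (set Y)" using JH_brauer[OF x] .
  have "thr x ~= set X" using rank_thr(1)[OF b] r o distinct_card[of X] unfolding olist_def by auto
  then obtain c e where "{Inl c, Inl e} : x" using thr_iff[OF b] rank_thr(2)[OF b] by blast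
  hence K: "{Inl c, Inl e} : x" "{Inl c, Inl e} <= range Inl" by auto
  obtain X' where X': "x : Jhom X' Y" "distinct X'" "set X' = set X" "length X' = length X" "X' = X \<or> s & X' = rev X"
   using JH_cases[OF x] by metis
  obtain a b us x' where f: "rot X' (a # b # us)" "x' : Jhom us Y" "x = insert {Inl a, Inl b} x'"
   using Jhom_factor[OF X'(1) K] by blast
  have dY: "distinct Y" using o unfolding olist_def by blast
  let ?h = "hook (set us) a b"
  have "cmp ?h (cmp (bflip ?h) x) = x"
   using hook_cancel_mul[OF f(1) X'(2) dY f(2)] hook_mul[OF f(1) X'(2) dY f(2)] f(3) by simp
  moreover have "\<exists>W. ?h : hooks X W"
  proof (cases "X' = X")
   case True
   thus ?thesis using f hooksI[OF o(1)] by blast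
  next
   case False
   \<comment> \<open>An adjacent pair of the reversed circle is one of the original circle with its
     points exchanged, and a hook is symmetric in its two points.\<close>
   hence "rot (rev X) (a # b # us)" using f X' by blast
   hence "rot X (rev us @ [b, a])" using rot_rev[of "rev X" "a # b # us"] by simp
   hence "rot X (b # a # rev us)" using rot_trans rot_append[of "rev us" "[b, a]"] by auto
   from hooksI[OF o(1) this] show ?thesis by (auto simp: hook_commute)
  qed
  ultimately show ?thesis by blast
 qed
 show "\<exists>W. hooks X W ~= {}" if X: "olist X" "3 <= length X" for X :: "'a list"
 proof -
  obtain a X1 where "X = a # X1" using X by (cases X) auto
  moreover obtain b us where "X1 = b # us" using X calculation by (cases X1) auto
  ultimately show ?thesis using hooksI[OF X(1), of a b us] by auto
 qed
qed

lemma brauer_remove: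
 assumes x: "x : brauer (insert a (insert b W)) Y" and K: "{Inl a, Inl b} : x" and ab: "a ~: W" "b ~: W"
 shows "x - {{Inl a, Inl b}} : brauer W Y"
proof -
 let ?K = "{Inl a, Inl b}"
 have d: "disjoint x" "\<Union>x = insert a (insert b W) <+> Y" "{} ~: x" using brauerD[OF x] unfolding partition_on_def by auto
 have "\<Union>(x - {?K}) = \<Union>x - ?K" using brauer_unique[OF x _ K] by blast
 also have "\<dots> = W <+> Y" unfolding d(2) using ab by auto
 finally have "\<Union>(x - {?K}) = W <+> Y" .
 moreover have "disjoint (x - {?K})" using d(1) unfolding disjoint_def by blast
 ultimately show ?thesis using d(3) brauer_card[OF x] unfolding brauer_def partition_on_def by blast
qed

lemma hook_has_cup: "hook W a b : brauer X Y ==> {Inl a, Inl b} : cmp (hook W a b) y"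
 by (rule comp_cup_persist[OF brauerD]) (auto simp: hook_def)

text \<open>Dictionary between the algebraic condition in \<open>factor\<close> and the presence of
  a block: a hook projection creates its cup in every product, and a cup already present can be
  taken off and put back.\<close>

lemma cup_hook_iff:
 assumes x: "x : brauer (set xs) Y" and r: "rot xs (a # b # us)" and o: "olist xs"
 shows "{Inl a, Inl b} : x \<longleftrightarrow> cmp (hook (set us) a b) (cmp (bflip (hook (set us) a b)) x) = x"
proof
 note u = olist_Cons2[OF o r]
 let ?h = "hook (set us) a b"
 assume K: "{Inl a, Inl b} : x"
 have x': "x - {{Inl a, Inl b}} : brauer (set us) Y" using brauer_remove[of x a b "set us" Y] x K u by simp
 have e: "cmp ?h (x - {{Inl a, Inl b}}) = x" using hook_comp[OF x'] u K by auto
 have "cmp (bflip ?h) x = x - {{Inl a, Inl b}}"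
  using hook_cancel[of a "set us" b] u one_comp[OF x'] e by (metis brauer_comp_assoc)
 thus "cmp ?h (cmp (bflip ?h) x) = x" using e by simp
next
 assume "cmp (hook (set us) a b) (cmp (bflip (hook (set us) a b)) x) = x"
 moreover have "hook (set us) a b : brauer (set xs) (set us)" using hook_brauer[of a "set us" b] olist_Cons2[OF o r] by auto
 ultimately show "{Inl a, Inl b} : x" using hook_has_cup by metis
qed

lemma bd_cup_iff:
 assumes f: "inj_on f W" and x: "x : brauer (f ` W) Y" and pq: "p : W" "q : W"
 shows "{Inl p, Inl q} : cmp (bd f W) x \<longleftrightarrow> {Inl (f p), Inl (f q)} : x"
proof -
 let ?g = "the_inv_into W f"
 note gf = the_inv_into_f_f[OF f]
 have e: "cmp (bd f W) x = relabel ?g x" by (rule bd_comp[OF f x])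
 show ?thesis unfolding e
 proof
  assume "{Inl (f p), Inl (f q)} : x"
  hence "map_sum ?g id ` {Inl (f p), Inl (f q)} : relabel ?g x" unfolding relabel_def by blast
  thus "{Inl p, Inl q} : relabel ?g x" using gf pq by simp
 next
  assume "{Inl p, Inl q} : relabel ?g x"
  then obtain K where K: "K : x" "{Inl p, Inl q} = map_sum ?g id ` K" unfolding relabel_def by blast
  have el: "EX w:W. v = Inl (f w) & map_sum ?g id v = Inl w" if v: "v : K" for v
  proof (cases v)
   case (Inl c)
   then obtain w where "w : W" "c = f w" using brauer_sub(1)[OF x K(1)] v by blast
   thus ?thesis using Inl gf by auto
  next
   case (Inr c)
   hence "map_sum ?g id v = Inr c" by simp
   thus ?thesis using K(2) v by (metis Inl_Inr_False image_eqI insertE singletonD)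
  qed
  have "K = {Inl (f p), Inl (f q)}"
  proof (rule subset_antisym; rule subsetI)
   fix v assume v: "v : K"
   then obtain w where w: "w : W" "v = Inl (f w)" "map_sum ?g id v = Inl w" using el by blast
   hence "Inl w : {Inl p, Inl q :: 'a + 'a}" using K(2) v by (metis image_eqI)
   thus "v : {Inl (f p), Inl (f q)}" using w by auto
  next
   fix v assume v: "v : {Inl (f p), Inl (f q) :: 'a + 'a}"
   have "Inl t : map_sum ?g id ` K ==> Inl (f t) : K" for t
   proof -
    assume "Inl t : map_sum ?g id ` K"
    then obtain v' where "v' : K" "map_sum ?g id v' = Inl t" by auto
    thus "Inl (f t) : K" using el by fastforce
   qed
   thus "v : K" using v K(2) by blast
  qed
  thus "{Inl (f p), Inl (f q)} : x" using K by simp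
 qed
qed

lemma rot_move: "rot xs (us @ vs) ==> rot xs (vs @ us)"
 using rot_trans rot_append by blast

section \<open>The hook axioms for the Jones and anti-Jones categories\<close>

context fixes s :: bool and dummy :: "'a itself" begin

interpretation B: hook_base olist "JH s :: 'a list => _" cmp bflip idb rank length hooks "[undefined]"
 by (rule hook_base_JH)

lemma unit_bd_JH:
 fixes xs :: "'a list"
 assumes "olist xs" "olist ys" "rot ys (map f xs)"
 shows "bd f (set xs) : JH s xs ys" "rank (bd f (set xs)) = length xs" "inj_on f (set xs)" "f ` set xs = set ys"
  "bd f (set xs) : B.coiso xs ys" "length ys = length xs"
proof -
 show 1: "bd f (set xs) : JH s xs ys" using JH_I[OF assms(1,2) bd_Jhom[OF assms(3)]] .
 show 2: "inj_on f (set xs)" using rot_distinct[OF assms(3)] assms by (simp add: distinct_map olist_def)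
 show 3: "rank (bd f (set xs)) = length xs" using 2 assms by (simp add: rank_bd distinct_card olist_def)
 show 4: "length ys = length xs" using rot_length[OF assms(3)] by simp
 show "f ` set xs = set ys" using rot_set[OF assms(3)] by simp
 show "bd f (set xs) : B.coiso xs ys" by (rule B.unit_coiso[OF 1 3 4])
qed

text \<open>The unit that turns the circle by two places converts the hook at \<open>a\<close>,
  \<open>b\<close> into the one at \<open>c\<close>, \<open>d\<close>. The two pairs are disjoint,
  so the hooks slide past each other and the compression factors through \<open>V\<close>, which has
  two points fewer than \<open>W\<close>.\<close>

lemma JH_gen:
 fixes xs :: "'a list"
 assumes et: "et : hooks xs W" and l: "length xs >= 5"
 shows "EX g:JH s xs xs. rank g = length xs & rank (cmp (bflip et) (cmp g et)) < length W"
proof -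
 obtain a b where h: "et = hook (set W) a b" "rot xs (a # b # W)" and o: "olist xs" using et by (rule hooksE)
 note u = olist_Cons2[OF o h(2)]
 have dx: "distinct (a # b # W)" using u unfolding olist_def by auto
 obtain c d V where W: "W = c # d # V"
 proof -
  obtain c W1 where "W = c # W1" using u l by (cases W) auto
  moreover obtain d V where "W1 = d # V" using u l calculation by (cases W1) auto
  ultimately show ?thesis using that by simp
 qed
 obtain f where f: "a # b # c # d # V = map f (c # d # V @ [a, b])"
  using distinct_map_ex[of "c # d # V @ [a, b]" "a # b # c # d # V"] dx unfolding W by auto
 have r0: "rot xs (a # b # c # d # V)" using h W by simp
 hence r1: "rot xs (c # d # V @ [a, b])" using rot_move[of xs "[a, b]" "c # d # V"] by simp
 have "rot xs (map f xs)" using rot_trans[OF r0] rot_sym[OF rot_map[OF r1, of f]] f by simp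
 note G = unit_bd_JH[OF o o this]
 let ?g = "bd f (set xs)" and ?i = "the_inv_into (set xs) f"
 have fv: "f c = a" "f d = b" "map f (V @ [a, b]) = W" using f W by auto
 have cd: "c : set xs" "d : set xs" "set (V @ [a, b]) <= set xs" using u W by auto
 have i: "?i a = c" "?i b = d" using the_inv_into_f_f[OF G(3)] fv cd by metis+
 have "?i ` set W = set (V @ [a, b])"
  unfolding fv(3)[symmetric] set_map image_image using the_inv_into_f_f[OF G(3)] cd(3) by (auto simp: subset_iff image_iff)
 moreover have "set (V @ [a, b]) = insert a (insert b (set V))" by auto
 ultimately have iW: "?i ` set W = insert a (insert b (set V))" by simp
 let ?u = "bd f (insert a (insert b (set V)))"
 have fX: "f ` set xs = insert a (insert b (set W))" using G(4) u by simp
 have gh: "cmp ?g et = cmp (hook (insert a (insert b (set V))) c d) ?u"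
  using bd_hook(1)[OF G(3) fX] u unfolding h(1) i iW by blast
 have "a ~: set V" "b ~: set V" "c ~: set V" "d ~: set V" "distinct [a, b, c, d]" using dx W by auto
 hence "cmp (bflip et) (hook (insert a (insert b (set V))) c d) = cmp (hook (set V) c d) (bflip (hook (set V) a b))"
  using hook_far[of a "set V" b c d] h(1) W by simp
 hence rk_e: "cmp (bflip et) (cmp ?g et) = cmp (hook (set V) c d) (cmp (bflip (hook (set V) a b)) ?u)"
  using brauer_comp_assoc unfolding gh by metis
 have oV: "olist V" and oW: "olist W" using u W unfolding olist_def by auto
 have hv: "hook (set V) c d : JH s W V" using hook_JH[OF oW, of c d V] W by simp
 have oabV: "olist (a # b # V)" using dx u W unfolding olist_def by auto
 have hv2: "bflip (hook (set V) a b) : JH s V (a # b # V)" using JH_bflip[OF hook_JH[OF oabV, of a b V]] by simp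
 have "bd f (set (V @ [a, b])) : JH s (V @ [a, b]) W"
  using unit_bd_JH(1)[of "V @ [a, b]" W f] fv oW dx W unfolding olist_def by auto
 moreover have "JH s (V @ [a, b]) W = JH s (a # b # V) W" using JH_rot[OF rot_append[of V "[a, b]"] rot_refl[of W]] by simp
 ultimately have hv3: "?u : JH s (a # b # V) W" using \<open>set (V @ [a, b]) = _\<close> by simp
 have "rank (cmp (hook (set V) c d) (cmp (bflip (hook (set V) a b)) ?u)) <= rank (hook (set V) c d)"
  using B.rk_mul1[OF hv JH_mul[OF hv2 hv3]] .
 also have "\<dots> <= length V" using B.rk_le2[OF hv] .
 finally have "rank (cmp (bflip et) (cmp ?g et)) < length W" using rk_e W by simp
 thus ?thesis using G(1,2) by blast
qed

lemma rot_neighbours: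
 assumes "a : set xs" "length xs >= 3"
 shows "\<exists>z b us. rot xs (z # a # b # us)"
proof -
 obtain p q where "xs = p @ a # q" using assms(1) by (meson split_list)
 hence r: "rot xs (a # q @ p)" using rot_append[of p "a # q"] by simp
 hence "length (q @ p) >= 2" using rot_length[OF r] assms(2) by simp
 then obtain b us z where e: "q @ p = b # us @ [z]"
  by (cases "q @ p" rule: rev_cases; cases "butlast (q @ p)") auto
 hence "rot xs ((a # b # us) @ [z])" using r by simp
 from rot_move[OF this] show ?thesis by auto
qed

text \<open>A unit that fixes all hook projections preserves every adjacent pair as a set. Each
  point is the intersection of its two adjacent pairs, which differ once there are three points, so
  it is fixed.\<close>

lemma JH_unit_move:
 fixes xs :: "'a list"
 assumes g: "g : JH s xs xs" "rank g = length xs" "length xs >= 3" "g ~= idb xs"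
 shows "\<exists>W. \<exists>et\<in>hooks xs W. cmp g (cmp et (cmp (bflip et) (bflip g))) ~= cmp et (bflip et)"
proof (rule ccontr)
 assume "\<not> ?thesis"
 hence all: "et : hooks xs W ==> cmp g (cmp et (cmp (bflip et) (bflip g))) = cmp et (bflip et)" for W et by blast
 have o: "olist xs" using JH_ob g(1) by blast
 obtain f where f: "inj_on f (set xs)" "f ` set xs = set xs" "g = bd f (set xs)" using JH_unit[OF g(1,2)] by blast
 let ?i = "the_inv_into (set xs) f"
 have pres: "{?i a, ?i b} = {a, b}" if r: "rot xs (a # b # us)" for a b us
 proof -
  note u = olist_Cons2[OF o r]
  let ?h = "hook (set us) a b"
  have fX: "f ` set xs = insert a (insert b (set us))" using f(2) u by simp
  have gh: "cmp g ?h = cmp (hook (?i ` set us) (?i a) (?i b)) (bd f (?i ` set us))"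
   unfolding f(3) using bd_hook(1)[OF f(1) fX] u by blast
  have hb: "hook (?i ` set us) (?i a) (?i b) : brauer (insert (?i a) (insert (?i b) (?i ` set us))) (?i ` set us)"
   by (rule hook_brauer) (use bd_hook(3,4,5)[OF f(1) fX] u in blast)+
  have "{Inl (?i a), Inl (?i b)} : cmp (cmp g ?h) (cmp (bflip ?h) (bflip g))"
   unfolding gh brauer_comp_assoc[of "hook (?i ` set us) (?i a) (?i b)"] by (rule hook_has_cup[OF hb])
  hence "{Inl (?i a), Inl (?i b)} : cmp ?h (bflip ?h)" using all[OF hooksI[OF o r]] by (simp add: brauer_comp_assoc)
  also have "cmp ?h (bflip ?h) = insert {Inl a, Inl b} (bflip ?h)"
   using hook_comp[OF JH_brauer[OF JH_bflip[OF hook_JH[OF o r]]], of a b] u by simp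
  finally have m: "{Inl (?i a), Inl (?i b)} = {Inl a, Inl b :: 'a + 'a} \<or> {Inl (?i a), Inl (?i b)} : bflip ?h" by (simp only: insert_iff)
  have "\<exists>v. Inr v : K" if "K : bflip ?h" for K using that unfolding bflip_hook bd_def by auto
  hence "{Inl p, Inl q} ~: bflip ?h" for p q by (metis Inl_Inr_False insertE singletonD)
  hence "{Inl (?i a), Inl (?i b)} = {Inl a, Inl b :: 'a + 'a}" using m by metis
  thus ?thesis by (auto simp: doubleton_eq_iff)
 qed
 have "?i a = a" if a: "a : set xs" for a
 proof -
  obtain z b us where r: "rot xs (z # a # b # us)" using rot_neighbours[OF a g(3)] by blast
  hence r': "rot xs (a # b # us @ [z])" using rot_move[of xs "[z]" "a # b # us"] by simp
  have "z ~= b" using rot_distinct[OF r] o unfolding olist_def by auto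
  thus ?thesis using pres[OF r] pres[OF r'] by (auto simp: doubleton_eq_iff)
 qed
 hence "f a = a" if "a : set xs" for a using that f_the_inv_into_f[OF f(1)] f(2) by metis
 hence "g = idb xs" unfolding f(3) idb_def by (intro bd_cong) simp
 thus False using g(4) by blast
qed

lemma far_meet:
 fixes xs :: "'a list"
 assumes o: "olist xs" and r: "rot xs (a # b # p @ c # d # q)"
 shows "hook (set (p @ q)) c d : JH s (p @ c # d # q) (p @ q)" "hook (set (p @ q)) a b : JH s (q @ a # b # p) (p @ q)"
  "cmp (hook (set (p @ c # d # q)) a b) (hook (set (p @ q)) c d) =
  cmp (hook (set (q @ a # b # p)) c d) (hook (set (p @ q)) a b)"
  "rot xs (c # d # q @ a # b # p)"
proof -
 show r': "rot xs (c # d # q @ a # b # p)" using rot_move[of xs "a # b # p" "c # d # q"] r by simp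
 have o1: "olist (p @ c # d # q)" "olist (q @ a # b # p)" using olist_Cons2[OF o r] olist_Cons2[OF o r'] by auto
 have s1: "rot (p @ c # d # q) (c # d # q @ p)" "rot (q @ a # b # p) (a # b # p @ q)"
  using rot_append[of p "c # d # q"] rot_append[of q "a # b # p"] by simp_all
 have qp: "JH s xs (q @ p) = JH s xs (p @ q)" for xs using JH_rot[OF rot_refl rot_append] by blast
 show h1: "hook (set (p @ q)) c d : JH s (p @ c # d # q) (p @ q)"
  using hook_JH[OF o1(1) s1(1), where s = s] unfolding qp by (simp add: Un_commute)
 show h2: "hook (set (p @ q)) a b : JH s (q @ a # b # p) (p @ q)" using hook_JH[OF o1(2) s1(2)] .
 have "cmp (hook (set (p @ c # d # q)) a b) (hook (set (p @ q)) c d) = insert {Inl a, Inl b} (hook (set (p @ q)) c d)"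
  using hook_comp[OF JH_brauer[OF h1]] olist_Cons2[OF o r] by blast
 moreover have "cmp (hook (set (q @ a # b # p)) c d) (hook (set (p @ q)) a b) = insert {Inl c, Inl d} (hook (set (p @ q)) a b)"
  using hook_comp[OF JH_brauer[OF h2]] olist_Cons2[OF o r'] by blast
 ultimately show "cmp (hook (set (p @ c # d # q)) a b) (hook (set (p @ q)) c d) =
  cmp (hook (set (q @ a # b # p)) c d) (hook (set (p @ q)) a b)" unfolding hook_def by (simp add: insert_commute)
qed

text \<open>Half of the axiom \<open>meet\<close>: the two hooks have a common right multiple. Its
  symmetry halves the case distinction by relative position.\<close>

definition meets :: "'a list => 'a list => 'a brauer => 'a list => 'a brauer => bool" where
 "meets X W et W' et' \<longleftrightarrow> (\<exists>V a b. a : JH s W V & b : JH s W' V & cmp et a = cmp et' b)"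

lemma meets_sym: "meets X W et W' et' ==> meets X W' et' W et"
 unfolding meets_def by metis

lemma far_meets:
 fixes xs :: "'a list"
 assumes "olist xs" "rot xs (a # b # p @ c # d # q)"
 shows "meets xs (p @ c # d # q) (hook (set (p @ c # d # q)) a b) (q @ a # b # p) (hook (set (q @ a # b # p)) c d)"
 unfolding meets_def using far_meet(1,2,3)[OF assms] by blast

lemma meets_refl: "et : JH s X W ==> meets X W et W et"
 unfolding meets_def using B.one_in JH_ob by blast

text \<open>Overlapping hooks are linked through a third one: from five points on there is an
  adjacent pair \<open>e\<close>, \<open>f\<close> disjoint from both, and disjoint hooks
  meet.\<close>

lemma adjacent_meets:
 fixes xs :: "'a list"
 assumes o: "olist xs" and l: "length xs >= 5" and r: "rot xs (a # b # d # ts)"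
 shows "\<exists>W''. \<exists>et''\<in>hooks xs W''. meets xs (d # ts) (hook (set (d # ts)) a b) W'' et'' &
  meets xs W'' et'' (ts @ [a]) (hook (set (ts @ [a])) b d)"
proof -
 obtain e f us where ts: "ts = e # f # us"
 proof -
  obtain e t1 where "ts = e # t1" using rot_length[OF r] l by (cases ts) auto
  moreover obtain f us where "t1 = f # us" using rot_length[OF r] l calculation by (cases t1) auto
  ultimately show ?thesis using that by simp
 qed
 have r1: "rot xs (a # b # [d] @ e # f # us)" using r ts by simp
 have r2: "rot xs (b # d # [] @ e # f # (us @ [a]))" using rot_move[of xs "[a]" "b # d # e # f # us"] r ts by simp
 let ?W = "us @ a # b # [d]" 
 have m1: "meets xs (d # ts) (hook (set (d # ts)) a b) ?W (hook (set ?W) e f)" using far_meets[OF o r1] ts by simp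
 have m2: "meets xs (ts @ [a]) (hook (set (ts @ [a])) b d) ?W (hook (set ?W) e f)" using far_meets[OF o r2] ts by simp
 have "hook (set ?W) e f : hooks xs ?W" using hooksI[OF o far_meet(4)[OF o r1]] by simp
 thus ?thesis using m1 meets_sym[OF m2] by blast
qed

lemma JH_meet:
 fixes xs :: "'a list"
 assumes et: "et : hooks xs W" "et' : hooks xs W'" and l: "length xs >= 5"
 shows "\<exists>W''. \<exists>et''\<in>hooks xs W''. meets xs W et W'' et'' & meets xs W'' et'' W' et'"
proof -
 obtain a b where h: "et = hook (set W) a b" "rot xs (a # b # W)" and o: "olist xs" using et(1) by (rule hooksE)
 obtain c d where h': "et' = hook (set W') c d" "rot xs (c # d # W')" using et(2) by (rule hooksE)
 have dx: "distinct xs" "odd (length xs)" using o unfolding olist_def by auto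
 have H: "et : JH s xs W" "et' : JH s xs W'" using B.hkD et by blast+
 from h(2) h'(2) dx show ?thesis
 proof (cases rule: adjacent_cases)
  case same
  thus ?thesis using h h' et meets_refl[OF H(1)] by auto
 next
  case (succ ts)
  thus ?thesis using adjacent_meets[OF o l, of a b d ts] h h' by simp
 next
  case (prev ts)
  hence "\<exists>W''. \<exists>et''\<in>hooks xs W''. meets xs W' et' W'' et'' & meets xs W'' et'' W et"
   using adjacent_meets[OF o l, of c d b ts] h h' by simp
  thus ?thesis using meets_sym by blast
 next
  case (far p q)
  have "meets xs W et W' et'" using far_meets[OF o, of a b p c d q] h h' far by simp
  thus ?thesis using et(1) meets_refl[OF H(1)] by blast
 qed
qed

text \<open>Such a partition is determined by the upper point that carries the transversal.\<close>

lemma brauer_three: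
 assumes t: "t : brauer {x, y, z} {u}" and d: "distinct [x, y, z]"
 shows "t : {{{Inl x, Inr u}, {Inl y, Inl z}}, {{Inl y, Inr u}, {Inl z, Inl x}}, {{Inl z, Inr u}, {Inl x, Inl y}}}"
proof -
 have U: "\<Union>t = {Inl x, Inl y, Inl z, Inr u}" using brauerD[OF t] unfolding partition_on_def by auto
 obtain K where K: "K : t" "Inr u : K" using brauer_cover(2)[OF t] by blast
 obtain p where p: "K = {p, Inr u}" "p ~= Inr u" using brauer_block[OF t K(1)] K(2) by auto
 have "p : \<Union>t" using K p by auto
 then consider "p = Inl x" | "p = Inl y" | "p = Inl z" using U p by auto
 hence "\<exists>c a b. p = Inl c & (c, a, b) : {(x, y, z), (y, z, x), (z, x, y)}" by cases blast+
 then obtain c a b where c: "p = Inl c" "(c, a, b) : {(x, y, z), (y, z, x), (z, x, y)}" by blast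
 from c(2) d have "{x, y, z} = {c, a, b} & distinct [c, a, b]" by (elim insertE emptyE) (auto simp: insert_commute)
 with c have c: "p = Inl c" "{x, y, z} = {c, a, b}" "distinct [c, a, b]" "(c, a, b) : {(x, y, z), (y, z, x), (z, x, y)}" by simp_all
 have "\<Union>t = insert (Inr u) (Inl ` {x, y, z})" using U by auto
 hence Uc: "\<Union>t = {Inl c, Inl a, Inl b, Inr u}" unfolding c(2) by auto
 have a: "a : {x, y, z}" unfolding c(2) by simp
 obtain L where L: "L : t" "Inl a : L" using brauer_cover(1)[OF t a] by (rule bexE)
 obtain q where q: "L = {Inl a, q}" "q ~= Inl a" using brauer_block[OF t L(1)] L(2) by auto
 have "q : \<Union>t" using L q by auto
 moreover have "q ~= Inl c" "q ~= Inr u" using brauer_unique[OF t K(1) L(1), of q] p c q by auto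
 ultimately have "q = Inl b" using Uc q by auto
 hence KL: "K = {Inl c, Inr u}" "L = {Inl a, Inl b}" using p c q by auto
 have "M = K \<or> M = L" if M: "M : t" for M
 proof -
  obtain v where v: "v : M" using brauer_block[OF t M] by blast
  hence "v : K \<or> v : L" using M Uc KL by blast
  thus ?thesis using brauer_unique[OF t M K(1) v] brauer_unique[OF t M L(1) v] by blast
 qed
 hence "t = {K, L}" using K L by blast
 hence "t = {{Inl c, Inr u}, {Inl a, Inl b}}" using KL by simp
 moreover from c(4) have "{{Inl c, Inr u}, {Inl a, Inl b}} : {{{Inl x, Inr u}, {Inl y, Inl z}}, {{Inl y, Inr u}, {Inl z, Inl x}}, {{Inl z, Inr u}, {Inl x, Inl y}}}"
  by (elim insertE emptyE) simp_all
 ultimately show ?thesis by (simp only:)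
qed

text \<open>\<tau> is the rotation of the three points; it moves the upper end of the transversal
  around and so permutes the three possible partitions cyclically.\<close>

lemma JH_three:
 fixes T :: "'a list"
 assumes T: "olist T" "length T = 3"
 shows "\<exists>\<tau>\<in>JH s T T. ALL t:JH s T [undefined]. cmp \<tau> (cmp \<tau> (cmp \<tau> t)) = t & cmp \<tau> t ~= t &
    (ALL s':JH s T [undefined]. s' = t \<or> s' = cmp \<tau> t \<or> s' = cmp \<tau> (cmp \<tau> t))"
proof -
 obtain x y z where xyz: "T = [x, y, z]" using T(2) by (auto simp: numeral_3_eq_3 length_Suc_conv)
 have d: "distinct [x, y, z]" using T xyz unfolding olist_def by simp
 let ?u = "undefined :: 'a"
 obtain f where f: "[z, x, y] = map f [x, y, z]" using distinct_map_ex[of "[x, y, z]" "[z, x, y]"] d by auto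
 have "rot T (map f T)" unfolding xyz f[symmetric] using rot_append[of "[x, y]" "[z]"] by simp
 note G = unit_bd_JH[OF T(1) T(1) this]
 let ?\<tau> = "bd f (set T)" and ?g = "the_inv_into (set T) f"
 have fv: "f x = z" "f y = x" "f z = y" using f[symmetric] by (simp_all only: list.map list.inject)
 have g: "?g z = x" "?g x = y" "?g y = z" using the_inv_into_f_f[OF G(3)] fv xyz by (metis list.set_intros)+
 have mul: "cmp ?\<tau> t = relabel ?g t" if "t : brauer {x, y, z} {?u}" for t
  using bd_comp[OF G(3), of t "{?u}"] that G(4) xyz by simp
 let ?A = "{{Inl x, Inr ?u}, {Inl y, Inl z}}" and ?B = "{{Inl y, Inr ?u}, {Inl z, Inl x}}" and ?C = "{{Inl z, Inr ?u}, {Inl x, Inl y}}"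
 have rel: "relabel ?g ?A = ?B" "relabel ?g ?B = ?C" "relabel ?g ?C = ?A" unfolding relabel_def using g by simp_all
 have ne: "?A ~= ?B" "?B ~= ?C" "?C ~= ?A" using d by (auto simp: doubleton_eq_iff)
 have H: "t : {?A, ?B, ?C}" "t : brauer {x, y, z} {?u}" if "t : JH s T [?u]" for t
 proof -
  show b: "t : brauer {x, y, z} {?u}" using JH_brauer[OF that] xyz by simp
  show "t : {?A, ?B, ?C}" by (rule brauer_three[OF b d])
 qed
 have m: "cmp ?\<tau> t = relabel ?g t" "cmp ?\<tau> t : JH s T [?u]" if "t : JH s T [?u]" for t
  using mul H(2)[OF that] JH_mul[OF G(1) that] by blast+
 show ?thesis
 proof (intro bexI[OF _ G(1)] ballI conjI)
  fix t assume t: "t : JH s T [?u]"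
  have e: "cmp ?\<tau> t = relabel ?g t" "cmp ?\<tau> (cmp ?\<tau> t) = relabel ?g (relabel ?g t)"
   "cmp ?\<tau> (cmp ?\<tau> (cmp ?\<tau> t)) = relabel ?g (relabel ?g (relabel ?g t))"
   using m[OF t] m[OF m(2)[OF t]] m[OF m(2)[OF m(2)[OF t]]] by simp_all
  have cs: "t = ?A \<or> t = ?B \<or> t = ?C" using H(1)[OF t] by (simp only: insert_iff empty_iff simp_thms)
  show "cmp ?\<tau> (cmp ?\<tau> (cmp ?\<tau> t)) = t" unfolding e(3) using cs by (elim disjE) (simp_all only: rel)
  show "cmp ?\<tau> t ~= t" unfolding e(1) using cs by (elim disjE) (simp_all only: rel not_sym[OF ne(1)] not_sym[OF ne(2)] not_sym[OF ne(3)] not_False_eq_True)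
  fix s' assume s': "s' : JH s T [?u]"
  have "s' = ?A \<or> s' = ?B \<or> s' = ?C" using H(1)[OF s'] by (simp only: insert_iff empty_iff simp_thms)
  thus "s' = t \<or> s' = cmp ?\<tau> t \<or> s' = cmp ?\<tau> (cmp ?\<tau> t)"
   unfolding e(2) unfolding e(1) using cs by (elim disjE) (simp_all only: rel simp_thms)
 qed
qed

text \<open>Equal projections make \<open>y\<close> a right multiple of \<open>x\<close>, and upper
  cups persist under right multiplication.\<close>

lemma proj_cups:
 fixes xs :: "'a list"
 assumes x: "x : JH s xs Z" and y: "y : JH s xs Z'" and e: "cmp x (bflip x) = cmp y (bflip y)"
  and K: "{Inl a, Inl b} : x"
 shows "{Inl a, Inl b} : y"
proof -
 have "y = cmp x (cmp (bflip x) y)" using B.regular[OF y] e by (metis brauer_comp_assoc)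
 thus ?thesis using comp_cup_persist[OF brauerD[OF JH_brauer[OF x]] K] by (metis insert_subset empty_subsetI rangeI)
qed

lemma far_cup:
 fixes xs :: "'a list"
 assumes o: "olist xs" and r: "rot xs (a # b # p @ c # d # q)" and x: "x : JH s xs Z" and K: "{Inl a, Inl b} : x"
 shows "{Inl a, Inl b} : cmp (bflip (hook (set (q @ a # b # p)) c d)) x"
proof -
 note u = olist_Cons2[OF o r]
 let ?h = "hook (set (p @ c # d # q)) a b" and ?V = "set p Un set q"
 have x1: "x = cmp ?h (cmp (bflip ?h) x)" using cup_hook_iff[OF JH_brauer[OF x] r o] K by simp
 have dist: "c ~: ?V" "d ~: ?V" "a ~: ?V" "b ~: ?V" "distinct [c, d, a, b]" using u unfolding olist_def by auto
 have "set (p @ c # d # q) = insert c (insert d ?V)" "set (q @ a # b # p) = insert a (insert b ?V)" by auto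
 hence "cmp (bflip (hook (set (q @ a # b # p)) c d)) ?h = cmp (hook ?V a b) (bflip (hook ?V c d))"
  using hook_far[OF dist] by simp
 hence "cmp (bflip (hook (set (q @ a # b # p)) c d)) x =
   cmp (hook ?V a b) (cmp (bflip (hook ?V c d)) (cmp (bflip ?h) x))"
  using x1 by (metis brauer_comp_assoc)
 moreover have "hook ?V a b : brauer (insert a (insert b ?V)) ?V" by (rule hook_brauer) (use dist in auto)
 ultimately show ?thesis using hook_has_cup by metis
qed

text \<open>The negation of the conclusion of \<open>sep\<close>, prepared for a proof by
  contradiction: no hook tells \<open>x\<close> and \<open>y\<close> apart.\<close>

definition insep :: "'a list => 'a list => 'a brauer => 'a brauer => bool" where
 "insep xs Z x y \<longleftrightarrow> (\<forall>W. \<forall>et\<in>hooks xs W. rank (cmp (bflip et) x) = length Z \<or> rank (cmp (bflip et) y) = length Z -->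
  rank (cmp (bflip et) x) = length Z & rank (cmp (bflip et) y) = length Z &
  cmp (cmp (bflip et) x) (bflip (cmp (bflip et) x)) =
  cmp (cmp (bflip et) y) (bflip (cmp (bflip et) y)))"

lemma insep_sym: "insep xs Z x y ==> insep xs Z y x"
 unfolding insep_def by metis

lemma insep_cups:
 fixes xs :: "'a list"
 assumes i: "insep xs Z x y" and x: "x : JH s xs Z" and y: "y : JH s xs Z" and et: "et : hooks xs W"
  and r: "rank (cmp (bflip et) x) = length Z \<or> rank (cmp (bflip et) y) = length Z"
 shows "{Inl a, Inl b} : cmp (bflip et) x \<longleftrightarrow> {Inl a, Inl b} : cmp (bflip et) y"
proof -
 have H: "cmp (bflip et) x : JH s W Z" "cmp (bflip et) y : JH s W Z"
  using B.hkD[OF et] JH_mul JH_bflip x y by blast+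
 have "cmp (cmp (bflip et) x) (bflip (cmp (bflip et) x)) =
  cmp (cmp (bflip et) y) (bflip (cmp (bflip et) y))" using i et r unfolding insep_def by blast
 thus ?thesis using proj_cups[OF H] proj_cups[OF H(2,1)] by metis
qed

lemma cup_rank:
 fixes xs :: "'a list"
 assumes x: "x : JH s xs Z" "rank x = length Z" and o: "olist xs" and r: "rot xs (a # b # us)" and K: "{Inl a, Inl b} : x"
 shows "x = cmp (hook (set us) a b) (cmp (bflip (hook (set us) a b)) x)"
  "cmp (bflip (hook (set us) a b)) x : JH s us Z"
  "rank (cmp (bflip (hook (set us) a b)) x) = length Z"
proof -
 let ?h = "hook (set us) a b"
 show e: "x = cmp ?h (cmp (bflip ?h) x)" using cup_hook_iff[OF JH_brauer[OF x(1)] r o] K by simp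
 have h: "?h : hooks xs us" using hooksI[OF o r] .
 show m: "cmp (bflip ?h) x : JH s us Z" using B.hkD[OF h] JH_mul JH_bflip x by blast
 show "rank (cmp (bflip ?h) x) = length Z" using B.coiso_rk_mul[OF B.hk_coiso[OF h] m] e x(2) by simp
qed

text \<open>Both arrows are rebuilt from their compressions by the hook of the common cup, and the
  projections of these compressions agree.\<close>

lemma common_cup:
 fixes xs :: "'a list"
 assumes i: "insep xs Z x y" and x: "x : JH s xs Z" "rank x = length Z" and y: "y : JH s xs Z" "rank y = length Z"
  and o: "olist xs" and r: "rot xs (a # b # us)" and K: "{Inl a, Inl b} : x" "{Inl a, Inl b} : y"
 shows "cmp x (bflip x) = cmp y (bflip y)"
proof -
 let ?h = "hook (set us) a b"
 note cx = cup_rank[OF x o r K(1)] and cy = cup_rank[OF y o r K(2)]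
 have e: "cmp (cmp (bflip ?h) x) (bflip (cmp (bflip ?h) x)) =
  cmp (cmp (bflip ?h) y) (bflip (cmp (bflip ?h) y))"
  using i hooksI[OF o r] cx(3) unfolding insep_def by blast
 have "cmp w (bflip w) = cmp ?h (cmp (cmp (cmp (bflip ?h) w) (bflip (cmp (bflip ?h) w))) (bflip ?h))"
  if "w = cmp ?h (cmp (bflip ?h) w)" for w
 proof -
  have "bflip w = cmp (bflip (cmp (bflip ?h) w)) (bflip ?h)" using that bflip_comp by metis
  thus ?thesis using that by (metis brauer_comp_assoc)
 qed
 thus ?thesis using cx(1) cy(1) e by metis
qed

text \<open>Overlapping cups are refuted by testing three hooks around the consecutive points
  \<open>z\<close>, \<open>a\<close>, \<open>b\<close>, \<open>d\<close>, \<open>e\<close>. In each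
  test a cup of one arrow is followed through a zigzag and must then occur in the other; at the end
  \<open>a\<close> would be joined both to \<open>z\<close> and to \<open>e\<close> in
  \<open>y1\<close>.\<close>

lemma insep_adjacent:
 fixes xs :: "'a list"
 assumes i: "insep xs Z x y" and x: "x : JH s xs Z" "rank x = length Z" and y: "y : JH s xs Z" "rank y = length Z"
  and o: "olist xs" and l: "length xs >= 5" and r: "rot xs (a # b # d # ts)"
  and K: "{Inl a, Inl b} : x" "{Inl b, Inl d} : y"
 shows False
proof -
 obtain e us z where ts: "ts = e # us @ [z]"
 proof -
  obtain e t1 where "ts = e # t1" using rot_length[OF r] l by (cases ts) auto
  moreover obtain us z where "t1 = us @ [z]" using rot_length[OF r] l calculation by (cases t1 rule: rev_cases) auto
  ultimately show ?thesis using that by simp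
 qed
 have r0: "rot xs (a # b # d # e # us @ [z])" using r ts by simp
 have dist: "distinct (a # b # d # e # us @ [z])" using rot_distinct[OF r0] o unfolding olist_def by simp
 have rza: "rot xs (z # a # b # d # e # us)" using rot_move[of xs "a # b # d # e # us" "[z]"] r0 by simp
 have rbd: "rot xs (b # d # e # us @ [z, a])" using rot_move[of xs "[a]" "b # d # e # us @ [z]"] r0 by simp
 have rde: "rot xs (d # e # us @ [z, a, b])" using rot_move[of xs "[a, b]" "d # e # us @ [z]"] r0 by simp
 let ?ab = "hook (set (d # e # us @ [z])) a b" and ?bd = "hook (set (e # us @ [z, a])) b d"
 let ?za = "hook (set (b # d # e # us)) z a" and ?de = "hook (set (us @ [z, a, b])) d e"
 define x1 where "x1 = cmp (bflip ?ab) x"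
 define y1 where "y1 = cmp (bflip ?bd) y"
 note cx = cup_rank[OF x o r0 K(1), folded x1_def]
 note cy = cup_rank[OF y o rbd K(2), folded y1_def]
 have unitcup: "rank (cmp (bd f (set us')) w) = length Z &
   ({Inl p, Inl q} : cmp (bd f (set us')) w \<longleftrightarrow> {Inl (f p), Inl (f q)} : w)"
  if "olist us'" "olist vs'" "rot vs' (map f us')" "w : JH s vs' Z" "rank w = length Z" "p : set us'" "q : set us'" for f us' vs' w p q
 proof -
  note G = unit_bd_JH[OF that(1,2,3)]
  have "w : brauer (f ` set us') (set Z)" using JH_brauer[OF that(4)] G(4) by simp
  from bd_cup_iff[OF G(3) this that(6,7)] show ?thesis using B.coiso_rk_mul[OF G(5) that(4)] that(5) by simp
 qed
 have ols: "olist (d # e # us @ [z])" "olist (b # d # e # us)" "olist (e # us @ [z, a])" "olist (us @ [z, a, b])"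
  using olist_Cons2[OF o r0] olist_Cons2[OF o rza] olist_Cons2[OF o rbd] olist_Cons2[OF o rde] by blast+
 \<comment> \<open>The hook at \<open>z, a\<close> shows that \<open>x\<close> joins \<open>z\<close> and \<open>d\<close>.\<close>
 let ?V1 = "insert d (insert e (set us))"
 have "z ~: ?V1" "a ~: ?V1" "b ~: ?V1" "distinct [z, a, b]" using dist by auto
 from hook_adjacent[OF this] have h1: "cmp (bflip ?za) ?ab = bd (id(b := z)) (set (b # d # e # us))"
  by (simp add: insert_commute)
 have e1: "cmp (bflip ?za) x = cmp (bd (id(b := z)) (set (b # d # e # us))) x1"
  using h1 cx(1) by (metis brauer_comp_assoc)
 have "map (id(b := z)) (b # d # e # us) = z # d # e # us" using dist by (auto simp: map_idI)
 hence "rot (d # e # us @ [z]) (map (id(b := z)) (b # d # e # us))" using rot_append[of "d # e # us" "[z]"] by simp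
 from unitcup[OF ols(2,1) this cx(2,3), of b d]
 have f1: "rank (cmp (bflip ?za) x) = length Z" "{Inl b, Inl d} : cmp (bflip ?za) x \<longleftrightarrow> {Inl z, Inl d} : x1"
  unfolding e1 using dist by auto
 have "rot xs (b # d # (e # us) @ z # a # [])" using rbd by simp
 from far_cup[OF o this y(1) K(2)] have "{Inl b, Inl d} : cmp (bflip ?za) y" by simp
 hence zd: "{Inl z, Inl d} : x1"
  using insep_cups[OF i x(1) y(1) hooksI[OF o rza]] f1 by blast
 \<comment> \<open>The hook at \<open>d, e\<close> shows that \<open>y\<close> joins \<open>a\<close> and \<open>e\<close>.\<close>
 let ?V2 = "insert z (insert a (set us))"
 have "e ~: ?V2" "d ~: ?V2" "b ~: ?V2" "distinct [e, d, b]" using dist by auto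
 from hook_adjacent[OF this] have h2: "cmp (bflip ?de) ?bd = bd (id(b := e)) (set (us @ [z, a, b]))"
  by (simp add: insert_commute hook_commute)
 have e2: "cmp (bflip ?de) y = cmp (bd (id(b := e)) (set (us @ [z, a, b]))) y1"
  using h2 cy(1) by (metis brauer_comp_assoc)
 have "map (id(b := e)) (us @ [z, a, b]) = us @ [z, a, e]" using dist by (auto simp: map_idI)
 hence "rot (e # us @ [z, a]) (map (id(b := e)) (us @ [z, a, b]))" using rot_append[of "[e]" "us @ [z, a]"] by simp
 from unitcup[OF ols(4,3) this cy(2,3), of a b]
 have f2: "rank (cmp (bflip ?de) y) = length Z" "{Inl a, Inl b} : cmp (bflip ?de) y \<longleftrightarrow> {Inl a, Inl e} : y1"
  unfolding e2 using dist by auto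
 have "rot xs (a # b # [] @ d # e # (us @ [z]))" using r0 by simp
 from far_cup[OF o this x(1) K(1)] have "{Inl a, Inl b} : cmp (bflip ?de) x" by simp
 hence ae: "{Inl a, Inl e} : y1"
  using insep_cups[OF i x(1) y(1) hooksI[OF o rde]] f2 by blast
 \<comment> \<open>The hook at \<open>a\<close>, \<open>b\<close> takes the cup off \<open>x\<close>
   and leaves \<open>x1\<close>, so the block of \<open>z\<close> and \<open>d\<close> must occur in
   the compression of \<open>y\<close> too; there it stems from a block of \<open>z\<close> and
   \<open>a\<close> in \<open>y1\<close>.\<close>
 let ?V0 = "insert e (insert z (set us))"
 have "a ~: ?V0" "b ~: ?V0" "d ~: ?V0" "distinct [a, b, d]" using dist by auto
 from hook_adjacent[OF this] have h0: "cmp (bflip ?ab) ?bd = bd (id(d := a)) (set (d # e # us @ [z]))"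
  by (simp add: insert_commute)
 have e0: "cmp (bflip ?ab) y = cmp (bd (id(d := a)) (set (d # e # us @ [z]))) y1"
  using h0 cy(1) by (metis brauer_comp_assoc)
 have "map (id(d := a)) (d # e # us @ [z]) = a # e # us @ [z]" using dist by (auto simp: map_idI)
 hence "rot (e # us @ [z, a]) (map (id(d := a)) (d # e # us @ [z]))" using rot_append[of "e # us @ [z]" "[a]"] by simp
 from unitcup[OF ols(1,3) this cy(2,3), of z d]
 have f0: "{Inl z, Inl d} : cmp (bflip ?ab) y \<longleftrightarrow> {Inl z, Inl a} : y1"
  unfolding e0 using dist by auto
 have "{Inl z, Inl d} : cmp (bflip ?ab) y"
  using insep_cups[OF i x(1) y(1) hooksI[OF o r0]] cx(3) zd unfolding x1_def by blast
 hence "{Inl z, Inl a} : y1" using f0 by blast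
 hence "{Inl z, Inl a} = {Inl a, Inl e :: 'a + 'a}" using brauer_unique[OF JH_brauer[OF cy(2)] _ ae, of _ "Inl a"] by blast
 thus False using dist by (auto simp: doubleton_eq_iff)
qed

text \<open>Neither arrow has full rank on the source, so each has an adjacent cup. A cup of
  \<open>x\<close> and one of \<open>y\<close> are equal, overlapping or disjoint; equal ones settle
  the claim, overlapping ones are impossible, and in the disjoint case the cup of \<open>x\<close>
  is found in \<open>y\<close> as well.\<close>

lemma JH_sep:
 fixes xs :: "'a list"
 assumes x: "x : JH s xs Z" and y: "y : JH s xs Z" and rx: "rank x = length Z" and ry: "rank y = length Z"
  and l: "length xs >= 5" and ne: "cmp x (bflip x) ~= cmp y (bflip y)"
 shows "\<not> insep xs Z x y"
proof
 assume i: "insep xs Z x y"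
 have o: "olist xs" using JH_ob x by blast
 have dx: "distinct xs" "odd (length xs)" using o unfolding olist_def by auto
 have "length Z ~= length xs" using B.full_unit[OF x] B.full_unit[OF y] rx ry ne by auto
 hence nf: "rank x ~= length xs" "rank y ~= length xs" using rx ry by auto
 have cup: "\<exists>a b us. rot xs (a # b # us) & {Inl a, Inl b} : w" if w: "w : JH s xs Z" "rank w ~= length xs" for w
 proof -
  obtain W et where et: "et : hooks xs W" "cmp et (cmp (bflip et) w) = w" using B.factor[OF w] by blast
  then obtain a b where h: "et = hook (set W) a b" "rot xs (a # b # W)" by (rule_tac hooksE)
  thus ?thesis using cup_hook_iff[OF JH_brauer[OF w(1)] h(2) o] et(2) by blast
 qed
 obtain a b us where a: "rot xs (a # b # us)" "{Inl a, Inl b} : x" using cup[OF x nf(1)] by blast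
 obtain c d vs where c: "rot xs (c # d # vs)" "{Inl c, Inl d} : y" using cup[OF y nf(2)] by blast
 from a(1) c(1) dx show False
 proof (cases rule: adjacent_cases)
  case same
  thus ?thesis using common_cup[OF i x rx y ry o a(1) a(2)] c ne by simp
 next
  case (succ ts)
  thus ?thesis using insep_adjacent[OF i x rx y ry o l, of a b d ts] a c by simp
 next
  case (prev ts)
  thus ?thesis using insep_adjacent[OF insep_sym[OF i] y ry x rx o l, of c d b ts] a c by simp
 next
  case (far p q)
  have r: "rot xs (a # b # p @ c # d # q)" using a far by simp
  have "{Inl a, Inl b} : cmp (bflip (hook (set vs) c d)) x" using far_cup[OF o r x a(2)] far by simp
  hence "{Inl a, Inl b} : cmp (bflip (hook (set vs) c d)) y"
   using insep_cups[OF i x y hooksI[OF o c(1)]] cup_rank(3)[OF y ry o c(1,2)] by blast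
  hence "{Inl a, Inl b} : insert {Inl c, Inl d} (cmp (bflip (hook (set vs) c d)) y)" by blast
  also have "\<dots> = y" using cup_rank(1)[OF y ry o c(1,2)] hook_comp[OF JH_brauer[OF cup_rank(2)[OF y ry o c(1,2)]]] olist_Cons2[OF o c(1)] by simp
  finally show ?thesis using common_cup[OF i x rx y ry o a(1) a(2)] ne by blast
 qed
qed

end

theorem hook_category_JH: "hook_category olist (JH s) cmp bflip idb rank length hooks [undefined]"
proof (intro hook_category.intro hook_base_JH hook_category_axioms.intro)
 fix X Z W W' T :: "'a list" and et et' g x y :: "'a brauer"
 show "et : hooks X W ==> 5 <= length X ==> EX g:JH s X X. rank g = length X & rank (cmp (bflip et) (cmp g et)) < length W"
  by (rule JH_gen)
 show "g : JH s X X ==> rank g = length X ==> 3 <= length X ==> g ~= idb X ==>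
  \<exists>W. \<exists>et\<in>hooks X W. cmp g (cmp et (cmp (bflip et) (bflip g))) ~= cmp et (bflip et)"
  by (rule JH_unit_move)
 show "\<exists>W'' V V' a b a' b'. \<exists>et''\<in>hooks X W''. a : JH s W V & b : JH s W'' V & cmp et a = cmp et'' b &
   a' : JH s W'' V' & b' : JH s W' V' & cmp et'' a' = cmp et' b'"
  if "et : hooks X W" "et' : hooks X W'" "5 <= length X"
  using JH_meet[OF that, of s] unfolding meets_def by blast
 show "olist T ==> length T = 3 ==> \<exists>\<tau>\<in>JH s T T. ALL t:JH s T [undefined]. cmp \<tau> (cmp \<tau> (cmp \<tau> t)) = t &
   cmp \<tau> t ~= t & (ALL sa:JH s T [undefined]. sa = t \<or> sa = cmp \<tau> t \<or> sa = cmp \<tau> (cmp \<tau> t))"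
  by (rule JH_three)
 show "\<exists>W. \<exists>et\<in>hooks X W. (rank (cmp (bflip et) x) = length Z \<or> rank (cmp (bflip et) y) = length Z) &
  \<not> (rank (cmp (bflip et) x) = length Z & rank (cmp (bflip et) y) = length Z &
   cmp (bflip et) (cmp x (cmp (bflip x) et)) = cmp (bflip et) (cmp y (cmp (bflip y) et)))"
  if "x : JH s X Z" "y : JH s X Z" "rank x = length Z" "rank y = length Z" "5 <= length X" "cmp x (bflip x) ~= cmp y (bflip y)"
  using JH_sep[OF that] unfolding insep_def bflip_comp bflip_bflip brauer_comp_assoc by blast
qed

section \<open>Planar and annular partitions\<close>

lemma pos_less_iff:
 assumes f: "finite A" and r: "linear_order_on A r" and ab: "a : A" "b : A"
 shows "pos r a < pos r b \<longleftrightarrow> (a, b) : r & a ~= b"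
proof -
 have r': "r <= A \<times> A" "refl_on A r" "trans r" "antisym r" "total_on A r"
  using r unfolding linear_order_on_def partial_order_on_def preorder_on_def by auto
 have less: "pos r a < pos r b" if "(a, b) : r" "a ~= b" "b : A" for a b
 proof -
  have "b ~: {x. (x, a) : r}" using that r'(4) by (auto dest: antisymD)
  moreover have "b : {x. (x, b) : r}" using that r'(2) by (auto dest: refl_onD)
  moreover have "{x. (x, a) : r} <= {x. (x, b) : r}" using that r'(3) by (auto dest: transD)
  ultimately have "{x. (x, a) : r} \<subset> {x. (x, b) : r}" by blast
  moreover have "finite {x. (x, b) : r}" using r'(1) by (intro finite_subset[OF _ f]) auto
  ultimately show ?thesis unfolding pos_def by (rule psubset_card_mono[rotated])
 qed
 show ?thesis
 proof (cases "a = b")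
  case False
  hence "(a, b) : r \<or> (b, a) : r" using r'(5) ab unfolding total_on_def by blast
  thus ?thesis using less[of a b] less[of b a] ab False by (auto dest: less_asym)
 qed simp
qed

lemma pos_bij:
 assumes f: "finite A" and r: "linear_order_on A r"
 shows "bij_betw (pos r) A {1..card A}"
proof -
 have r': "r <= A \<times> A" "refl_on A r" "total_on A r"
  using r unfolding linear_order_on_def partial_order_on_def preorder_on_def by auto
 have inj: "inj_on (pos r) A"
 proof (rule inj_onI, rule ccontr)
  fix a b assume h: "a : A" "b : A" "pos r a = pos r b" "a ~= b"
  hence "(a, b) : r \<or> (b, a) : r" using r'(3) unfolding total_on_def by blast
  thus False using pos_less_iff[OF f r, of a b] pos_less_iff[OF f r, of b a] h by auto
 qed
 have "pos r a : {1..card A}" if "a : A" for a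
 proof -
  have s: "{x. (x, a) : r} <= A" using r'(1) by auto
  have "a : {x. (x, a) : r}" using r'(2) that by (auto dest: refl_onD)
  hence "card {x. (x, a) : r} ~= 0" using finite_subset[OF s f] by auto
  thus ?thesis using card_mono[OF f s] unfolding pos_def by auto
 qed
 hence "pos r ` A <= {1..card A}" by blast
 moreover have "card (pos r ` A) = card {1..card A}" using card_image[OF inj] by simp
 ultimately have "pos r ` A = {1..card A}" by (intro card_subset_eq) auto
 thus ?thesis using inj unfolding bij_betw_def by blast
qed

text \<open>The list enumerates \<open>A\<close> increasingly. Positions by \<open>pos\<close> count
  from 1, list indices from 0, so the element at index \<open>i\<close> has position
  \<open>Suc i\<close>.\<close>

definition ord_list :: "'a rel => 'a set => 'a list" where
 "ord_list r A = map (the_inv_into A (pos r)) [1..<Suc (card A)]"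

lemma ord_list:
 assumes "finite A" "linear_order_on A r"
 shows map_pos_ord_list: "map (pos r) (ord_list r A) = [1..<Suc (card A)]"
  and set_ord_list: "set (ord_list r A) = A" and distinct_ord_list: "distinct (ord_list r A)"
  and length_ord_list: "length (ord_list r A) = card A"
  and sorted_ord_list: "sorted_wrt (%x y. pos r x < pos r y) (ord_list r A)"
proof -
 note b = pos_bij[OF assms]
 have i: "{1..<Suc (card A)} = {1..card A}" by auto
 show l: "length (ord_list r A) = card A" unfolding ord_list_def by simp
 show m: "map (pos r) (ord_list r A) = [1..<Suc (card A)]"
  unfolding ord_list_def map_map using b by (intro map_idI) (auto simp: bij_betw_def intro!: f_the_inv_into_f)
 show "set (ord_list r A) = A"
  using bij_betw_the_inv_into[OF b] unfolding ord_list_def bij_betw_def by (simp only: set_map set_upt i)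
 show "distinct (ord_list r A)" using m by (metis distinct_map distinct_upt)
 have "sorted_wrt (<) (map (pos r) (ord_list r A))" unfolding m by (rule sorted_wrt_upt)
 thus "sorted_wrt (%x y. pos r x < pos r y) (ord_list r A)" unfolding sorted_wrt_map .
qed

section \<open>Crossings on a line and planar drawings\<close>

definition noncross :: "('v => real) => 'v set set => bool" where
 "noncross ka M \<longleftrightarrow> (\<forall>p q a b. {p, q} : M --> {a, b} : M --> ka p < ka a --> ka a < ka q --> \<not> ka q < ka b)"

lemma noncrossD: "noncross ka M ==> {p, q} : M ==> {a, b} : M ==> ka p < ka a ==> ka a < ka q ==> ka q < ka b ==> False"
 unfolding noncross_def by blast

text \<open>An adjacent pair cannot interleave with another block, since no other key lies between
  its two.\<close>

lemma NC_noncross: "NC l M ==> sorted_wrt (%x y. ka x < ka y) l ==> \<Union>M <= set l & noncross ka M"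
proof (induction rule: NC.induct)
 case NC_Nil
 thus ?case by (simp add: noncross_def)
next
 case (NC_insert us vs M a b)
 from NC_insert.prems have s: "sorted_wrt (%x y. ka x < ka y) (us @ vs)" "ka a < ka b"
  and out: "!!c. c : set (us @ vs) ==> ka c < ka a \<or> ka b < ka c" by (auto simp: sorted_wrt_append)
 from NC_insert.IH[OF s(1)] have IH: "\<Union>M <= set (us @ vs)" "noncross ka M" by auto
 have "noncross ka (insert {a, b} M)" unfolding noncross_def
 proof (intro allI impI notI)
  fix p q c d assume h: "{p, q} : insert {a, b} M" "{c, d} : insert {a, b} M" "ka p < ka c" "ka c < ka q" "ka q < ka d"
  have dq: "{x, y} = {a, b} ==> ka x < ka y ==> x = a & y = b" for x y using s(2) by (auto simp: doubleton_eq_iff)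
  show False
  proof (cases "{p, q} = {a, b}")
   case True
   hence pq: "p = a" "q = b" using dq h by auto
   show ?thesis
   proof (cases "{c, d} = {a, b}")
    case True thus ?thesis using dq[OF True] h pq by auto
   next
    case False
    hence "c : set (us @ vs)" using h(2) IH(1) by blast
    thus ?thesis using out[of c] h pq by auto
   qed
  next
   case False
   hence pqM: "{p, q} : M" using h(1) by blast
   show ?thesis
   proof (cases "{c, d} = {a, b}")
    case True
    hence "c = a" "d = b" using dq h by auto
    moreover have "q : set (us @ vs)" using pqM IH(1) by blast
    ultimately show ?thesis using out[of q] h by auto
   next
    case False
    thus ?thesis using noncrossD[OF IH(2) pqM _ h(3-5)] h(2) by blast
   qed
  qed
 qed
 thus ?case using IH(1) by auto
qed

text \<open>A block of least width has width one: otherwise the point next to its left end would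
  have its partner inside as well, giving a narrower block.\<close>

lemma noncross_adjacent:
 assumes l: "sorted_wrt (%x y. ka x < ka y) l" and P: "partition_on (set l) M" "ALL K:M. card K = 2"
  and n: "noncross ka M" and ne: "l ~= []"
 shows "\<exists>i. Suc i < length l & {l ! i, l ! Suc i} : M"
proof -
 have mono: "ka (l ! i) < ka (l ! j)" if "i < j" "j < length l" for i j using sorted_wrt_nth_less[OF l that] .
 have block: "\<exists>k<length l. k ~= i & {l ! i, l ! k} : M" if i: "i < length l" for i
 proof -
  obtain K where K: "K : M" "l ! i : K" using P(1) nth_mem[OF i] unfolding partition_on_def by blast
  obtain x y where "K = {x, y}" "x ~= y" using P(2) K(1) by (metis card_2_iff)
  then obtain y where y: "K = {l ! i, y}" "y ~= l ! i" using K(2) by auto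
  hence "y : set l" using P(1) K(1) unfolding partition_on_def by blast
  thus ?thesis using y K(1) by (metis in_set_conv_nth)
 qed
 define Pr where "Pr = (%d. \<exists>i. 0 < d & i + d < length l & {l ! i, l ! (i + d)} : M)"
 have PrI: "Pr (j - i)" if "i < j" "j < length l" "{l ! i, l ! j} : M" for i j
  unfolding Pr_def using that by (intro exI[of _ i]) auto
 obtain k where "k < length l" "k ~= 0" "{l ! 0, l ! k} : M" using block[of 0] ne by auto
 hence "Pr k" using PrI[of 0 k] by simp
 define d where "d = (LEAST d. Pr d)"
 have d: "Pr d" unfolding d_def by (rule LeastI[of Pr, OF \<open>Pr k\<close>])
 have least: "d <= e" if "Pr e" for e unfolding d_def using that by (rule Least_le)
 obtain i where i: "0 < d" "i + d < length l" "{l ! i, l ! (i + d)} : M" using d unfolding Pr_def by blast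
 have "d = 1"
 proof (rule ccontr)
  assume "d ~= 1"
  hence d2: "2 <= d" using i(1) by simp
  obtain k where k: "k < length l" "k ~= Suc i" "{l ! Suc i, l ! k} : M" using block[of "Suc i"] i d2 by auto
  have diff: "{l ! Suc i, l ! k} ~= {l ! i, l ! (i + d)}"
  proof
   assume "{l ! Suc i, l ! k} = {l ! i, l ! (i + d)}"
   hence "l ! Suc i = l ! i \<or> l ! Suc i = l ! (i + d)" by blast
   thus False using mono[of i "Suc i"] mono[of "Suc i" "i + d"] i d2 by auto
  qed
  have "{l ! Suc i, l ! k} Int {l ! i, l ! (i + d)} = {}"
   using disjointD[OF partition_onD2[OF P(1)] k(3) i(3) diff] .
  hence "k ~= i" "k ~= i + d" by auto
  then consider "k < i" | "Suc i < k" "k < i + d" | "i + d < k" using k(2) by linarith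
  thus False
  proof cases
   case 1
   thus ?thesis using noncrossD[OF n, of "l ! k" "l ! Suc i" "l ! i" "l ! (i + d)"] k(3) i mono[of k i] mono[of i "Suc i"] mono[of "Suc i" "i + d"] d2
    by (simp add: insert_commute)
  next
   case 2
   hence "Pr (k - Suc i)" using PrI k by blast
   thus ?thesis using least[of "k - Suc i"] 2 by linarith
  next
   case 3
   thus ?thesis using noncrossD[OF n i(3) k(3)] k(1) i mono[of "i + d" k] mono[of i "Suc i"] mono[of "Suc i" "i + d"] d2 by simp
  qed
 qed
 thus ?thesis using i by auto
qed

lemma partition_on_remove:
 assumes P: "partition_on A P" and K: "K : P"
 shows "partition_on (A - K) (P - {K})"
proof -
 have "\<Union>(P - {K}) = \<Union>P - K" using K partition_onD2[OF P] unfolding disjoint_def by blast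
 thus ?thesis using P unfolding partition_on_def disjoint_def by auto
qed

lemma noncross_NC:
 "sorted_wrt (%x y. ka x < ka y) l ==> partition_on (set l) M ==> ALL K:M. card K = 2 ==> noncross ka M ==> NC l M"
proof (induction "length l" arbitrary: l M rule: less_induct)
 case less
 show ?case
 proof (cases "l = []")
  case True
  hence "M = {}" using less.prems(2) unfolding partition_on_def by auto
  thus ?thesis using True NC_Nil by simp
 next
  case False
  obtain i where i: "Suc i < length l" "{l ! i, l ! Suc i} : M" using noncross_adjacent[OF less.prems False] by blast
  define us vs a b where "us = take i l" and "vs = drop (i + 2) l" and "a = l ! i" and "b = l ! Suc i"
  have l: "l = us @ a # b # vs" unfolding us_def vs_def a_def b_def using i
   by (metis Cons_nth_drop_Suc Suc_lessD add_2_eq_Suc' id_take_nth_drop)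
  let ?K = "{a, b}"
  have K: "?K : M" using i unfolding a_def b_def by simp
  have s: "sorted_wrt (%x y. ka x < ka y) (us @ vs)" using less.prems(1) unfolding l by (auto simp: sorted_wrt_append)
  have ab: "a ~: set (us @ vs)" "b ~: set (us @ vs)" using less.prems(1) unfolding l by (auto simp: sorted_wrt_append)
  have "set l - ?K = set (us @ vs)" unfolding l using ab by auto
  hence "partition_on (set (us @ vs)) (M - {?K})" using partition_on_remove[OF less.prems(2) K] by simp
  moreover have "noncross ka (M - {?K})" using less.prems(4) unfolding noncross_def by blast
  ultimately have "NC (us @ vs) (M - {?K})" using less.hyps[OF _ s] less.prems(3) unfolding l by auto
  from NC_insert[OF this, of a b] show ?thesis unfolding l using K by (simp add: insert_absorb)
 qed
qed

text \<open>The map \<open>(X, Y) \<mapsto> R (cos \<theta>, sin \<theta>)\<close> with \<open>R = w - X\<close> and \<open>cos \<theta> = 1 - 2 Y\<close> bends the strip into a half annulus: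
 the upper points move to the negative half axis, the lower ones to the positive half axis.\<close>

definition bend :: "real => real \<times> real => real^2" where
 "bend w p = (\<chi> i. if i = 1 then (w - fst p) * (1 - 2 * snd p) else 2 * (w - fst p) * sqrt (snd p * (1 - snd p)))"

lemma continuous_bend: "continuous_on S (bend w)"
proof -
 have "continuous_on S (%p. if i = 1 then (w - fst p) * (1 - 2 * snd p) else 2 * (w - fst p) * sqrt (snd p * (1 - snd p)))" for i :: 2
  by (cases "i = 1") (auto intro!: continuous_intros)
 thus ?thesis unfolding bend_def by (intro continuous_on_vec_lambda) auto
qed

lemma bend_strip:
 assumes "p : {0..w - 1} \<times> {0..1}"
 shows "bend w p $ 1 : {-w..w}" "bend w p $ 2 : {0..w}" "(bend w p $ 1)\<^sup>2 + (bend w p $ 2)\<^sup>2 = (w - fst p)\<^sup>2"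
proof -
 define R Y where "R = w - fst p" and "Y = snd p"
 have R: "1 <= R" "R <= w" and Y: "0 <= Y" "Y <= 1" using assms unfolding R_def Y_def by auto
 have b: "bend w p $ 1 = R * (1 - 2 * Y)" "bend w p $ 2 = 2 * R * sqrt (Y * (1 - Y))" unfolding bend_def R_def Y_def by simp_all
 have s: "(sqrt (Y * (1 - Y)))\<^sup>2 = Y * (1 - Y)" "0 <= sqrt (Y * (1 - Y))" using Y by simp_all
 show e: "(bend w p $ 1)\<^sup>2 + (bend w p $ 2)\<^sup>2 = (w - fst p)\<^sup>2"
  unfolding b R_def[symmetric] power_mult_distrib s(1) by (simp add: power2_eq_square algebra_simps)
 have "\<bar>bend w p $ 1\<bar> <= R" "\<bar>bend w p $ 2\<bar> <= R"
  by (rule power2_le_imp_le; use e R in \<open>simp add: R_def[symmetric]\<close>; smt (verit) zero_le_power2)+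
 moreover have "0 <= bend w p $ 2" unfolding b using s(2) R by simp
 ultimately show "bend w p $ 1 : {-w..w}" "bend w p $ 2 : {0..w}" using R by auto
qed

lemma bend_inj:
 assumes "p : {0..w - 1} \<times> {0..1}" "q : {0..w - 1} \<times> {0..1}" "bend w p = bend w q"
 shows "p = q"
proof -
 have "(w - fst p)\<^sup>2 = (w - fst q)\<^sup>2" using bend_strip(3)[OF assms(1)] bend_strip(3)[OF assms(2)] assms(3) by simp
 moreover have "w - fst p >= 1" "w - fst q >= 1" using assms(1,2) by auto
 ultimately have e: "w - fst p = w - fst q" by (simp add: power2_eq_iff)
 have "(w - fst p) * (1 - 2 * snd p) = (w - fst q) * (1 - 2 * snd q)" using arg_cong[OF assms(3), of "%v. v $ 1"] unfolding bend_def by simp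
 hence "snd p = snd q" using e \<open>w - fst q >= 1\<close> by simp
 thus ?thesis using e by (simp add: prod_eq_iff)
qed

text \<open>First coordinate of a vertex after bending; the second one is 0. Upper points become
  negative, lower ones positive and reversed, which is the order of the list used with
  \<open>NC\<close>.\<close>

definition bent_key :: "real => ('a => nat) => ('a => nat) => 'a + 'a => real" where
 "bent_key w f g v = (case v of Inl a => real (f a) - w | Inr b => w - real (g b))"

text \<open>After bending, two interleaved blocks are paths in a box with alternating end points on
  its bottom side, and such paths meet. Bending is injective on the strip, so the original arcs meet
  as well.\<close>

lemma planar_noncross:
 assumes p: "planar leq al" and w: "w = real (max (card (bdom al)) (card (bran al))) + 2"
 shows "noncross (bent_key w (pos (leq (bdom al))) (pos (leq (bran al)))) al"
 unfolding noncross_def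
proof (intro allI impI notI)
 let ?ka = "bent_key w (pos (leq (bdom al))) (pos (leq (bran al)))" and ?v = "vertex leq al"
 fix x y a b assume K: "{x, y} : al" "{a, b} : al" and o: "?ka x < ?ka a" "?ka a < ?ka y" "?ka y < ?ka b"
 from p[unfolded planar_def] obtain \<gamma> :: "('a + 'a) set => real => real \<times> real" where
  G: "(ALL K:al. arc (\<gamma> K) & {pathstart (\<gamma> K), pathfinish (\<gamma> K)} = ?v ` K &
    path_image (\<gamma> K) <= {0 .. real (max (card (bdom al)) (card (bran al))) + 1} \<times> {0 .. 1}) &
   (ALL K:al. ALL L:al. K ~= L --> path_image (\<gamma> K) Int path_image (\<gamma> L) = {})" by (rule exE)
 note \<gamma> = bspec[OF G[THEN conjunct1]] and dis = bspec[OF bspec[OF G[THEN conjunct2]], THEN mp]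
 have ne: "{x, y} ~= {a, b}" using o by auto
 have v: "bend w (?v u) $ 1 = ?ka u" "bend w (?v u) $ 2 = 0" for u
  unfolding bend_def vertex_def bent_key_def by (auto split: sum.split)
 \<comment> \<open>The rectangle ends at \<open>w - 1\<close>, which is why \<open>w\<close> is the
   larger size plus two: the radius stays at least one, as the injectivity of \<open>bend\<close>
   requires.\<close>
 have strip: "path_image (\<gamma> K) <= {0..w - 1} \<times> {0..1}" if "K : al" for K using \<gamma>[OF that] w by auto
 have ex: "\<exists>f. path f & path_image f = path_image (\<gamma> {p, q}) & pathstart f = ?v p & pathfinish f = ?v q" if pq: "{p, q} : al" for p q
 proof -
  have ap: "path (\<gamma> {p, q})" using \<gamma>[OF pq] arc_imp_path by blast
  have "{pathstart (\<gamma> {p, q}), pathfinish (\<gamma> {p, q})} = {?v p, ?v q}" using \<gamma>[OF pq] by simp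
  then consider "pathstart (\<gamma> {p, q}) = ?v p" "pathfinish (\<gamma> {p, q}) = ?v q" | "pathstart (\<gamma> {p, q}) = ?v q" "pathfinish (\<gamma> {p, q}) = ?v p"
   by (auto simp: doubleton_eq_iff)
  thus ?thesis
  proof cases
   case 1 thus ?thesis using ap by blast
  next
   case 2 thus ?thesis using ap by (intro exI[of _ "reversepath (\<gamma> {p, q})"]) simp
  qed
 qed
 obtain f where f: "path f" "path_image f = path_image (\<gamma> {x, y})" "pathstart f = ?v x" "pathfinish f = ?v y" using ex[OF K(1)] by blast
 obtain g where g: "path g" "path_image g = path_image (\<gamma> {a, b})" "pathstart g = ?v a" "pathfinish g = ?v b" using ex[OF K(2)] by blast
 let ?lo = "(\<chi> i. if i = 1 then -w else 0) :: real^2" and ?hi = "(\<chi> i. w) :: real^2"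
 have box: "bend w ` S <= cbox ?lo ?hi" if "S <= {0..w - 1} \<times> {0..1}" for S
  using bend_strip(1,2)[of _ w] that unfolding subset_iff image_iff mem_box_cart forall_2 by fastforce
 have "path (bend w \<circ> f)" "path (bend w \<circ> g)"
  using path_continuous_image[OF f(1) continuous_bend] path_continuous_image[OF g(1) continuous_bend] by this+
 moreover have "path_image (bend w \<circ> f) <= cbox ?lo ?hi" "path_image (bend w \<circ> g) <= cbox ?lo ?hi"
  unfolding path_image_compose f(2) g(2) using box[OF strip[OF K(1)]] box[OF strip[OF K(2)]] by this+
 moreover have "pathstart (bend w \<circ> f) = bend w (?v x)" "pathfinish (bend w \<circ> f) = bend w (?v y)"
  "pathstart (bend w \<circ> g) = bend w (?v a)" "pathfinish (bend w \<circ> g) = bend w (?v b)"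
  using f(3,4) g(3,4) by (simp_all add: pathstart_compose pathfinish_compose)
 ultimately obtain z where z: "z : path_image (bend w \<circ> f)" "z : path_image (bend w \<circ> g)"
  using fashoda_interlace[of "bend w \<circ> f" "bend w \<circ> g" ?lo ?hi] o v by auto
 from z have zz: "z : bend w ` path_image (\<gamma> {x, y})" "z : bend w ` path_image (\<gamma> {a, b})"
  unfolding path_image_compose f(2) g(2) by this+
 from zz(1) obtain s where s: "z = bend w s" "s : path_image (\<gamma> {x, y})" by (rule imageE)
 from zz(2) obtain t where t: "z = bend w t" "t : path_image (\<gamma> {a, b})" by (rule imageE)
 have "s = t" using bend_inj[OF subsetD[OF strip[OF K(1)] s(2)] subsetD[OF strip[OF K(2)] t(2)]] s t by simp
 thus False using s(2) t(2) dis[OF K ne] by (metis IntI empty_iff)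
qed

text \<open>Preimage under \<open>bend\<close> of the half circle over the segment from \<open>s\<close> to \<open>t\<close>.\<close>

definition barc :: "real => real => real => real => real \<times> real" where
 "barc w s t u = (w - sqrt ((1 - u) * s\<^sup>2 + u * t\<^sup>2), (1 - ((1 - u) * s + u * t) / sqrt ((1 - u) * s\<^sup>2 + u * t\<^sup>2)) / 2)"

text \<open>\<open>x\<close> runs over the segment from \<open>s\<close> to \<open>t\<close>,
  \<open>(x - s) * (t - x)\<close> is the squared height of the half circle above it, and
  \<open>R\<close> is the distance of that point from the origin. The bounds on \<open>R\<close>
  keep the preimage under bending inside the strip.\<close>

lemma barc_rad:
 fixes s t u w :: real
 assumes u: "0 <= u" "u <= 1" and s: "1 <= \<bar>s\<bar>" "\<bar>s\<bar> <= w" and t: "1 <= \<bar>t\<bar>" "\<bar>t\<bar> <= w"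
 defines "R \<equiv> sqrt ((1 - u) * s\<^sup>2 + u * t\<^sup>2)" and "x \<equiv> (1 - u) * s + u * t"
 shows "1 <= R" "R <= w" "\<bar>x\<bar> <= R" "R\<^sup>2 = x\<^sup>2 + (x - s) * (t - x)"
proof -
 have b: "1 <= s\<^sup>2" "1 <= t\<^sup>2" "s\<^sup>2 <= w\<^sup>2" "t\<^sup>2 <= w\<^sup>2" using s t using power_mono[of 1 "\<bar>s\<bar>" 2] power_mono[of 1 "\<bar>t\<bar>" 2] power_mono[of "\<bar>s\<bar>" w 2] power_mono[of "\<bar>t\<bar>" w 2] by auto
 have "(1 - u) * 1 + u * 1 <= (1 - u) * s\<^sup>2 + u * t\<^sup>2" using b u by (intro add_mono mult_left_mono) auto
 hence l: "1 <= (1 - u) * s\<^sup>2 + u * t\<^sup>2" by simp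
 have "(1 - u) * s\<^sup>2 + u * t\<^sup>2 <= (1 - u) * w\<^sup>2 + u * w\<^sup>2" using b u by (intro add_mono mult_left_mono) auto
 hence h: "(1 - u) * s\<^sup>2 + u * t\<^sup>2 <= w\<^sup>2" by (simp add: algebra_simps)
 show "1 <= R" unfolding R_def using l by simp
 show "R <= w" unfolding R_def using h s by (intro real_le_lsqrt) auto
 have R2: "R\<^sup>2 = (1 - u) * s\<^sup>2 + u * t\<^sup>2" unfolding R_def using l by simp
 show e: "R\<^sup>2 = x\<^sup>2 + (x - s) * (t - x)" unfolding R2 x_def by (simp add: power2_eq_square algebra_simps)
 have "(x - s) * (t - x) = u * (1 - u) * (t - s)\<^sup>2" unfolding x_def by (simp add: power2_eq_square algebra_simps)
 also have "\<dots> >= 0" using u by simp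
 finally have "x\<^sup>2 <= R\<^sup>2" using e by simp
 thus "\<bar>x\<bar> <= R" using \<open>1 <= R\<close> by (simp add: abs_le_square_iff[symmetric])
qed

text \<open>Equal values mean equal radius and equal angle, hence the same point of the half plane,
  here given by its abscissa and squared height.\<close>

lemma barc_eq:
 fixes s t u w :: real
 assumes u: "0 <= u" "u <= 1" and s: "1 <= \<bar>s\<bar>" "\<bar>s\<bar> <= w" and t: "1 <= \<bar>t\<bar>" "\<bar>t\<bar> <= w"
  and u': "0 <= u'" "u' <= 1" and s': "1 <= \<bar>s'\<bar>" "\<bar>s'\<bar> <= w" and t': "1 <= \<bar>t'\<bar>" "\<bar>t'\<bar> <= w"
  and e: "barc w s t u = barc w s' t' u'"
 defines "x \<equiv> (1 - u) * s + u * t" and "x' \<equiv> (1 - u') * s' + u' * t'"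
 shows "x = x'" "(x - s) * (t - x) = (x - s') * (t' - x)"
proof -
 let ?R = "sqrt ((1 - u) * s\<^sup>2 + u * t\<^sup>2)" and ?R' = "sqrt ((1 - u') * s'\<^sup>2 + u' * t'\<^sup>2)"
 have e1: "w - ?R = w - ?R'" "(1 - x / ?R) / 2 = (1 - x' / ?R') / 2" using e unfolding barc_def x_def x'_def by (simp_all only: prod.inject)
 have RR: "?R = ?R'" using e1(1) by linarith
 have "(1 - p) / 2 = (1 - q) / 2 ==> p = q" for p q :: real by simp
 from this[OF e1(2)] have q: "x / ?R = x' / ?R'" .
 note r = barc_rad[OF u s t] barc_rad[OF u' s' t']
 show xx: "x = x'" using q r(1) unfolding RR by simp
 have "?R\<^sup>2 = ?R'\<^sup>2" using RR by simp
 thus "(x - s) * (t - x) = (x - s') * (t' - x)" using r(4,8) xx unfolding x_def x'_def by simp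
qed

lemma barc_arc:
 fixes s t w :: real
 assumes st: "s < t" and s: "1 <= \<bar>s\<bar>" "\<bar>s\<bar> <= w" and t: "1 <= \<bar>t\<bar>" "\<bar>t\<bar> <= w"
 shows "arc (barc w s t)" "path_image (barc w s t) <= {0..w - 1} \<times> {0..1}"
  "pathstart (barc w s t) = (w - \<bar>s\<bar>, (1 - sgn s) / 2)" "pathfinish (barc w s t) = (w - \<bar>t\<bar>, (1 - sgn t) / 2)"
proof -
 have R: "1 <= sqrt ((1 - u) * s\<^sup>2 + u * t\<^sup>2)" if "u : {0..1}" for u using barc_rad(1)[OF _ _ s t] that by auto
 have "continuous_on {0..1} (barc w s t)" unfolding barc_def using R by (auto intro!: continuous_intros simp: less_le_not_le) (smt (verit))+
 moreover have "inj_on (barc w s t) {0..1}"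
 proof (rule inj_onI)
  fix u v assume uv: "u : {0..1}" "v : {0..1}" "barc w s t u = barc w s t v"
  hence "(1 - u) * s + u * t = (1 - v) * s + v * t" using barc_eq(1)[OF _ _ s t _ _ s t] by auto
  hence "(u - v) * (t - s) = 0" by (simp add: algebra_simps)
  thus "u = v" using st by simp
 qed
 ultimately show "arc (barc w s t)" unfolding arc_def path_def by blast
 show "path_image (barc w s t) <= {0..w - 1} \<times> {0..1}"
 proof
  fix z assume "z : path_image (barc w s t)"
  then obtain u where u: "0 <= u" "u <= 1" "z = barc w s t u" unfolding path_image_def by auto
  note r = barc_rad[OF u(1,2) s t]
  have "\<bar>((1 - u) * s + u * t) / sqrt ((1 - u) * s\<^sup>2 + u * t\<^sup>2)\<bar> <= 1" using r(1,3) by (simp add: abs_divide)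
  moreover have "0 <= (1 - p) / 2 & (1 - p) / 2 <= 1" if "\<bar>p\<bar> <= 1" for p :: real using that by auto
  ultimately have "0 <= (1 - ((1 - u) * s + u * t) / sqrt ((1 - u) * s\<^sup>2 + u * t\<^sup>2)) / 2 & (1 - ((1 - u) * s + u * t) / sqrt ((1 - u) * s\<^sup>2 + u * t\<^sup>2)) / 2 <= 1"
   by blast
  thus "z : {0..w - 1} \<times> {0..1}" using r(1,2) unfolding u(3) barc_def mem_Times_iff fst_conv snd_conv atLeastAtMost_iff by simp
 qed
 show "pathstart (barc w s t) = (w - \<bar>s\<bar>, (1 - sgn s) / 2)" "pathfinish (barc w s t) = (w - \<bar>t\<bar>, (1 - sgn t) / 2)"
  unfolding pathstart_def pathfinish_def barc_def by (simp_all add: real_sgn_eq)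
qed

text \<open>Disjoint segments share no abscissa, and over nested segments the outer half circle is
  strictly higher.\<close>

lemma barc_disjoint:
 fixes s t w :: real
 assumes st: "s < t" and s: "1 <= \<bar>s\<bar>" "\<bar>s\<bar> <= w" and t: "1 <= \<bar>t\<bar>" "\<bar>t\<bar> <= w"
  and st': "s' < t'" and s': "1 <= \<bar>s'\<bar>" "\<bar>s'\<bar> <= w" and t': "1 <= \<bar>t'\<bar>" "\<bar>t'\<bar> <= w"
  and dis: "t < s' \<or> t' < s \<or> s < s' & t' < t \<or> s' < s & t < t'"
 shows "path_image (barc w s t) Int path_image (barc w s' t') = {}"
proof (rule ccontr)
 assume "\<not> ?thesis"
 then obtain u u' where u: "0 <= u" "u <= 1" "0 <= u'" "u' <= 1" "barc w s t u = barc w s' t' u'"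
  unfolding path_image_def by fastforce
 define x where "x = (1 - u) * s + u * t"
 have x': "x = (1 - u') * s' + u' * t'" and e: "(x - s) * (t - x) = (x - s') * (t' - x)"
  using barc_eq[OF u(1,2) s t u(3,4) s' t' u(5)] unfolding x_def by auto
 have cb: "c <= (1 - v) * c + v * d" "(1 - v) * c + v * d <= d" if "0 <= v" "v <= 1" "c < d" for c d v :: real
  using mult_left_mono[of c d v] mult_left_mono[of c d "1 - v"] that by (simp_all add: algebra_simps)
 have b: "s <= x" "x <= t" using cb[OF u(1,2) st] unfolding x_def by auto
 have b': "s' <= x" "x <= t'" using cb[OF u(3,4) st'] unfolding x' by auto
 from dis show False
 proof (elim disjE conjE)
  assume "s < s'" "t' < t"
  hence "(x - s') * (t' - x) <= (x - s') * (t - x)" "(x - s') * (t - x) < (x - s) * (t - x)" using b b'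
   by (auto intro!: mult_left_mono mult_strict_right_mono)
  thus False using e by simp
 next
  assume "s' < s" "t < t'"
  hence "(x - s) * (t - x) <= (x - s) * (t' - x)" "(x - s) * (t' - x) < (x - s') * (t' - x)" using b b'
   by (auto intro!: mult_left_mono mult_strict_right_mono)
  thus False using e by simp
 qed (use b b' in auto)
qed

lemma noncross_planar:
 assumes al: "al : brauer A B" and w: "w = real (max (card A) (card B)) + 2"
  and f: "bij_betw (pos (leq A)) A {1..card A}" "bij_betw (pos (leq B)) B {1..card B}"
  and n: "noncross (bent_key w (pos (leq A)) (pos (leq B))) al"
 shows "planar leq al"
proof -
 let ?ka = "bent_key w (pos (leq A)) (pos (leq B))"
 have dom: "bdom al = A" "bran al = B" using brauer_dom[OF al] by auto
 have pA: "1 <= pos (leq A) a & pos (leq A) a <= card A" if "a : A" for a using f(1) that unfolding bij_betw_def by fastforce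
 have pB: "1 <= pos (leq B) a & pos (leq B) a <= card B" if "a : B" for a using f(2) that unfolding bij_betw_def by fastforce
 have cases: "?ka v <= -1 & -w <= ?ka v & (EX a:A. v = Inl a) \<or> 1 <= ?ka v & ?ka v <= w & (EX b:B. v = Inr b)" if "v : A <+> B" for v
  using that pA pB unfolding bent_key_def w by fastforce
 have bnd: "1 <= \<bar>?ka v\<bar>" "\<bar>?ka v\<bar> <= w" if "v : A <+> B" for v using cases[OF that] by auto
 have inj: "u = v" if uv: "u : A <+> B" "v : A <+> B" "?ka u = ?ka v" for u v
  using cases[OF uv(1)] cases[OF uv(2)] uv(3) f unfolding bij_betw_def by (auto simp: bent_key_def dest: inj_onD)
 have vert: "vertex leq al v = (w - \<bar>?ka v\<bar>, (1 - sgn (?ka v)) / 2)" if "v : A <+> B" for v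
  using cases[OF that] unfolding vertex_def dom bent_key_def by auto
 have blk: "\<exists>p q. K = {p, q} & p : A <+> B & q : A <+> B & ?ka p < ?ka q & Min (?ka ` K) = ?ka p & Max (?ka ` K) = ?ka q" if K: "K : al" for K
 proof -
  obtain p q where pq: "p ~= q" "K = {p, q}" using brauer_block[OF al K] by blast
  have m: "p : A <+> B" "q : A <+> B" using brauerD[OF al] K pq(2) unfolding partition_on_def by blast+
  have one: "\<exists>p q. K = {p, q} & p : A <+> B & q : A <+> B & ?ka p < ?ka q & Min (?ka ` K) = ?ka p & Max (?ka ` K) = ?ka q"
   if "K = {p, q}" "p : A <+> B" "q : A <+> B" "?ka p < ?ka q" for p q
   by (rule exI[of _ p], rule exI[of _ q]) (use that in \<open>simp add: min_def max_def\<close>)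
  have "?ka p < ?ka q \<or> ?ka q < ?ka p" using inj[OF m] pq(1) by linarith
  thus ?thesis using one[OF pq(2) m] one[OF pq(2)[unfolded insert_commute[of p q]] m(2,1)] by blast
 qed
 \<comment> \<open>A block has no preferred order of its points; minimum and maximum of the keys
   orient its arc from left to right.\<close>
 let ?\<gamma> = "%K. barc w (Min (?ka ` K)) (Max (?ka ` K))"
 show ?thesis unfolding planar_def
 proof (intro exI[of _ ?\<gamma>] conjI ballI impI)
  fix K assume "K : al"
  then obtain p q where K: "K = {p, q}" "p : A <+> B" "q : A <+> B" "?ka p < ?ka q" "Min (?ka ` K) = ?ka p" "Max (?ka ` K) = ?ka q"
   using blk by metis
  note a = barc_arc[OF K(4) bnd[OF K(2)] bnd[OF K(3)]]
  show "arc (?\<gamma> K)" unfolding K(5,6) by (rule a)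
  show "{pathstart (?\<gamma> K), pathfinish (?\<gamma> K)} = vertex leq al ` K" unfolding K(5,6) a(3,4) using vert K(1,2,3) by simp
  have w1: "real (max (card A) (card B)) + 1 = w - 1" using w by simp
  show "path_image (?\<gamma> K) <= {0..real (max (card (bdom al)) (card (bran al))) + 1} \<times> {0..1}" unfolding K(5,6) dom w1 by (rule a(2))
 next
  fix K L assume KL: "K : al" "L : al" "K ~= L"
  obtain p q where K: "K = {p, q}" "p : A <+> B" "q : A <+> B" "?ka p < ?ka q" "Min (?ka ` K) = ?ka p" "Max (?ka ` K) = ?ka q"
   using blk[OF KL(1)] by metis
  obtain a b where L: "L = {a, b}" "a : A <+> B" "b : A <+> B" "?ka a < ?ka b" "Min (?ka ` L) = ?ka a" "Max (?ka ` L) = ?ka b"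
   using blk[OF KL(2)] by metis
  have "K Int L = {}" using brauer_unique[OF al KL(1,2)] KL(3) by blast
  hence "p ~= a" "p ~= b" "q ~= a" "q ~= b" using K(1) L(1) by auto
  hence "?ka p ~= ?ka a" "?ka p ~= ?ka b" "?ka q ~= ?ka a" "?ka q ~= ?ka b" using inj K(2,3) L(2,3) by blast+
  moreover have "\<not> (?ka p < ?ka a & ?ka a < ?ka q & ?ka q < ?ka b)" "\<not> (?ka a < ?ka p & ?ka p < ?ka b & ?ka b < ?ka q)"
   using noncrossD[OF n, of p q a b] noncrossD[OF n, of a b p q] KL(1,2) unfolding K(1) L(1) by blast+
  ultimately show "path_image (?\<gamma> K) Int path_image (?\<gamma> L) = {}" unfolding K(5,6) L(5,6)
   by (intro barc_disjoint K(4) L(4) bnd K(2,3) L(2,3)) linarith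
 qed
qed

theorem planar_iff_NC:
 assumes A: "finite A" "linear_order_on A (leq A)" and B: "finite B" "linear_order_on B (leq B)" and al: "al : brauer A B"
 shows "planar leq al \<longleftrightarrow> NC (map Inl (ord_list (leq A) A) @ rev (map Inr (ord_list (leq B) B))) al"
proof -
 let ?l = "map Inl (ord_list (leq A) A) @ rev (map Inr (ord_list (leq B) B)) :: ('a + 'a) list"
 define w where "w = real (max (card A) (card B)) + 2"
 let ?ka = "bent_key w (pos (leq A)) (pos (leq B))"
 have dom: "bdom al = A" "bran al = B" using brauer_dom[OF al] by auto
 have pA: "pos (leq A) a <= card A" if "a : A" for a using pos_bij[OF A] that unfolding bij_betw_def by fastforce
 have pB: "pos (leq B) a <= card B" if "a : B" for a using pos_bij[OF B] that unfolding bij_betw_def by fastforce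
 have "?ka (Inl a) < ?ka (Inr b)" if "a : A" "b : B" for a b
  using pA[OF that(1)] pB[OF that(2)] unfolding bent_key_def w_def by auto
 hence s: "sorted_wrt (%x y. ?ka x < ?ka y) ?l"
  using sorted_ord_list[OF A] sorted_ord_list[OF B] set_ord_list[OF A] set_ord_list[OF B]
  by (auto simp: sorted_wrt_append sorted_wrt_map sorted_wrt_rev bent_key_def elim!: sorted_wrt_mono_rel[rotated])
 have set: "set ?l = A <+> B" using set_ord_list[OF A] set_ord_list[OF B] by auto
 show ?thesis
 proof
  assume "planar leq al"
  from planar_noncross[OF this, of w] have "noncross ?ka al" unfolding dom w_def by simp
  thus "NC ?l al" using noncross_NC[OF s] brauerD[OF al] brauer_card[OF al] unfolding set by blast
 next
  assume "NC ?l al"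
  thus "planar leq al" using NC_noncross[OF _ s] noncross_planar[of al A B, OF al w_def pos_bij[OF A] pos_bij[OF B]] by blast
 qed
qed

section \<open>Annular and anti-annular partitions as cyclic matchings\<close>

lemma rel_bd:
 fixes f :: "'a => 'a"
 assumes "!!a. a : A ==> f a : A" "!!a b. a : A ==> b : A ==> R a b \<longleftrightarrow> b = f a"
 shows "{{Inl a, Inr b} | a b. a : A & b : A & R a b} = bd f A"
proof -
 have "(\<exists>a b. K = {Inl a, Inr b} & a : A & b : A & R a b) \<longleftrightarrow> (\<exists>c. K = {Inl c, Inr (f c)} & c : A)" for K :: "('a + 'a) set"
  using assms by metis
 thus ?thesis unfolding bd_def by (intro Collect_cong)
qed

lemma pos_nth:
 assumes "finite A" "linear_order_on A r" "i < card A"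
 shows "pos r (ord_list r A ! i) = Suc i"
 using arg_cong[OF map_pos_ord_list[OF assms(1,2)], of "%l. l ! i"] assms(3) length_ord_list[OF assms(1,2)] by (simp del: upt_Suc)

lemma ord_list_nthE:
 assumes "finite A" "linear_order_on A r" "a : A"
 obtains i where "i < card A" "a = ord_list r A ! i"
 using assms(3) set_ord_list[OF assms(1,2)] length_ord_list[OF assms(1,2)] by (metis in_set_conv_nth)

lemma delta_bd:
 assumes A: "finite A" "linear_order_on A r"
 shows "\<exists>f. map f (ord_list r A) = rotate1 (ord_list r A) & inj_on f A & f ` A = A & delta r A = bd f A"
proof -
 let ?xs = "ord_list r A"
 note s = set_ord_list[OF A] and d = distinct_ord_list[OF A] and l = length_ord_list[OF A]
 obtain f where f: "rotate1 ?xs = map f ?xs" using distinct_map_ex[OF d, of "rotate1 ?xs"] by auto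
 have fs: "f ` A = A" using arg_cong[OF f, of set] s by simp
 have fn: "f (?xs ! i) = ?xs ! (Suc i mod card A)" if "i < card A" for i
  using arg_cong[OF f, of "%l. l ! i"] that l by (simp add: nth_rotate1)
 have "(pos r b = pos r a + 1 \<or> pos r a = card A & pos r b = 1) \<longleftrightarrow> b = f a" if ab: "a : A" "b : A" for a b
 proof -
  obtain i j where i: "i < card A" "a = ?xs ! i" and j: "j < card A" "b = ?xs ! j" using ord_list_nthE[OF A] ab by metis
  have "b = f a \<longleftrightarrow> j = Suc i mod card A"
   unfolding i(2) fn[OF i(1)] j(2) using nth_eq_iff_index_eq[OF d] i(1) j(1) l by simp
  also have "\<dots> \<longleftrightarrow> j = Suc i \<or> Suc i = card A & j = 0" using i(1) j(1) by (auto simp: mod_Suc)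
  finally show ?thesis unfolding i(2) j(2) pos_nth[OF A i(1)] pos_nth[OF A j(1)] by auto
 qed
 hence "delta r A = bd f A" unfolding delta_def using fs by (intro rel_bd) auto
 moreover have "inj_on f A" using arg_cong[OF f, of distinct] d s by (simp add: distinct_map)
 ultimately show ?thesis using f fs by metis
qed

lemma gamma_bd:
 assumes A: "finite A" "linear_order_on A r"
 shows "\<exists>f. map f (ord_list r A) = rev (ord_list r A) & inj_on f A & f ` A = A & gamma r A = bd f A"
proof -
 let ?xs = "ord_list r A"
 note s = set_ord_list[OF A] and d = distinct_ord_list[OF A] and l = length_ord_list[OF A]
 obtain f where f: "rev ?xs = map f ?xs" using distinct_map_ex[OF d, of "rev ?xs"] by auto
 have fs: "f ` A = A" using arg_cong[OF f, of set] s by simp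
 have fn: "f (?xs ! i) = ?xs ! (card A - Suc i)" if "i < card A" for i
  using arg_cong[OF f, of "%l. l ! i"] that l by (simp add: rev_nth)
 have "(pos r a + pos r b = card A + 1) \<longleftrightarrow> b = f a" if ab: "a : A" "b : A" for a b
 proof -
  obtain i j where i: "i < card A" "a = ?xs ! i" and j: "j < card A" "b = ?xs ! j" using ord_list_nthE[OF A] ab by metis
  have "b = f a \<longleftrightarrow> j = card A - Suc i"
   unfolding i(2) fn[OF i(1)] j(2) using nth_eq_iff_index_eq[OF d] i(1) j(1) l by simp
  thus ?thesis unfolding i(2) j(2) pos_nth[OF A i(1)] pos_nth[OF A j(1)] using i(1) j(1) by auto
 qed
 hence "gamma r A = bd f A" unfolding gamma_def using fs by (intro rel_bd) auto
 moreover have "inj_on f A" using arg_cong[OF f, of distinct] d s by (simp add: distinct_map)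
 ultimately show ?thesis using f fs by metis
qed

text \<open>Pulling one rotation out on the left turns the upper list by \<open>j\<close> further
  places; the induction repeats this \<open>k\<close> times.\<close>

lemma rotate_left_factor:
 assumes d: "distinct xs" and f: "map f xs = rotate j xs"
 shows "al : brauer (set xs) Y ==> NC (map Inl (rotate m xs) @ rev (map Inr ys)) al ==>
  \<exists>be\<in>brauer (set xs) Y. NC (map Inl (rotate (m + k * j) xs) @ rev (map Inr ys)) be & al = (cmp (bd f (set xs)) ^^ k) be"
proof (induction k arbitrary: m al)
 case 0
 thus ?case by auto
next
 case (Suc k)
 let ?A = "set xs"
 have inj: "inj_on f ?A" and fA: "f ` ?A = ?A" using f d by (metis distinct_map distinct_rotate, metis set_map set_rotate)
 let ?g = "the_inv_into ?A f"
 have g: "inj_on ?g ?A" "?g ` ?A = ?A" using inj_on_the_inv_into[OF inj] the_inv_into_onto[OF inj] fA by auto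
 let ?h = "the_inv_into ?A ?g"
 have h: "?h c = f c" if "c : ?A" for c
 proof -
  have "f c : ?A" using fA that by blast
  hence "?h (?g (f c)) = f c" by (rule the_inv_into_f_f[OF g(1)])
  thus ?thesis using the_inv_into_f_f[OF inj that] by simp
 qed
 have al: "al : brauer (?g ` ?A) Y" using Suc.prems(1) g(2) by simp
 let ?M = "relabel ?h al"
 have M: "?M : brauer ?A Y" by (rule relabel_brauer[OF g(1) al])
 have "?M = cmp (bflip (bd f ?A)) al" using bd_comp[OF g(1) al] bflip_bd[OF inj] fA by simp
 hence "cmp (bd f ?A) ?M = cmp (bd id ?A) al" using bd_bflip[OF inj] brauer_comp_assoc by metis
 hence eq: "cmp (bd f ?A) ?M = al" using one_comp[OF Suc.prems(1)] by simp
 have "map ?h (rotate m xs) = map f (rotate m xs)" using h by simp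
 also have "\<dots> = rotate m (map f xs)" by (rule rotate_map[symmetric])
 also have "\<dots> = rotate (m + j) xs" unfolding f by (simp add: rotate_rotate)
 finally have e: "map ?h (rotate m xs) = rotate (m + j) xs" .
 have "map (map_sum ?h id) (map Inl (rotate m xs) @ rev (map Inr ys)) = map Inl (rotate (m + j) xs) @ rev (map Inr ys)"
  unfolding e[symmetric] by (simp add: rev_map comp_def)
 hence N: "NC (map Inl (rotate (m + j) xs) @ rev (map Inr ys)) ?M"
  using NC_map[OF Suc.prems(2), of "map_sum ?h id"] unfolding relabel_def by simp
 from Suc.IH[OF M N] obtain be where "be : brauer ?A Y" "NC (map Inl (rotate (m + j + k * j) xs) @ rev (map Inr ys)) be"
  "?M = (cmp (bd f ?A) ^^ k) be" by blast
 moreover have "m + j + k * j = m + Suc k * j" by simp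
 ultimately show ?case using eq by (intro bexI[of _ be]) simp_all
qed

lemma NC_bflip: "NC (map Inl xs @ rev (map Inr ys)) al ==> NC (map Inl ys @ rev (map Inr xs)) (bflip al)"
 using NC_rev[OF NC_map[of "map Inl xs @ rev (map Inr ys)" al swap_sum]] unfolding map_swap_parts bflip_def by simp

lemma bflip_power: "bflip ((cmp u ^^ k) be) = ((%x. cmp x (bflip u)) ^^ k) (bflip be)"
 by (induction k) (simp_all add: bflip_comp)

lemma rot_to: "rot xs xs' ==> \<exists>m. xs' = rotate m xs" unfolding rot_def .

lemma rotate_multiple: "rotate (length xs * m) xs = xs"
 by (simp add: rotate_id)

text \<open>Towards \<open>Jhom\<close> closure under products suffices. In the other direction both
  lists must be brought back to their standard position, but only nonnegative powers of the
  rotations are available; so each circle is turned onwards until it has completed full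
  turns.\<close>

theorem annular_iff:
 assumes A: "finite A" "linear_order_on A (leq A)" "odd (card A)" and B: "finite B" "linear_order_on B (leq B)" "odd (card B)"
  and al: "al : brauer A B"
 shows "annular leq al \<longleftrightarrow> al : Jhom (ord_list (leq A) A) (ord_list (leq B) B)"
proof -
 let ?xs = "ord_list (leq A) A" and ?ys = "ord_list (leq B) B"
 let ?dA = "delta (leq A) A" and ?dB = "delta (leq B) B"
 note sA = set_ord_list[OF A(1,2)] and dA = distinct_ord_list[OF A(1,2)] and lA = length_ord_list[OF A(1,2)]
 note sB = set_ord_list[OF B(1,2)] and dB = distinct_ord_list[OF B(1,2)] and lB = length_ord_list[OF B(1,2)]
 obtain f where f: "map f ?xs = rotate1 ?xs" "inj_on f A" "f ` A = A" "?dA = bd f A" using delta_bd[OF A(1,2)] by blast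
 obtain g where g: "map g ?ys = rotate1 ?ys" "inj_on g B" "g ` B = B" "?dB = bd g B" using delta_bd[OF B(1,2)] by blast
 have rot1: "rot zs (rotate1 zs)" for zs :: "'a list" unfolding rot_def by (intro exI[of _ 1]) simp
 have DA: "?dA : Jhom ?xs ?xs" using bd_Jhom[of ?xs f ?xs] rot1 f sA by simp
 have DB: "?dB : Jhom ?ys ?ys" using bd_Jhom[of ?ys g ?ys] rot1 g sB by simp
 have oA: "odd (length ?xs)" and oB: "odd (length ?ys)" using A(3) B(3) lA lB by auto
 have ann: "annular leq al \<longleftrightarrow> (\<exists>s t. \<exists>be\<in>brauer A B. planar leq be &
    al = ((%x. cmp x ?dB) ^^ t) ((cmp ?dA ^^ s) be))"
  unfolding annular_def Let_def using brauer_dom[OF al] by simp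
 show ?thesis
 proof
  assume "annular leq al"
  then obtain s t be where b: "be : brauer A B" "planar leq be"
   and e: "al = ((%x. cmp x ?dB) ^^ t) ((cmp ?dA ^^ s) be)" unfolding ann by blast
  have b0: "be : Jhom ?xs ?ys"
   using planar_iff_NC[OF A(1,2) B(1,2) b(1)] b(2) JhomI[OF rot_refl rot_refl] by blast
  have l: "(cmp ?dA ^^ s) be : Jhom ?xs ?ys"
   by (induction s) (use b0 Jhom_comp[OF dA dA oA dB DA] in simp_all)
  have "((%x. cmp x ?dB) ^^ t) ((cmp ?dA ^^ s) be) : Jhom ?xs ?ys"
   by (induction t) (use l Jhom_comp[OF dA dB oB dB _ DB] in simp_all)
  thus "al : Jhom ?xs ?ys" using e by simp
 next
  assume "al : Jhom ?xs ?ys"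
  then obtain xs' ys' where h: "rot ?xs xs'" "rot ?ys ys'" "NC (map Inl xs' @ rev (map Inr ys')) al" unfolding Jhom_def by blast
  obtain m where m: "xs' = rotate m ?xs" using rot_to[OF h(1)] by blast
  obtain n where n: "ys' = rotate n ?ys" using rot_to[OF h(2)] by blast
  \<comment> \<open>On the flipped partition the lower rotations act through the inverse of
    \<open>g\<close>, which turns by \<open>?k - 1\<close>. The list stands at \<open>n\<close>, and
    \<open>n\<close> such steps bring it to \<open>?k * n\<close>, that is \<open>n\<close> full
    turns.\<close>
  let ?k = "length ?ys" and ?gi = "the_inv_into B g"
  have k1: "?k >= 1" using oB by (cases ?ys) auto
  have "map g (rotate (?k - 1) ?ys) = rotate (?k - 1) (rotate1 ?ys)" unfolding rotate_map[symmetric] g(1) ..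
  also have "\<dots> = rotate (Suc (?k - 1)) ?ys" by (simp add: rotate1_rotate_swap)
  also have "Suc (?k - 1) = ?k" using k1 by simp
  also have "rotate ?k ?ys = ?ys" by (simp only: rotate_id mod_self)
  finally have "map ?gi ?ys = map ?gi (map g (rotate (?k - 1) ?ys))" by simp
  also have "\<dots> = rotate (?k - 1) ?ys" unfolding map_map by (rule map_idI) (use the_inv_into_f_f[OF g(2)] sB in simp)
  finally have gi: "map ?gi ?ys = rotate (?k - 1) ?ys" .
  have "bflip al : brauer (set ?ys) A" using bflip_brauer[OF al] sB by simp
  from rotate_left_factor[OF dB gi this, of n xs' n] NC_bflip[OF h(3)]
  obtain be1 where be1: "be1 : brauer B A" "NC (map Inl (rotate (n + n * (?k - 1)) ?ys) @ rev (map Inr xs')) be1"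
   "bflip al = (cmp (bd ?gi B) ^^ n) be1" unfolding n sB by blast
  have "n + n * (?k - 1) = ?k * n" using k1 by (cases ?k) auto
  hence N1: "NC (map Inl xs' @ rev (map Inr ?ys)) (bflip be1)" using NC_bflip[OF be1(2)] rotate_multiple[of ?ys n] by simp
  have b1: "bflip be1 : brauer (set ?xs) B" using bflip_brauer[OF be1(1)] sA by simp
  have "bflip (bd ?gi B) = ?dB" using bflip_bd[OF g(2)] g(3,4) bflip_bflip by metis
  hence e0: "bflip (bd ?gi B) = ?dB" .
  have e1: "al = ((%x. cmp x ?dB) ^^ n) (bflip be1)" using arg_cong[OF be1(3), of bflip] unfolding bflip_power e0 bflip_bflip .
  let ?l = "length ?xs"
  have f1: "map f ?xs = rotate 1 ?xs" using f(1) by simp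
  \<comment> \<open>The upper list stands at \<open>m\<close>; a further \<open>?l * m - m\<close>
    single rotations complete \<open>m\<close> full turns.\<close>
  from rotate_left_factor[OF dA f1 b1, of m ?ys "?l * m - m"] N1
  obtain be where be: "be : brauer A B" "NC (map Inl (rotate (m + (?l * m - m) * 1) ?xs) @ rev (map Inr ?ys)) be"
   "bflip be1 = (cmp (bd f A) ^^ (?l * m - m)) be" unfolding m sA by blast
  have "?l >= 1" using oA by (cases ?xs) auto
  hence "m <= ?l * m" by simp
  hence "m + (?l * m - m) * 1 = ?l * m" by simp
  hence "NC (map Inl ?xs @ rev (map Inr ?ys)) be" using be(2) rotate_multiple[of ?xs m] by simp
  hence "planar leq be" using planar_iff_NC[OF A(1,2) B(1,2) be(1)] by blast
  thus "annular leq al" unfolding ann using be(1,3) e1 f(4) by metis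
 qed
qed

text \<open>The reflection given by \<open>gamma\<close> is an involution that reverses the upper
  list, so multiplying by it converts one description into the other in both directions.\<close>

theorem anti_annular_iff:
 assumes A: "finite A" "linear_order_on A (leq A)" "odd (card A)" and B: "finite B" "linear_order_on B (leq B)" "odd (card B)"
  and al: "al : brauer A B"
 shows "anti_annular leq al \<longleftrightarrow> al : Jhom (rev (ord_list (leq A) A)) (ord_list (leq B) B)"
proof -
 let ?xs = "ord_list (leq A) A" and ?ys = "ord_list (leq B) B" and ?c = "gamma (leq A) A"
 note sA = set_ord_list[OF A(1,2)] and dA = distinct_ord_list[OF A(1,2)]
 note sB = set_ord_list[OF B(1,2)] and dB = distinct_ord_list[OF B(1,2)]
 obtain f where f: "map f ?xs = rev ?xs" "inj_on f A" "f ` A = A" "?c = bd f A" using gamma_bd[OF A(1,2)] by blast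
 have al': "al : brauer (f ` A) B" using al f(3) by simp
 have b: "cmp ?c al : brauer A B" unfolding f(4) bd_comp[OF f(2) al'] by (rule relabel_brauer[OF f(2) al'])
 have "anti_annular leq al \<longleftrightarrow> cmp ?c al : Jhom ?xs ?ys"
  unfolding anti_annular_def brauer_dom(1)[OF al] using annular_iff[OF A B b] .
 also have "\<dots> \<longleftrightarrow> al : Jhom (rev ?xs) ?ys"
 proof
  assume h: "cmp ?c al : Jhom ?xs ?ys"
  have rr: "map f (rev ?xs) = ?xs" using f(1) by (simp flip: rev_map)
  hence "rot ?xs (map f (rev ?xs))" by simp
  from bd_mul_Jhom[OF dA dB _ this h] have m: "cmp ?c (cmp ?c al) : Jhom (rev ?xs) ?ys"
   using f(2,4) sA by simp
  have "map (f \<circ> f) ?xs = ?xs" using f(1) rr by (metis map_map)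
  hence "(f \<circ> f) c = id c" if "c : A" for c using that sA map_eq_conv[of "f \<circ> f" ?xs id] by (simp add: map_idI)
  hence "bd (f \<circ> f) A = bd id A" by (intro bd_cong)
  hence "cmp ?c ?c = bd id A" using bd_bd[of f A f] f by simp
  hence "cmp ?c (cmp ?c al) = al" using one_comp[OF al] brauer_comp_assoc by metis
  thus "al : Jhom (rev ?xs) ?ys" using m by simp
 next
  assume h: "al : Jhom (rev ?xs) ?ys"
  have "rot (rev ?xs) (map f ?xs)" using f(1) by simp
  from bd_mul_Jhom[OF _ dB _ this h] show "cmp ?c al : Jhom ?xs ?ys" using f(2,4) sA dA by simp
 qed
 finally show ?thesis .
qed

lemma Jones_carrier_iff:
 assumes A: "finite A & odd (card A) & linear_order_on A (leq A)" and B: "finite B & odd (card B) & linear_order_on B (leq B)"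
 shows "al : brauer A B & annular leq al \<longleftrightarrow> al : JH False (ord_list (leq A) A) (ord_list (leq B) B)" (is ?J)
  and "al : brauer A B & (annular leq al \<or> anti_annular leq al) \<longleftrightarrow> al : JH True (ord_list (leq A) A) (ord_list (leq B) B)" (is ?K)
proof -
 have a: "finite A" "linear_order_on A (leq A)" "odd (card A)" and b: "finite B" "linear_order_on B (leq B)" "odd (card B)" using A B by auto
 have o: "olist (ord_list (leq A) A)" "olist (ord_list (leq B) B)"
  unfolding olist_def using distinct_ord_list[OF a(1,2)] length_ord_list[OF a(1,2)] distinct_ord_list[OF b(1,2)] length_ord_list[OF b(1,2)] a(3) b(3) by simp_all
 have br: "al : brauer A B" if "al : JH s (ord_list (leq A) A) (ord_list (leq B) B)" for s
  using JH_brauer[OF that] set_ord_list[OF a(1,2)] set_ord_list[OF b(1,2)] by simp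
 show ?J using br[of False] annular_iff[OF a b, of al] o unfolding JH_def by blast
 show ?K using br[of True] annular_iff[OF a b, of al] anti_annular_iff[OF a b, of al] o unfolding JH_def by blast
qed

section \<open>Partial rectangular bands\<close>

lemma equiv_iff: "equiv A r \<longleftrightarrow> r <= A \<times> A & (ALL x:A. (x, x) : r) & (\<forall>x y. (x, y) : r --> (y, x) : r) &
  (\<forall>x y z. (x, y) : r --> (y, z) : r --> (x, z) : r)"
 unfolding equiv_def refl_on_def sym_def trans_def by blast

lemma CongI:
 assumes "!!x y. (x, y) : sg ==> x : carrier S & y : carrier S" "!!x. x : carrier S ==> (x, x) : sg"
  "!!x y. (x, y) : sg ==> (y, x) : sg" "!!x y z. (x, y) : sg ==> (y, z) : sg ==> (x, z) : sg"
  and t: "!!x y. (x, y) : sg ==> src S x = src S y & tgt S x = tgt S y"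
  and l: "!!x y a. (x, y) : sg ==> a : carrier S ==> tgt S a = src S x ==> (pmul S a x, pmul S a y) : sg"
  and r: "!!x y a. (x, y) : sg ==> a : carrier S ==> tgt S x = src S a ==> (pmul S x a, pmul S y a) : sg"
 shows "sg : Cong S"
 unfolding Cong_def congruence_on_def
proof (intro CollectI conjI)
 show "equiv (carrier S) sg" unfolding equiv_iff
 proof (intro conjI allI impI ballI)
  show "sg <= carrier S \<times> carrier S" by (rule subrelI) (use assms(1) in simp)
 qed (fact assms(2-4))+
 show "sg <= tnabla S" unfolding tnabla_def by (rule subrelI) (use assms(1) t in simp)
 show "ALL (x, y):sg. ALL a:carrier S. (tgt S a = src S x --> (pmul S a x, pmul S a y) : sg) &
    (tgt S x = src S a --> (pmul S x a, pmul S y a) : sg)"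
  by (intro ballI, clarify) (use l r in blast)
qed

lemma CongD:
 assumes "sg : Cong S"
 shows "(x, y) : sg ==> x : carrier S & y : carrier S" "x : carrier S ==> (x, x) : sg"
  "(x, y) : sg ==> (y, x) : sg" "(x, y) : sg ==> (y, z) : sg ==> (x, z) : sg"
  "(x, y) : sg ==> src S x = src S y & tgt S x = tgt S y"
  "(x, y) : sg ==> a : carrier S ==> tgt S a = src S x ==> (pmul S a x, pmul S a y) : sg"
  "(x, y) : sg ==> a : carrier S ==> tgt S x = src S a ==> (pmul S x a, pmul S y a) : sg"
proof -
 note h = assms[unfolded Cong_def congruence_on_def mem_Collect_eq]
 note e = h[THEN conjunct1, unfolded equiv_iff]
 note e1 = e[THEN conjunct1] and e2 = e[THEN conjunct2, THEN conjunct1] and e3 = e[THEN conjunct2, THEN conjunct2, THEN conjunct1]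
  and e4 = e[THEN conjunct2, THEN conjunct2, THEN conjunct2]
 show "x : carrier S ==> (x, x) : sg" using e2 by (rule bspec)
 show "(x, y) : sg ==> (y, x) : sg" using e3 by simp
 show "(x, y) : sg ==> (y, z) : sg ==> (x, z) : sg" using e4[THEN spec, THEN spec, THEN spec, THEN mp, THEN mp] .
 {
  assume xy: "(x, y) : sg"
  show "x : carrier S & y : carrier S" using subsetD[OF e1 xy] by simp
  show "src S x = src S y & tgt S x = tgt S y"
   using subsetD[OF h[THEN conjunct2, THEN conjunct1] xy] unfolding tnabla_def by simp
  have c: "ALL a:carrier S. (tgt S a = src S x --> (pmul S a x, pmul S a y) : sg) &
    (tgt S x = src S a --> (pmul S x a, pmul S y a) : sg)"
   using bspec[OF h[THEN conjunct2, THEN conjunct2] xy] by simp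
  show "a : carrier S ==> tgt S a = src S x ==> (pmul S a x, pmul S a y) : sg"
   "a : carrier S ==> tgt S x = src S a ==> (pmul S x a, pmul S y a) : sg" using c by simp_all
 }
qed

definition pullback :: "'m set => ('m => 'n) => 'n rel => 'm rel" where
 "pullback A \<phi> \<tau> = {(x, y) : A \<times> A. (\<phi> x, \<phi> y) : \<tau>}"

lemma mem_pullback: "(x, y) : pullback A \<phi> \<tau> \<longleftrightarrow> x : A & y : A & (\<phi> x, \<phi> y) : \<tau>"
 unfolding pullback_def by simp

lemma Cong_psg_iso:
 assumes iso: "psg_iso S T \<phi>"
  and closed: "!!x y. x : carrier S ==> y : carrier S ==> tgt S x = src S y ==> pmul S x y : carrier S"
 shows "Cong S = pullback (carrier S) \<phi> ` Cong T"
proof -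
 have inj: "!!x y. x : carrier S ==> y : carrier S ==> \<phi> x = \<phi> y ==> x = y" and im: "\<phi> ` carrier S = carrier T"
  using iso unfolding psg_iso_def bij_betw_def inj_on_def by blast+
 have st: "!!x. x : carrier S ==> src T (\<phi> x) = src S x" "!!x. x : carrier S ==> tgt T (\<phi> x) = tgt S x"
  and hom: "!!x y. x : carrier S ==> y : carrier S ==> tgt S x = src S y ==> \<phi> (pmul S x y) = pmul T (\<phi> x) (\<phi> y)"
  using iso unfolding psg_iso_def by blast+
 have mem: "!!x. x : carrier S ==> \<phi> x : carrier T" using im by blast
 have preim: "\<exists>x. x : carrier S & p = \<phi> x" if h: "p : carrier T" for p
 proof -
  have "p : \<phi> ` carrier S" using h im by simp
  thus ?thesis by (rule imageE) (intro exI conjI)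
 qed
 have pre: "pullback (carrier S) \<phi> \<tau> : Cong S" if "\<tau> : Cong T" for \<tau>
 proof -
  note t1 = CongD(2)[OF that] and t2 = CongD(3)[OF that] and t3 = CongD(4)[OF that] and t4 = CongD(5)[OF that]
   and t5 = CongD(6)[OF that] and t6 = CongD(7)[OF that]
  show ?thesis
  proof (rule CongI)
   fix x y assume "(x, y) : pullback (carrier S) \<phi> \<tau>" thus "x : carrier S & y : carrier S" unfolding mem_pullback by blast
  next
   fix x assume "x : carrier S" thus "(x, x) : pullback (carrier S) \<phi> \<tau>" using t1 mem unfolding mem_pullback by blast
  next
   fix x y assume "(x, y) : pullback (carrier S) \<phi> \<tau>" thus "(y, x) : pullback (carrier S) \<phi> \<tau>" using t2 unfolding mem_pullback by blast
  next
   fix x y z assume "(x, y) : pullback (carrier S) \<phi> \<tau>" "(y, z) : pullback (carrier S) \<phi> \<tau>"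
   thus "(x, z) : pullback (carrier S) \<phi> \<tau>" using t3 unfolding mem_pullback by blast
  next
   fix x y assume "(x, y) : pullback (carrier S) \<phi> \<tau>"
   thus "src S x = src S y & tgt S x = tgt S y" using t4 st unfolding mem_pullback by metis
  next
   fix x y a assume h: "(x, y) : pullback (carrier S) \<phi> \<tau>" "a : carrier S" "tgt S a = src S x"
   hence x: "x : carrier S" "y : carrier S" "(\<phi> x, \<phi> y) : \<tau>" unfolding mem_pullback by auto
   have e: "tgt S a = src S y" "tgt T (\<phi> a) = src T (\<phi> x)" using t4[OF x(3)] st x h by auto
   show "(pmul S a x, pmul S a y) : pullback (carrier S) \<phi> \<tau>"
    using t5[OF x(3) mem[OF h(2)] e(2)] closed[OF h(2) x(1) h(3)] closed[OF h(2) x(2) e(1)] hom[OF h(2) x(1) h(3)] hom[OF h(2) x(2) e(1)]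
    unfolding mem_pullback by simp
  next
   fix x y a assume h: "(x, y) : pullback (carrier S) \<phi> \<tau>" "a : carrier S" "tgt S x = src S a"
   hence x: "x : carrier S" "y : carrier S" "(\<phi> x, \<phi> y) : \<tau>" unfolding mem_pullback by auto
   have e: "tgt S y = src S a" "tgt T (\<phi> x) = src T (\<phi> a)" using t4[OF x(3)] st x h by auto
   show "(pmul S x a, pmul S y a) : pullback (carrier S) \<phi> \<tau>"
    using t6[OF x(3) mem[OF h(2)] e(2)] closed[OF x(1) h(2) h(3)] closed[OF x(2) h(2) e(1)] hom[OF x(1) h(2) h(3)] hom[OF x(2) h(2) e(1)]
    unfolding mem_pullback by simp
  qed
 qed
 moreover have "sg : pullback (carrier S) \<phi> ` Cong T" if "sg : Cong S" for sg
 proof -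
  note t0 = CongD(1)[OF that] and t1 = CongD(2)[OF that] and t2 = CongD(3)[OF that] and t3 = CongD(4)[OF that]
   and t4 = CongD(5)[OF that] and t5 = CongD(6)[OF that] and t6 = CongD(7)[OF that]
  define \<tau> where "\<tau> = map_prod \<phi> \<phi> ` sg"
  have TI: "(x, y) : sg ==> (\<phi> x, \<phi> y) : \<tau>" for x y unfolding \<tau>_def by force
  have TE: "\<exists>x y. p = \<phi> x & q = \<phi> y & (x, y) : sg" if "(p, q) : \<tau>" for p q using that unfolding \<tau>_def by auto
  have TD: "(x, y) : sg" if h: "(\<phi> x, \<phi> y) : \<tau>" "x : carrier S" "y : carrier S" for x y
  proof -
   obtain x' y' where e: "\<phi> x = \<phi> x'" "\<phi> y = \<phi> y'" "(x', y') : sg" using TE[OF h(1)] by blast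
   hence "x = x'" "y = y'" using inj h(2,3) t0[OF e(3)] by blast+
   thus ?thesis using e(3) by simp
  qed
  have "\<tau> : Cong T"
  proof (rule CongI)
   fix p q assume h: "(p, q) : \<tau>"
   obtain x y where x: "p = \<phi> x" "q = \<phi> y" "(x, y) : sg" using TE[OF h] by blast
   show "p : carrier T & q : carrier T" using t0[OF x(3)] mem x(1,2) by simp
  next
   fix p assume "p : carrier T"
   then obtain x where x: "x : carrier S" "p = \<phi> x" using preim by metis
   show "(p, p) : \<tau>" unfolding x(2) by (rule TI[OF t1[OF x(1)]])
  next
   fix p q assume h: "(p, q) : \<tau>"
   obtain x y where x: "p = \<phi> x" "q = \<phi> y" "(x, y) : sg" using TE[OF h] by blast
   show "(q, p) : \<tau>" unfolding x(1,2) by (rule TI[OF t2[OF x(3)]])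
  next
   fix p q r assume h: "(p, q) : \<tau>" "(q, r) : \<tau>"
   obtain x y where x: "p = \<phi> x" "q = \<phi> y" "(x, y) : sg" using TE[OF h(1)] by blast
   obtain y' z where z: "q = \<phi> y'" "r = \<phi> z" "(y', z) : sg" using TE[OF h(2)] by blast
   have "y' = y" using inj[of y' y] t0[OF x(3)] t0[OF z(3)] x(2) z(1) by simp
   hence "(x, z) : sg" using t3[OF x(3)] z(3) by simp
   thus "(p, r) : \<tau>" unfolding x(1) z(2) by (rule TI)
  next
   fix p q assume h: "(p, q) : \<tau>"
   obtain x y where x: "p = \<phi> x" "q = \<phi> y" "(x, y) : sg" using TE[OF h] by blast
   show "src T p = src T q & tgt T p = tgt T q" unfolding x(1,2) using t4[OF x(3)] t0[OF x(3)] st by simp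
  next
   fix p q a assume h: "(p, q) : \<tau>" "a : carrier T" "tgt T a = src T p"
   obtain x y where x: "p = \<phi> x" "q = \<phi> y" "(x, y) : sg" using TE[OF h(1)] by blast
   obtain b where b: "b : carrier S" "a = \<phi> b" using preim[OF h(2)] by (elim exE conjE)
   have c: "x : carrier S" "y : carrier S" using t0[OF x(3)] by auto
   have e: "tgt S b = src S x" "tgt S b = src S y" using h(3) x(1) b st c t4[OF x(3)] by auto
   show "(pmul T a p, pmul T a q) : \<tau>"
    using TI[OF t5[OF x(3) b(1) e(1)]] hom[OF b(1) c(1) e(1)] hom[OF b(1) c(2) e(2)] x b by simp
  next
   fix p q a assume h: "(p, q) : \<tau>" "a : carrier T" "tgt T p = src T a"
   obtain x y where x: "p = \<phi> x" "q = \<phi> y" "(x, y) : sg" using TE[OF h(1)] by blast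
   obtain b where b: "b : carrier S" "a = \<phi> b" using preim[OF h(2)] by (elim exE conjE)
   have c: "x : carrier S" "y : carrier S" using t0[OF x(3)] by auto
   have e: "tgt S x = src S b" "tgt S y = src S b" using h(3) x(1) b st c t4[OF x(3)] by auto
   show "(pmul T p a, pmul T q a) : \<tau>"
    using TI[OF t6[OF x(3) b(1) e(1)]] hom[OF c(1) b(1) e(1)] hom[OF c(2) b(1) e(2)] x b by simp
  qed
  moreover have "sg = pullback (carrier S) \<phi> \<tau>"
  proof (rule subset_antisym; rule subrelI)
   fix x y assume "(x, y) : sg" thus "(x, y) : pullback (carrier S) \<phi> \<tau>" using TI t0 unfolding mem_pullback by blast
  next
   fix x y assume "(x, y) : pullback (carrier S) \<phi> \<tau>" thus "(x, y) : sg" using TD unfolding mem_pullback by blast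
  qed
  ultimately show ?thesis by blast
 qed
 ultimately show ?thesis by blast
qed

context
 fixes C :: "'o set" and X :: "'o => 'x set" and Y :: "'o => 'y set"
 assumes bf: "band_families C X Y"
begin

lemma X_unique: "A : C ==> B : C ==> x : X A ==> x : X B ==> A = B"
 using bf unfolding band_families_def disjoint_family_on_def by blast

lemma Y_unique: "A : C ==> B : C ==> y : Y A ==> y : Y B ==> A = B"
 using bf unfolding band_families_def disjoint_family_on_def by blast

lemma XY_ex: "A : C ==> \<exists>x. x : X A" "A : C ==> \<exists>y. y : Y A"
 using bf unfolding band_families_def by blast+

lemma src_rect_band: "A : C ==> x : X A ==> src (rect_band C X Y) (x, y) = A"
 unfolding rect_band_def by (auto intro!: the_equality X_unique)

lemma tgt_rect_band: "A : C ==> y : Y A ==> tgt (rect_band C X Y) (x, y) = A"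
 unfolding rect_band_def by (auto intro!: the_equality Y_unique)

lemma pmul_rect_band: "pmul (rect_band C X Y) (x, y) (x', y') = (x, y')"
 unfolding rect_band_def by simp

lemma carrier_rect_band: "(x, y) : carrier (rect_band C X Y) \<longleftrightarrow> (EX A:C. EX B:C. x : X A & y : Y B)"
 unfolding rect_band_def by auto

lemma mem_band_sigma: "((x, y), (x', y')) : band_sigma C X Y E1 E2 \<longleftrightarrow>
 (EX A:C. EX B:C. x : X A & x' : X A & y : Y B & y' : Y B & (x, x') : E1 A & (y, y') : E2 B)"
 unfolding band_sigma_def by simp

lemma band_sigma_iff: "A : C ==> B : C ==> x : X A ==> y : Y B ==> ((x, y), (x', y')) : band_sigma C X Y E1 E2 \<longleftrightarrow>
 x' : X A & y' : Y B & (x, x') : E1 A & (y, y') : E2 B"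
 unfolding mem_band_sigma using X_unique Y_unique by metis

lemma band_sigma_Cong:
 assumes E1: "!!A. A : C ==> E1 A : Eqv (X A)" and E2: "!!A. A : C ==> E2 A : Eqv (Y A)"
 shows "band_sigma C X Y E1 E2 : Cong (rect_band C X Y)"
proof -
 have e1: "A : C ==> x : X A ==> (x, x) : E1 A" "A : C ==> (x, y) : E1 A ==> (y, x) : E1 A"
  "A : C ==> (x, y) : E1 A ==> (y, z) : E1 A ==> (x, z) : E1 A" for A x y z
  using E1[of A] unfolding Eqv_def equiv_iff mem_Collect_eq by blast+
 have e2: "A : C ==> x : Y A ==> (x, x) : E2 A" "A : C ==> (x, y) : E2 A ==> (y, x) : E2 A"
  "A : C ==> (x, y) : E2 A ==> (y, z) : E2 A ==> (x, z) : E2 A" for A x y z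
  using E2[of A] unfolding Eqv_def equiv_iff mem_Collect_eq by blast+
 let ?s = "band_sigma C X Y E1 E2"
 show ?thesis
 proof (rule CongI)
  fix p q assume p: "(p, q) : ?s"
  obtain x y x' y' where q: "p = (x, y)" "q = (x', y')" by (cases p, cases q)
  thus "p : carrier (rect_band C X Y) & q : carrier (rect_band C X Y)"
   using p unfolding q mem_band_sigma carrier_rect_band by blast
 next
  fix p assume p: "p : carrier (rect_band C X Y)"
  obtain x y where q: "p = (x, y)" by (cases p)
  obtain A B where "A : C" "B : C" "x : X A" "y : Y B" using p unfolding q carrier_rect_band by blast
  thus "(p, p) : ?s" unfolding q using band_sigma_iff e1(1) e2(1) by blast
 next
  fix p q assume h: "(p, q) : ?s"
  obtain x y x' y' where q: "p = (x, y)" "q = (x', y')" by (cases p, cases q)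
  show "(q, p) : ?s" using h unfolding q mem_band_sigma using e1(2) e2(2) by metis
 next
  fix p q r assume h: "(p, q) : ?s" "(q, r) : ?s"
  obtain x y x' y' x'' y'' where q: "p = (x, y)" "q = (x', y')" "r = (x'', y'')" by (cases p, cases q, cases r)
  obtain A B where a: "A : C" "B : C" "x : X A" "x' : X A" "y : Y B" "y' : Y B" "(x, x') : E1 A" "(y, y') : E2 B"
   using h(1) unfolding q mem_band_sigma by blast
  hence "x'' : X A & y'' : Y B & (x', x'') : E1 A & (y', y'') : E2 B" using h(2) band_sigma_iff unfolding q by metis
  thus "(p, r) : ?s" unfolding q band_sigma_iff[OF a(1,2,3,5)] using a e1(3) e2(3) by metis
 next
  fix p q assume h: "(p, q) : ?s"
  obtain x y x' y' where q: "p = (x, y)" "q = (x', y')" by (cases p, cases q)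
  obtain A B where a: "A : C" "B : C" "x : X A" "x' : X A" "y : Y B" "y' : Y B" using h unfolding q mem_band_sigma by blast
  show "src (rect_band C X Y) p = src (rect_band C X Y) q & tgt (rect_band C X Y) p = tgt (rect_band C X Y) q"
   unfolding q using src_rect_band tgt_rect_band a by simp
 next
  fix p q a assume h: "(p, q) : ?s" "a : carrier (rect_band C X Y)"
  obtain x y x' y' u v where q: "p = (x, y)" "q = (x', y')" "a = (u, v)" by (cases p, cases q, cases a)
  obtain A B where b: "A : C" "B : C" "y : Y B" "y' : Y B" "(y, y') : E2 B" using h(1) unfolding q mem_band_sigma by blast
  obtain D where "D : C" "u : X D" using h(2) unfolding q carrier_rect_band by blast
  thus "(pmul (rect_band C X Y) a p, pmul (rect_band C X Y) a q) : ?s"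
   unfolding q pmul_rect_band using band_sigma_iff b e1(1) by metis
 next
  fix p q a assume h: "(p, q) : ?s" "a : carrier (rect_band C X Y)"
  obtain x y x' y' u v where q: "p = (x, y)" "q = (x', y')" "a = (u, v)" by (cases p, cases q, cases a)
  obtain A B where b: "A : C" "B : C" "x : X A" "x' : X A" "(x, x') : E1 A" using h(1) unfolding q mem_band_sigma by blast
  obtain D where "D : C" "v : Y D" using h(2) unfolding q carrier_rect_band by blast
  thus "(pmul (rect_band C X Y) p a, pmul (rect_band C X Y) q a) : ?s"
   unfolding q pmul_rect_band using band_sigma_iff b e2(1) by metis
 qed
qed

text \<open>A product keeps the first coordinate of its left factor and the second of its right one.
  So a related pair stays related after both second coordinates are overwritten by a common value,
  and likewise for the first ones; the coordinates can be treated separately.\<close>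

lemma Cong_band_sigma:
 assumes s: "sg : Cong (rect_band C X Y)"
 obtains E1 E2 where "sg = band_sigma C X Y E1 E2" "!!A. A : C ==> E1 A : Eqv (X A)" "!!A. A : C ==> E2 A : Eqv (Y A)"
proof -
 let ?T = "rect_band C X Y"
 note t0 = CongD(1)[OF s] and t1 = CongD(2)[OF s] and t2 = CongD(3)[OF s] and t3 = CongD(4)[OF s]
  and t4 = CongD(5)[OF s] and t5 = CongD(6)[OF s] and t6 = CongD(7)[OF s]
 have car: "(x, y) : carrier ?T" if "A : C" "B : C" "x : X A" "y : Y B" for A B x y using that carrier_rect_band by blast
 have right: "((x, v), (x', v)) : sg" if h: "((x, y), (x', y')) : sg" and "D : C" "v : Y D" for x y x' y' v D
 proof -
  obtain B where B: "B : C" "y : Y B" using t0[OF h] carrier_rect_band by blast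
  obtain u where u: "u : X B" using XY_ex(1)[OF B(1)] by blast
  have "tgt ?T (x, y) = src ?T (u, v)" using tgt_rect_band[OF B] src_rect_band[OF B(1) u] by simp
  thus ?thesis using t6[OF h car[OF B(1) that(2) u that(3)]] unfolding pmul_rect_band by blast
 qed
 have left: "((u, y), (u, y')) : sg" if h: "((x, y), (x', y')) : sg" and "D : C" "u : X D" for x y x' y' u D
 proof -
  obtain A where A: "A : C" "x : X A" using t0[OF h] carrier_rect_band by blast
  obtain v where v: "v : Y A" using XY_ex(2)[OF A(1)] by blast
  have "tgt ?T (u, v) = src ?T (x, y)" using tgt_rect_band[OF A(1) v] src_rect_band[OF A] by simp
  thus ?thesis using t5[OF h car[OF that(2) A(1) that(3) v]] unfolding pmul_rect_band by blast
 qed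
 \<comment> \<open>By overwriting, the existential witness can be exchanged for any fixed
   \<open>v\<close>, which is what makes the relation transitive.\<close>
 define E1 where "E1 = (%A. {(x, x'). x : X A & x' : X A & (\<exists>y y'. ((x, y), (x', y')) : sg)})"
 define E2 where "E2 = (%B. {(y, y'). y : Y B & y' : Y B & (\<exists>x x'. ((x, y), (x', y')) : sg)})"
 have E1D: "((x, v), (x', v)) : sg" if "(x, x') : E1 A" "D : C" "v : Y D" for x x' A D v
  using that(1) right[OF _ that(2,3)] unfolding E1_def by blast
 have E2D: "((u, y), (u, y')) : sg" if "(y, y') : E2 A" "D : C" "u : X D" for y y' A D u
  using that(1) left[OF _ that(2,3)] unfolding E2_def by blast
 have "E1 A : Eqv (X A)" if A: "A : C" for A
 proof -
  obtain v where v: "v : Y A" using XY_ex(2)[OF A] by blast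
  have e: "(x, x') : E1 A \<longleftrightarrow> x : X A & x' : X A & ((x, v), (x', v)) : sg" for x x'
   using E1D[OF _ A v] unfolding E1_def by blast
  have sy: "((x, v), (x', v)) : sg ==> ((x', v), (x, v)) : sg" for x x' by (rule t2)
  have tr: "((x, v), (x', v)) : sg ==> ((x', v), (x'', v)) : sg ==> ((x, v), (x'', v)) : sg" for x x' x'' by (rule t3)
  show ?thesis unfolding Eqv_def equiv_iff mem_Collect_eq subset_iff split_paired_All mem_Times_iff fst_conv snd_conv e
   using t1[OF car[OF A A _ v]] sy tr by blast
 qed
 moreover have "E2 A : Eqv (Y A)" if A: "A : C" for A
 proof -
  obtain u where u: "u : X A" using XY_ex(1)[OF A] by blast
  have e: "(y, y') : E2 A \<longleftrightarrow> y : Y A & y' : Y A & ((u, y), (u, y')) : sg" for y y'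
   using E2D[OF _ A u] unfolding E2_def by blast
  have sy: "((u, y), (u, y')) : sg ==> ((u, y'), (u, y)) : sg" for y y' by (rule t2)
  have tr: "((u, y), (u, y')) : sg ==> ((u, y'), (u, y'')) : sg ==> ((u, y), (u, y'')) : sg" for y y' y'' by (rule t3)
  show ?thesis unfolding Eqv_def equiv_iff mem_Collect_eq subset_iff split_paired_All mem_Times_iff fst_conv snd_conv e
   using t1[OF car[OF A A u]] sy tr by blast
 qed
 moreover have "sg = band_sigma C X Y E1 E2"
 proof (rule subset_antisym; rule subrelI)
  fix p q assume h: "(p, q) : sg"
  obtain x y x' y' where q: "p = (x, y)" "q = (x', y')" by (cases p, cases q)
  obtain A B where a: "A : C" "B : C" "x : X A" "y : Y B" using t0[OF h] unfolding q carrier_rect_band by blast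
  obtain A' B' where a': "A' : C" "B' : C" "x' : X A'" "y' : Y B'" using t0[OF h] unfolding q carrier_rect_band by blast
  have "A' = A" "B' = B" using t4[OF h] unfolding q src_rect_band[OF a(1,3)] src_rect_band[OF a'(1,3)] tgt_rect_band[OF a(2,4)] tgt_rect_band[OF a'(2,4)] by auto
  hence "(x, x') : E1 A" "(y, y') : E2 B" using a a' h unfolding q E1_def E2_def by blast+
  thus "(p, q) : band_sigma C X Y E1 E2" unfolding q band_sigma_iff[OF a] using a' \<open>A' = A\<close> \<open>B' = B\<close> by blast
 next
  fix p q assume h: "(p, q) : band_sigma C X Y E1 E2"
  obtain x y x' y' where q: "p = (x, y)" "q = (x', y')" by (cases p, cases q)
  obtain A B where a: "A : C" "B : C" "x : X A" "x' : X A" "y : Y B" "y' : Y B" "(x, x') : E1 A" "(y, y') : E2 B"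
   using h unfolding q mem_band_sigma by blast
  show "(p, q) : sg" unfolding q using t3[OF E1D[OF a(7,2,5)] E2D[OF a(8,1,4)]] .
 qed
 ultimately show ?thesis using that by blast
qed

text \<open>The families can be compared one coordinate at a time: every \<open>X A\<close> and
  \<open>Y A\<close> has an element, whose diagonal pair fills the other coordinate.\<close>

lemma band_sigma_le:
 assumes E1: "!!A. A : C ==> E1 A : Eqv (X A)" and E2: "!!A. A : C ==> E2 A : Eqv (Y A)"
 shows "band_sigma C X Y E1 E2 <= band_sigma C X Y F1 F2 \<longleftrightarrow> (ALL A:C. E1 A <= F1 A) & (ALL A:C. E2 A <= F2 A)"
proof
 assume s: "band_sigma C X Y E1 E2 <= band_sigma C X Y F1 F2"
 have "(x, x') : F1 A" if A: "A : C" and h: "(x, x') : E1 A" for A x x'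
 proof -
  obtain y where y: "y : Y A" using XY_ex(2)[OF A] by blast
  have m: "x : X A" "x' : X A" "(y, y) : E2 A" using E1[OF A] E2[OF A] h y unfolding Eqv_def equiv_iff by blast+
  show ?thesis using s h m y band_sigma_iff[OF A A m(1) y] by blast
 qed
 moreover have "(y, y') : F2 A" if A: "A : C" and h: "(y, y') : E2 A" for A y y'
 proof -
  obtain x where x: "x : X A" using XY_ex(1)[OF A] by blast
  have m: "y : Y A" "y' : Y A" "(x, x) : E1 A" using E1[OF A] E2[OF A] h x unfolding Eqv_def equiv_iff by blast+
  show ?thesis using s h m x band_sigma_iff[OF A A x m(1)] by blast
 qed
 ultimately show "(ALL A:C. E1 A <= F1 A) & (ALL A:C. E2 A <= F2 A)" by auto
next
 assume h: "(ALL A:C. E1 A <= F1 A) & (ALL A:C. E2 A <= F2 A)"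
 show "band_sigma C X Y E1 E2 <= band_sigma C X Y F1 F2" unfolding band_sigma_def using h by blast
qed

end

section \<open>Lattices of congruences and their isomorphisms\<close>

lemma lattice_rel_lattice:
 assumes "!!sg \<tau>. sg : K ==> \<tau> : K ==> sg Int \<tau> : K & (sg Un \<tau>)\<^sup>+ : K" and tr: "!!sg. sg : K ==> trans sg"
 shows "lattice (rel_lattice K)"
proof unfold_locales
 fix sg \<tau> assume h: "sg : carrier (rel_lattice K)" "\<tau> : carrier (rel_lattice K)"
 hence k: "sg : K" "\<tau> : K" unfolding rel_lattice_def by auto
 have "(sg Un \<tau>)\<^sup>+ <= \<upsilon>" if "\<upsilon> : K" "sg <= \<upsilon>" "\<tau> <= \<upsilon>" for \<upsilon>
  using trancl_id[OF tr[OF that(1)]] trancl_mono_subset[of "sg Un \<tau>" \<upsilon>] that by blast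
 moreover have "sg Un \<tau> <= (sg Un \<tau>)\<^sup>+" by (rule subrelI) (rule r_into_trancl)
 ultimately show "\<exists>s. least (rel_lattice K) s (Upper (rel_lattice K) {sg, \<tau>})"
  using assms(1)[OF k] k by (intro exI[of _ "(sg Un \<tau>)\<^sup>+"]) (auto simp: least_def Upper_def rel_lattice_def)
 show "\<exists>s. greatest (rel_lattice K) s (Lower (rel_lattice K) {sg, \<tau>})"
  using assms(1)[OF k] k by (intro exI[of _ "sg Int \<tau>"]) (auto simp: greatest_def Lower_def rel_lattice_def)
qed (auto simp: rel_lattice_def)

text \<open>Compatibility passes to the transitive closure step by step, since all members of a
  chain share source and target and admit the same multipliers.\<close>

lemma lattice_Cong: "lattice (Cong_lattice S)"
 unfolding Cong_lattice_def
proof (rule lattice_rel_lattice)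
 fix sg \<tau> assume s: "sg : Cong S" and t: "\<tau> : Cong S"
 show "sg Int \<tau> : Cong S & (sg Un \<tau>)\<^sup>+ : Cong S"
 proof
  show "sg Int \<tau> : Cong S"
  proof (rule CongI; unfold Int_iff; (elim conjE)?; (intro conjI)?)
  qed (use CongD[OF s] CongD[OF t] in metis)+
  let ?r = "sg Un \<tau>"
  have r0: "?r <= carrier S \<times> carrier S" using CongD(1)[OF s] CongD(1)[OF t] by auto
  have r1: "(x, x) : ?r" if "x : carrier S" for x using CongD(2)[OF s that] by blast
  have r2: "(y, x) : ?r" if "(x, y) : ?r" for x y using that CongD(3)[OF s] CongD(3)[OF t] by blast
  have r4: "src S x = src S y & tgt S x = tgt S y" if "(x, y) : ?r" for x y using that CongD(5)[OF s] CongD(5)[OF t] by blast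
  have r5: "(pmul S a x, pmul S a y) : ?r" if "(x, y) : ?r" "a : carrier S" "tgt S a = src S x" for x y a
   using that CongD(6)[OF s] CongD(6)[OF t] by blast
  have r6: "(pmul S x a, pmul S y a) : ?r" if "(x, y) : ?r" "a : carrier S" "tgt S x = src S a" for x y a
   using that CongD(7)[OF s] CongD(7)[OF t] by blast
  have st: "(x, y) : ?r\<^sup>+ ==> src S x = src S y & tgt S x = tgt S y" for x y by (induction rule: trancl_induct) (use r4 in metis)+
  show "?r\<^sup>+ : Cong S"
  proof (rule CongI)
   fix x y assume "(x, y) : ?r\<^sup>+" thus "x : carrier S & y : carrier S" using subsetD[OF trancl_subset_Sigma[OF r0]] by blast
  next
   fix x assume "x : carrier S" thus "(x, x) : ?r\<^sup>+" using r1 by blast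
  next
   fix x y assume "(x, y) : ?r\<^sup>+"
   moreover have "sym ?r" using r2 by (rule symI)
   ultimately show "(y, x) : ?r\<^sup>+" using sym_trancl symD by metis
  next
   fix x y z assume "(x, y) : ?r\<^sup>+" "(y, z) : ?r\<^sup>+" thus "(x, z) : ?r\<^sup>+" by (rule trancl_trans)
  next
   fix x y assume "(x, y) : ?r\<^sup>+" thus "src S x = src S y & tgt S x = tgt S y" by (rule st)
  next
   fix x y a assume "(x, y) : ?r\<^sup>+" "a : carrier S" "tgt S a = src S x"
   thus "(pmul S a x, pmul S a y) : ?r\<^sup>+"
   proof (induction rule: trancl_induct)
    case (base y) thus ?case using r5 by blast
   next
    case (step y z)
    hence "(pmul S a y, pmul S a z) : ?r" using r5[OF step.hyps(2)] st[OF step.hyps(1)] by simp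
    thus ?case using step trancl_into_trancl by metis
   qed
  next
   fix x y a assume "(x, y) : ?r\<^sup>+" "a : carrier S" "tgt S x = src S a"
   thus "(pmul S x a, pmul S y a) : ?r\<^sup>+"
   proof (induction rule: trancl_induct)
    case (base y) thus ?case using r6 by blast
   next
    case (step y z)
    hence "(pmul S y a, pmul S z a) : ?r" using r6[OF step.hyps(2)] st[OF step.hyps(1)] by simp
    thus ?case using step trancl_into_trancl by metis
   qed
  qed
 qed
next
 fix sg assume "sg : Cong S" thus "trans sg" by (intro transI) (rule CongD(4))
qed

text \<open>\<open>join_pres\<close> and \<open>meet_pres\<close> presuppose lattices on both sides;
  for \<open>K\<close> this is not assumed but carried over from \<open>L\<close> along the order
  isomorphism.\<close>

lemma lattice_isomorphicI:
 fixes L :: "'l gorder" and K :: "'k gorder"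
 assumes L: "lattice L" and f: "bij_betw f (carrier L) (carrier K)"
  and le: "!!x y. x : carrier L ==> y : carrier L ==> f x \<sqsubseteq>\<^bsub>K\<^esub> f y \<longleftrightarrow> x \<sqsubseteq>\<^bsub>L\<^esub> y" and eq: "eq K = (=)"
 shows "lattice_isomorphic L K"
proof -
 interpret L: lattice L by (rule L)
 have im: "f ` carrier L = carrier K" and inj: "inj_on f (carrier L)" using f unfolding bij_betw_def by auto
 have ex: "EX x:carrier L. y = f x" if "y : carrier K" for y using that im by blast
 have mem: "x : carrier L ==> f x : carrier K" for x using im by blast
 have refl: "y \<sqsubseteq>\<^bsub>K\<^esub> y" if h: "y : carrier K" for y
 proof -
  obtain a where a: "a : carrier L" "y = f a" using ex[OF h] by blast
  thus ?thesis using le[OF a(1) a(1)] by simp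
 qed
 have anti: "y = z" if h: "y \<sqsubseteq>\<^bsub>K\<^esub> z" "z \<sqsubseteq>\<^bsub>K\<^esub> y" "y : carrier K" "z : carrier K" for y z
 proof -
  obtain a where a: "a : carrier L" "y = f a" using ex[OF h(3)] by blast
  obtain b where b: "b : carrier L" "z = f b" using ex[OF h(4)] by blast
  have "a \<sqsubseteq>\<^bsub>L\<^esub> b" "b \<sqsubseteq>\<^bsub>L\<^esub> a" using h(1,2) le[OF a(1) b(1)] le[OF b(1) a(1)] a(2) b(2) by simp_all
  hence "a = b" using L.le_antisym a(1) b(1) by blast
  thus ?thesis using a(2) b(2) by simp
 qed
 have trans: "x \<sqsubseteq>\<^bsub>K\<^esub> z" if h: "x \<sqsubseteq>\<^bsub>K\<^esub> y" "y \<sqsubseteq>\<^bsub>K\<^esub> z" "x : carrier K" "y : carrier K" "z : carrier K" for x y z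
 proof -
  obtain a where a: "a : carrier L" "x = f a" using ex[OF h(3)] by blast
  obtain b where b: "b : carrier L" "y = f b" using ex[OF h(4)] by blast
  obtain c where c: "c : carrier L" "z = f c" using ex[OF h(5)] by blast
  have "a \<sqsubseteq>\<^bsub>L\<^esub> b" "b \<sqsubseteq>\<^bsub>L\<^esub> c" using h(1,2) le[OF a(1) b(1)] le[OF b(1) c(1)] a(2) b(2) c(2) by simp_all
  thus ?thesis using L.le_trans[OF _ _ a(1) b(1) c(1)] le[OF a(1) c(1)] a c by simp
 qed
 have least: "least K (f s) (Upper K {f x, f y})" if h: "least L s (Upper L {x, y})" "x : carrier L" "y : carrier L" for s x y
 proof -
  have UL: "u : Upper L {x, y} \<longleftrightarrow> u : carrier L & x \<sqsubseteq>\<^bsub>L\<^esub> u & y \<sqsubseteq>\<^bsub>L\<^esub> u" for u using h(2,3) unfolding Upper_def by auto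
  have UK: "v : Upper K {f x, f y} \<longleftrightarrow> v : carrier K & f x \<sqsubseteq>\<^bsub>K\<^esub> v & f y \<sqsubseteq>\<^bsub>K\<^esub> v" for v using mem[OF h(2)] mem[OF h(3)] unfolding Upper_def by auto
  have s: "s : Upper L {x, y}" "!!u. u : Upper L {x, y} ==> s \<sqsubseteq>\<^bsub>L\<^esub> u" using h(1) unfolding least_def by blast+
  have sL: "s : carrier L" "x \<sqsubseteq>\<^bsub>L\<^esub> s" "y \<sqsubseteq>\<^bsub>L\<^esub> s" using s(1) UL by auto
  show ?thesis unfolding least_def
  proof (intro conjI ballI)
   show "Upper K {f x, f y} <= carrier K" using UK by blast
   show "f s : Upper K {f x, f y}" unfolding UK using mem[OF sL(1)] sL le h(2,3) by simp
   fix v assume v: "v : Upper K {f x, f y}"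
   hence vK: "v : carrier K" unfolding UK by blast
   obtain u where u: "u : carrier L" "v = f u" using ex[OF vK] by blast
   have "u : Upper L {x, y}" unfolding UL using v u le h(2,3) unfolding UK by simp
   thus "f s \<sqsubseteq>\<^bsub>K\<^esub> v" unfolding u(2) using s(2) le sL(1) u(1) by simp
  qed
 qed
 have greatest: "greatest K (f s) (Lower K {f x, f y})" if h: "greatest L s (Lower L {x, y})" "x : carrier L" "y : carrier L" for s x y
 proof -
  have UL: "u : Lower L {x, y} \<longleftrightarrow> u : carrier L & u \<sqsubseteq>\<^bsub>L\<^esub> x & u \<sqsubseteq>\<^bsub>L\<^esub> y" for u using h(2,3) unfolding Lower_def by auto
  have UK: "v : Lower K {f x, f y} \<longleftrightarrow> v : carrier K & v \<sqsubseteq>\<^bsub>K\<^esub> f x & v \<sqsubseteq>\<^bsub>K\<^esub> f y" for v using mem[OF h(2)] mem[OF h(3)] unfolding Lower_def by auto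
  have s: "s : Lower L {x, y}" "!!u. u : Lower L {x, y} ==> u \<sqsubseteq>\<^bsub>L\<^esub> s" using h(1) unfolding greatest_def by blast+
  have sL: "s : carrier L" "s \<sqsubseteq>\<^bsub>L\<^esub> x" "s \<sqsubseteq>\<^bsub>L\<^esub> y" using s(1) UL by auto
  show ?thesis unfolding greatest_def
  proof (intro conjI ballI)
   show "Lower K {f x, f y} <= carrier K" using UK by blast
   show "f s : Lower K {f x, f y}" unfolding UK using mem[OF sL(1)] sL le h(2,3) by simp
   fix v assume v: "v : Lower K {f x, f y}"
   hence vK: "v : carrier K" unfolding UK by blast
   obtain u where u: "u : carrier L" "v = f u" using ex[OF vK] by blast
   have "u : Lower L {x, y}" unfolding UL using v u le h(2,3) unfolding UK by simp
   thus "v \<sqsubseteq>\<^bsub>K\<^esub> f s" unfolding u(2) using s(2) le sL(1) u(1) by simp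
  qed
 qed
 have K: "lattice K"
 proof unfold_locales
  fix y z assume y: "y : carrier K" and z: "z : carrier K"
  obtain a where a: "a : carrier L" "y = f a" using ex[OF y] by blast
  obtain b where b: "b : carrier L" "z = f b" using ex[OF z] by blast
  show "\<exists>s. least K s (Upper K {y, z})" "\<exists>s. greatest K s (Lower K {y, z})"
   unfolding a(2) b(2) using least[OF L.sup_of_two_least[OF a(1) b(1)] a(1) b(1)] greatest[OF L.inf_of_two_greatest[OF a(1) b(1)] a(1) b(1)] by blast+
 qed (simp_all only: eq, (rule refl anti trans; assumption)+)
 then interpret K: lattice K .
 have least_eq: "v = w" if h: "least K v U" "least K w U" for v w U
 proof -
  have "U <= carrier K" "v : U" "w : U" using h unfolding least_def by simp_all
  moreover from this have "v \<sqsubseteq>\<^bsub>K\<^esub> w" "w \<sqsubseteq>\<^bsub>K\<^esub> v" using h unfolding least_def by simp_all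
  ultimately show ?thesis using anti[of v w] by blast
 qed
 have greatest_eq: "v = w" if h: "greatest K v U" "greatest K w U" for v w U
 proof -
  have "U <= carrier K" "v : U" "w : U" using h unfolding greatest_def by simp_all
  moreover from this have "v \<sqsubseteq>\<^bsub>K\<^esub> w" "w \<sqsubseteq>\<^bsub>K\<^esub> v" using h unfolding greatest_def by simp_all
  ultimately show ?thesis using anti[of v w] by blast
 qed
 have "f (x \<squnion>\<^bsub>L\<^esub> y) = f x \<squnion>\<^bsub>K\<^esub> f y" if "x : carrier L" "y : carrier L" for x y
 proof -
  have a: "least K (f (x \<squnion>\<^bsub>L\<^esub> y)) (Upper K {f x, f y})" using least[OF L.sup_of_two_least[OF that] that] unfolding join_def .
  have b: "least K (f x \<squnion>\<^bsub>K\<^esub> f y) (Upper K {f x, f y})" unfolding join_def by (rule K.sup_of_two_least[OF mem[OF that(1)] mem[OF that(2)]])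
  show ?thesis by (rule least_eq[OF a b])
 qed
 moreover have "f (x \<sqinter>\<^bsub>L\<^esub> y) = f x \<sqinter>\<^bsub>K\<^esub> f y" if "x : carrier L" "y : carrier L" for x y
 proof -
  have a: "greatest K (f (x \<sqinter>\<^bsub>L\<^esub> y)) (Lower K {f x, f y})" using greatest[OF L.inf_of_two_greatest[OF that] that] unfolding meet_def .
  have b: "greatest K (f x \<sqinter>\<^bsub>K\<^esub> f y) (Lower K {f x, f y})" unfolding meet_def by (rule K.inf_of_two_greatest[OF mem[OF that(1)] mem[OF that(2)]])
  show ?thesis by (rule greatest_eq[OF a b])
 qed
 ultimately show ?thesis unfolding lattice_isomorphic_def join_pres_def meet_pres_def using f L K by blast
qed

theorem Cong_band_iso:
 assumes bf: "band_families C X Y" and iso: "psg_iso S (rect_band C X Y) \<phi>"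
  and closed: "!!x y. x : carrier S ==> y : carrier S ==> tgt S x = src S y ==> pmul S x y : carrier S"
 shows "Cong S = {{(al, be) : carrier S \<times> carrier S. (\<phi> al, \<phi> be) : band_sigma C X Y E1 E2} | E1 E2.
        (ALL A:C. E1 A : Eqv (X A)) & (ALL A:C. E2 A : Eqv (Y A))}" (is "_ = ?R")
  and "lattice_isomorphic (Cong_lattice S)
     (prod2_lattice (Prod_lattice C (%A. Eq_lattice (X A))) (Prod_lattice C (%A. Eq_lattice (Y A))))" (is "lattice_isomorphic _ ?K")
proof -
 let ?T = "rect_band C X Y"
 have CS: "Cong S = pullback (carrier S) \<phi> ` Cong ?T" by (rule Cong_psg_iso[OF iso]) (rule closed; assumption)
 have RI: "sg : Cong S \<longleftrightarrow> (\<exists>E1 E2. sg = pullback (carrier S) \<phi> (band_sigma C X Y E1 E2) &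
   (ALL A:C. E1 A : Eqv (X A)) & (ALL A:C. E2 A : Eqv (Y A)))" (is "_ \<longleftrightarrow> ?E sg") for sg
 proof
  assume "sg : Cong S"
  then obtain \<tau> where t: "\<tau> : Cong ?T" "sg = pullback (carrier S) \<phi> \<tau>" using CS by blast
  from t(1) show "?E sg"
  proof (rule Cong_band_sigma[OF bf])
   fix E1 E2 assume h: "\<tau> = band_sigma C X Y E1 E2" "!!A. A : C ==> E1 A : Eqv (X A)" "!!A. A : C ==> E2 A : Eqv (Y A)"
   show "?E sg" by (rule exI[of _ E1], rule exI[of _ E2]) (use t(2) h in simp)
  qed
 next
  assume "?E sg"
  then obtain E1 E2 where E: "sg = pullback (carrier S) \<phi> (band_sigma C X Y E1 E2)" "ALL A:C. E1 A : Eqv (X A)" "ALL A:C. E2 A : Eqv (Y A)"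
   by (elim exE conjE)
  have "band_sigma C X Y E1 E2 : Cong ?T" by (rule band_sigma_Cong[OF bf]) (use E(2,3) in blast)+
  thus "sg : Cong S" unfolding CS E(1) by (rule imageI)
 qed
 show "Cong S = ?R" by (rule Set.set_eqI) (simp only: mem_Collect_eq RI pullback_def)
 let ?G = "%(E1, E2). pullback (carrier S) \<phi> (band_sigma C X Y E1 E2)"
 have carK: "carrier ?K = (\<Pi>\<^sub>E A\<in>C. Eqv (X A)) \<times> (\<Pi>\<^sub>E A\<in>C. Eqv (Y A))"
  unfolding prod2_lattice_def Prod_lattice_def Eq_lattice_def rel_lattice_def by simp
 have leK: "le ?K (E1, E2) (F1, F2) \<longleftrightarrow> (ALL A:C. E1 A <= F1 A) & (ALL A:C. E2 A <= F2 A)" for E1 E2 F1 F2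
  unfolding prod2_lattice_def Prod_lattice_def Eq_lattice_def rel_lattice_def by simp
 have im: "\<phi> ` carrier S = carrier ?T" using iso unfolding psg_iso_def bij_betw_def by blast
 have mono: "pullback (carrier S) \<phi> sg <= pullback (carrier S) \<phi> \<tau> \<longleftrightarrow> sg <= \<tau>" if "sg : Cong ?T" for sg \<tau>
 proof
  assume h: "pullback (carrier S) \<phi> sg <= pullback (carrier S) \<phi> \<tau>"
  show "sg <= \<tau>"
  proof (rule subrelI)
   fix p q assume pq: "(p, q) : sg"
   hence "p : \<phi> ` carrier S" "q : \<phi> ` carrier S" using CongD(1)[OF that pq] im by simp_all
   then obtain x y where x: "p = \<phi> x" "x : carrier S" and y: "q = \<phi> y" "y : carrier S" by (elim imageE)
   have "(x, y) : pullback (carrier S) \<phi> sg" using pq x y by (simp add: mem_pullback)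
   hence "(x, y) : pullback (carrier S) \<phi> \<tau>" by (rule subsetD[OF h])
   thus "(p, q) : \<tau>" using x y by (simp add: mem_pullback)
  qed
 next
  assume "sg <= \<tau>" thus "pullback (carrier S) \<phi> sg <= pullback (carrier S) \<phi> \<tau>" unfolding pullback_def by blast
 qed
 have le: "?G a <= ?G b \<longleftrightarrow> le ?K a b" if "a : carrier ?K" "b : carrier ?K" for a b
 proof -
  obtain E1 E2 F1 F2 where ab: "a = (E1, E2)" "b = (F1, F2)" by (cases a, cases b)
  have E: "!!A. A : C ==> E1 A : Eqv (X A)" "!!A. A : C ==> E2 A : Eqv (Y A)" using that(1) unfolding ab carK by auto
  have bs: "band_sigma C X Y E1 E2 : Cong ?T" by (rule band_sigma_Cong[OF bf]) (use E in blast)+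
  have bl: "band_sigma C X Y E1 E2 <= band_sigma C X Y F1 F2 \<longleftrightarrow> (ALL A:C. E1 A <= F1 A) & (ALL A:C. E2 A <= F2 A)"
   by (rule band_sigma_le[OF bf]) (use E in blast)+
  show ?thesis unfolding ab split leK mono[OF bs] bl ..
 qed
 have inj: "inj_on ?G (carrier ?K)"
 proof (rule inj_onI)
  fix a b assume h: "a : carrier ?K" "b : carrier ?K" "?G a = ?G b"
  obtain E1 E2 F1 F2 where ab: "a = (E1, E2)" "b = (F1, F2)" by (cases a, cases b)
  have "le ?K a b" "le ?K b a" using le[OF h(1,2)] le[OF h(2,1)] h(3) by auto
  hence e: "!!A. A : C ==> E1 A = F1 A" "!!A. A : C ==> E2 A = F2 A" unfolding ab leK by blast+
  have m: "E1 : (\<Pi>\<^sub>E A\<in>C. Eqv (X A))" "F1 : (\<Pi>\<^sub>E A\<in>C. Eqv (X A))" "E2 : (\<Pi>\<^sub>E A\<in>C. Eqv (Y A))" "F2 : (\<Pi>\<^sub>E A\<in>C. Eqv (Y A))"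
   using h(1,2) unfolding ab carK by simp_all
  have "E1 = F1" by (rule PiE_ext[OF m(1,2)]) (rule e(1))
  moreover have "E2 = F2" by (rule PiE_ext[OF m(3,4)]) (rule e(2))
  ultimately show "a = b" unfolding ab by simp
 qed
 have surj: "?G ` carrier ?K = Cong S"
 proof (rule subset_antisym; rule subsetI)
  fix sg assume "sg : ?G ` carrier ?K"
  then obtain a where a: "sg = ?G a" "a : carrier ?K" by (rule imageE)
  obtain E1 E2 where E: "a = (E1, E2)" by (cases a)
  have m: "E1 : (\<Pi>\<^sub>E A\<in>C. Eqv (X A))" "E2 : (\<Pi>\<^sub>E A\<in>C. Eqv (Y A))" using a(2) unfolding E carK by simp_all
  have "band_sigma C X Y E1 E2 : Cong ?T" by (rule band_sigma_Cong[OF bf]) (use m in \<open>simp_all add: PiE_iff\<close>)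
  thus "sg : Cong S" unfolding CS a(1) E split by (rule imageI)
 next
  fix sg assume "sg : Cong S"
  then obtain E1 E2 where E: "sg = pullback (carrier S) \<phi> (band_sigma C X Y E1 E2)" "ALL A:C. E1 A : Eqv (X A)" "ALL A:C. E2 A : Eqv (Y A)"
   unfolding RI by blast
  \<comment> \<open>The product lattice consists of extensional families, whereas \<open>E1\<close>
    and \<open>E2\<close> may take any values outside \<open>C\<close>.\<close>
  have "band_sigma C X Y (restrict E1 C) (restrict E2 C) = band_sigma C X Y E1 E2" unfolding band_sigma_def by simp
  hence "sg = ?G (restrict E1 C, restrict E2 C)" using E(1) by simp
  moreover have "(restrict E1 C, restrict E2 C) : carrier ?K" unfolding carK using E(2,3) by auto
  ultimately show "sg : ?G ` carrier ?K" by (rule image_eqI)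
 qed
 have bij: "bij_betw ?G (carrier ?K) (Cong S)" using inj surj unfolding bij_betw_def by blast
 have carL: "carrier (Cong_lattice S) = Cong S" unfolding Cong_lattice_def rel_lattice_def by simp
 let ?f = "the_inv_into (carrier ?K) ?G"
 have f: "?f sg : carrier ?K" "?G (?f sg) = sg" if "sg : Cong S" for sg
  using that the_inv_into_into[OF inj] f_the_inv_into_f[OF inj] surj by auto
 show "lattice_isomorphic (Cong_lattice S) ?K"
 proof (rule lattice_isomorphicI[OF lattice_Cong])
  show "bij_betw ?f (carrier (Cong_lattice S)) (carrier ?K)" unfolding carL by (rule bij_betw_the_inv_into[OF bij])
  show "le ?K (?f sg) (?f \<tau>) \<longleftrightarrow> le (Cong_lattice S) sg \<tau>" if "sg : carrier (Cong_lattice S)" "\<tau> : carrier (Cong_lattice S)" for sg \<tau>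
   using le[OF f(1) f(1), of sg \<tau>] f(2) that unfolding carL by (simp add: Cong_lattice_def rel_lattice_def)
  show "eq ?K = (=)" unfolding prod2_lattice_def by simp
 qed
qed

lemma equiv_relD:
 assumes "equiv A r"
 shows "(x, y) : r ==> x : A & y : A" "x : A ==> (x, x) : r" "(x, y) : r ==> (y, x) : r"
  "(x, y) : r ==> (y, z) : r ==> (x, z) : r"
proof -
 note h = assms[unfolded equiv_iff]
 show "(x, y) : r ==> x : A & y : A" using subsetD[OF h[THEN conjunct1], of "(x, y)"] by simp
 show "x : A ==> (x, x) : r" using h[THEN conjunct2, THEN conjunct1] by simp
 show "(x, y) : r ==> (y, x) : r" using h[THEN conjunct2, THEN conjunct2, THEN conjunct1] by simp
 show "(x, y) : r ==> (y, z) : r ==> (x, z) : r"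
  using h[THEN conjunct2, THEN conjunct2, THEN conjunct2, THEN spec, THEN spec, THEN spec, THEN mp, THEN mp] .
qed

lemma thrI: "{Inl a, Inr b} : x ==> a : thr x"
 unfolding thr_def by (rule CollectI, rule bexI[of _ "{Inl a, Inr b}"]) auto

lemma thrI_flip: "{Inr a, Inl b} : x ==> b : thr x"
 unfolding insert_commute[of "Inr a"] by (rule thrI)

section \<open>The minimal ideal\<close>

text \<open>In rank one the only singleton class is the upper end of the transversal, so the
  relation lies in \<open>Eq2\<close>. The corresponding relation on the lower points is taken from
  \<open>bflip al\<close>.\<close>

definition cup_eq :: "'a brauer => 'a rel" where
 "cup_eq al = {(a, b). a : bdom al & b : bdom al & (a = b \<or> {Inl a, Inl b} : al)}"

context
 fixes al :: "'a brauer" and A B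
 assumes al: "al : brauer A B"
begin

lemma cup_eq_iff: "(a, b) : cup_eq al \<longleftrightarrow> a : A & b : A & (a = b \<or> {Inl a, Inl b} : al)"
 unfolding cup_eq_def brauer_dom(1)[OF al] by simp

lemma cup_sub: "{Inl a, Inl b} : al ==> a : A & b : A & a ~= b"
 using brauer_sub(1)[OF al, of "{Inl a, Inl b}"] brauer_card[OF al, of "{Inl a, Inl b}"] by (cases "a = b") auto

lemma cup_unique: "{Inl a, Inl b} : al ==> {Inl a, Inl c} : al ==> b = c"
 using brauer_unique[OF al, of "{Inl a, Inl b}" "{Inl a, Inl c}" "Inl a"] by (auto simp: doubleton_eq_iff)

lemma cup_eq_equiv: "equiv A (cup_eq al)"
proof -
 have sym: "(b, a) : cup_eq al" if "(a, b) : cup_eq al" for a b using that unfolding cup_eq_iff by (auto simp: insert_commute)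
 have "(a, c) : cup_eq al" if h: "(a, b) : cup_eq al" "(b, c) : cup_eq al" for a b c
 proof (cases "a = b \<or> b = c")
  case False
  hence "{Inl b, Inl a} : al" "{Inl b, Inl c} : al" using h sym unfolding cup_eq_iff by auto
  hence "a = c" by (rule cup_unique)
  thus ?thesis using h unfolding cup_eq_iff by simp
 qed (use h in auto)
 note tr = this
 show ?thesis unfolding equiv_iff
 proof (intro conjI allI impI ballI)
  show "cup_eq al <= A \<times> A" by (rule subrelI) (simp add: cup_eq_iff)
  show "(a, a) : cup_eq al" if "a : A" for a using that by (simp add: cup_eq_iff)
 qed (fact sym tr)+
qed

lemma thr_no_cup: "t : thr al ==> {Inl t, Inl c} ~: al"
 using thr_iff[OF al, of t] rank_thr(2)[OF al] by blast

lemma thr_cup_eq: "thr al = {a : A. \<forall>c. (a, c) : cup_eq al --> c = a}"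
 using thr_iff[OF al] rank_thr(2)[OF al] cup_sub unfolding cup_eq_iff by blast

lemma cup_eq_class: "a : A ==> a ~: thr al ==> \<exists>b. b ~= a & cup_eq al `` {a} = {a, b}"
proof -
 assume a: "a : A" "a ~: thr al"
 then obtain b where b: "{Inl a, Inl b} : al" using thr_iff[OF al] by blast
 have ne: "b ~= a" using cup_sub[OF b] by auto
 have cl: "cup_eq al `` {a} = {a, b}"
 proof (rule subset_antisym; rule subsetI)
  fix c assume "c : cup_eq al `` {a}"
  hence "a = c \<or> {Inl a, Inl c} : al" by (simp add: cup_eq_iff)
  thus "c : {a, b}" using cup_unique[OF b, of c] by auto
 next
  fix c assume "c : {a, b}"
  hence "c = a \<or> c = b" by simp
  thus "c : cup_eq al `` {a}" using b a(1) cup_sub[OF b] by (auto simp: cup_eq_iff)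
 qed
 show ?thesis by (rule exI[of _ b], rule conjI[OF ne cl])
qed

lemma rank1_transversal:
 assumes r: "rank al = 1"
 obtains t t' where "thr al = {t}" "thr (bflip al) = {t'}" "{Inl t, Inr t'} : al" "t : A" "t' : B"
proof -
 obtain t where t: "thr al = {t}" using rank_thr(1)[OF al] r by (metis card_1_singletonE)
 have "card (thr (bflip al)) = 1" using rank_thr(1)[OF bflip_brauer[OF al]] r rank_bflip by metis
 then obtain t' where t': "thr (bflip al) = {t'}" by (metis card_1_singletonE)
 have "t : thr al" using t by simp
 then obtain K b where K: "K : al" "Inl t : K" "Inr b : K" unfolding thr_def by blast
 obtain p q where "K = {p, q}" using brauer_block[OF al K(1)] by blast
 hence Kb: "K = {Inl t, Inr b}" using K(2,3) by auto
 have "swap_sum ` K : bflip al" using K(1) unfolding bflip_def by blast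
 hence "{Inr t, Inl b} : bflip al" unfolding Kb by simp
 hence "b : thr (bflip al)" by (rule thrI_flip)
 hence "b = t'" using t' by simp
 thus ?thesis using that[OF t t'] K(1) Kb brauer_sub[OF al K(1)] K(2,3) by simp
qed

end

text \<open>The two equivalences show the cups and caps as their classes of size two and the ends of
  the transversal as their singletons, which is all there is to a partition of rank one.\<close>

lemma rank1_sub:
 assumes al: "al : brauer A B" "rank al = 1" and be: "be : brauer A B" "rank be = 1"
  and e: "cup_eq al = cup_eq be" "cup_eq (bflip al) = cup_eq (bflip be)"
 shows "al <= be"
proof
 note fa = bflip_brauer[OF al(1)] and fb = bflip_brauer[OF be(1)]
 obtain t t' where t: "thr al = {t}" "thr (bflip al) = {t'}" "{Inl t, Inr t'} : al" using rank1_transversal[OF al] by metis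
 obtain u u' where u: "thr be = {u}" "thr (bflip be) = {u'}" "{Inl u, Inr u'} : be" using rank1_transversal[OF be] by metis
 have "thr al = thr be" "thr (bflip al) = thr (bflip be)"
  unfolding thr_cup_eq[OF al(1)] thr_cup_eq[OF be(1)] thr_cup_eq[OF fa] thr_cup_eq[OF fb] e by (rule refl)+
 hence tu: "u = t" "u' = t'" using t u by auto
 have cup: "{Inl a, Inl b} : y" if "cup_eq x = cup_eq y" "x : brauer D E" "y : brauer D E" "{Inl a, Inl b} : x" for x y :: "'a brauer" and D E a b
 proof -
  have "(a, b) : cup_eq x" using cup_eq_iff[OF that(2)] cup_sub[OF that(2,4)] that(4) by blast
  thus ?thesis using that(1) cup_eq_iff[OF that(3)] cup_sub[OF that(2,4)] by blast
 qed
 fix K assume K: "K : al"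
 obtain p q where pq: "K = {p, q}" using brauer_block[OF al(1) K] by blast
 have mixed: "{Inl a, Inr b} : be" if "{Inl a, Inr b} : al" for a b
 proof -
  have "a : thr al" using that by (rule thrI)
  hence "a = t" using t by simp
  have "swap_sum ` {Inl a, Inr b} : bflip al" unfolding bflip_def by (rule imageI[OF that])
  hence "{Inr a, Inl b} : bflip al" by simp
  hence "b : thr (bflip al)" by (rule thrI_flip)
  hence "b = t'" using t by simp
  thus ?thesis using \<open>a = t\<close> u tu by simp
 qed
 show "K : be"
 proof (cases p; cases q)
  fix a b assume "p = Inl a" "q = Inl b"
  thus ?thesis using cup[OF e(1) al(1) be(1), of a b] K pq by simp
 next
  fix a b assume "p = Inl a" "q = Inr b"
  thus ?thesis using mixed K pq by simp
 next
  fix a b assume "p = Inr a" "q = Inl b"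
  thus ?thesis using mixed[of b a] K pq by (simp add: insert_commute)
 next
  fix a b assume pq': "p = Inr a" "q = Inr b"
  have "swap_sum ` K : bflip al" using K unfolding bflip_def by blast
  hence "{Inl a, Inl b} : bflip al" unfolding pq pq' by simp
  hence "{Inl a, Inl b} : bflip be" by (rule cup[OF e(2) fa fb])
  hence "swap_sum ` {Inl a, Inl b} : be" unfolding mem_bflip .
  thus ?thesis unfolding pq pq' by simp
 qed
qed

lemma rank1_eq:
 assumes "al : brauer A B" "rank al = 1" "be : brauer A B" "rank be = 1"
  "cup_eq al = cup_eq be" "cup_eq (bflip al) = cup_eq (bflip be)"
 shows "al = be"
 using rank1_sub[OF assms] rank1_sub[OF assms(3,4,1,2) assms(5,6)[symmetric]] by (rule subset_antisym)

text \<open>Cups persist, and only one upper point is still free, whereas a new cup would need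
  two.\<close>

lemma cup_eq_comp:
 assumes al: "al : brauer A B" "rank al = 1" and \<gamma>: "cmp al be : brauer A D"
 shows "cup_eq (cmp al be) = cup_eq al"
proof -
 let ?g = "cmp al be"
 obtain t where t: "thr al = {t}" using rank1_transversal[OF al] by metis
 have per: "{Inl a, Inl b} : ?g" if "{Inl a, Inl b} : al" for a b
  by (rule comp_cup_persist[OF brauerD[OF al(1)] that]) auto
 have bk: "{Inl a, Inl b} : al" if h: "{Inl a, Inl b} : ?g" and a: "a ~: thr al" for a b
 proof -
  have "a : A" using cup_sub[OF \<gamma> h] by blast
  then obtain c where c: "{Inl a, Inl c} : al" using thr_iff[OF al(1)] a by blast
  have "c = b" by (rule cup_unique[OF \<gamma> per[OF c] h])
  thus ?thesis using c by simp
 qed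
 have "{Inl a, Inl b} : al" if h: "{Inl a, Inl b} : ?g" for a b
 proof (cases "a : thr al")
  case True
  have ab: "a ~= b" using cup_sub[OF \<gamma> h] by blast
  hence nb: "b ~: thr al" using True t by simp
  have "{Inl b, Inl a} : ?g" using h by (simp add: insert_commute)
  from this nb have "{Inl b, Inl a} : al" by (rule bk)
  thus ?thesis by (simp add: insert_commute)
 qed (rule bk[OF h])
 hence "{Inl a, Inl b} : ?g \<longleftrightarrow> {Inl a, Inl b} : al" for a b using per by blast
 thus ?thesis unfolding cup_eq_def by simp
qed

section \<open>Planar equivalences as the ends of rank-one partitions\<close>

lemma sep_nest:
 fixes ka :: "'a => nat"
 assumes L: "!!u v. u : {a, b, c, d} ==> v : {a, b, c, d} ==> lt_in r u v \<longleftrightarrow> ka u < ka v"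
  and o: "ka a <= ka b" "ka c <= ka d" and ne: "ka a ~= ka c" "ka a ~= ka d" "ka b ~= ka c" "ka b ~= ka d"
 shows "separated r {a, b} {c, d} \<or> nested_by r {a, b} {c, d} \<or> nested_by r {c, d} {a, b} \<longleftrightarrow>
  \<not> (ka a < ka c & ka c < ka b & ka b < ka d) & \<not> (ka c < ka a & ka a < ka d & ka d < ka b)"
proof -
 have "separated r {a, b} {c, d} \<longleftrightarrow> ka b < ka c \<or> ka d < ka a"
  unfolding separated_def using o ne by (simp add: L) linarith
 moreover have "nested_by r {a, b} {c, d} \<longleftrightarrow> ka c < ka a & ka b < ka d"
  unfolding nested_by_def using o ne by (simp add: L) linarith
 moreover have "nested_by r {c, d} {a, b} \<longleftrightarrow> ka a < ka c & ka d < ka b"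
  unfolding nested_by_def using o ne by (simp add: L) linarith
 ultimately show ?thesis using o ne by linarith
qed

text \<open>The classes are pairs apart from one singleton, and for such classes being neither
  separated nor nested means that they interleave. This brings planarity into the form of
  \<open>noncross\<close>.\<close>

lemma planar_Eq2_iff:
 assumes A: "finite A" "linear_order_on A (leq A)"
 shows "ep : planar_Eq2 leq A \<longleftrightarrow> equiv A ep &
  (EX t:A. ep `` {t} = {t} & (ALL a:A. a ~= t --> (\<exists>b. b ~= a & ep `` {a} = {a, b}))) &
  (\<forall>p q a b. (p, q) : ep --> (a, b) : ep --> pos (leq A) p < pos (leq A) a --> pos (leq A) a < pos (leq A) q --> \<not> pos (leq A) q < pos (leq A) b)"
  (is "_ \<longleftrightarrow> _ & ?S & ?N")
proof -
 let ?ka = "pos (leq A)"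
 have lt: "lt_in (leq A) u v \<longleftrightarrow> ?ka u < ?ka v" if "u : A" "v : A" for u v unfolding lt_in_def using pos_less_iff[of A "leq A"] A that by blast
 have inj: "?ka u = ?ka v \<longleftrightarrow> u = v" if "u : A" "v : A" for u v
  using pos_bij[OF A] that unfolding bij_betw_def inj_on_def by blast
 have quot: "(K : A // ep) \<longleftrightarrow> (EX a:A. K = ep `` {a})" for K unfolding quotient_def by blast
 have pe: "planar_equiv (leq A) A ep \<longleftrightarrow> ?N" if e: "equiv A ep" and cl: "!!a. a : A ==> EX b:A. ep `` {a} = {a, b}"
 proof -
  have in_A: "(x, y) : ep ==> x : A & y : A" for x y by (rule equiv_relD(1)[OF e])
  have cross: "separated (leq A) {a, b} {c, d} \<or> nested_by (leq A) {a, b} {c, d} \<or> nested_by (leq A) {c, d} {a, b} \<longleftrightarrow>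
   \<not> (?ka a < ?ka c & ?ka c < ?ka b & ?ka b < ?ka d) & \<not> (?ka c < ?ka a & ?ka a < ?ka d & ?ka d < ?ka b)"
   if h: "{a, b, c, d} <= A" "?ka a <= ?ka b" "?ka c <= ?ka d" "a ~= c" "a ~= d" "b ~= c" "b ~= d" for a b c d
   by (rule sep_nest) (use h lt inj in auto)
  have ordered: "\<exists>a b. K = {a, b} & a : A & b : A & (a, b) : ep & ?ka a <= ?ka b" if K: "K : A // ep" for K
  proof -
   obtain a where a: "a : A" "K = ep `` {a}" using K quot by blast
   obtain b where b: "b : A" "ep `` {a} = {a, b}" using cl[OF a(1)] by blast
   have ab: "(a, b) : ep" "(b, a) : ep" using b(2) equiv_relD(3)[OF e] by blast+
   show ?thesis
   proof (cases "?ka a <= ?ka b")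
    case True thus ?thesis using a b ab by metis
   next
    case False
    have "K = {b, a}" using a(2) b(2) by (simp add: insert_commute)
    thus ?thesis using a b ab False by (metis linear)
   qed
  qed
  show ?thesis
  proof
   assume pl: "planar_equiv (leq A) A ep"
   show ?N
   proof (intro allI impI notI)
    fix p q a b assume h: "(p, q) : ep" "(a, b) : ep" "?ka p < ?ka a" "?ka a < ?ka q" "?ka q < ?ka b"
    have m: "p : A" "q : A" "a : A" "b : A" using in_A h(1,2) by blast+
    have ne: "p ~= q" "a ~= b" "p ~= a" "p ~= b" "q ~= a" "q ~= b" using h(3-5) by auto
    have pair: "ep `` {x} = {x, y}" if xy: "(x, y) : ep" "x ~= y" "x : A" for x y
    proof -
     obtain z where z: "ep `` {x} = {x, z}" using cl[OF xy(3)] by blast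
     have "y : ep `` {x}" using xy(1) by simp
     hence "y = z" unfolding z using xy(2) by simp
     thus ?thesis using z by simp
    qed
    have U: "ep `` {p} = {p, q}" by (rule pair[OF h(1) ne(1) m(1)])
    have V: "ep `` {a} = {a, b}" by (rule pair[OF h(2) ne(2) m(3)])
    have ne': "{p, q} ~= {a, b}" using ne by blast
    have q1: "{p, q} : A // ep" using quotientI[OF m(1), of ep] unfolding U .
    have q2: "{a, b} : A // ep" using quotientI[OF m(3), of ep] unfolding V .
    note bspec[OF bspec[OF pl[unfolded planar_equiv_def] q1] q2, THEN mp, OF ne']
    thus False using cross[of p q a b] m h(3-5) ne by simp
   qed
  next
   assume N: ?N
   show "planar_equiv (leq A) A ep" unfolding planar_equiv_def
   proof (intro ballI impI)
    fix U V assume UV: "U : A // ep" "V : A // ep" "U ~= V"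
    obtain a b where a: "U = {a, b}" "a : A" "b : A" "(a, b) : ep" "?ka a <= ?ka b" using ordered[OF UV(1)] by blast
    obtain c d where c: "V = {c, d}" "c : A" "d : A" "(c, d) : ep" "?ka c <= ?ka d" using ordered[OF UV(2)] by blast
    have "U Int V = {}" using quotient_disj[OF e UV(1,2)] UV(3) by blast
    hence ne: "a ~= c" "a ~= d" "b ~= c" "b ~= d" using a(1) c(1) by auto
    have "\<not> (?ka a < ?ka c & ?ka c < ?ka b & ?ka b < ?ka d)" "\<not> (?ka c < ?ka a & ?ka a < ?ka d & ?ka d < ?ka b)"
     using N a(4) c(4) by blast+
    thus "separated (leq A) U V \<or> nested_by (leq A) U V \<or> nested_by (leq A) V U"
     unfolding a(1) c(1) using cross[of a b c d] a c ne by simp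
   qed
  qed
 qed
 show ?thesis
 proof
  assume "ep : planar_Eq2 leq A"
  hence e: "equiv A ep" and u: "\<exists>!K. K : A // ep & card K = 1" and c12: "ALL K:A // ep. card K = 1 \<or> card K = 2"
   and pl: "planar_equiv (leq A) A ep" unfolding planar_Eq2_def Eq2_def Eqv_def by auto
  have self: "a : ep `` {a}" if "a : A" for a using equiv_relD(2)[OF e that] by simp
  have sub: "ep `` {a} <= A" for a using equiv_relD(1)[OF e] by blast
  from u obtain K where K0: "K : A // ep & card K = 1" "\<forall>L. L : A // ep & card L = 1 --> L = K" by (rule ex1E)
  note K = conjunct1[OF K0(1)] conjunct2[OF K0(1)]
  have Ku: "L : A // ep ==> card L = 1 ==> L = K" for L by (rule K0(2)[THEN spec, THEN mp, OF conjI])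
  obtain t where t: "t : A" "K = ep `` {t}" using K(1) by (rule quotientE)
  obtain k where k: "K = {k}" using K(2) by (rule card_1_singletonE)
  have "t : {k}" using self[OF t(1)] unfolding t(2)[symmetric] k .
  hence Kt: "ep `` {t} = {t}" using k t(2) by simp
  have two: "\<exists>b. b ~= a & ep `` {a} = {a, b}" if a: "a : A" "a ~= t" for a
  proof -
   have q: "ep `` {a} : A // ep" by (rule quotientI[OF a(1)])
   have "ep `` {a} ~= K" using self[OF a(1)] Kt t(2) a(2) by auto
   hence "card (ep `` {a}) = 2" using bspec[OF c12 q] Ku[OF q] by blast
   then obtain x y where xy: "ep `` {a} = {x, y}" "x ~= y" by (metis card_2_iff)
   have "a = x \<or> a = y" using self[OF a(1)] unfolding xy(1) by simp
   thus ?thesis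
   proof
    assume e: "a = x" show ?thesis by (rule exI[of _ y]) (use xy e in auto)
   next
    assume e: "a = y" show ?thesis by (rule exI[of _ x]) (use xy e in auto)
   qed
  qed
  have "EX b:A. ep `` {a} = {a, b}" if a: "a : A" for a
  proof (cases "a = t")
   case True thus ?thesis using Kt a by (intro bexI[of _ a]) auto
  next
   case False
   obtain b where "ep `` {a} = {a, b}" using two[OF a False] by blast
   thus ?thesis using sub[of a] by blast
  qed
  hence ?N using pe[OF e] pl by simp
  moreover have ?S by (rule bexI[OF _ t(1)], rule conjI[OF Kt]) (use two in blast)
  ultimately show "equiv A ep & ?S & ?N" using e by blast
 next
  assume h: "equiv A ep & ?S & ?N"
  hence e: "equiv A ep" and N: ?N by auto
  from h obtain t where t: "t : A" "ep `` {t} = {t}" and two: "!!a. a : A ==> a ~= t ==> \<exists>b. b ~= a & ep `` {a} = {a, b}" by blast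
  have sub: "ep `` {a} <= A" for a using equiv_relD(1)[OF e] by blast
  have c2: "card (ep `` {a}) = 2" if a: "a : A" "a ~= t" for a
  proof -
   obtain b where "b ~= a" "ep `` {a} = {a, b}" using two[OF a] by blast
   thus ?thesis by simp
  qed
  have cls: "K = {t} \<or> card K = 2" if K: "K : A // ep" for K
  proof -
   obtain a where a: "a : A" "K = ep `` {a}" using K by (rule quotientE)
   show ?thesis
   proof (cases "a = t")
    case True thus ?thesis using a(2) t(2) by simp
   next
    case False thus ?thesis using c2[OF a(1)] a(2) by simp
   qed
  qed
  have u1: "\<exists>!K. K : A // ep & card K = 1"
  proof (rule ex1I[of _ "{t}"])
   have "{t} : A // ep" using quotientI[OF t(1), of ep] unfolding t(2) .
   thus "{t} : A // ep & card {t} = 1" by simp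
   fix K assume K: "K : A // ep & card K = 1"
   thus "K = {t}" using cls[of K] by linarith
  qed
  have u2: "card K = 1 \<or> card K = 2" if "K : A // ep" for K using cls[OF that] by (elim disjE) simp_all
  have u3: "EX b:A. ep `` {a} = {a, b}" if a: "a : A" for a
  proof (cases "a = t")
   case True thus ?thesis using t a by simp
  next
   case False
   obtain b where b: "ep `` {a} = {a, b}" using two[OF a False] by blast
   have "b : A" using sub[of a] unfolding b by simp
   thus ?thesis using b by (rule bexI[rotated])
  qed
  have "ep : Eq2 A" unfolding Eq2_def Eqv_def by (intro CollectI conjI e u1 ballI u2)
  moreover have "planar_equiv (leq A) A ep" by (rule iffD2[OF pe[OF e] N]) (rule u3)
  ultimately show "ep : planar_Eq2 leq A" unfolding planar_Eq2_def by simp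
 qed
qed

lemma NC_restrict:
 "NC l M ==> (!!K. K : M ==> K <= S \<or> K Int S = {}) ==> NC (filter (%x. x : S) l) {K : M. K <= S}"
proof (induction rule: NC.induct)
 case NC_Nil
 thus ?case using NC.NC_Nil by simp
next
 case (NC_insert us vs M a b)
 have IH: "NC (filter (%x. x : S) us @ filter (%x. x : S) vs) {K : M. K <= S}" using NC_insert.IH NC_insert.prems by simp
 consider "a : S" "b : S" | "a ~: S" "b ~: S" using NC_insert.prems[of "{a, b}"] by auto
 thus ?case
 proof cases
  case 1
  hence "{K : insert {a, b} M. K <= S} = insert {a, b} {K : M. K <= S}" by auto
  thus ?thesis using NC.NC_insert[OF IH, of a b] 1 by simp
 next
  case 2
  hence "{K : insert {a, b} M. K <= S} = {K : M. K <= S}" by auto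
  thus ?thesis using IH 2 by simp
 qed
qed

lemma rot_filter: "rot xs ys ==> rot (filter P xs) (filter P ys)"
proof -
 assume "rot xs ys"
 then obtain us vs where "xs = us @ vs" "ys = vs @ us" using rotE by blast
 thus ?thesis using rot_append[of "filter P us" "filter P vs"] by simp
qed

definition line_key :: "('a => nat) => 'a + 'a => real" where
 "line_key f v = (case v of Inl a => real (f a) | Inr b => 0)"

lemma sorted_line_key:
 assumes "finite A" "linear_order_on A r"
 shows "sorted_wrt (%x y. line_key (pos r) x < line_key (pos r) y) (map Inl (filter P (ord_list r A)))"
 unfolding sorted_wrt_map line_key_def sum.case of_nat_less_iff by (rule sorted_wrt_filter[OF sorted_ord_list[OF assms]])

text \<open>The cups of an annular partition are known to be non-crossing only in a rotated and
  possibly reversed order. Once the transversal and the lower points are deleted, they match the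
  points of a single circle, which may be turned back to the linear order.\<close>

lemma JH_cups_noncross:
 assumes A: "finite A" "linear_order_on A r" and al: "al : JH s (ord_list r A) ys" "rank al = 1"
  and h: "{Inl p, Inl q} : al" "{Inl a, Inl b} : al" "pos r p < pos r a" "pos r a < pos r q" "pos r q < pos r b"
 shows False
proof -
 let ?L = "ord_list r A"
 note sA = set_ord_list[OF A]
 have br: "al : brauer A (set ys)" using JH_brauer[OF al(1)] sA by simp
 obtain t where t: "thr al = {t}" using rank1_transversal[OF br al(2)] by metis
 obtain zs where zs: "al : Jhom zs ys" "zs = ?L \<or> zs = rev ?L" using al(1) unfolding JH_def by blast
 obtain xs' ys' where x: "rot zs xs'" "NC (map Inl xs' @ rev (map Inr ys')) al" using zs(1) unfolding Jhom_def by blast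
 have sx: "set xs' = A" using rot_set[OF x(1)] zs(2) sA by auto
 let ?S = "Inl ` (A - {t}) :: ('a + 'a) set"
 have cupS: "K <= ?S" if "K : al" "Inl c : K" "c ~= t" for K c
 proof -
  have "c : A" "c ~: thr al" using brauer_sub(1)[OF br that(1,2)] that(3) t by auto
  then obtain e where e: "{Inl c, Inl e} : al" using thr_iff[OF br] by blast
  have "{Inl e, Inl c} : al" using e by (simp add: insert_commute)
  hence "e ~= t" using thr_no_cup[OF br, of t] t by auto
  moreover have "K = {Inl c, Inl e}" using brauer_unique[OF br that(1) e that(2)] by simp
  ultimately show ?thesis using cup_sub[OF br e] that(3) by auto
 qed
 hence "K <= ?S \<or> K Int ?S = {}" if "K : al" for K using that by auto
 from NC_restrict[OF x(2) this]
 have N: "NC (filter (%v. v : ?S) (map Inl xs' @ rev (map Inr ys'))) {K : al. K <= ?S}" by simp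
 have "filter (%v. v : ?S) (map Inl xs') = map Inl (filter (%c. c ~= t) xs')"
  unfolding filter_map by (rule arg_cong[where f = "map Inl"], rule filter_cong) (use sx in auto)
 moreover have "filter (%v. v : ?S) (rev (map Inr ys')) = []" by (rule filter_False) auto
 ultimately have N1: "NC (map Inl (filter (%c. c ~= t) xs')) {K : al. K <= ?S}" using N by simp
 have N2: "NC (map Inl (filter (%c. c ~= t) zs)) {K : al. K <= ?S}"
  by (rule NC_rot[OF N1 rot_map[OF rot_filter[OF rot_sym[OF x(1)]]]])
 have N3: "NC (map Inl (filter (%c. c ~= t) ?L)) {K : al. K <= ?S}"
 proof (cases "zs = ?L")
  case False
  hence "zs = rev ?L" using zs(2) by blast
  hence "rev (map Inl (filter (%c. c ~= t) zs)) = (map Inl (filter (%c. c ~= t) ?L) :: ('a + 'a) list)" by (simp add: rev_map rev_filter)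
  thus ?thesis using NC_rev[OF N2] by simp
 qed (use N2 in simp)
 have n: "noncross (line_key (pos r)) {K : al. K <= ?S}" using NC_noncross[OF N3 sorted_line_key[OF A]] by blast
 have nt: "u ~= t" if "{Inl u, Inl v} : al" for u v using thr_no_cup[OF br, of t v] t that by auto
 have "{Inl p, Inl q} : {K : al. K <= ?S}" "{Inl a, Inl b} : {K : al. K <= ?S}"
  using h(1,2) cupS[OF h(1), of p] cupS[OF h(2), of a] nt[OF h(1)] nt[OF h(2)] by simp_all
 from noncrossD[OF n this] show False using h(3-5) by (simp add: line_key_def)
qed

lemma cup_eq_planar:
 assumes A: "finite A" "linear_order_on A (leq A)" and al: "al : JH s (ord_list (leq A) A) ys" "rank al = 1"
 shows "cup_eq al : planar_Eq2 leq A"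
proof -
 have br: "al : brauer A (set ys)" using JH_brauer[OF al(1)] set_ord_list[OF A] by simp
 obtain t where t: "thr al = {t}" "t : A" using rank1_transversal[OF br al(2)] by metis
 have "t : thr al" using t by simp
 hence "cup_eq al `` {t} = {t}" using thr_cup_eq[OF br] cup_eq_iff[OF br] t(2) by blast
 moreover have "\<exists>b. b ~= a & cup_eq al `` {a} = {a, b}" if "a : A" "a ~= t" for a
  using cup_eq_class[OF br that(1)] that(2) t by simp
 moreover have "\<not> pos (leq A) q < pos (leq A) b"
  if h: "(p, q) : cup_eq al" "(a, b) : cup_eq al" "pos (leq A) p < pos (leq A) a" "pos (leq A) a < pos (leq A) q" for p q a b
 proof
  assume "pos (leq A) q < pos (leq A) b"
  moreover from this have "{Inl p, Inl q} : al" "{Inl a, Inl b} : al" using h unfolding cup_eq_iff[OF br] by auto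
  ultimately show False using JH_cups_noncross[OF A al, of p q a b] h(3,4) by blast
 qed
 ultimately show ?thesis unfolding planar_Eq2_iff[of A leq, OF A] using cup_eq_equiv[OF br] t(2) by blast
qed

definition cups :: "'a rel => 'a brauer" where
 "cups ep = {{Inl a, Inl b} | a b. (a, b) : ep & a ~= b}"

lemma mem_cups: "sym ep ==> {Inl a, Inl b} : cups ep \<longleftrightarrow> (a, b) : ep & a ~= b"
 unfolding cups_def by (auto simp: doubleton_eq_iff dest: symD)

text \<open>The circle is cut at the singleton \<open>t\<close>, so that a transversal can later be
  attached there without enclosing only part of the cups.\<close>

lemma NC_cups:
 assumes A: "finite A" "linear_order_on A (leq A)" and ep: "ep : planar_Eq2 leq A"
 obtains t zs where "t : A" "ep `` {t} = {t}" "rot (ord_list (leq A) A) (t # zs)" "NC (map Inl zs) (cups ep)"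
proof -
 let ?L = "ord_list (leq A) A"
 note e = ep[unfolded planar_Eq2_iff[of A leq, OF A]]
 have eq: "equiv A ep" using e by blast
 have sy: "sym ep" using eq unfolding equiv_def by blast
 from e obtain t where t: "t : A" "ep `` {t} = {t}" and two: "!!a. a : A ==> a ~= t ==> \<exists>b. b ~= a & ep `` {a} = {a, b}" by blast
 have inA: "(a, b) : ep ==> a : A & b : A" for a b by (rule equiv_relD(1)[OF eq])
 have nt: "a ~= t & b ~= t" if "(a, b) : ep" "a ~= b" for a b
 proof -
  have "c = t" if "(t, c) : ep" for c using that t(2) by blast
  thus ?thesis using that equiv_relD(3)[OF eq that(1)] by metis
 qed
 have uniq: "b = c" if h: "(a, b) : ep" "a ~= b" "(a, c) : ep" "a ~= c" for a b c
 proof -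
  obtain d where d: "ep `` {a} = {a, d}" using two[of a] inA[OF h(1)] nt[OF h(1,2)] by blast
  have "b : ep `` {a}" "c : ep `` {a}" using h by simp_all
  thus ?thesis unfolding d using h(2,4) by simp
 qed
 have P: "partition_on (Inl ` (A - {t})) (cups ep)"
 proof (rule partition_onI)
  show "\<Union>(cups ep) = Inl ` (A - {t})"
  proof (rule subset_antisym; rule subsetI)
   fix v :: "'a + 'a" assume "v : \<Union>(cups ep)"
   then obtain a b where "v : {Inl a, Inl b}" "(a, b) : ep" "a ~= b" unfolding cups_def by blast
   thus "v : Inl ` (A - {t})" using inA nt by blast
  next
   fix v :: "'a + 'a" assume "v : Inl ` (A - {t})"
   then obtain a where a: "v = Inl a" "a : A" "a ~= t" by blast
   obtain b where "b ~= a" "ep `` {a} = {a, b}" using two[OF a(2,3)] by blast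
   hence "{Inl a, Inl b} : cups ep" unfolding mem_cups[OF sy] by blast
   thus "v : \<Union>(cups ep)" using a(1) by blast
  qed
 next
  fix K L :: "('a + 'a) set" assume KL: "K : cups ep" "L : cups ep" "K ~= L"
  obtain a b where K: "K = {Inl a, Inl b}" "(a, b) : ep" "a ~= b" using KL(1) unfolding cups_def by blast
  obtain c d where L: "L = {Inl c, Inl d}" "(c, d) : ep" "c ~= d" using KL(2) unfolding cups_def by blast
  have ba: "(b, a) : ep" "(d, c) : ep" using K(2) L(2) sy by (blast dest: symD)+
  have "a ~= c & a ~= d & b ~= c & b ~= d"
  proof (intro conjI notI)
   assume "a = c" thus False using uniq[OF K(2,3), of d] K L KL(3) by simp
  next
   assume "a = d" thus False using uniq[OF K(2,3), of c] K L KL(3) ba by (simp add: insert_commute)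
  next
   assume "b = c" thus False using uniq[OF ba(1), of d] K L KL(3) by (simp add: insert_commute)
  next
   assume "b = d" thus False using uniq[OF ba(1), of c] K L KL(3) ba by simp
  qed
  thus "disjnt K L" unfolding K(1) L(1) disjnt_def by auto
 next
  show "{} ~: cups ep" unfolding cups_def by blast
 qed
 have c2: "ALL K:cups ep. card K = 2" unfolding cups_def by auto
 have n: "noncross (line_key (pos (leq A))) (cups ep)" unfolding noncross_def
 proof (intro allI impI notI)
  fix p q a b :: "'a + 'a"
  assume h: "{p, q} : cups ep" "{a, b} : cups ep" "line_key (pos (leq A)) p < line_key (pos (leq A)) a"
   "line_key (pos (leq A)) a < line_key (pos (leq A)) q" "line_key (pos (leq A)) q < line_key (pos (leq A)) b"
  have dest: "\<exists>c d. x = Inl c & y = Inl d & (c, d) : ep" if xy: "{x, y} : cups ep" for x y :: "'a + 'a"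
  proof -
   have "x : Inl ` (A - {t})" "y : Inl ` (A - {t})" using P xy unfolding partition_on_def by blast+
   then obtain c d where "x = Inl c" "y = Inl d" by blast
   thus ?thesis using xy mem_cups[OF sy, of c d] by blast
  qed
  obtain p' q' where pq: "p = Inl p'" "q = Inl q'" "(p', q') : ep" using dest[OF h(1)] by blast
  obtain a' b' where ab: "a = Inl a'" "b = Inl b'" "(a', b') : ep" using dest[OF h(2)] by blast
  have "pos (leq A) p' < pos (leq A) a'" "pos (leq A) a' < pos (leq A) q'" "pos (leq A) q' < pos (leq A) b'"
   using h(3-5) unfolding pq ab line_key_def by simp_all
  thus False using e pq(3) ab(3) by blast
 qed
 obtain ps qs where L: "?L = ps @ t # qs" using set_ord_list[OF A] t(1) by (metis split_list)
 have dL: "distinct (ps @ t # qs)" using distinct_ord_list[OF A] unfolding L .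
 have f: "filter (%c. c ~= t) ?L = ps @ qs"
 proof -
  have "filter (%c. c ~= t) ps = ps" "filter (%c. c ~= t) qs = qs" by (rule filter_True, use dL in auto)+
  thus ?thesis unfolding L by simp
 qed
 have setL: "set (map Inl (filter (%c. c ~= t) ?L)) = (Inl ` (A - {t}) :: ('a + 'a) set)" using set_ord_list[OF A] by auto
 have "NC (map Inl (filter (%c. c ~= t) ?L)) (cups ep)"
  by (rule noncross_NC[OF sorted_line_key[OF A] _ c2 n]) (unfold setL, rule P)
 hence "NC (map Inl (qs @ ps)) (cups ep)" using NC_rot[OF _ rot_map[OF rot_append[of ps qs]]] unfolding f by blast
 moreover have "rot ?L (t # qs @ ps)" unfolding L using rot_append[of ps "t # qs"] by simp
 ultimately show ?thesis using that t by blast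
qed

lemma glue_cup_eq:
 assumes al: "insert {Inl t, Inr t'} (cups ep Un bflip (cups ep')) : brauer A B" (is "?al : _") and e: "equiv A ep"
 shows "cup_eq ?al = ep"
proof -
 have sy: "sym ep" using e unfolding equiv_def by blast
 have "{Inl a, Inl b} ~: bflip (cups ep')" for a b
 proof
  assume "{Inl a, Inl b} : bflip (cups ep')"
  hence "{Inr a, Inr b} : cups ep'" unfolding mem_bflip by simp
  thus False unfolding cups_def by (auto simp: doubleton_eq_iff)
 qed
 moreover have "{Inl a, Inl b} ~= {Inl t, Inr t'}" for a b by (auto simp: doubleton_eq_iff)
 ultimately have m: "{Inl a, Inl b} : ?al \<longleftrightarrow> (a, b) : ep & a ~= b" for a b
  unfolding insert_iff Un_iff mem_cups[OF sy] by simp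
 have "(a, b) : cup_eq ?al \<longleftrightarrow> (a, b) : ep" for a b
  unfolding cup_eq_iff[OF al] m using equiv_relD(1,2)[OF e] by blast
 thus ?thesis by auto
qed

text \<open>Both circles are cut at their singletons. The two matchings of cups are put side by
  side, and the transversal joining the cut points encloses them.\<close>

lemma rank1_ex:
 assumes A: "finite A & odd (card A) & linear_order_on A (leq A)" and B: "finite B & odd (card B) & linear_order_on B (leq B)"
  and e1: "ep1 : planar_Eq2 leq A" and e2: "ep2 : planar_Eq2 leq B"
 shows "\<exists>al\<in>JH s (ord_list (leq A) A) (ord_list (leq B) B). rank al = 1 & cup_eq al = ep1 & cup_eq (bflip al) = ep2"
proof -
 have a: "finite A" "linear_order_on A (leq A)" and b: "finite B" "linear_order_on B (leq B)" using A B by auto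
 have eq: "equiv A ep1" "equiv B ep2"
  using e1 e2 unfolding planar_Eq2_iff[of A leq, OF a] planar_Eq2_iff[of B leq, OF b] by blast+
 obtain t zs where t: "t : A" "ep1 `` {t} = {t}" "rot (ord_list (leq A) A) (t # zs)" "NC (map Inl zs) (cups ep1)" using NC_cups[of A leq, OF a e1] by metis
 obtain t' zs' where t': "t' : B" "ep2 `` {t'} = {t'}" "rot (ord_list (leq B) B) (t' # zs')" "NC (map Inl zs') (cups ep2)" using NC_cups[of B leq, OF b e2] by metis
 let ?al = "insert {Inl t, Inr t'} (cups ep1 Un bflip (cups ep2))"
 have "NC (rev (map swap_sum (map Inl zs'))) (bflip (cups ep2))" unfolding bflip_def by (rule NC_rev[OF NC_map[OF t'(4)]])
 moreover have mm: "map swap_sum (map Inl zs') = map Inr zs'" by simp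
 ultimately have "NC (rev (map Inr zs')) (bflip (cups ep2))" unfolding mm by blast
 from NC_wrap[OF NC_append[OF t(4) this], of "Inl t" "Inr t'"]
 have "NC (map Inl (t # zs) @ rev (map Inr (t' # zs'))) ?al" by simp
 from JhomI[OF t(3) t'(3) this] have J: "?al : Jhom (ord_list (leq A) A) (ord_list (leq B) B)" .
 have "olist (ord_list (leq A) A)" "olist (ord_list (leq B) B)"
  unfolding olist_def using distinct_ord_list[OF a] length_ord_list[OF a] distinct_ord_list[OF b] length_ord_list[OF b] A B by simp_all
 hence JJ: "?al : JH s (ord_list (leq A) A) (ord_list (leq B) B)" using J by (intro JH_I)
 have br: "?al : brauer A B" using JH_brauer[OF JJ] set_ord_list[OF a] set_ord_list[OF b] by simp
 have fl: "bflip ?al = insert {Inl t', Inr t} (cups ep2 Un bflip (cups ep1))"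
 proof -
  have "bflip (X Un Y) = bflip X Un bflip Y" for X Y :: "'a brauer" unfolding bflip_def by (rule image_Un)
  thus ?thesis unfolding bflip_insert by (simp add: Un_commute insert_commute)
 qed
 have c1: "cup_eq ?al = ep1" by (rule glue_cup_eq[OF br eq(1)])
 have c2: "cup_eq (bflip ?al) = ep2" using glue_cup_eq[OF bflip_brauer[OF br, unfolded fl] eq(2)] unfolding fl .
 have "thr ?al = {t}"
 proof (rule subset_antisym; rule subsetI)
  fix c assume "c : thr ?al"
  then obtain K d where K: "K : ?al" "Inl c : K" "Inr d : K" unfolding thr_def by blast
  have "K ~: cups ep1" using K(3) unfolding cups_def by auto
  moreover have "K ~: bflip (cups ep2)" using K(2) unfolding bflip_def cups_def by auto
  ultimately have "K = {Inl t, Inr t'}" using K(1) by blast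
  thus "c : {t}" using K(2) by simp
 next
  fix c assume "c : {t}"
  moreover have "t : thr ?al" by (rule thrI) (rule insertI1)
  ultimately show "c : thr ?al" by simp
 qed
 hence "rank ?al = 1" using rank_thr(1)[OF br] by simp
 thus ?thesis using JJ c1 c2 by blast
qed

theorem theorem9p8:
  fixes C :: "'a set set"
    and leq :: "'a set \<Rightarrow> 'a rel"
    and Q :: "('a brauer, 'a set) psemigroup"
    and G :: "nat \<Rightarrow> 'a brauer set"
  assumes "C \<noteq> {}"
    and "\<And>A. A \<in> C \<Longrightarrow> finite A \<and> odd (card A) \<and> linear_order_on A (leq A)"
    and "Q = Jones C leq \<or> Q = anti_Jones C leq"
    and "\<And>q. odd q \<Longrightarrow> 1 \<le> q \<Longrightarrow> enat q < xi C \<Longrightarrow>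
           group_H_class Q (G q) \<and> G q \<subseteq> {\<alpha> \<in> carrier Q. rank \<alpha> = q}"
  shows
    "(let I1 = rank_ideal Q 1; P = planar_Eq2 leq in
        minimal_ideal Q (carrier I1) \<and>
        band_families C P P \<and>
        (\<exists>\<phi>. psg_iso I1 (rect_band C P P) \<phi> \<and>
           Cong I1 =
             {{(\<alpha>, \<beta>) \<in> carrier I1 \<times> carrier I1. (\<phi> \<alpha>, \<phi> \<beta>) \<in> band_sigma C P P E1 E2} | E1 E2.
                (\<forall>A\<in>C. E1 A \<in> Eqv (P A)) \<and> (\<forall>A\<in>C. E2 A \<in> Eqv (P A))}) \<and>
        lattice_isomorphic (Cong_lattice I1)
          (prod2_lattice (Prod_lattice C (\<lambda>A. Eq_lattice (P A)))
                         (Prod_lattice C (\<lambda>A. Eq_lattice (P A)))))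
     \<and>
     (\<forall>r. (\<exists>n. r = enat n \<and> odd n \<and> 3 \<le> n \<and> r < xi C) \<or> (r = \<infinity> \<and> xi C = \<infinity>) \<longrightarrow>
        (let Ir = rank_ideal Q r; I = (\<lambda>q. carrier (rank_ideal Q q)) in
          Cong Ir =
            {Id_on (carrier Ir), lambda_cong Ir (I 1), rho_cong Ir (I 1), Rees Ir (I 1)}
            \<union> {Rees_N Ir (I (enat q)) N | q N.
                 1 \<le> q \<and> enat q < r \<and> odd q \<and> N \<lhd> H_group Q (G (q + 2))}
            \<union> {tnabla Ir}))"
proof -
 define L where "L = (%A. ord_list (leq A) A)"
 define P where "P = planar_Eq2 leq"
 note O = assms(2)
 have fin: "finite A" "linear_order_on A (leq A)" "odd (card A)" if "A : C" for A using O[OF that] by auto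
 have setL: "set (L A) = A" and oL: "olist (L A)" if A: "A : C" for A
  using set_ord_list[OF fin(1,2)[OF A]] distinct_ord_list[OF fin(1,2)[OF A]] length_ord_list[OF fin(1,2)[OF A]] fin(3)[OF A]
  unfolding L_def olist_def by simp_all
 \<comment> \<open>Both categories have this shape once the sets in \<open>C\<close> are replaced by
   their increasing lists; the flag tells them apart.\<close>
 let ?psg = "%s. \<lparr>carrier = {x. EX A:C. EX B:C. x : JH s (L A) (L B)}, src = bdom, tgt = bran, pmul = cmp\<rparr> :: ('a brauer, 'a set) psemigroup"
 have JF: "Jones C leq = ?psg False"
 proof -
  have "(EX A:C. EX B:C. al : brauer A B & annular leq al) \<longleftrightarrow> (EX A:C. EX B:C. al : JH False (L A) (L B))" for al
   unfolding L_def by (intro bex_cong refl Jones_carrier_iff(1)[OF O O])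
  thus ?thesis unfolding Jones_def by simp
 qed
 have JT: "anti_Jones C leq = ?psg True"
 proof -
  have "(EX A:C. EX B:C. al : brauer A B & (annular leq al \<or> anti_annular leq al)) \<longleftrightarrow> (EX A:C. EX B:C. al : JH True (L A) (L B))" for al
   unfolding L_def by (intro bex_cong refl Jones_carrier_iff(2)[OF O O])
  thus ?thesis unfolding anti_Jones_def by simp
 qed
 from assms(3) have "\<exists>s. Q = ?psg s"
 proof
  assume "Q = Jones C leq"
  thus ?thesis unfolding JF by (rule exI[of _ False])
 next
  assume "Q = anti_Jones C leq"
  thus ?thesis unfolding JT by (rule exI[of _ True])
 qed
 then obtain s where Qs: "Q = ?psg s" by (rule exE)
 have br: "x : brauer A B" if "x : JH s (L A) (L B)" "A : C" "B : C" for x A B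
  using JH_brauer[OF that(1)] setL that(2,3) by simp
 interpret S: hook_subcat olist "JH s" cmp bflip idb rank length hooks "[undefined]" C L bdom bran
 proof (intro hook_subcat.intro hook_category_JH hook_subcat_axioms.intro)
  show "C ~= {}" by (rule assms(1))
  show "A : C ==> olist (L A)" for A by (rule oL)
  show "A : C ==> B : C ==> x : JH s (L A) (L B) ==> bdom x = A & bran x = B" for A B x
   using brauer_dom[OF br] by blast
 qed
 have QS: "Q = S.Q" unfolding Qs S.Q_def ..
 have IrS: "rank_ideal Q r = S.Ir r" for r unfolding rank_ideal_def S.Ir_def QS ..
 \<comment> \<open>A list of odd length is not empty, so it admits a coisometry onto the one-point
   object.\<close>
 have pt: "\<exists>u. u : JH s (L A) [undefined]" if A: "A : C" for A
 proof -
  have "odd (length (L A))" using oL[OF A] unfolding olist_def by blast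
  hence "length [undefined] <= length (L A)" by (cases "L A") auto
  thus ?thesis using S.coiso_ex[OF oL[OF A] S.ob_pt] S.coisoD(1) by metis
 qed
 have rk1: "1 <= rank x" if x: "x : JH s (L A) (L B)" "A : C" "B : C" for x A B
 proof -
  obtain u where u: "u : JH s (L A) [undefined]" using pt[OF x(2)] by blast
  obtain v where v: "v : JH s (L B) [undefined]" using pt[OF x(3)] by blast
  have xv: "cmp x v : JH s (L A) [undefined]" by (rule S.mul_in[OF x(1) v])
  have "rank (cmp x v) = 1" by (rule S.pt_rk[OF xv])
  thus ?thesis using S.rk_mul1[OF x(1) v] by simp
 qed
 have one_ex: "EX z:JH s (L A) (L B). rank z = 1" if AB: "A : C" "B : C" for A B
 proof -
  obtain u where u: "u : JH s (L A) [undefined]" using pt[OF AB(1)] by blast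
  obtain v where v: "v : JH s (L B) [undefined]" using pt[OF AB(2)] by blast
  have m: "cmp u (bflip v) : JH s (L A) (L B)" by (rule S.mul_in[OF u S.st_in[OF v]])
  have "rank (cmp u (bflip v)) <= rank u" by (rule S.rk_mul1[OF u S.st_in[OF v]])
  hence "rank (cmp u (bflip v)) = 1" using S.pt_rk[OF u] rk1[OF m AB] by simp
  thus ?thesis using m by blast
 qed
 have mul1: "rank (cmp x y) = 1"
  if h: "x : JH s (L A) (L B)" "y : JH s (L B) (L D)" "A : C" "B : C" "D : C" "rank x = 1 \<or> rank y = 1" for x y A B D
  using S.rk_mul1[OF h(1,2)] S.rk_mul2[OF h(1,2)] rk1[OF S.mul_in[OF h(1,2)] h(3,5)] h(6) by auto
 have car1: "x : carrier (S.Ir 1) \<longleftrightarrow> (EX A:C. EX B:C. x : JH s (L A) (L B) & rank x = 1)" for x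
  unfolding S.carrier_Ir one_enat_def enat_ord_simps(1) using rk1 by (metis le_antisym order_refl)
 let ?\<phi> = "%al. (cup_eq al, cup_eq (bflip al)) :: 'a rel \<times> 'a rel"
 have cupP: "cup_eq x : P A" "cup_eq (bflip x) : P B" if x: "x : JH s (L A) (L B)" "A : C" "B : C" "rank x = 1" for x A B
 proof -
  show "cup_eq x : P A" unfolding P_def using cup_eq_planar[of A leq, OF fin(1,2)[OF x(2)]] x(1,4) unfolding L_def by blast
  have "bflip x : JH s (ord_list (leq B) B) (L A)" using S.st_in[OF x(1)] unfolding L_def by simp
  thus "cup_eq (bflip x) : P B" unfolding P_def
   by (rule cup_eq_planar[of B leq, OF fin(1,2)[OF x(3)]]) (simp add: rank_bflip x(4))
 qed
 have PE: "equiv A ep" if "ep : P A" for A ep using that unfolding P_def planar_Eq2_def Eq2_def Eqv_def by blast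
 \<comment> \<open>An equivalence determines its underlying set by its diagonal; this makes the
   families of the band disjoint.\<close>
 have Pdis: "A = B" if "ep : P A" "ep : P B" for A B ep
 proof -
  have "x : A \<longleftrightarrow> (x, x) : ep" "x : B \<longleftrightarrow> (x, x) : ep" for x
   using equiv_relD(1,2)[OF PE[OF that(1)]] equiv_relD(1,2)[OF PE[OF that(2)]] by blast+
  thus ?thesis by blast
 qed
 have band: "band_families C P P"
 proof -
  have "P A ~= {}" if A: "A : C" for A
  proof -
   obtain z where "z : JH s (L A) (L A)" "rank z = 1" using one_ex[OF A A] by blast
   thus ?thesis using cupP(1)[OF _ A A] by blast
  qed
  moreover have "disjoint_family_on P C" unfolding disjoint_family_on_def using Pdis by blast
  ultimately show ?thesis unfolding band_families_def by blast
 qed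
 have eqI: "x = y" if x: "x : JH s (L A) (L B)" "rank x = 1" and y: "y : JH s (L A) (L B)" "rank y = 1"
  and AB: "A : C" "B : C" and e: "cup_eq x = cup_eq y" "cup_eq (bflip x) = cup_eq (bflip y)" for x y A B
  by (rule rank1_eq[OF br[OF x(1) AB] x(2) br[OF y(1) AB] y(2) e])
 have cup_mul: "cup_eq (cmp x y) = cup_eq x"
  if h: "x : JH s (L A) (L B)" "y : JH s (L B) (L D)" "A : C" "B : C" "D : C" "rank x = 1" for x y A B D
  by (rule cup_eq_comp[OF br[OF h(1,3,4)] h(6) br[OF S.mul_in[OF h(1,2)] h(3,5)]])
 have cup_mul2: "cup_eq (bflip (cmp x y)) = cup_eq (bflip y)"
  if h: "x : JH s (L A) (L B)" "y : JH s (L B) (L D)" "A : C" "B : C" "D : C" "rank y = 1" for x y A B D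
  unfolding bflip_comp by (rule cup_mul[OF S.st_in[OF h(2)] S.st_in[OF h(1)] h(5,4,3)]) (simp add: rank_bflip h(6))
 have tgt_src: "B = B'" if "x : JH s (L A) (L B)" "y : JH s (L B') (L D)" "A : C" "B : C" "B' : C" "D : C" "bran x = bdom y" for x y A B B' D
  using S.sr_tg[OF that(3,4,1)] S.sr_tg[OF that(5,6,2)] that(7) by simp
 have closed: "pmul (S.Ir 1) x y : carrier (S.Ir 1)"
  if h: "x : carrier (S.Ir 1)" "y : carrier (S.Ir 1)" "tgt (S.Ir 1) x = src (S.Ir 1) y" for x y
 proof -
  obtain A B where x: "A : C" "B : C" "x : JH s (L A) (L B)" "rank x = 1" using h(1) unfolding car1 by blast
  obtain B' D where y: "B' : C" "D : C" "y : JH s (L B') (L D)" using h(2) unfolding car1 by blast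
  have "B = B'" using tgt_src[OF x(3) y(3) x(1,2) y(1,2)] h(3) by simp
  hence y': "y : JH s (L B) (L D)" using y(3) by simp
  show ?thesis unfolding car1 S.Ir_simps using S.mul_in[OF x(3) y'] mul1[OF x(3) y' x(1,2) y(2)] x(1,4) y(2) by blast
 qed
 have iso: "psg_iso (S.Ir 1) (rect_band C P P) ?\<phi>" unfolding psg_iso_def
 proof (intro conjI ballI impI)
  have into: "?\<phi> x : carrier (rect_band C P P)" if x: "x : carrier (S.Ir 1)" for x
  proof -
   obtain A B where x: "A : C" "B : C" "x : JH s (L A) (L B)" "rank x = 1" using x unfolding car1 by blast
   show ?thesis unfolding carrier_rect_band[OF band] using cupP[OF x(3,1,2,4)] x(1,2) by blast
  qed
  show "bij_betw ?\<phi> (carrier (S.Ir 1)) (carrier (rect_band C P P))" unfolding bij_betw_def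
  proof
   show "inj_on ?\<phi> (carrier (S.Ir 1))"
   proof (rule inj_onI)
    fix x y assume h: "x : carrier (S.Ir 1)" "y : carrier (S.Ir 1)" "?\<phi> x = ?\<phi> y"
    obtain A B where x: "A : C" "B : C" "x : JH s (L A) (L B)" "rank x = 1" using h(1) unfolding car1 by blast
    obtain A' B' where y: "A' : C" "B' : C" "y : JH s (L A') (L B')" "rank y = 1" using h(2) unfolding car1 by blast
    have e: "cup_eq x = cup_eq y" "cup_eq (bflip x) = cup_eq (bflip y)" using h(3) by simp_all
    note cx = cupP[OF x(3,1,2,4)] and cy = cupP[OF y(3,1,2,4)]
    have "A' = A" by (rule Pdis[OF cy(1)]) (use cx(1) e(1) in simp)
    moreover have "B' = B" by (rule Pdis[OF cy(2)]) (use cx(2) e(2) in simp)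
    ultimately have "y : JH s (L A) (L B)" using y(3) by simp
    thus "x = y" by (rule eqI[OF x(3,4) _ y(4) x(1,2) e])
   qed
   show "?\<phi> ` carrier (S.Ir 1) = carrier (rect_band C P P)"
   proof (rule subset_antisym; rule subsetI)
    fix p assume "p : ?\<phi> ` carrier (S.Ir 1)"
    thus "p : carrier (rect_band C P P)" using into by blast
   next
    fix p assume p: "p : carrier (rect_band C P P)"
    obtain e1 e2 where e: "p = (e1, e2)" by (cases p)
    obtain A B where AB: "A : C" "B : C" "e1 : P A" "e2 : P B" using p unfolding e carrier_rect_band[OF band] by blast
    have "\<exists>al\<in>JH s (L A) (L B). rank al = 1 & cup_eq al = e1 & cup_eq (bflip al) = e2"
     unfolding L_def by (rule rank1_ex[OF O[OF AB(1)] O[OF AB(2)]]) (use AB(3,4) in \<open>simp_all add: P_def\<close>)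
    then obtain x where x: "x : JH s (L A) (L B)" "rank x = 1" "cup_eq x = e1" "cup_eq (bflip x) = e2" by blast
    have "x : carrier (S.Ir 1)" unfolding car1 using x(1,2) AB(1,2) by blast
    thus "p : ?\<phi> ` carrier (S.Ir 1)" by (rule rev_image_eqI) (simp add: e x)
   qed
  qed
  fix x assume h: "x : carrier (S.Ir 1)"
  obtain A B where x: "A : C" "B : C" "x : JH s (L A) (L B)" "rank x = 1" using h unfolding car1 by blast
  note cx = cupP[OF x(3,1,2,4)]
  show "src (rect_band C P P) (?\<phi> x) = src (S.Ir 1) x" "tgt (rect_band C P P) (?\<phi> x) = tgt (S.Ir 1) x"
   using src_rect_band[OF band x(1) cx(1)] tgt_rect_band[OF band x(2) cx(2)] S.sr_tg[OF x(1,2,3)] by simp_all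
  fix y assume h': "y : carrier (S.Ir 1)" "tgt (S.Ir 1) x = src (S.Ir 1) y"
  obtain B' D where y: "B' : C" "D : C" "y : JH s (L B') (L D)" "rank y = 1" using h'(1) unfolding car1 by blast
  have "B = B'" using tgt_src[OF x(3) y(3) x(1,2) y(1,2)] h'(2) by simp
  hence y': "y : JH s (L B) (L D)" using y(3) by simp
  show "?\<phi> (pmul (S.Ir 1) x y) = pmul (rect_band C P P) (?\<phi> x) (?\<phi> y)"
   unfolding pmul_rect_band[OF band] S.Ir_simps cup_mul[OF x(3) y' x(1,2) y(2) x(4)] cup_mul2[OF x(3) y' x(1,2) y(2,4)] ..
 qed
 have minimal: "minimal_ideal Q (carrier (S.Ir 1))" unfolding minimal_ideal_def
 proof (intro conjI allI impI)
  obtain A where A: "A : C" using assms(1) by blast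
  obtain z where "z : JH s (L A) (L A)" "rank z = 1" using one_ex[OF A A] by blast
  hence "z : carrier (S.Ir 1)" unfolding car1 using A by blast
  moreover have "carrier (S.Ir 1) <= carrier Q" unfolding QS S.Ir_infinity[symmetric] by (auto simp: S.carrier_Ir)
  moreover have "pmul Q a x : carrier (S.Ir 1)" if h: "x : carrier (S.Ir 1)" "a : carrier Q" "tgt Q a = src Q x" for x a
  proof -
   obtain A B where x: "A : C" "B : C" "x : JH s (L A) (L B)" "rank x = 1" using h(1) unfolding car1 by blast
   obtain D E where a: "D : C" "E : C" "a : JH s (L D) (L E)" using h(2) unfolding Qs by auto
   have "E = A" using tgt_src[OF a(3) x(3) a(1,2) x(1,2)] h(3) unfolding Qs by simp
   hence a': "a : JH s (L D) (L A)" using a(3) by simp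
   have "pmul Q a x = cmp a x" unfolding Qs by simp
   thus ?thesis unfolding car1 using S.mul_in[OF a' x(3)] mul1[OF a' x(3) a(1) x(1,2)] x(2,4) a(1) by auto
  qed
  moreover have "pmul Q x a : carrier (S.Ir 1)" if h: "x : carrier (S.Ir 1)" "a : carrier Q" "tgt Q x = src Q a" for x a
  proof -
   obtain A B where x: "A : C" "B : C" "x : JH s (L A) (L B)" "rank x = 1" using h(1) unfolding car1 by blast
   obtain D E where a: "D : C" "E : C" "a : JH s (L D) (L E)" using h(2) unfolding Qs by auto
   have "B = D" using tgt_src[OF x(3) a(3) x(1,2) a(1,2)] h(3) unfolding Qs by simp
   hence a': "a : JH s (L B) (L E)" using a(3) by simp
   have "pmul Q x a = cmp x a" unfolding Qs by simp
   thus ?thesis unfolding car1 using S.mul_in[OF x(3) a'] mul1[OF x(3) a' x(1,2) a(2)] x(1,4) a(2) by auto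
  qed
  ultimately show "psg_ideal Q (carrier (S.Ir 1))" unfolding psg_ideal_def by blast
 next
  fix I assume I: "psg_ideal Q I"
  have Isub: "I <= carrier Q" and Ine: "I ~= {}" using I unfolding psg_ideal_def by blast+
  have Il: "cmp a x : I" if h: "x : I" "x : JH s (L A) (L B)" "a : JH s (L D) (L A)" "A : C" "B : C" "D : C" for a x A B D
  proof -
   have "a : carrier Q" "tgt Q a = src Q x" using S.sr_tg[OF h(6,4,3)] S.sr_tg[OF h(4,5,2)] h unfolding Qs by auto
   hence "pmul Q a x : I" using I h(1) unfolding psg_ideal_def by blast
   thus ?thesis unfolding Qs by simp
  qed
  have Ir: "cmp x a : I" if h: "x : I" "x : JH s (L A) (L B)" "a : JH s (L B) (L D)" "A : C" "B : C" "D : C" for a x A B D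
  proof -
   have "a : carrier Q" "tgt Q x = src Q a" using S.sr_tg[OF h(5,6,3)] S.sr_tg[OF h(4,5,2)] h unfolding Qs by auto
   hence "pmul Q x a : I" using I h(1) unfolding psg_ideal_def by blast
   thus ?thesis unfolding Qs by simp
  qed
  show "carrier (S.Ir 1) <= I"
  proof
   fix x assume "x : carrier (S.Ir 1)"
   then obtain A B where x: "A : C" "B : C" "x : JH s (L A) (L B)" "rank x = 1" unfolding car1 by blast
   obtain y where yI: "y : I" using Ine by blast
   then obtain D E where y: "D : C" "E : C" "y : JH s (L D) (L E)" using Isub unfolding Qs by auto
   obtain z where z: "z : JH s (L B) (L D)" using one_ex[OF x(2) y(1)] by blast
   obtain w where w: "w : JH s (L E) (L A)" using one_ex[OF y(2) x(1)] by blast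
   note xz = S.mul_in[OF x(3) z]
   note xzy = S.mul_in[OF xz y(3)]
   note xzyw = S.mul_in[OF xzy w]
   \<comment> \<open>Placing an element \<open>y\<close> of the ideal between two copies of
     \<open>x\<close> gives an element of the ideal with the same two ends as \<open>x\<close>, and
     a rank-one arrow is determined by its ends.\<close>
   let ?m = "cmp (cmp (cmp (cmp x z) y) w) x"
   have 1: "cmp (cmp x z) y : I" by (rule Il[OF yI y(3) xz y(1,2) x(1)])
   have 2: "cmp (cmp (cmp x z) y) w : I" by (rule Ir[OF 1 xzy w x(1) y(2) x(1)])
   have 3: "?m : I" by (rule Ir[OF 2 xzyw x(3) x(1) x(1,2)])
   have m: "?m : JH s (L A) (L B)" by (rule S.mul_in[OF xzyw x(3)])
   have rm: "rank ?m = 1" by (rule mul1[OF xzyw x(3) x(1) x(1,2)]) (simp add: x(4))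
   have zz: "cmp z (cmp y (cmp w x)) : JH s (L B) (L B)"
    by (rule S.mul_in[OF z S.mul_in[OF y(3) S.mul_in[OF w x(3)]]])
   have "cup_eq ?m = cup_eq x" unfolding brauer_comp_assoc by (rule cup_mul[OF x(3) zz x(1,2) x(2) x(4)])
   moreover have "cup_eq (bflip ?m) = cup_eq (bflip x)" by (rule cup_mul2[OF xzyw x(3) x(1) x(1,2) x(4)])
   ultimately have "?m = x" by (rule eqI[OF m rm x(3,4) x(1,2)])
   thus "x : I" using 3 by simp
  qed
 qed
 have ii: "Cong (S.Ir r) = {Id_on (carrier (S.Ir r)), lambda_cong (S.Ir r) (carrier (S.Ir 1)), rho_cong (S.Ir r) (carrier (S.Ir 1)), Rees (S.Ir r) (carrier (S.Ir 1))}
      Un {Rees_N (S.Ir r) (carrier (S.Ir (enat q))) N | q N.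
        1 <= q & enat q < r & odd q & N \<lhd> H_group S.Q (G (q + 2))} Un {tnabla (S.Ir r)}"
  if r: "(\<exists>n. r = enat n & odd n & 3 <= n & r < xi C) \<or> (r = \<infinity> & xi C = \<infinity>)" for r
 proof (rule S.Cong_Ir)
  show "enat 3 <= r" using r by auto
  show "r = \<infinity> \<or> (\<exists>n. r = enat n & odd n)" using r by blast
  fix q :: nat assume q: "odd q" "enat (q + 2) <= r"
  have "enat (q + 2) < xi C"
  proof (cases "r = \<infinity>")
   case True thus ?thesis using r by auto
  next
   case False
   hence "r < xi C" using r by blast
   thus ?thesis using q(2) by (rule le_less_trans[rotated])
  qed
  thus "group_H_class S.Q (G (q + 2)) & G (q + 2) <= {x : carrier S.Q. rank x = q + 2}"
   using assms(4)[of "q + 2"] q(1) unfolding QS[symmetric] by simp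
 qed
 show ?thesis unfolding Let_def IrS P_def[symmetric]
 proof (intro conjI allI impI)
  show "minimal_ideal Q (carrier (S.Ir 1))" by (rule minimal)
  show "band_families C P P" by (rule band)
  show "\<exists>\<phi>. psg_iso (S.Ir 1) (rect_band C P P) \<phi> & Cong (S.Ir 1) =
      {{(al, be) : carrier (S.Ir 1) \<times> carrier (S.Ir 1). (\<phi> al, \<phi> be) : band_sigma C P P E1 E2} | E1 E2.
        (ALL A:C. E1 A : Eqv (P A)) & (ALL A:C. E2 A : Eqv (P A))}"
   by (rule exI[of _ ?\<phi>], rule conjI[OF iso], rule Cong_band_iso(1)[OF band iso], rule closed; assumption)
  show "lattice_isomorphic (Cong_lattice (S.Ir 1))
     (prod2_lattice (Prod_lattice C (%A. Eq_lattice (P A))) (Prod_lattice C (%A. Eq_lattice (P A))))" by (rule Cong_band_iso(2)[OF band iso], rule closed; assumption)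
  fix r assume "(\<exists>n. r = enat n & odd n & 3 <= n & r < xi C) \<or> (r = \<infinity> & xi C = \<infinity>)"
  from ii[OF this] show "Cong (S.Ir r) = {Id_on (carrier (S.Ir r)), lambda_cong (S.Ir r) (carrier (S.Ir 1)), rho_cong (S.Ir r) (carrier (S.Ir 1)), Rees (S.Ir r) (carrier (S.Ir 1))}
      Un {Rees_N (S.Ir r) (carrier (S.Ir (enat q))) N | q N.
        1 <= q & enat q < r & odd q & N \<lhd> H_group Q (G (q + 2))} Un {tnabla (S.Ir r)}" unfolding QS .
 qed
qed

end
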